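(* Let $d\in\{2,3\}$, let $\Omega\subseteq\mathbb R^d$ be a bounded, open, contractible polytopal Lipschitz domain with a regular simplicial triangulation $\mathcal T$, and let $V$, $V_h$, $a$, $b$, $M_h$ and the other quantities below be as defined in the context. Let $(\lambda,u)\in\mathbb R\times V$ with $\|u\|_b=1$ be the $k$th eigenpair of the problem $$a(u,v)=\lambda\, b(u,v)\quad\text{for all }v\in V,$$ and let $(\lambda_h,u_h)\in\mathbb R\times V_h$ with $\|u_h\|_b=1$ be the $k$th discrete eigenpair of the problem $$a(u_h,v_h)=\lambda_h\, b(u_h,v_h)\quad\text{for all }v_h\in V_h$$ (in both cases eigenvalues are ordered increasingly and counted with multiplicity, and $1\le k\le\dim V_h$). Then $$\frac{\lambda_h}{1+M_h^2\lambda_h}\le\lambda .$$ In particular, for every real number $\hat M_h$ with $$\hat M_h\ \ge\ \bigl(h_{\max}\hat C+\kappa_h C_{1,\operatorname{div}}\bigr)\sqrt{C_{\mathit{OL}}}$$ one has $$\frac{\lambda_h}{1+\hat M_h^2\lambda_h}\le\lambda .$$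
   Context: All functions are real-valued. **Differential operators.** For $d=2$: $\operatorname{rot}v=\partial_1v_2-\partial_2v_1$ for vector fields $v$, and $\operatorname{Curl}\phi=(-\partial_2\phi,\partial_1\phi)^T$ for scalar $\phi$. For $d=3$: $\operatorname{rot}$ is the usual curl, and $\operatorname{Curl}=\operatorname{rot}$. **Spaces and forms.** $H(\operatorname{div},\Omega)$ is the space of $L^2$ vector fields with weak divergence in $L^2$; $H(\operatorname{div}^0,\Omega)$ is its subspace of divergence-free fields; $H(\operatorname{rot},\Omega)$ is the space of $L^2$ vector fields with weak $\operatorname{rot}$ in $L^2$; $H_0(\operatorname{rot},\Omega)$ is its subspace with vanishing tangential trace on $\partial\Omega$. Set $H(\operatorname{Curl},\Omega)=H^1(\Omega)$ if $d=2$ and $H(\operatorname{Curl},\Omega)=H(\operatorname{rot},\Omega)$ if $d=3$. Let $b(\cdot,\cdot)=(\cdot,\cdot)_{L^2(\Omega)}$ with norm $\|\cdot\|_b$, let $a(v,w)=(\operatorname{rot}v,\operatorname{rot}w)_{L^2(\Omega)}$ with (semi)norm $\|\cdot\|_a=\sqrt{a(\cdot,\cdot)}$, and $V=H_0(\operatorname{rot},\Omega)\cap H(\operatorname{div}^0,\Omega)$. The form $a$ is an inner product on $V$. **Discrete spaces.** $\mathcal T$ is a regular (face-to-face) simplicial triangulation of $\Omega$ into closed simplices, $h_T$ is the diameter of $T\in\mathcal T$, $h_{\max}=\max_{T\in\mathcal T}h_T$. $S^1(\mathcal T)$ is the space of $H^1(\Omega)$ functions that are affine on each $T\in\mathcal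 T$, and $S^1_0(\mathcal T)=S^1(\mathcal T)\cap H^1_0(\Omega)$. $\mathcal N_0(\mathcal T)$ (lowest-order edge elements) is the space of $v\in H(\operatorname{rot},\Omega)$ such that for each $T\in\mathcal T$ there are $\alpha_T\in\mathbb R^d$ and $\beta_T\in P_1(T)^d$ (affine vector field) with $v(x)=\alpha_T+\beta_T(x)$ and $\beta_T(x)\cdot x=0$ for all $x\in T$; $\mathcal N_{0,D}(\mathcal T)=\mathcal N_0(\mathcal T)\cap H_0(\operatorname{rot},\Omega)$. $\mathit{RT}_0(\mathcal T)$ is the space of $v\in H(\operatorname{div},\Omega)$ such that for each $T\in\mathcal T$, $v|_T(x)=\alpha_T+\beta_Tx$ with some $\alpha_T\in\mathbb R^d$, $\beta_T\in\mathbb R$. Set $$V_h=\{\psi_h\in\mathcal N_{0,D}(\mathcal T):(\nabla v_h,\psi_h)_{L^2(\Omega)}=0\ \text{for all }v_h\in S^1_0(\mathcal T)\}$$ (in general $V_h\not\subseteq V$; $a$ is an inner product on $V_h$), $\mathcal S_h=S^1(\mathcal T)$ if $d=2$ and $\mathcal S_h=\mathcal N_0(\mathcal T)$ if $d=3$, $X_h=\mathit{RT}_0(\mathcal T)\cap H(\operatorname{div}^0,\Omega)$. **Galerkin projection and $M_h$.** For $u\in V$, $G_hu\in V_h$ is defined by $a(u-G_hu,v_h)=0$ for all $v_h\in V_h$. $M_h$ is the smallest number such that $\|u-G_hu\|_a\le M_h\|f\|_b$ for all $f\in H(\operatorname{div}^0,\Omega)$, where $u\in V$ is the solution of $a(u,v)=b(f,v)$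 for all $v\in V$. **Element patches.** For $T\in\mathcal T$, $\omega_T=\operatorname{int}\bigl(\bigcup\{K\in\mathcal T:K\cap T\ne\emptyset\}\bigr)$, and $C_{\mathit{OL}}=\max_{T\in\mathcal T}\operatorname{card}\{K\in\mathcal T:T\subseteq\overline{\omega_K}\}$. **Falk–Winther projections.** $\pi^{\operatorname{div}}:H(\operatorname{div},\Omega)\to\mathit{RT}_0(\mathcal T)$ and $\pi^{\operatorname{Curl}}:H(\operatorname{Curl},\Omega)\to\mathcal S_h$ are fixed linear projections (the Falk–Winther quasi-interpolations) with $\pi^{\operatorname{div}}\operatorname{Curl}=\operatorname{Curl}\pi^{\operatorname{Curl}}$ and with constants $C_{1,\operatorname{div}},C_{2,\operatorname{div}},C_{1,\operatorname{Curl}},C_{2,\operatorname{Curl}}$ such that for all $T\in\mathcal T$ $$\|\pi^{\operatorname{div}}v\|_{L^2(T)}\le C_{1,\operatorname{div}}\|v\|_{L^2(\omega_T)}+h_TC_{2,\operatorname{div}}\|\operatorname{div}v\|_{L^2(\omega_T)}\quad(v\in H(\operatorname{div},\Omega)),$$ $$\|\pi^{\operatorname{Curl}}v\|_{L^2(T)}\le C_{1,\operatorname{Curl}}\|v\|_{L^2(\omega_T)}+h_TC_{2,\operatorname{Curl}}\|\operatorname{Curl}v\|_{L^2(\omega_T)}\quad(v\in H(\operatorname{Curl},\Omega)).$$ **Further constants.** $C_{RD}$ is a constant such that for every $f\in H(\operatorname{div}^0,\Omega)$ there is $\beta\in H^1(\Omega;\mathbb R^{2d-3})$ with $\operatorname{Curl}\beta=f$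 and $\|D\beta\|_{L^2(\Omega)}\le C_{RD}\|f\|_{L^2(\Omega)}$, where $D\beta$ is the Jacobian (such a constant exists; $C_{RD}=1$ if $d=2$). $\tilde c$ is the smallest constant such that $\|v\|_{L^2(\omega_T)}\le h_T\tilde c\|Dv\|_{L^2(\omega_T)}$ for all $T\in\mathcal T$ and all $H^1$ functions $v$ on $\omega_T$ with vanishing average over $\omega_T$. Further $$\hat C=\begin{cases}(1+C_{1,\operatorname{Curl}})\tilde c+C_{2,\operatorname{Curl}}&\text{if }d=2,\\ \sqrt{2\bigl(((1+C_{1,\operatorname{Curl}})\tilde c\,C_{RD})^2+C_{2,\operatorname{Curl}}^2\bigr)}&\text{if }d=3,\end{cases}$$ and, with $\mathcal S_{f_h}=\{v_h\in\mathcal S_h:\operatorname{Curl}v_h=(-1)^{d-1}f_h\}$ for $f_h\in X_h$, $$\kappa_h=\max_{f_h\in X_h\setminus\{0\}}\ \min_{v_h\in V_h}\ \min_{\tau_h\in\mathcal S_{f_h}}\frac{\|\tau_h-\operatorname{rot}v_h\|_{L^2(\Omega)}}{\|f_h\|_{L^2(\Omega)}}.$$ *)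

theory Defs
  imports "HOL-Analysis.Analysis" "HOL-Library.Extended_Nat"
begin

text \<open>
  Elements of Lebesgue and Sobolev spaces over an open set \<open>S\<close> are represented by functions
  on the whole space; only their values on \<open>S\<close> matter, and equality in these spaces is equality
  almost everywhere on \<open>S\<close>. Spatial dimension two is treated with scalar potentials of type
  \<^typ>\<open>real\<close>, dimension three with potentials of type \<^typ>\<open>real^3\<close>; the type variable \<open>'m\<close>
  stands for this potential space, whose dimension is \<open>2 d - 3\<close>.
\<close>

section \<open>Lebesgue spaces, test functions, weak derivatives\<close>

definition L2 :: "(real^'d) set \<Rightarrow> (real^'d \<Rightarrow> 'b::euclidean_space) set" where
  "L2 S = {f \<in> borel_measurable (lebesgue_on S). integrable (lebesgue_on S) (\<lambda>x. (norm (f x))\<^sup>2)}"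

definition l2_inner :: "(real^'d) set \<Rightarrow> (real^'d \<Rightarrow> 'b::euclidean_space) \<Rightarrow> (real^'d \<Rightarrow> 'b) \<Rightarrow> real"
  where "l2_inner S f g = (LINT x|lebesgue_on S. f x \<bullet> g x)"

definition l2_norm :: "(real^'d) set \<Rightarrow> (real^'d \<Rightarrow> 'b::euclidean_space) \<Rightarrow> real" where
  "l2_norm S f = sqrt (l2_inner S f f)"

coinductive smooth :: "('a::real_normed_vector \<Rightarrow> 'b::real_normed_vector) \<Rightarrow> bool" where
  "\<lbrakk>\<forall>x. f differentiable (at x); \<forall>e. smooth (\<lambda>x. frechet_derivative f (at x) e)\<rbrakk> \<Longrightarrow> smooth f"

definition test_functions :: "(real^'d) set \<Rightarrow> (real^'d \<Rightarrow> 'b::euclidean_space) set" where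
  "test_functions S =
     {\<phi>. smooth \<phi> \<and> compact (closure {x. \<phi> x \<noteq> 0}) \<and> closure {x. \<phi> x \<noteq> 0} \<subseteq> S}"

definition partial :: "'d \<Rightarrow> (real^'d \<Rightarrow> 'b::euclidean_space) \<Rightarrow> real^'d \<Rightarrow> 'b" where
  "partial i \<phi> x = frechet_derivative \<phi> (at x) (axis i 1)"

definition grad :: "(real^'d \<Rightarrow> real) \<Rightarrow> real^'d \<Rightarrow> real^'d" where
  "grad \<phi> x = (\<chi> i. partial i \<phi> x)"

definition rot2 :: "(real^2 \<Rightarrow> real^2) \<Rightarrow> real^2 \<Rightarrow> real" where
  "rot2 v x = partial 1 (\<lambda>y. v y $ 2) x - partial 2 (\<lambda>y. v y $ 1) x"

definition Curl2 :: "(real^2 \<Rightarrow> real) \<Rightarrow> real^2 \<Rightarrow> real^2" where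
  "Curl2 \<phi> x = vector [- partial 2 \<phi> x, partial 1 \<phi> x]"

definition rot3 :: "(real^3 \<Rightarrow> real^3) \<Rightarrow> real^3 \<Rightarrow> real^3" where
  "rot3 v x = vector
     [partial 2 (\<lambda>y. v y $ 3) x - partial 3 (\<lambda>y. v y $ 2) x,
      partial 3 (\<lambda>y. v y $ 1) x - partial 1 (\<lambda>y. v y $ 3) x,
      partial 1 (\<lambda>y. v y $ 2) x - partial 2 (\<lambda>y. v y $ 1) x]"

text \<open>
  If \<open>s \<cdot> A\<close> is the formal adjoint of a first-order operator \<open>B\<close> (with \<open>s = \<plusminus>1\<close>), then
  \<open>has_weak s A S v g\<close> states that \<open>g\<close> is the weak \<open>B v\<close>. The weak derivative is unique
  up to null sets, so the choice in \<open>weak\<close> is immaterial.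
\<close>

definition has_weak ::
  "real \<Rightarrow> ((real^'d \<Rightarrow> 'c::euclidean_space) \<Rightarrow> real^'d \<Rightarrow> 'b::euclidean_space) \<Rightarrow> (real^'d) set
    \<Rightarrow> (real^'d \<Rightarrow> 'b) \<Rightarrow> (real^'d \<Rightarrow> 'c) \<Rightarrow> bool" where
  "has_weak s A S v g \<longleftrightarrow>
     g \<in> L2 S \<and> (\<forall>\<phi> \<in> test_functions S. l2_inner S v (A \<phi>) = s * l2_inner S g \<phi>)"

definition weak ::
  "real \<Rightarrow> ((real^'d \<Rightarrow> 'c::euclidean_space) \<Rightarrow> real^'d \<Rightarrow> 'b::euclidean_space) \<Rightarrow> (real^'d) set
    \<Rightarrow> (real^'d \<Rightarrow> 'b) \<Rightarrow> real^'d \<Rightarrow> 'c" where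
  "weak s A S v = (SOME g. has_weak s A S v g)"

definition Hspace ::
  "real \<Rightarrow> ((real^'d \<Rightarrow> 'c::euclidean_space) \<Rightarrow> real^'d \<Rightarrow> 'b::euclidean_space) \<Rightarrow> (real^'d) set
    \<Rightarrow> (real^'d \<Rightarrow> 'b) set" where
  "Hspace s A S = {v \<in> L2 S. \<exists>g. has_weak s A S v g}"

definition wpartial :: "'d \<Rightarrow> (real^'d) set \<Rightarrow> (real^'d \<Rightarrow> 'b::euclidean_space) \<Rightarrow> real^'d \<Rightarrow> 'b" where
  "wpartial i = weak (-1) (partial i)"

definition wgrad :: "(real^'d) set \<Rightarrow> (real^'d \<Rightarrow> real) \<Rightarrow> real^'d \<Rightarrow> real^'d" where
  "wgrad S v x = (\<chi> i. wpartial i S v x)"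

definition jacobian_norm :: "(real^'d) set \<Rightarrow> (real^'d \<Rightarrow> 'b::euclidean_space) \<Rightarrow> real" where
  "jacobian_norm S v = sqrt (\<Sum>i\<in>UNIV. (l2_norm S (wpartial i S v))\<^sup>2)"

definition H1 :: "(real^'d) set \<Rightarrow> (real^'d \<Rightarrow> 'b::euclidean_space) set" where
  "H1 S = (\<Inter>i. Hspace (-1) (partial i) S)"

definition H10 :: "(real^'d) set \<Rightarrow> (real^'d \<Rightarrow> real) set" where
  "H10 S = {v \<in> H1 S. \<exists>\<phi>::nat \<Rightarrow> real^'d \<Rightarrow> real. (\<forall>n. \<phi> n \<in> test_functions S) \<and>
     (\<lambda>n. l2_norm S (\<lambda>x. v x - \<phi> n x)) \<longlonglongrightarrow> 0 \<and>
     (\<forall>i. (\<lambda>n. l2_norm S (\<lambda>x. wpartial i S v x - partial i (\<phi> n) x)) \<longlonglongrightarrow> 0)}"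

definition Hdiv :: "(real^'d) set \<Rightarrow> (real^'d \<Rightarrow> real^'d) set" where
  "Hdiv = Hspace (-1) grad"

definition wdiv :: "(real^'d) set \<Rightarrow> (real^'d \<Rightarrow> real^'d) \<Rightarrow> real^'d \<Rightarrow> real" where
  "wdiv = weak (-1) grad"

definition Hdiv0 :: "(real^'d) set \<Rightarrow> (real^'d \<Rightarrow> real^'d) set" where
  "Hdiv0 S = {v \<in> Hdiv S. AE x in lebesgue_on S. wdiv S v x = 0}"


section \<open>Domains and triangulations\<close>

text \<open>The boundary is locally the graph of a Lipschitz function over the hyperplane orthogonal
  to \<open>n\<close>, and the set lies on one side of this graph.\<close>

definition lipschitz_boundary :: "'a::euclidean_space set \<Rightarrow> bool" where
  "lipschitz_boundary S \<longleftrightarrow> (\<forall>x \<in> frontier S. \<exists>r>0. \<exists>n L. \<exists>\<gamma>::'a \<Rightarrow> real. norm n = 1 \<and>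
     L-lipschitz_on {y. y \<bullet> n = 0} \<gamma> \<and>
     S \<inter> ball x r = {y \<in> ball x r. \<gamma> (y - (y \<bullet> n) *\<^sub>R n) < y \<bullet> n})"

definition polytopal_lipschitz_domain :: "'a::euclidean_space set \<Rightarrow> bool" where
  "polytopal_lipschitz_domain S \<longleftrightarrow> open S \<and> connected S \<and> S \<noteq> {} \<and> lipschitz_boundary S \<and>
     (\<exists>P. finite P \<and> (\<forall>p\<in>P. polytope p) \<and> closure S = \<Union>P)"

text \<open>The library predicate \<^const>\<open>triangulation\<close> admits simplices of any dimension.\<close>

definition triangulation_of :: "(real^'d) set \<Rightarrow> (real^'d) set set \<Rightarrow> bool" where
  "triangulation_of S \<T> \<longleftrightarrow>
     triangulation \<T> \<and> (\<forall>T\<in>\<T>. int CARD('d) simplex T) \<and> \<Union>\<T> = closure S"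

definition hmax :: "'a::euclidean_space set set \<Rightarrow> real" where
  "hmax \<T> = Max (diameter ` \<T>)"

definition patch :: "'a::euclidean_space set set \<Rightarrow> 'a set \<Rightarrow> 'a set" where
  "patch \<T> T = interior (\<Union>{K \<in> \<T>. K \<inter> T \<noteq> {}})"

definition C_OL :: "'a::euclidean_space set set \<Rightarrow> nat" where
  "C_OL \<T> = Max ((\<lambda>T. card {K \<in> \<T>. T \<subseteq> closure (patch \<T> K)}) ` \<T>)"

definition poincare_bound :: "(real^'d) set set \<Rightarrow> real \<Rightarrow> bool" where
  "poincare_bound \<T> c \<longleftrightarrow> (\<forall>T\<in>\<T>. \<forall>v \<in> H1 (patch \<T> T) :: (real^'d \<Rightarrow> real) set.
     (LINT x|lebesgue_on (patch \<T> T). v x) = 0 \<longrightarrow>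
     l2_norm (patch \<T> T) v \<le> diameter T * c * jacobian_norm (patch \<T> T) v)"

definition poincare_constant :: "(real^'d) set set \<Rightarrow> real \<Rightarrow> bool" where
  "poincare_constant \<T> c \<longleftrightarrow> poincare_bound \<T> c \<and> (\<forall>c'. poincare_bound \<T> c' \<longrightarrow> c \<le> c')"


section \<open>Rotation operators and finite element spaces\<close>

text \<open>
  The sign \<open>(-1)^(d - 1)\<close>. Integration by parts gives
  \<open>\<integral> rot v \<cdot> \<phi> = (-1)^(d - 1) \<integral> v \<cdot> Curl \<phi>\<close> and
  \<open>\<integral> Curl w \<cdot> \<psi> = (-1)^(d - 1) \<integral> w \<cdot> rot \<psi>\<close> for test functions: for \<open>d = 2\<close> because of
  \<open>Curl \<phi> = (- \<partial>\<^sub>2 \<phi>, \<partial>\<^sub>1 \<phi>)\<close>, and for \<open>d = 3\<close> because the curl is formally self-adjoint.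
  Hence the weak rot is defined by testing with \<open>Curl\<close>, and vice versa.
\<close>

abbreviation sgn_dim :: "'d::finite itself \<Rightarrow> real" where
  "sgn_dim _ \<equiv> (-1) ^ (CARD('d) - 1)"

definition S1 :: "(real^'d) set \<Rightarrow> (real^'d) set set \<Rightarrow> (real^'d \<Rightarrow> real) set" where
  "S1 S \<T> = {v \<in> H1 S. \<forall>T\<in>\<T>. \<exists>a c. AE x in lebesgue_on T. v x = a \<bullet> x + c}"

definition S10 :: "(real^'d) set \<Rightarrow> (real^'d) set set \<Rightarrow> (real^'d \<Rightarrow> real) set" where
  "S10 S \<T> = S1 S \<T> \<inter> H10 S"

text \<open>In the following definitions \<open>C\<close> is the classical operator \<open>Curl\<close>.\<close>

definition Hrot ::
  "((real^'d \<Rightarrow> 'm::euclidean_space) \<Rightarrow> real^'d \<Rightarrow> real^'d) \<Rightarrow> (real^'d) set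
    \<Rightarrow> (real^'d \<Rightarrow> real^'d) set" where
  "Hrot C = Hspace (sgn_dim TYPE('d)) C"

definition N0 ::
  "((real^'d \<Rightarrow> 'm::euclidean_space) \<Rightarrow> real^'d \<Rightarrow> real^'d) \<Rightarrow> (real^'d) set \<Rightarrow> (real^'d) set set
    \<Rightarrow> (real^'d \<Rightarrow> real^'d) set" where
  "N0 C S \<T> = {v \<in> Hrot C S. \<forall>T\<in>\<T>. \<exists>\<alpha> (B::real^'d^'d) c.
     (AE x in lebesgue_on T. v x = \<alpha> + (B *v x + c)) \<and> (\<forall>x\<in>T. (B *v x + c) \<bullet> x = 0)}"

definition RT0 :: "(real^'d) set \<Rightarrow> (real^'d) set set \<Rightarrow> (real^'d \<Rightarrow> real^'d) set" where
  "RT0 S \<T> = {v \<in> Hdiv S. \<forall>T\<in>\<T>. \<exists>\<alpha> (\<beta>::real). AE x in lebesgue_on T. v x = \<alpha> + \<beta> *\<^sub>R x}"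

definition Xh :: "(real^'d) set \<Rightarrow> (real^'d) set set \<Rightarrow> (real^'d \<Rightarrow> real^'d) set" where
  "Xh S \<T> = RT0 S \<T> \<inter> Hdiv0 S"

text \<open>The data that depend on the spatial dimension: the classical operators \<open>rot\<close> and
  \<open>Curl\<close>, the space \<open>H(Curl)\<close>, and the discrete space \<open>S\<^sub>h\<close>.\<close>

record ('d, 'm) dimension_data =
  cl_rot :: "(real^'d \<Rightarrow> real^'d) \<Rightarrow> real^'d \<Rightarrow> 'm"
  cl_Curl :: "(real^'d \<Rightarrow> 'm) \<Rightarrow> real^'d \<Rightarrow> real^'d"
  HCurl :: "(real^'d) set \<Rightarrow> (real^'d \<Rightarrow> 'm) set"
  Sh :: "(real^'d) set \<Rightarrow> (real^'d) set set \<Rightarrow> (real^'d \<Rightarrow> 'm) set"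

definition dim2 :: "(2, real) dimension_data" where
  "dim2 = \<lparr>cl_rot = rot2, cl_Curl = Curl2, HCurl = H1, Sh = S1\<rparr>"

definition dim3 :: "(3, real^3) dimension_data" where
  "dim3 = \<lparr>cl_rot = rot3, cl_Curl = rot3, HCurl = Hrot rot3, Sh = N0 rot3\<rparr>"

definition wrot ::
  "('d, 'm::euclidean_space) dimension_data \<Rightarrow> (real^'d) set \<Rightarrow> (real^'d \<Rightarrow> real^'d) \<Rightarrow> real^'d \<Rightarrow> 'm"
  where "wrot D = weak (sgn_dim TYPE('d)) (cl_Curl D)"

definition wCurl ::
  "('d, 'm::euclidean_space) dimension_data \<Rightarrow> (real^'d) set \<Rightarrow> (real^'d \<Rightarrow> 'm) \<Rightarrow> real^'d \<Rightarrow> real^'d"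
  where "wCurl D = weak (sgn_dim TYPE('d)) (cl_rot D)"

text \<open>
  For \<open>v \<in> H(rot)\<close>, the tangential trace is (up to sign) the functional
  \<open>w \<mapsto> \<integral> v \<cdot> Curl w - (-1)^(d - 1) \<integral> rot v \<cdot> w\<close> on \<open>H(Curl)\<close>; by Green's formula it is given
  by the boundary integral of the tangential component of \<open>v\<close> against \<open>w\<close> if \<open>v\<close> and \<open>w\<close>
  are smooth up to the boundary.
\<close>

definition tangential_trace ::
  "('d, 'm::euclidean_space) dimension_data \<Rightarrow> (real^'d) set \<Rightarrow> (real^'d \<Rightarrow> real^'d)
    \<Rightarrow> (real^'d \<Rightarrow> 'm) \<Rightarrow> real" where
  "tangential_trace D S v w =
     l2_inner S v (wCurl D S w) - sgn_dim TYPE('d) * l2_inner S (wrot D S v) w"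

definition H0rot ::
  "('d, 'm::euclidean_space) dimension_data \<Rightarrow> (real^'d) set \<Rightarrow> (real^'d \<Rightarrow> real^'d) set" where
  "H0rot D S = {v \<in> Hrot (cl_Curl D) S. \<forall>w \<in> HCurl D S. tangential_trace D S v w = 0}"

definition V :: "('d, 'm::euclidean_space) dimension_data \<Rightarrow> (real^'d) set \<Rightarrow> (real^'d \<Rightarrow> real^'d) set"
  where "V D S = H0rot D S \<inter> Hdiv0 S"

definition a_form ::
  "('d, 'm::euclidean_space) dimension_data \<Rightarrow> (real^'d) set
    \<Rightarrow> (real^'d \<Rightarrow> real^'d) \<Rightarrow> (real^'d \<Rightarrow> real^'d) \<Rightarrow> real" where
  "a_form D S v w = l2_inner S (wrot D S v) (wrot D S w)"

definition a_norm ::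
  "('d, 'm::euclidean_space) dimension_data \<Rightarrow> (real^'d) set \<Rightarrow> (real^'d \<Rightarrow> real^'d) \<Rightarrow> real" where
  "a_norm D S v = sqrt (a_form D S v v)"

definition N0D ::
  "('d, 'm::euclidean_space) dimension_data \<Rightarrow> (real^'d) set \<Rightarrow> (real^'d) set set
    \<Rightarrow> (real^'d \<Rightarrow> real^'d) set" where
  "N0D D S \<T> = N0 (cl_Curl D) S \<T> \<inter> H0rot D S"

definition Vh ::
  "('d, 'm::euclidean_space) dimension_data \<Rightarrow> (real^'d) set \<Rightarrow> (real^'d) set set
    \<Rightarrow> (real^'d \<Rightarrow> real^'d) set" where
  "Vh D S \<T> = {\<psi> \<in> N0D D S \<T>. \<forall>v \<in> S10 S \<T>. l2_inner S (wgrad S v) \<psi> = 0}"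


section \<open>Galerkin projection and the constants\<close>

text \<open>Unique up to null sets because \<open>a\<close> is an inner product on \<open>V\<^sub>h\<close>.\<close>

definition Gh ::
  "('d, 'm::euclidean_space) dimension_data \<Rightarrow> (real^'d) set \<Rightarrow> (real^'d) set set
    \<Rightarrow> (real^'d \<Rightarrow> real^'d) \<Rightarrow> real^'d \<Rightarrow> real^'d" where
  "Gh D S \<T> u = (SOME w. w \<in> Vh D S \<T> \<and> (\<forall>v \<in> Vh D S \<T>. a_form D S (\<lambda>x. u x - w x) v = 0))"

text \<open>The set of admissible constants is closed, nonempty and bounded below, so that its infimum
  is its smallest element.\<close>

definition Mh ::
  "('d, 'm::euclidean_space) dimension_data \<Rightarrow> (real^'d) set \<Rightarrow> (real^'d) set set \<Rightarrow> real" where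
  "Mh D S \<T> = Inf {M. \<forall>f \<in> Hdiv0 S. \<forall>u \<in> V D S. (\<forall>v \<in> V D S. a_form D S u v = l2_inner S f v) \<longrightarrow>
     a_norm D S (\<lambda>x. u x - Gh D S \<T> u x) \<le> M * l2_norm S f}"

definition Sf ::
  "('d, 'm::euclidean_space) dimension_data \<Rightarrow> (real^'d) set \<Rightarrow> (real^'d) set set
    \<Rightarrow> (real^'d \<Rightarrow> real^'d) \<Rightarrow> (real^'d \<Rightarrow> 'm) set" where
  "Sf D S \<T> f = {v \<in> Sh D S \<T>. AE x in lebesgue_on S. wCurl D S v x = sgn_dim TYPE('d) *\<^sub>R f x}"

text \<open>All spaces involved are finite-dimensional modulo null functions, and the supremum and
  the infima are attained.\<close>

definition kappa_h ::
  "('d, 'm::euclidean_space) dimension_data \<Rightarrow> (real^'d) set \<Rightarrow> (real^'d) set set \<Rightarrow> real" where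
  "kappa_h D S \<T> = (SUP f \<in> {f \<in> Xh S \<T>. \<not> (AE x in lebesgue_on S. f x = 0)}.
     INF v \<in> Vh D S \<T>. INF \<tau> \<in> Sf D S \<T> f.
       l2_norm S (\<lambda>x. \<tau> x - wrot D S v x) / l2_norm S f)"

definition l2_linear_on ::
  "(real^'d) set \<Rightarrow> (real^'d \<Rightarrow> 'b::euclidean_space) set
    \<Rightarrow> ((real^'d \<Rightarrow> 'b) \<Rightarrow> real^'d \<Rightarrow> 'b) \<Rightarrow> bool" where
  "l2_linear_on S W P \<longleftrightarrow> (\<forall>v\<in>W. \<forall>w\<in>W. \<forall>r::real.
     AE x in lebesgue_on S. P (\<lambda>y. r *\<^sub>R v y + w y) x = r *\<^sub>R P v x + P w x)"

definition l2_projection ::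
  "(real^'d) set \<Rightarrow> (real^'d \<Rightarrow> 'b::euclidean_space) set \<Rightarrow> (real^'d \<Rightarrow> 'b) set
    \<Rightarrow> ((real^'d \<Rightarrow> 'b) \<Rightarrow> real^'d \<Rightarrow> 'b) \<Rightarrow> bool" where
  "l2_projection S W W' P \<longleftrightarrow> l2_linear_on S W P \<and> (\<forall>v\<in>W. P v \<in> W') \<and>
     (\<forall>v\<in>W'. AE x in lebesgue_on S. P v x = v x)"

definition falk_winther ::
  "('d, 'm::euclidean_space) dimension_data \<Rightarrow> (real^'d) set \<Rightarrow> (real^'d) set set
    \<Rightarrow> ((real^'d \<Rightarrow> real^'d) \<Rightarrow> real^'d \<Rightarrow> real^'d) \<Rightarrow> ((real^'d \<Rightarrow> 'm) \<Rightarrow> real^'d \<Rightarrow> 'm)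
    \<Rightarrow> real \<Rightarrow> real \<Rightarrow> real \<Rightarrow> real \<Rightarrow> bool" where
  "falk_winther D S \<T> \<pi>div \<pi>Curl C1div C2div C1Curl C2Curl \<longleftrightarrow>
     l2_projection S (Hdiv S) (RT0 S \<T>) \<pi>div \<and>
     l2_projection S (HCurl D S) (Sh D S \<T>) \<pi>Curl \<and>
     (\<forall>w \<in> HCurl D S. AE x in lebesgue_on S. \<pi>div (wCurl D S w) x = wCurl D S (\<pi>Curl w) x) \<and>
     (\<forall>T\<in>\<T>. \<forall>v \<in> Hdiv S. l2_norm T (\<pi>div v) \<le>
        C1div * l2_norm (patch \<T> T) v + diameter T * C2div * l2_norm (patch \<T> T) (wdiv S v)) \<and>
     (\<forall>T\<in>\<T>. \<forall>v \<in> HCurl D S. l2_norm T (\<pi>Curl v) \<le>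
        C1Curl * l2_norm (patch \<T> T) v + diameter T * C2Curl * l2_norm (patch \<T> T) (wCurl D S v))"

definition regular_decomposition_constant ::
  "('d, 'm::euclidean_space) dimension_data \<Rightarrow> (real^'d) set \<Rightarrow> real \<Rightarrow> bool" where
  "regular_decomposition_constant D S C \<longleftrightarrow>
     (\<forall>f \<in> Hdiv0 S. \<exists>\<beta> \<in> H1 S. (AE x in lebesgue_on S. wCurl D S \<beta> x = f x) \<and>
        jacobian_norm S \<beta> \<le> C * l2_norm S f) \<and>
     (CARD('d) = 2 \<longrightarrow> C = 1)"

definition C_hat :: "nat \<Rightarrow> real \<Rightarrow> real \<Rightarrow> real \<Rightarrow> real \<Rightarrow> real" where
  "C_hat d C1Curl C2Curl c CRD =
     (if d = 2 then (1 + C1Curl) * c + C2Curl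
      else sqrt (2 * (((1 + C1Curl) * c * CRD)\<^sup>2 + C2Curl\<^sup>2)))"


section \<open>Eigenpairs\<close>

text \<open>Dimension of a space of square-integrable functions modulo null functions.\<close>

definition l2_dim :: "(real^'d) set \<Rightarrow> (real^'d \<Rightarrow> 'b::euclidean_space) set \<Rightarrow> enat" where
  "l2_dim S W = Sup {enat n |n. \<exists>w::nat \<Rightarrow> real^'d \<Rightarrow> 'b. (\<forall>i<n. w i \<in> W) \<and>
     (\<forall>c::nat \<Rightarrow> real. (AE x in lebesgue_on S. (\<Sum>i<n. c i *\<^sub>R w i x) = 0) \<longrightarrow> (\<forall>i<n. c i = 0))}"

definition eigenfunction ::
  "(real^'d) set \<Rightarrow> ((real^'d \<Rightarrow> 'b::euclidean_space) \<Rightarrow> (real^'d \<Rightarrow> 'b) \<Rightarrow> real)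
    \<Rightarrow> (real^'d \<Rightarrow> 'b) set \<Rightarrow> real \<Rightarrow> (real^'d \<Rightarrow> 'b) \<Rightarrow> bool" where
  "eigenfunction S a W lam u \<longleftrightarrow> u \<in> W \<and> (\<forall>v\<in>W. a u v = lam * l2_inner S u v)"

text \<open>
  An enumeration (by \<open>1, \<dots>, N\<close>, where possibly \<open>N = \<infinity>\<close>) of all eigenvalues in increasing
  order and counted with multiplicity: the functions \<open>w\<^sub>i\<close> with \<open>\<mu>\<^sub>i = \<nu>\<close> form an orthonormal
  basis of the eigenspace of \<open>\<nu>\<close>, modulo null functions.
\<close>

definition eigensystem ::
  "(real^'d) set \<Rightarrow> ((real^'d \<Rightarrow> 'b::euclidean_space) \<Rightarrow> (real^'d \<Rightarrow> 'b) \<Rightarrow> real)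
    \<Rightarrow> (real^'d \<Rightarrow> 'b) set \<Rightarrow> enat \<Rightarrow> (nat \<Rightarrow> real) \<Rightarrow> (nat \<Rightarrow> real^'d \<Rightarrow> 'b) \<Rightarrow> bool" where
  "eigensystem S a W N \<mu> w \<longleftrightarrow> (let I = {i. 1 \<le> i \<and> enat i \<le> N} in
     (\<forall>i\<in>I. eigenfunction S a W (\<mu> i) (w i)) \<and>
     (\<forall>i\<in>I. \<forall>j\<in>I. l2_inner S (w i) (w j) = (if i = j then 1 else 0)) \<and>
     (\<forall>i\<in>I. \<forall>j\<in>I. i \<le> j \<longrightarrow> \<mu> i \<le> \<mu> j) \<and>
     (\<forall>\<nu> v. eigenfunction S a W \<nu> v \<longrightarrow> (\<exists>J c. finite J \<and> J \<subseteq> {i\<in>I. \<mu> i = \<nu>} \<and>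
        (AE x in lebesgue_on S. v x = (\<Sum>i\<in>J. c i *\<^sub>R w i x)))))"

definition kth_eigenpair ::
  "(real^'d) set \<Rightarrow> ((real^'d \<Rightarrow> 'b::euclidean_space) \<Rightarrow> (real^'d \<Rightarrow> 'b) \<Rightarrow> real)
    \<Rightarrow> (real^'d \<Rightarrow> 'b) set \<Rightarrow> nat \<Rightarrow> real \<Rightarrow> (real^'d \<Rightarrow> 'b) \<Rightarrow> bool" where
  "kth_eigenpair S a W k lam u \<longleftrightarrow>
     (\<exists>N \<mu> w. eigensystem S a W N \<mu> w \<and> 1 \<le> k \<and> enat k \<le> N \<and> lam = \<mu> k \<and> u = w k)"

end

theory Submission
  imports Defs "HOL-Computational_Algebra.Polynomial"
begin

text \<open>Let \<open>w\<close> be a normalized combination of the first \<open>k\<close> eigenfunctions whose Galerkin projection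
  \<open>w\<^sub>h\<close> is orthogonal to the first \<open>k - 1\<close> discrete eigenfunctions. Aubin--Nitsche duality,
  applied with the divergence-free part of \<open>w - w\<^sub>h\<close>, gives \<open>1 \<le> M \<parallel>w - w\<^sub>h\<parallel>\<^sub>a + \<parallel>w\<^sub>h\<parallel>\<^sub>b\<close>. Together with
  \<open>\<parallel>w - w\<^sub>h\<parallel>\<^sub>a\<^sup>2 + \<parallel>w\<^sub>h\<parallel>\<^sub>a\<^sup>2 = \<parallel>w\<parallel>\<^sub>a\<^sup>2 \<le> \<lambda>\<close> and \<open>\<lambda>\<^sub>h \<parallel>w\<^sub>h\<parallel>\<^sub>b\<^sup>2 \<le> \<parallel>w\<^sub>h\<parallel>\<^sub>a\<^sup>2\<close> the Cauchy--Schwarz inequality yields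
  \<open>\<lambda>\<^sub>h \<le> \<lambda> (1 + M\<^sup>2 \<lambda>\<^sub>h)\<close>. The Galerkin error for a right-hand side \<open>f = Curl \<beta>\<close> is split into the
  distance \<open>\<parallel>\<beta> - \<pi>Curl \<beta>\<parallel>\<close>, which is controlled by a Poincare inequality on patches, and the
  discrete error with right-hand side \<open>\<pi>div f\<close>, which is measured by \<open>\<kappa>\<^sub>h\<close>.\<close>

section \<open>Square-integrable functions\<close>

text \<open>The fields in \<open>Vh\<close> are in general not divergence free, so
  \<open>w - w_h\<close> itself cannot serve as right-hand side of a problem on \<open>V\<close>;
  its divergence-free part can, and rotations do not see the gradient part that is split off.
  Duality needs a solution for every such right-hand side, hence a Friedrichs inequality on
  \<open>V\<close>. Its constant, like all constants obtained from finite-dimensionality, is purely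
  qualitative: the final bounds contain only \<open>M\<close>. The continuous side works with
  \<open>k\<close> orthonormal eigenfunctions; on the discrete side the lower bound for Rayleigh
  quotients comes from minimisation over a finite-dimensional subspace. Two obstacles shape the
  details. Functions are representatives and weak derivatives are chosen by \<open>SOME\<close>, so
  that identities hold almost everywhere and operators are linear only up to null sets. Moreover,
  the signs of the given constants are not among the assumptions, and \<open>kappa_h\<close> and
  \<open>Mh\<close> are infima and suprema of real sets: nonnegativity, nonemptiness and boundedness
  all have to be proved before these numbers mean anything.\<close>

lemma L2_measurable: "f \<in> L2 S \<Longrightarrow> f \<in> borel_measurable (lebesgue_on S)"
  and L2_integrable_norm_sq: "f \<in> L2 S \<Longrightarrow> integrable (lebesgue_on S) (\<lambda>x. (norm (f x))\<^sup>2)"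
  by (auto simp: L2_def)

lemma L2_integrable_inner:
  assumes "f \<in> L2 S" "g \<in> L2 S"
  shows "integrable (lebesgue_on S) (\<lambda>x. f x \<bullet> g x)"
proof (rule Bochner_Integration.integrable_bound)
  show "integrable (lebesgue_on S) (\<lambda>x. (norm (f x))\<^sup>2 + (norm (g x))\<^sup>2)"
    using assms by (intro Bochner_Integration.integrable_add L2_integrable_norm_sq)
  show "(\<lambda>x. f x \<bullet> g x) \<in> borel_measurable (lebesgue_on S)"
    using assms[THEN L2_measurable] by measurable
  have "norm (f x \<bullet> g x) \<le> norm ((norm (f x))\<^sup>2 + (norm (g x))\<^sup>2)" for x
  proof -
    have "\<bar>f x \<bullet> g x\<bar> \<le> norm (f x) * norm (g x)" by (rule Cauchy_Schwarz_ineq2)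
    also have "\<dots> \<le> (norm (f x))\<^sup>2 + (norm (g x))\<^sup>2"
      using sum_squares_bound[of "norm (f x)" "norm (g x)"]
        mult_nonneg_nonneg[OF norm_ge_zero[of "f x"] norm_ge_zero[of "g x"]] by linarith
    finally show ?thesis by simp
  qed
  then show "AE x in lebesgue_on S. norm (f x \<bullet> g x) \<le> norm ((norm (f x))\<^sup>2 + (norm (g x))\<^sup>2)"
    by simp
qed

lemma L2_zero [simp]: "(\<lambda>x. 0) \<in> L2 S"
  by (simp add: L2_def)

lemma L2_scaleR [intro]:
  assumes "f \<in> L2 S"
  shows "(\<lambda>x. r *\<^sub>R f x) \<in> L2 S"
  using assms by (auto simp: L2_def power_mult_distrib)

lemma L2_add [intro]:
  assumes "f \<in> L2 S" "g \<in> L2 S"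
  shows "(\<lambda>x. f x + g x) \<in> L2 S"
proof -
  have "integrable (lebesgue_on S)
      (\<lambda>x. (norm (f x))\<^sup>2 + (2 *\<^sub>R (f x \<bullet> g x) + (norm (g x))\<^sup>2))"
    using assms by (intro Bochner_Integration.integrable_add L2_integrable_norm_sq
        integrable_scaleR_right impI L2_integrable_inner)
  also have "(\<lambda>x. (norm (f x))\<^sup>2 + (2 *\<^sub>R (f x \<bullet> g x) + (norm (g x))\<^sup>2)) = (\<lambda>x. (norm (f x + g x))\<^sup>2)"
    by (auto simp: power2_norm_eq_inner inner_simps inner_commute)
  finally show ?thesis
    using assms by (auto simp: L2_def)
qed

lemma L2_diff [intro]:
  assumes "f \<in> L2 S" "g \<in> L2 S"
  shows "(\<lambda>x. f x - g x) \<in> L2 S"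
  using L2_add[OF assms(1) L2_scaleR[OF assms(2), of "-1"]] by simp

lemma L2_sum [intro]:
  assumes "\<And>i. i \<in> I \<Longrightarrow> f i \<in> L2 S"
  shows "(\<lambda>x. \<Sum>i\<in>I. f i x) \<in> L2 S"
  using assms by (induction I rule: infinite_finite_induct) auto

lemma l2_inner_commute: "l2_inner S f g = l2_inner S g f"
  by (simp add: l2_inner_def inner_commute)

lemma l2_inner_add_left:
  assumes "f \<in> L2 S" "g \<in> L2 S" "h \<in> L2 S"
  shows "l2_inner S (\<lambda>x. f x + g x) h = l2_inner S f h + l2_inner S g h"
  using assms by (simp add: l2_inner_def inner_add_left L2_integrable_inner)

lemma l2_inner_scaleR_left: "l2_inner S (\<lambda>x. r *\<^sub>R f x) h = r * l2_inner S f h"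
  by (simp add: l2_inner_def)

lemma l2_inner_diff_left:
  assumes "f \<in> L2 S" "g \<in> L2 S" "h \<in> L2 S"
  shows "l2_inner S (\<lambda>x. f x - g x) h = l2_inner S f h - l2_inner S g h"
  using assms by (simp add: l2_inner_def inner_diff_left L2_integrable_inner)

lemma l2_inner_sum_left:
  assumes "\<And>i. i \<in> I \<Longrightarrow> f i \<in> L2 S" "h \<in> L2 S"
  shows "l2_inner S (\<lambda>x. \<Sum>i\<in>I. f i x) h = (\<Sum>i\<in>I. l2_inner S (f i) h)"
  using assms by (simp add: l2_inner_def inner_sum_left L2_integrable_inner)

lemma l2_inner_add_right:
  "h \<in> L2 S \<Longrightarrow> f \<in> L2 S \<Longrightarrow> g \<in> L2 S \<Longrightarrow> l2_inner S h (\<lambda>x. f x + g x) = l2_inner S h f + l2_inner S h g"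
  by (simp add: l2_inner_add_left l2_inner_commute[of S h])

lemma l2_inner_scaleR_right: "l2_inner S h (\<lambda>x. r *\<^sub>R f x) = r * l2_inner S h f"
  by (simp add: l2_inner_def)

lemma l2_inner_diff_right:
  "h \<in> L2 S \<Longrightarrow> f \<in> L2 S \<Longrightarrow> g \<in> L2 S \<Longrightarrow> l2_inner S h (\<lambda>x. f x - g x) = l2_inner S h f - l2_inner S h g"
  by (simp add: l2_inner_diff_left l2_inner_commute[of S h])

lemma l2_inner_sum_right:
  "h \<in> L2 S \<Longrightarrow> (\<And>i. i \<in> I \<Longrightarrow> f i \<in> L2 S) \<Longrightarrow>
    l2_inner S h (\<lambda>x. \<Sum>i\<in>I. f i x) = (\<Sum>i\<in>I. l2_inner S h (f i))"
  by (simp add: l2_inner_sum_left l2_inner_commute[of S h])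

lemmas l2_inner_simps = l2_inner_add_left l2_inner_add_right l2_inner_diff_left l2_inner_diff_right
  l2_inner_scaleR_left l2_inner_scaleR_right

lemma l2_inner_zero_left [simp]: "l2_inner S (\<lambda>x. 0) f = 0"
  and l2_inner_zero_right [simp]: "l2_inner S f (\<lambda>x. 0) = 0"
  by (simp_all add: l2_inner_def)

lemma l2_inner_cong_AE:
  assumes "f \<in> L2 S" "f' \<in> L2 S" "g \<in> L2 S" "g' \<in> L2 S"
    "AE x in lebesgue_on S. f x = f' x" "AE x in lebesgue_on S. g x = g' x"
  shows "l2_inner S f g = l2_inner S f' g'"
  unfolding l2_inner_def
proof (rule integral_cong_AE)
  show "AE x in lebesgue_on S. f x \<bullet> g x = f' x \<bullet> g' x"
    using assms(5,6) by eventually_elim simp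
qed (use assms(1-4)[THEN L2_measurable] in measurable)

lemma l2_inner_ge_0 [simp]: "0 \<le> l2_inner S f f"
  by (simp add: l2_inner_def integral_nonneg_AE)

lemma l2_norm_ge_0 [simp]: "0 \<le> l2_norm S f"
  by (simp add: l2_norm_def)

lemma l2_norm_sq: "(l2_norm S f)\<^sup>2 = l2_inner S f f"
  by (simp add: l2_norm_def)

lemma l2_norm_zero [simp]: "l2_norm S (\<lambda>x. 0) = 0"
  by (simp add: l2_norm_def)

lemma l2_norm_cong_AE:
  "f \<in> L2 S \<Longrightarrow> g \<in> L2 S \<Longrightarrow> AE x in lebesgue_on S. f x = g x \<Longrightarrow> l2_norm S f = l2_norm S g"
  unfolding l2_norm_def by (subst l2_inner_cong_AE[of f S g f g]) auto

lemma l2_norm_scaleR: "l2_norm S (\<lambda>x. r *\<^sub>R f x) = \<bar>r\<bar> * l2_norm S f"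
  by (simp add: l2_norm_def l2_inner_scaleR_left l2_inner_scaleR_right real_sqrt_mult
      flip: mult.assoc)

lemma l2_norm_minus_commute: "l2_norm S (\<lambda>x. f x - g x) = l2_norm S (\<lambda>x. g x - f x)"
  using l2_norm_scaleR[of S "-1" "\<lambda>x. f x - g x"] by simp

lemma l2_norm_eq_0_iff:
  assumes "f \<in> L2 S"
  shows "l2_norm S f = 0 \<longleftrightarrow> (AE x in lebesgue_on S. f x = 0)"
proof -
  have "l2_norm S f = 0 \<longleftrightarrow> (LINT x|lebesgue_on S. f x \<bullet> f x) = 0"
    by (simp add: l2_norm_def l2_inner_def)
  also have "\<dots> \<longleftrightarrow> (AE x in lebesgue_on S. f x \<bullet> f x = 0)"
    using assms by (intro integral_nonneg_eq_0_iff_AE L2_integrable_inner) auto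
  finally show ?thesis by simp
qed

text \<open>The form is only semidefinite on representatives, so a \<open>g\<close> of norm zero is
  treated apart: there the quadratic polynomial in \<open>t\<close> degenerates to a linear one,
  whose slope must vanish.\<close>

lemma l2_Cauchy_Schwarz:
  assumes "f \<in> L2 S" "g \<in> L2 S"
  shows "\<bar>l2_inner S f g\<bar> \<le> l2_norm S f * l2_norm S g"
proof -
  let ?a = "l2_inner S f f" and ?b = "l2_inner S f g" and ?c = "l2_inner S g g"
  have *: "0 \<le> ?a + 2 * t * ?b + t\<^sup>2 * ?c" for t
  proof -
    have "0 \<le> l2_inner S (\<lambda>x. f x + t *\<^sub>R g x) (\<lambda>x. f x + t *\<^sub>R g x)" by simp
    also have "\<dots> = ?a + 2 * t * ?b + t\<^sup>2 * ?c"
      using assms by (simp add: l2_inner_simps L2_add L2_scaleR power2_eq_square algebra_simps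
          l2_inner_commute[of S g f])
    finally show ?thesis .
  qed
  have "?b\<^sup>2 \<le> ?a * ?c"
  proof (cases "?c = 0")
    case True
    have "?b = 0"
    proof (rule ccontr)
      assume "?b \<noteq> 0"
      \<comment> \<open>For this \<open>t\<close> the polynomial takes the value -1.\<close>
      then show False using *[of "- (?a + 1) / (2 * ?b)"] True by (simp add: field_simps)
    qed
    then show ?thesis using True by simp
  next
    case False
    then have "0 < ?c" using l2_inner_ge_0[of S g] by linarith
    then show ?thesis using *[of "- ?b / ?c"] by (simp add: field_simps power2_eq_square)
  qed
  then have "sqrt (?b\<^sup>2) \<le> sqrt (?a * ?c)" by (rule real_sqrt_le_mono)
  then show ?thesis by (simp add: l2_norm_def real_sqrt_mult)
qed

lemma l2_norm_triangle:
  assumes "f \<in> L2 S" "g \<in> L2 S"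
  shows "l2_norm S (\<lambda>x. f x + g x) \<le> l2_norm S f + l2_norm S g"
proof (rule power2_le_imp_le)
  have "(l2_norm S (\<lambda>x. f x + g x))\<^sup>2 = (l2_norm S f)\<^sup>2 + 2 * l2_inner S f g + (l2_norm S g)\<^sup>2"
    using assms by (simp add: l2_norm_sq l2_inner_simps L2_add l2_inner_commute[of S g f])
  also have "\<dots> \<le> (l2_norm S f + l2_norm S g)\<^sup>2"
    using l2_Cauchy_Schwarz[OF assms] by (simp add: power2_eq_square algebra_simps)
  finally show "(l2_norm S (\<lambda>x. f x + g x))\<^sup>2 \<le> (l2_norm S f + l2_norm S g)\<^sup>2" .
qed simp

lemma l2_norm_triangle_diff:
  assumes "f \<in> L2 S" "g \<in> L2 S"
  shows "l2_norm S (\<lambda>x. f x - g x) \<le> l2_norm S f + l2_norm S g"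
  using l2_norm_triangle[OF assms(1) L2_scaleR[OF assms(2), of "-1"]] l2_norm_scaleR[of S "-1" g]
  by simp

lemma l2_norm_triangle3:
  assumes "f \<in> L2 S" "g \<in> L2 S" "h \<in> L2 S"
  shows "l2_norm S (\<lambda>x. f x - h x) \<le> l2_norm S (\<lambda>x. f x - g x) + l2_norm S (\<lambda>x. g x - h x)"
  using l2_norm_triangle[of "\<lambda>x. f x - g x" S "\<lambda>x. g x - h x"] assms by auto

lemma l2_norm_sum:
  assumes "\<And>i. i \<in> I \<Longrightarrow> f i \<in> L2 S"
  shows "l2_norm S (\<lambda>x. \<Sum>i\<in>I. f i x) \<le> (\<Sum>i\<in>I. l2_norm S (f i))"
  using assms
proof (induction I rule: infinite_finite_induct)
  case (insert i I)
  then have "l2_norm S (\<lambda>x. f i x + (\<Sum>i\<in>I. f i x)) \<le> l2_norm S (f i) + l2_norm S (\<lambda>x. \<Sum>i\<in>I. f i x)"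
    by (intro l2_norm_triangle L2_sum) auto
  moreover have "l2_norm S (\<lambda>x. \<Sum>i\<in>I. f i x) \<le> (\<Sum>i\<in>I. l2_norm S (f i))"
    using insert by auto
  ultimately show ?case using insert.hyps by simp
qed auto

text \<open>Norm convergence implies weak convergence by Cauchy--Schwarz; the closedness arguments
  for weak operators and for \<open>H0rot\<close> all pass to the limit this way.\<close>

lemma l2_inner_tendsto:
  assumes "\<And>n. f n \<in> L2 S" "g \<in> L2 S" "h \<in> L2 S"
    and "(\<lambda>n. l2_norm S (\<lambda>x. f n x - g x)) \<longlonglongrightarrow> 0"
  shows "(\<lambda>n. l2_inner S (f n) h) \<longlonglongrightarrow> l2_inner S g h"
proof -
  have "(\<lambda>n. l2_norm S (\<lambda>x. f n x - g x) * l2_norm S h) \<longlonglongrightarrow> 0"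
    using tendsto_mult_left_zero[OF assms(4)] .
  then have "(\<lambda>n. l2_inner S (f n) h - l2_inner S g h) \<longlonglongrightarrow> 0"
  proof (rule Lim_null_comparison[rotated])
    show "\<forall>\<^sub>F n in sequentially. norm (l2_inner S (f n) h - l2_inner S g h)
        \<le> l2_norm S (\<lambda>x. f n x - g x) * l2_norm S h"
      using l2_Cauchy_Schwarz[of "\<lambda>x. f _ x - g x" S h] assms(1-3)
      by (simp add: l2_inner_diff_left[symmetric] L2_diff)
  qed
  then show ?thesis by (rule LIM_zero_cancel)
qed

lemma l2_inner_orthogonal_limit:
  assumes "\<And>n. f n \<in> L2 S" "g \<in> L2 S" "h \<in> L2 S"
    and "(\<lambda>n. l2_norm S (\<lambda>x. f n x - g x)) \<longlonglongrightarrow> 0" "\<And>n. l2_inner S (f n) h = 0"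
  shows "l2_inner S g h = 0"
  using l2_inner_tendsto[OF assms(1-4)] assms(5) by (simp add: LIMSEQ_const_iff)

subsection \<open>Completeness and orthogonal projection\<close>

lemma L2_norm_real:
  assumes "f \<in> L2 S"
  shows "(\<lambda>x. norm (f x)) \<in> L2 S" and "l2_norm S (\<lambda>x. norm (f x)) = l2_norm S f"
  using assms by (auto simp: L2_def l2_norm_def l2_inner_def power2_norm_eq_inner
      simp flip: power2_eq_square)

lemma L2_const:
  assumes "S \<in> lmeasurable"
  shows "(\<lambda>x. c) \<in> L2 S"
  using finite_measure.integrable_const[OF finite_measure_lebesgue_on[OF assms]]
  by (auto simp: L2_def)

lemma L2_integrable:
  fixes f :: "real^'d \<Rightarrow> 'b::euclidean_space"
  assumes "S \<in> lmeasurable" "f \<in> L2 S"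
  shows "integrable (lebesgue_on S) f"
proof -
  have "integrable (lebesgue_on S) (\<lambda>x. norm (f x) \<bullet> (1::real))"
    by (intro L2_integrable_inner L2_norm_real L2_const assms)
  then have "integrable (lebesgue_on S) (\<lambda>x. norm (f x))" by simp
  then show ?thesis
    using integrable_norm_iff[OF L2_measurable[OF assms(2)]] by simp
qed

text \<open>Cauchy--Schwarz against the constant 1. On a set of finite measure an \<open>L2\<close>
  Cauchy sequence is thus an \<open>L1\<close> Cauchy sequence, which has an almost everywhere
  convergent subsequence.\<close>

lemma L1_norm_le:
  assumes "S \<in> lmeasurable" "f \<in> L2 S"
  shows "(LINT x|lebesgue_on S. norm (f x)) \<le> l2_norm S f * l2_norm S (\<lambda>x. 1::real)"
  using l2_Cauchy_Schwarz[OF L2_norm_real(1)[OF assms(2)] L2_const[OF assms(1), of "1::real"]]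
    L2_norm_real(2)[OF assms(2)]
  by (simp add: l2_inner_def)

text \<open>Riesz--Fischer: a subsequence converges almost everywhere, and Fatou's lemma bounds the
  distance of each late member of the sequence to the pointwise limit.\<close>

lemma L2_complete:
  fixes f :: "nat \<Rightarrow> real^'d \<Rightarrow> 'b::euclidean_space"
  assumes S: "S \<in> lmeasurable" and f: "\<And>n. f n \<in> L2 S"
    and Cauchy: "\<And>e. e > 0 \<Longrightarrow> \<exists>N. \<forall>i\<ge>N. \<forall>j\<ge>N. l2_norm S (\<lambda>x. f i x - f j x) < e"
  obtains g where "g \<in> L2 S" "(\<lambda>n. l2_norm S (\<lambda>x. f n x - g x)) \<longlonglongrightarrow> 0"
proof -
  let ?M = "lebesgue_on S" and ?c = "l2_norm S (\<lambda>x. 1::real)"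
  have [measurable]: "f n \<in> borel_measurable ?M" for n using f L2_measurable by blast
  have L1: "\<exists>N. \<forall>i\<ge>N. \<forall>j\<ge>N. (LINT x|?M. norm (f i x - f j x)) < e" if "e > 0" for e
  proof -
    \<comment> \<open>Adding 1 to the norm of the constant function covers the case of a null set
      \<open>S\<close>.\<close>
    have "0 < e / (?c + 1)" using that by (intro divide_pos_pos add_nonneg_pos) auto
    from Cauchy[OF this]
    obtain N where N: "\<forall>i\<ge>N. \<forall>j\<ge>N. l2_norm S (\<lambda>x. f i x - f j x) < e / (?c + 1)" ..
    have "(LINT x|?M. norm (f i x - f j x)) < e" if "i \<ge> N" "j \<ge> N" for i j
    proof -
      have "(LINT x|?M. norm (f i x - f j x)) \<le> l2_norm S (\<lambda>x. f i x - f j x) * ?c"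
        by (intro L1_norm_le S L2_diff f)
      also have "\<dots> \<le> l2_norm S (\<lambda>x. f i x - f j x) * (?c + 1)"
        by (intro mult_left_mono) auto
      also have "\<dots> < e"
      proof -
        have "?c + 1 > 0" by (intro add_nonneg_pos) auto
        then show ?thesis using N that by (simp add: pos_less_divide_eq)
      qed
      finally show ?thesis .
    qed
    then show ?thesis by blast
  qed
  obtain r where r: "strict_mono r" and C: "AE x in ?M. Cauchy (\<lambda>i. f (r i) x)"
    by (rule cauchy_L1_AE_cauchy_subseq[OF L2_integrable[OF S f] L1])
  define g where "g = (\<lambda>x. lim (\<lambda>i. f (r i) x))"
  have [measurable]: "g \<in> borel_measurable ?M" unfolding g_def
    by (rule borel_measurable_lim_metric) measurable
  have lim: "AE x in ?M. (\<lambda>i. f (r i) x) \<longlonglongrightarrow> g x"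
    using C by eventually_elim (simp add: g_def Cauchy_convergent convergent_LIMSEQ_iff[symmetric])
  have nn: "(\<integral>\<^sup>+x. ennreal ((norm (h x))\<^sup>2) \<partial>?M) = ennreal ((l2_norm S h)\<^sup>2)" if "h \<in> L2 S" for h :: "real^'d \<Rightarrow> 'b"
    using that nn_integral_eq_integral[OF L2_integrable_norm_sq[OF that]]
    by (simp add: l2_norm_sq l2_inner_def power2_norm_eq_inner)
  have key: "\<exists>N. \<forall>n\<ge>N. (\<lambda>x. f n x - g x) \<in> L2 S \<and> l2_norm S (\<lambda>x. f n x - g x) \<le> e" if "e > 0" for e
  proof -
    obtain N where N: "\<forall>i\<ge>N. \<forall>j\<ge>N. l2_norm S (\<lambda>x. f i x - f j x) < e"
      using Cauchy[OF \<open>e > 0\<close>] ..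
    have "(\<lambda>x. f n x - g x) \<in> L2 S \<and> l2_norm S (\<lambda>x. f n x - g x) \<le> e" if n: "n \<ge> N" for n
    proof -
      have "(\<integral>\<^sup>+x. ennreal ((norm (f n x - g x))\<^sup>2) \<partial>?M)
          = (\<integral>\<^sup>+x. liminf (\<lambda>i. ennreal ((norm (f n x - f (r i) x))\<^sup>2)) \<partial>?M)"
      proof (rule nn_integral_cong_AE)
        show "AE x in ?M. ennreal ((norm (f n x - g x))\<^sup>2) = liminf (\<lambda>i. ennreal ((norm (f n x - f (r i) x))\<^sup>2))"
          using lim
        proof eventually_elim
          case (elim x)
          then have "(\<lambda>i. ennreal ((norm (f n x - f (r i) x))\<^sup>2)) \<longlonglongrightarrow> ennreal ((norm (f n x - g x))\<^sup>2)"
            by (intro tendsto_intros)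
          then show ?case using lim_imp_Liminf[OF sequentially_bot] by metis
        qed
      qed
      \<comment> \<open>Fatou's lemma. The passage from \<open>liminf\<close> to
        \<open>limsup\<close> afterwards only serves to apply an eventual upper bound.\<close>
      also have "\<dots> \<le> liminf (\<lambda>i. \<integral>\<^sup>+x. ennreal ((norm (f n x - f (r i) x))\<^sup>2) \<partial>?M)"
        by (rule nn_integral_liminf) measurable
      also have "\<dots> \<le> limsup (\<lambda>i. \<integral>\<^sup>+x. ennreal ((norm (f n x - f (r i) x))\<^sup>2) \<partial>?M)"
        by (rule Liminf_le_Limsup) simp
      also have "\<dots> \<le> ennreal (e\<^sup>2)"
      proof (rule Limsup_bounded)
        show "\<forall>\<^sub>F i in sequentially. (\<integral>\<^sup>+x. ennreal ((norm (f n x - f (r i) x))\<^sup>2) \<partial>?M) \<le> ennreal (e\<^sup>2)"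
          using eventually_ge_at_top[of N]
        proof eventually_elim
          case (elim i)
          then have "r i \<ge> N" using seq_suble[OF r, of i] by linarith
          then have "l2_norm S (\<lambda>x. f n x - f (r i) x) \<le> e" using N n by (simp add: less_imp_le)
          then show ?case
            using nn[OF L2_diff[OF f f]] by (auto intro!: ennreal_leI power_mono)
        qed
      qed
      finally have le: "(\<integral>\<^sup>+x. ennreal ((norm (f n x - g x))\<^sup>2) \<partial>?M) \<le> ennreal (e\<^sup>2)" .
      then have "integrable ?M (\<lambda>x. (norm (f n x - g x))\<^sup>2)"
        by (intro integrableI_bounded) (auto simp: le_less_trans)
      then have L: "(\<lambda>x. f n x - g x) \<in> L2 S" by (simp add: L2_def)
      then have "(l2_norm S (\<lambda>x. f n x - g x))\<^sup>2 \<le> e\<^sup>2" using le nn[OF L] by simp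
      then show ?thesis using L \<open>e > 0\<close> power2_le_imp_le by fastforce
    qed
    then show ?thesis by blast
  qed
  obtain N where "\<forall>n\<ge>N. (\<lambda>x. f n x - g x) \<in> L2 S" using key[of 1] by auto
  then have g: "g \<in> L2 S" using L2_diff[of "f N" S "\<lambda>x. f N x - g x"] f by simp
  have "(\<lambda>n. l2_norm S (\<lambda>x. f n x - g x)) \<longlonglongrightarrow> 0"
  proof (rule LIMSEQ_I)
    fix e :: real assume "e > 0"
    then obtain N where "\<forall>n\<ge>N. l2_norm S (\<lambda>x. f n x - g x) \<le> e / 2" using key[of "e/2"] by auto
    then show "\<exists>N. \<forall>n\<ge>N. norm (l2_norm S (\<lambda>x. f n x - g x) - 0) < e"
      using \<open>e > 0\<close> by (intro exI[of _ N]) force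
  qed
  then show ?thesis using that g by blast
qed

text \<open>A vector space of representatives, not of classes modulo null functions. The single
  combination \<open>r v + w\<close> covers sums, differences and multiples.\<close>

definition lin_space :: "(real^'d \<Rightarrow> 'b::euclidean_space) set \<Rightarrow> bool" where
  "lin_space W \<longleftrightarrow> (\<lambda>x. 0) \<in> W \<and> (\<forall>v\<in>W. \<forall>w\<in>W. \<forall>r. (\<lambda>x. r *\<^sub>R v x + w x) \<in> W)"

lemma lin_spaceD:
  assumes "lin_space W"
  shows "(\<lambda>x. 0) \<in> W" "\<And>v w r. v \<in> W \<Longrightarrow> w \<in> W \<Longrightarrow> (\<lambda>x. r *\<^sub>R v x + w x) \<in> W"
  using assms by (auto simp: lin_space_def)

lemma lin_space_scaleR: "lin_space W \<Longrightarrow> v \<in> W \<Longrightarrow> (\<lambda>x. r *\<^sub>R v x) \<in> W"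
  using lin_spaceD(2)[of W v "\<lambda>x. 0" r] lin_spaceD(1) by auto

lemma lin_space_add: "lin_space W \<Longrightarrow> v \<in> W \<Longrightarrow> w \<in> W \<Longrightarrow> (\<lambda>x. v x + w x) \<in> W"
  using lin_spaceD(2)[of W v w 1] by auto

lemma lin_space_diff: "lin_space W \<Longrightarrow> v \<in> W \<Longrightarrow> w \<in> W \<Longrightarrow> (\<lambda>x. v x - w x) \<in> W"
  using lin_spaceD(2)[of W w v "-1"] by auto

lemma lin_space_sum:
  assumes "lin_space W" "\<And>i. i \<in> I \<Longrightarrow> w i \<in> W"
  shows "(\<lambda>x. \<Sum>i\<in>I. c i *\<^sub>R w i x) \<in> W"
  using assms by (induction I rule: infinite_finite_induct) (auto intro: lin_spaceD)

lemma lin_space_Int: "lin_space W \<Longrightarrow> lin_space W' \<Longrightarrow> lin_space (W \<inter> W')"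
  by (auto simp: lin_space_def)

text \<open>First-order condition at a minimum: if \<open>d\<close> were nonzero,
  \<open>t = - d / (\<bar>e\<bar> + 1)\<close> would make the expression negative. Both variational
  arguments end here, the \<open>L2\<close> projection and the minimisation of the Rayleigh
  quotient.\<close>

lemma nonneg_quadratic_imp_zero:
  fixes d e :: real
  assumes "\<And>t. 0 \<le> 2 * t * d + t\<^sup>2 * e"
  shows "d = 0"
proof (rule ccontr)
  assume "d \<noteq> 0"
  let ?c = "\<bar>e\<bar> + 1"
  have c: "0 < ?c" by simp
  have "(- d / ?c)\<^sup>2 * e = d\<^sup>2 / ?c * (e / ?c)" by (simp add: power2_eq_square)
  also have "\<dots> \<le> d\<^sup>2 / ?c * 1"
    using c by (intro mult_left_mono) (simp_all add: pos_divide_le_eq)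
  finally have "2 * (- d / ?c) * d + (- d / ?c)\<^sup>2 * e \<le> - (d\<^sup>2 / ?c)"
    by (simp add: power2_eq_square)
  moreover have "0 < d\<^sup>2 / ?c" using c \<open>d \<noteq> 0\<close> by simp
  ultimately show False using assms[of "- d / ?c"] by linarith
qed

text \<open>\<open>W\<close> need not be closed, so the nearest point lies in its closure. The
  approximating sequence \<open>w\<close> is returned together with \<open>g\<close> because
  properties of \<open>g\<close> are later inferred from those of \<open>w n\<close> by
  closedness.\<close>

lemma L2_projection:
  fixes y :: "real^'d \<Rightarrow> 'b::euclidean_space"
  assumes S: "S \<in> lmeasurable" and W: "lin_space W" "W \<subseteq> L2 S" and y: "y \<in> L2 S"
  obtains g w where "g \<in> L2 S" "\<And>n::nat. w n \<in> W" "(\<lambda>n. l2_norm S (\<lambda>x. w n x - g x)) \<longlonglongrightarrow> 0"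
    "\<And>v. v \<in> W \<Longrightarrow> l2_inner S (\<lambda>x. y x - g x) v = 0"
proof -
  let ?q = "\<lambda>f. l2_inner S f f"
  define d where "d = (INF w\<in>W. ?q (\<lambda>x. y x - w x))"
  have bdd: "bdd_below ((\<lambda>w. ?q (\<lambda>x. y x - w x)) ` W)" by (intro bdd_belowI[of _ 0]) auto
  have d: "d \<le> ?q (\<lambda>x. y x - w x)" if "w \<in> W" for w
    unfolding d_def using that by (intro cINF_lower bdd)
  have "\<exists>w\<in>W. ?q (\<lambda>x. y x - w x) < d + 1 / (real n + 1)" for n
  proof -
    have "d < d + 1 / (real n + 1)" by simp
    then show ?thesis unfolding d_def
      using lin_spaceD(1)[OF W(1)] by (subst (asm) cINF_less_iff[OF _ bdd]) auto
  qed
  then obtain w where w: "\<And>n. w n \<in> W" "\<And>n. ?q (\<lambda>x. y x - w n x) < d + 1 / (real n + 1)"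
    by metis
  have wL: "w n \<in> L2 S" for n using w W by blast
  \<comment> \<open>Parallelogram law: the midpoint of \<open>w i\<close> and \<open>w j\<close>
    lies in \<open>W\<close>, so its squared distance to \<open>y\<close> is at least
    \<open>d\<close>.\<close>
  have par: "?q (\<lambda>x. w i x - w j x) \<le> 2 / (real i + 1) + 2 / (real j + 1)" for i j
  proof -
    have "(\<lambda>x. (1/2) *\<^sub>R w i x + (1/2) *\<^sub>R w j x) \<in> W"
      by (intro lin_space_add lin_space_scaleR W w)
    from d[OF this] have "d \<le> ?q (\<lambda>x. y x - ((1/2) *\<^sub>R w i x + (1/2) *\<^sub>R w j x))" .
    moreover have "?q (\<lambda>x. w i x - w j x) = 2 * ?q (\<lambda>x. y x - w i x) + 2 * ?q (\<lambda>x. y x - w j x)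
        - 4 * ?q (\<lambda>x. y x - ((1/2) *\<^sub>R w i x + (1/2) *\<^sub>R w j x))"
      using wL y by (simp add: l2_inner_simps L2_diff L2_add L2_scaleR algebra_simps
          l2_inner_commute[of S "w j" "w i"] l2_inner_commute[of S "w _" y])
    moreover have "2 / (real i + 1) = 2 * (1 / (real i + 1))" "2 / (real j + 1) = 2 * (1 / (real j + 1))"
      by simp_all
    ultimately show ?thesis using w(2)[of i] w(2)[of j] by linarith
  qed
  have Cauchy: "\<exists>N. \<forall>i\<ge>N. \<forall>j\<ge>N. l2_norm S (\<lambda>x. w i x - w j x) < e" if "e > 0" for e
  proof -
    obtain N where N: "4 / e\<^sup>2 < real N" using reals_Archimedean2 by blast
    have "l2_norm S (\<lambda>x. w i x - w j x) < e" if "i \<ge> N" "j \<ge> N" for i j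
    proof (rule power2_less_imp_less)
      have "2 / (real i + 1) \<le> 2 / (real N + 1)" "2 / (real j + 1) \<le> 2 / (real N + 1)"
        using that by (auto intro!: divide_left_mono)
      then have "(l2_norm S (\<lambda>x. w i x - w j x))\<^sup>2 \<le> 4 / (real N + 1)"
        using par[of i j] by (simp add: l2_norm_sq)
      also have "\<dots> < e\<^sup>2" using N \<open>e > 0\<close> by (simp add: field_simps add_strict_increasing)
      finally show "(l2_norm S (\<lambda>x. w i x - w j x))\<^sup>2 < e\<^sup>2" .
    qed (use \<open>e > 0\<close> in simp)
    then show ?thesis by blast
  qed
  obtain g where g: "g \<in> L2 S" "(\<lambda>n. l2_norm S (\<lambda>x. w n x - g x)) \<longlonglongrightarrow> 0"
    using L2_complete[of S w] S wL Cauchy by blast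
  have "l2_inner S (\<lambda>x. y x - g x) v = 0" if v: "v \<in> W" for v
  proof -
    have vL: "v \<in> L2 S" using v W by blast
    let ?b = "l2_inner S (\<lambda>x. y x - g x) v" and ?c = "?q v"
    \<comment> \<open>The infimum need not be attained in \<open>W\<close>. The variation in
      direction \<open>v\<close> is therefore carried out at \<open>w n\<close>, with defect
      \<open>1 / (n + 1)\<close>, and then passed to the limit.\<close>
    have pos: "0 \<le> - 2 * t * ?b + t\<^sup>2 * ?c" for t
    proof -
      have "0 \<le> 1 / (real n + 1) + (- 2 * t * l2_inner S (\<lambda>x. y x - w n x) v + t\<^sup>2 * ?c)" for n
      proof -
        have "(\<lambda>x. t *\<^sub>R v x + w n x) \<in> W" by (intro lin_spaceD(2) W v w)
        from d[OF this] have "d \<le> ?q (\<lambda>x. y x - (t *\<^sub>R v x + w n x))" .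
        also have "\<dots> = ?q (\<lambda>x. y x - w n x) - 2 * t * l2_inner S (\<lambda>x. y x - w n x) v + t\<^sup>2 * ?c"
          using wL y vL by (simp add: l2_inner_simps L2_diff L2_add L2_scaleR algebra_simps
              power2_eq_square l2_inner_commute[of S v "w n"] l2_inner_commute[of S v y])
        finally show ?thesis using w(2)[of n] by linarith
      qed
      moreover have "(\<lambda>n. 1 / (real n + 1) + (- 2 * t * l2_inner S (\<lambda>x. y x - w n x) v + t\<^sup>2 * ?c))
          \<longlonglongrightarrow> 0 + (- 2 * t * ?b + t\<^sup>2 * ?c)"
      proof (intro tendsto_intros)
        show "(\<lambda>n. 1 / (real n + 1)) \<longlonglongrightarrow> 0"
          using LIMSEQ_inverse_real_of_nat by (simp add: inverse_eq_divide add.commute)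
        have "(\<lambda>n. l2_norm S (\<lambda>x. (y x - w n x) - (y x - g x))) \<longlonglongrightarrow> 0"
          using g(2) by (subst l2_norm_minus_commute) simp
        then show "(\<lambda>n. l2_inner S (\<lambda>x. y x - w n x) v) \<longlonglongrightarrow> ?b"
          using y wL g(1) vL by (intro l2_inner_tendsto) auto
      qed
      ultimately show ?thesis using LIMSEQ_le_const[of _ "0 + (- 2 * t * ?b + t\<^sup>2 * ?c)" 0] by auto
    qed
    have "- ?b = 0" by (rule nonneg_quadratic_imp_zero[of _ ?c]) (use pos in \<open>simp add: algebra_simps\<close>)
    then show ?thesis by simp
  qed
  then show ?thesis using that g w by blast
qed

subsection \<open>Finite-dimensional spaces modulo null functions\<close>

text \<open>Gaussian elimination by induction on the number of equations: unless the last equation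
  is void, it is solved for an unknown \<open>p\<close>, and substitution leaves one equation and
  one unknown fewer.\<close>

lemma underdetermined_system:
  fixes A :: "nat \<Rightarrow> nat \<Rightarrow> real"
  assumes "m < n"
  obtains c where "\<exists>i<n. c i \<noteq> 0" "\<And>j. j < m \<Longrightarrow> (\<Sum>i<n. c i * A i j) = 0"
proof -
  have "\<exists>c. (\<exists>i<n. c i \<noteq> 0) \<and> (\<forall>j<m. (\<Sum>i<n. c i * A i j) = 0)"
    using assms
  proof (induction m arbitrary: n A)
    case 0
    then show ?case by (intro exI[of _ "\<lambda>i. 1"]) auto
  next
    case (Suc m)
    show ?case
    proof (cases "\<exists>p<n. A p m \<noteq> 0")
      case False
      obtain c where c: "\<exists>i<n. c i \<noteq> 0" "\<forall>j<m. (\<Sum>i<n. c i * A i j) = 0"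
        using Suc.IH[of n A] Suc.prems by auto
      have "(\<Sum>i<n. c i * A i m) = 0" using False by (intro sum.neutral) auto
      then show ?thesis using c less_Suc_eq by (intro exI[of _ c]) auto
    next
      case True
      then obtain p where p: "p < n" "A p m \<noteq> 0" by blast
      obtain n' where n': "n = Suc n'" using Suc.prems by (cases n) auto
      \<comment> \<open>Enumerates the unknowns other than \<open>p\<close>.\<close>
      define \<sigma> where "\<sigma> i = (if i < p then i else Suc i)" for i :: nat
      have inj: "inj_on \<sigma> {..<n'}" by (auto simp: inj_on_def \<sigma>_def split: if_splits)
      have "i \<in> \<sigma> ` {..<n'}" if "i < n" "i \<noteq> p" for i
        using that n' p by (intro image_eqI[of _ _ "if i < p then i else i - 1"]) (auto simp: \<sigma>_def)
      moreover have "\<sigma> i < n" "\<sigma> i \<noteq> p" if "i < n'" for i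
        using that n' by (auto simp: \<sigma>_def)
      ultimately have img: "{..<n} = insert p (\<sigma> ` {..<n'})" "p \<notin> \<sigma> ` {..<n'}"
        using p by auto
      obtain c where c: "\<exists>i<n'. c i \<noteq> 0"
        "\<forall>j<m. (\<Sum>i<n'. c i * (A (\<sigma> i) j - A (\<sigma> i) m / A p m * A p j)) = 0"
        using Suc.IH[of n' "\<lambda>i j. A (\<sigma> i) j - A (\<sigma> i) m / A p m * A p j"] Suc.prems n' by auto
      \<comment> \<open>The value at \<open>p\<close> is dictated by equation \<open>m\<close>; the
        other values are those of the reduced system.\<close>
      define c' where "c' i = (if i = p then - (\<Sum>i<n'. c i * A (\<sigma> i) m) / A p m
         else c (the_inv_into {..<n'} \<sigma> i))" for i
      have c'\<sigma>: "c' (\<sigma> i) = c i" if "i < n'" for i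
        using that img(2) by (auto simp: c'_def the_inv_into_f_f[OF inj])
      have *: "(\<Sum>i<n. c' i * A i j) = c' p * A p j + (\<Sum>i<n'. c i * A (\<sigma> i) j)" for j
        using img(2) by (simp add: img(1) sum.reindex[OF inj] c'\<sigma>)
      have "(\<Sum>i<n. c' i * A i j) = 0" if "j < Suc m" for j
      proof (cases "j = m")
        case True
        then show ?thesis using p by (simp add: *) (simp add: c'_def)
      next
        case False
        then have "j < m" using that by simp
        then show ?thesis using c(2) p
          by (simp add: *) (simp add: c'_def sum_subtractf sum_distrib_left sum_divide_distrib
              algebra_simps)
      qed
      moreover obtain i where "i < n'" "c i \<noteq> 0" using c(1) by blast
      then have "\<sigma> i < n \<and> c' (\<sigma> i) \<noteq> 0" using c'\<sigma> img by auto
      ultimately show ?thesis by blast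
    qed
  qed
  then show ?thesis using that by blast
qed

text \<open>Phrased as dependence of any \<open>n\<close> members, so that it passes to arbitrary
  subsets and involves no choice of a basis.\<close>

definition finite_dim :: "(real^'d) set \<Rightarrow> (real^'d \<Rightarrow> 'b::euclidean_space) set \<Rightarrow> bool" where
  "finite_dim S W \<longleftrightarrow> (\<exists>n. \<forall>w. (\<forall>i<n. w i \<in> W) \<longrightarrow>
     (\<exists>c::nat \<Rightarrow> real. (\<exists>i<n. c i \<noteq> 0) \<and> (AE x in lebesgue_on S. (\<Sum>i<n. c i *\<^sub>R w i x) = 0)))"

lemma finite_dim_subset:
  assumes "finite_dim S W" "W' \<subseteq> W"
  shows "finite_dim S W'"
proof -
  obtain n where n: "\<And>w. (\<forall>i<n. w i \<in> W) \<Longrightarrow>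
     \<exists>c::nat \<Rightarrow> real. (\<exists>i<n. c i \<noteq> 0) \<and> (AE x in lebesgue_on S. (\<Sum>i<n. c i *\<^sub>R w i x) = 0)"
    using assms(1) by (auto simp: finite_dim_def)
  show ?thesis unfolding finite_dim_def
  proof (intro exI[of _ n] allI impI)
    fix w assume "\<forall>i<n. w i \<in> W'"
    then have "\<forall>i<n. w i \<in> W" using assms(2) by blast
    from n[OF this] show "\<exists>c::nat \<Rightarrow> real. (\<exists>i<n. c i \<noteq> 0)
      \<and> (AE x in lebesgue_on S. (\<Sum>i<n. c i *\<^sub>R w i x) = 0)" .
  qed
qed

text \<open>A linear operator on classes modulo null functions, expressed through representatives.
  Operators such as \<open>weak\<close> choose an arbitrary representative, so linearity holds only
  almost everywhere, and \<open>null\<close> is what makes the class of the image depend on the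
  class of the argument alone.\<close>

locale L2_linear =
  fixes S :: "(real^'d) set" and W :: "(real^'d \<Rightarrow> 'b::euclidean_space) set"
    and A :: "(real^'d \<Rightarrow> 'b) \<Rightarrow> real^'d \<Rightarrow> 'c::euclidean_space"
  assumes in_L2: "v \<in> W \<Longrightarrow> A v \<in> L2 S"
    and lincomb: "v \<in> W \<Longrightarrow> w \<in> W \<Longrightarrow>
      AE x in lebesgue_on S. A (\<lambda>y. r *\<^sub>R v y + w y) x = r *\<^sub>R A v x + A w x"
    and null: "v \<in> W \<Longrightarrow> AE x in lebesgue_on S. v x = 0 \<Longrightarrow> AE x in lebesgue_on S. A v x = 0"

lemmas L2_linearD = L2_linear.in_L2 L2_linear.lincomb L2_linear.null

lemma L2_linear_mono:
  assumes "L2_linear S W A" "W' \<subseteq> W"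
  shows "L2_linear S W' A"
proof
  fix v w r assume "v \<in> W'"
  then have v: "v \<in> W" using assms(2) by blast
  show "A v \<in> L2 S" by (rule L2_linearD(1)[OF assms(1) v])
  show "AE x in lebesgue_on S. A v x = 0" if "AE x in lebesgue_on S. v x = 0"
    by (rule L2_linearD(3)[OF assms(1) v that])
  assume "w \<in> W'"
  then have w: "w \<in> W" using assms(2) by blast
  show "AE x in lebesgue_on S. A (\<lambda>y. r *\<^sub>R v y + w y) x = r *\<^sub>R A v x + A w x"
    by (rule L2_linearD(2)[OF assms(1) v w])
qed

lemma L2_linear_sum:
  fixes w :: "nat \<Rightarrow> real^'d \<Rightarrow> 'b::euclidean_space"
  assumes A: "L2_linear S W A" and W: "lin_space W" and w: "\<And>i. i < n \<Longrightarrow> w i \<in> W"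
  shows "AE x in lebesgue_on S. A (\<lambda>y. \<Sum>i<n. c i *\<^sub>R w i y) x = (\<Sum>i<n. c i *\<^sub>R A (w i) x)"
  using w
proof (induction n)
  case 0
  then show ?case using L2_linearD(3)[OF A lin_spaceD(1)[OF W]] by simp
next
  case (Suc n)
  have "AE x in lebesgue_on S. A (\<lambda>y. c n *\<^sub>R w n y + (\<Sum>i<n. c i *\<^sub>R w i y)) x
      = c n *\<^sub>R A (w n) x + A (\<lambda>y. \<Sum>i<n. c i *\<^sub>R w i y) x"
    using Suc.prems by (intro L2_linearD(2)[OF A] lin_space_sum W) auto
  moreover have "AE x in lebesgue_on S. A (\<lambda>y. \<Sum>i<n. c i *\<^sub>R w i y) x = (\<Sum>i<n. c i *\<^sub>R A (w i) x)"
    using Suc by auto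
  ultimately show ?case by eventually_elim (simp add: add.commute)
qed

lemma L2_linear_diff:
  assumes A: "L2_linear S W A" and W: "lin_space W" and "v \<in> W" "w \<in> W"
  shows "AE x in lebesgue_on S. A (\<lambda>y. v y - w y) x = A v x - A w x"
  using L2_linearD(2)[OF A assms(4,3), of "-1"] by simp

lemma L2_linear_scaleR:
  assumes A: "L2_linear S W A" and W: "lin_space W" and "v \<in> W"
  shows "AE x in lebesgue_on S. A (\<lambda>y. r *\<^sub>R v y) x = r *\<^sub>R A v x"
proof -
  have "AE x in lebesgue_on S. A (\<lambda>x. 0) x = 0"
    using L2_linearD(3)[OF A lin_spaceD(1)[OF W]] by simp
  moreover have "AE x in lebesgue_on S. A (\<lambda>y. r *\<^sub>R v y) x = r *\<^sub>R A v x + A (\<lambda>x. 0) x"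
    using L2_linearD(2)[OF A assms(3) lin_spaceD(1)[OF W], of r] by simp
  ultimately show ?thesis by eventually_elim simp
qed

text \<open>A family of maximal size with orthonormal images; a function whose image is not spanned
  would allow one more member. \<open>A\<close> may have a kernel, so it is \<open>A v\<close> and
  not \<open>v\<close> that is expanded. Applied to the rotation on \<open>Vh\<close>, to the Curl
  on \<open>Sh\<close> and to the identity.\<close>

lemma finite_dim_orthonormal:
  assumes W: "lin_space W" "finite_dim S W" and A: "L2_linear S W A"
  obtains m :: nat and b where "\<And>i. i < m \<Longrightarrow> b i \<in> W"
    "\<And>i j. i < m \<Longrightarrow> j < m \<Longrightarrow> l2_inner S (A (b i)) (A (b j)) = (if i = j then 1 else 0)"
    "\<And>v. v \<in> W \<Longrightarrow> AE x in lebesgue_on S. A v x = (\<Sum>i<m. l2_inner S (A v) (A (b i)) *\<^sub>R A (b i) x)"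
proof -
  define P where "P m \<longleftrightarrow> (\<exists>b. (\<forall>i<m. b i \<in> W) \<and>
    (\<forall>i<m. \<forall>j<m. l2_inner S (A (b i)) (A (b j)) = (if i = j then 1 else (0::real))))" for m :: nat
  obtain n where n: "\<And>w. (\<forall>i<n. w i \<in> W) \<Longrightarrow>
     \<exists>c::nat \<Rightarrow> real. (\<exists>i<n. c i \<noteq> 0) \<and> (AE x in lebesgue_on S. (\<Sum>i<n. c i *\<^sub>R w i x) = 0)"
    using W(2) by (auto simp: finite_dim_def)
  \<comment> \<open>Functions with orthonormal images are independent modulo null functions, so
    their number stays below \<open>n\<close> and a maximum exists.\<close>
  have bound: "m < n" if Pm: "P m" for m
  proof (rule ccontr)
    assume "\<not> m < n"
    then have "n \<le> m" by simp
    obtain b where b: "\<And>i. i < m \<Longrightarrow> b i \<in> W"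
      "\<And>i j. i < m \<Longrightarrow> j < m \<Longrightarrow> l2_inner S (A (b i)) (A (b j)) = (if i = j then 1 else (0::real))"
      using Pm unfolding P_def by blast
    obtain c where c: "\<exists>i<n. c i \<noteq> 0" "AE x in lebesgue_on S. (\<Sum>i<n. c i *\<^sub>R b i x) = 0"
      using n[of b] b(1) \<open>n \<le> m\<close> by (meson order.strict_trans2)
    have "AE x in lebesgue_on S. A (\<lambda>x. \<Sum>i<n. c i *\<^sub>R b i x) x = 0"
      using b(1) \<open>n \<le> m\<close> c(2) by (intro L2_linearD(3)[OF A] lin_space_sum W(1)) auto
    moreover have "AE x in lebesgue_on S. A (\<lambda>y. \<Sum>i<n. c i *\<^sub>R b i y) x = (\<Sum>i<n. c i *\<^sub>R A (b i) x)"
      using b(1) \<open>n \<le> m\<close> by (intro L2_linear_sum[OF A W(1)]) auto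
    ultimately have zero: "AE x in lebesgue_on S. (\<Sum>i<n. c i *\<^sub>R A (b i) x) = 0"
      by eventually_elim simp
    have "c j = 0" if "j < n" for j
    proof -
      have AL: "A (b i) \<in> L2 S" if "i < n" for i
        using that b(1) \<open>n \<le> m\<close> by (intro L2_linearD(1)[OF A]) auto
      have sL: "(\<lambda>x. \<Sum>i<n. c i *\<^sub>R A (b i) x) \<in> L2 S"
        by (rule L2_sum, rule L2_scaleR, rule AL) simp
      have "0 = l2_inner S (\<lambda>x. \<Sum>i<n. c i *\<^sub>R A (b i) x) (A (b j))"
        using l2_inner_cong_AE[OF sL L2_zero AL[OF that] AL[OF that] zero] by simp
      also have "\<dots> = (\<Sum>i<n. c i * l2_inner S (A (b i)) (A (b j)))"
        using AL that by (subst l2_inner_sum_left) (auto simp: l2_inner_scaleR_left)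
      also have "\<dots> = (\<Sum>i<n. if i = j then c j else 0)"
        using b(2) that \<open>n \<le> m\<close> by (intro sum.cong) auto
      finally show ?thesis using that by simp
    qed
    then show False using c(1) by blast
  qed
  have "P 0" by (simp add: P_def)
  define m where "m = Greatest P"
  have Pm: "P m" unfolding m_def using GreatestI_nat[of P 0 n] \<open>P 0\<close> bound by (simp add: less_imp_le)
  have max: "k \<le> m" if "P k" for k
    unfolding m_def using Greatest_le_nat[of P k n] that bound by (simp add: less_imp_le)
  obtain b where b: "\<And>i. i < m \<Longrightarrow> b i \<in> W"
      "\<And>i j. i < m \<Longrightarrow> j < m \<Longrightarrow> l2_inner S (A (b i)) (A (b j)) = (if i = j then 1 else (0::real))"
    using Pm unfolding P_def by blast
  have AL: "A (b i) \<in> L2 S" if "i < m" for i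
    using that b(1) by (intro L2_linearD(1)[OF A]) auto
  have "AE x in lebesgue_on S. A v x = (\<Sum>i<m. l2_inner S (A v) (A (b i)) *\<^sub>R A (b i) x)" if v: "v \<in> W" for v
  proof -
    define s where "s = (\<lambda>x. \<Sum>i<m. l2_inner S (A v) (A (b i)) *\<^sub>R b i x)"
    define r where "r = (\<lambda>x. v x - s x)"
    have sW: "s \<in> W" unfolding s_def using b(1) by (intro lin_space_sum W) auto
    then have rW: "r \<in> W" unfolding r_def using v by (intro lin_space_diff W)
    have vL: "A v \<in> L2 S" and rL: "A r \<in> L2 S" using L2_linearD(1)[OF A] v rW by auto
    have "AE x in lebesgue_on S. A s x = (\<Sum>i<m. l2_inner S (A v) (A (b i)) *\<^sub>R A (b i) x)"
      unfolding s_def using b(1) by (intro L2_linear_sum[OF A W(1)]) auto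
    moreover have "AE x in lebesgue_on S. A r x = A v x - A s x"
      unfolding r_def using v sW by (intro L2_linear_diff[OF A W(1)])
    ultimately have Ar: "AE x in lebesgue_on S. A r x = A v x - (\<Sum>i<m. l2_inner S (A v) (A (b i)) *\<^sub>R A (b i) x)"
      by eventually_elim simp
    have sL: "(\<lambda>x. \<Sum>i<m. l2_inner S (A v) (A (b i)) *\<^sub>R A (b i) x) \<in> L2 S"
      by (rule L2_sum, rule L2_scaleR, rule AL) simp
    have orth: "l2_inner S (A r) (A (b j)) = 0" if j: "j < m" for j
    proof -
      have "l2_inner S (A r) (A (b j))
          = l2_inner S (\<lambda>x. A v x - (\<Sum>i<m. l2_inner S (A v) (A (b i)) *\<^sub>R A (b i) x)) (A (b j))"
        using L2_diff[OF vL sL] by (intro l2_inner_cong_AE rL AL[OF j] Ar) auto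
      also have "\<dots> = l2_inner S (A v) (A (b j)) - (\<Sum>i<m. l2_inner S (A v) (A (b i)) * l2_inner S (A (b i)) (A (b j)))"
        using l2_inner_sum_left[of "{..<m}" "\<lambda>i x. l2_inner S (A v) (A (b i)) *\<^sub>R A (b i) x" S "A (b j)"]
          L2_scaleR[OF AL] AL[OF j]
        by (simp add: l2_inner_diff_left[OF vL sL AL[OF j]] l2_inner_scaleR_left)
      also have "(\<Sum>i<m. l2_inner S (A v) (A (b i)) * l2_inner S (A (b i)) (A (b j)))
          = (\<Sum>i<m. if i = j then l2_inner S (A v) (A (b j)) else 0)"
        using b(2) j by (intro sum.cong) auto
      finally show ?thesis using j by simp
    qed
    have "l2_norm S (A r) = 0"
    proof (rule ccontr)
      assume nz: "l2_norm S (A r) \<noteq> 0"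
      \<comment> \<open>If the remainder of the expansion had a nonzero image, its normalisation
        could be appended to the family.\<close>
      define k where "k = 1 / l2_norm S (A r)"
      define b' where "b' i = (if i = m then (\<lambda>x. k *\<^sub>R r x) else b i)" for i
      have b'W: "b' i \<in> W" if "i < Suc m" for i
        using that b(1) lin_space_scaleR[OF W(1) rW, of k] by (cases "i = m") (simp_all add: b'_def)
      have Am: "AE x in lebesgue_on S. A (b' m) x = k *\<^sub>R A r x"
        using L2_linear_scaleR[OF A W(1) rW, of k] by (simp add: b'_def)
      have b'L: "A (b' m) \<in> L2 S" using L2_linearD(1)[OF A b'W[of m]] by simp
      have 1: "l2_inner S (A (b' m)) (A (b j)) = 0" if "j < m" for j
      proof -
        have "l2_inner S (A (b' m)) (A (b j)) = l2_inner S (\<lambda>x. k *\<^sub>R A r x) (A (b j))"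
          using Am b'L AL rL that by (intro l2_inner_cong_AE) auto
        then show ?thesis using orth[OF that] by (simp add: l2_inner_scaleR_left)
      qed
      have "l2_inner S (A (b' m)) (A (b' m)) = l2_inner S (\<lambda>x. k *\<^sub>R A r x) (\<lambda>x. k *\<^sub>R A r x)"
        using Am b'L rL by (intro l2_inner_cong_AE) auto
      also have "\<dots> = k * k * (l2_norm S (A r))\<^sup>2"
        by (simp add: l2_inner_scaleR_left l2_inner_scaleR_right l2_norm_sq)
      also have "\<dots> = 1" using nz by (simp add: k_def power2_eq_square)
      finally have 2: "l2_inner S (A (b' m)) (A (b' m)) = 1" .
      have "l2_inner S (A (b' i)) (A (b' j)) = (if i = j then 1 else 0)" if "i < Suc m" "j < Suc m" for i j
      proof -
        have [simp]: "b' l = b l" if "l < m" for l using that by (simp add: b'_def)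
        from that consider "i < m" "j < m" | "i = m" "j < m" | "i < m" "j = m" | "i = m" "j = m"
          by linarith
        then show ?thesis
        proof cases
          case 1
          then show ?thesis using b(2) by simp
        next
          case 2
          then show ?thesis using 1 by simp
        next
          case 3
          then show ?thesis using 1[of i] by (simp add: l2_inner_commute)
        next
          case 4
          then show ?thesis using 2 by simp
        qed
      qed
      then have "P (Suc m)" using b'W unfolding P_def by blast
      then show False using max by force
    qed
    then have "AE x in lebesgue_on S. A r x = 0" using l2_norm_eq_0_iff[OF rL] by simp
    then show ?thesis using Ar by eventually_elim simp
  qed
  with b show ?thesis by (rule that[of m b])
qed

section \<open>Smooth functions\<close>

lemma smooth_differentiable: "smooth f \<Longrightarrow> f differentiable (at x)"
  by (auto elim: smooth.cases)

lemma smooth_frechet: "smooth f \<Longrightarrow> smooth (\<lambda>x. frechet_derivative f (at x) e)"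
  by (auto elim: smooth.cases)

lemma smooth_has_derivative: "smooth f \<Longrightarrow> (f has_derivative frechet_derivative f (at x)) (at x)"
  using frechet_derivative_works smooth_differentiable by blast

lemma smooth_continuous_on: "smooth f \<Longrightarrow> continuous_on A f"
  by (meson continuous_at_imp_continuous_on differentiable_imp_continuous_within smooth_differentiable)

text \<open>Derivatives are unique, so the coinductive invariant may be checked with any explicitly
  given derivative in place of \<open>frechet_derivative\<close>.\<close>

lemma smooth_coinduct_derivative:
  assumes "P f" "\<And>f. P f \<Longrightarrow> \<exists>f'. (\<forall>x. (f has_derivative f' x) (at x)) \<and> (\<forall>e. P (\<lambda>x. f' x e))"
  shows "smooth f"
  using assms(1)
proof (coinduction arbitrary: f)
  case smooth
  then obtain f' where f': "\<And>x. (f has_derivative f' x) (at x)" "\<And>e. P (\<lambda>x. f' x e)"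
    using assms(2) by blast
  then have "frechet_derivative f (at x) = f' x" for x
    using frechet_derivative_at by metis
  then show ?case using f' by (auto simp: differentiable_def)
qed

lemma smooth_linear:
  assumes "bounded_linear L" "smooth f"
  shows "smooth (\<lambda>x. L (f x))"
proof (rule smooth_coinduct_derivative[where P = "\<lambda>h. \<exists>f. smooth f \<and> h = (\<lambda>x. L (f x))"])
  fix h assume "\<exists>f. smooth f \<and> h = (\<lambda>x. L (f x))"
  then obtain f where f: "smooth f" "h = (\<lambda>x. L (f x))" by blast
  show "\<exists>h'. (\<forall>x. (h has_derivative h' x) (at x))
      \<and> (\<forall>e. \<exists>f. smooth f \<and> (\<lambda>x. h' x e) = (\<lambda>x. L (f x)))"
  proof (intro exI[of _ "\<lambda>x e. L (frechet_derivative f (at x) e)"] conjI allI)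
    show "(h has_derivative (\<lambda>e. L (frechet_derivative f (at x) e))) (at x)" for x
      unfolding f(2) by (rule bounded_linear.has_derivative[OF assms(1) smooth_has_derivative[OF f(1)]])
    show "\<exists>g. smooth g \<and> (\<lambda>x. L (frechet_derivative f (at x) e)) = (\<lambda>x. L (g x))" for e
      using smooth_frechet[OF f(1)] by blast
  qed
qed (use assms in blast)

lemma smooth_add:
  assumes "smooth f" "smooth g"
  shows "smooth (\<lambda>x. f x + g x)"
proof (rule smooth_coinduct_derivative[where P = "\<lambda>h. \<exists>f g. smooth f \<and> smooth g \<and> h = (\<lambda>x. f x + g x)"])
  fix h :: "'a \<Rightarrow> 'b" assume "\<exists>f g. smooth f \<and> smooth g \<and> h = (\<lambda>x. f x + g x)"
  then obtain f g where f: "smooth f" and g: "smooth g" and h: "h = (\<lambda>x. f x + g x)" by blast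
  show "\<exists>h'. (\<forall>x. (h has_derivative h' x) (at x))
      \<and> (\<forall>e. \<exists>f g. smooth f \<and> smooth g \<and> (\<lambda>x. h' x e) = (\<lambda>x. f x + g x))"
  proof (intro exI[of _ "\<lambda>x e. frechet_derivative f (at x) e + frechet_derivative g (at x) e"] conjI allI)
    show "(h has_derivative (\<lambda>e. frechet_derivative f (at x) e + frechet_derivative g (at x) e)) (at x)" for x
      unfolding h by (intro has_derivative_add smooth_has_derivative f g)
    show "\<exists>f' g'. smooth f' \<and> smooth g' \<and>
        (\<lambda>x. frechet_derivative f (at x) e + frechet_derivative g (at x) e) = (\<lambda>x. f' x + g' x)" for e
      using smooth_frechet[OF f] smooth_frechet[OF g] by blast
  qed
qed (use assms in blast)

lemma smooth_const: "smooth (\<lambda>x. c)"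
proof (rule smooth_coinduct_derivative[where P = "\<lambda>h. \<exists>c. h = (\<lambda>x. c)"])
  fix h :: "'a \<Rightarrow> 'b" assume "\<exists>c. h = (\<lambda>x. c)"
  then show "\<exists>h'. (\<forall>x. (h has_derivative h' x) (at x)) \<and> (\<forall>e. \<exists>c. (\<lambda>x. h' x e) = (\<lambda>x. c))"
    by (intro exI[of _ "\<lambda>x e. 0"]) auto
qed blast

lemma smooth_partial: "smooth f \<Longrightarrow> smooth (partial i f)"
  unfolding partial_def using smooth_frechet[of f "axis i 1"] by (simp add: partial_def[abs_def])

lemma partial_linear:
  assumes "bounded_linear L" "smooth f"
  shows "partial i (\<lambda>x. L (f x)) x = L (partial i f x)"
  unfolding partial_def
  using frechet_derivative_at[OF bounded_linear.has_derivative[OF assms(1) smooth_has_derivative[OF assms(2)]], of x]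
  by (metis (no_types))

subsection \<open>Symmetry of second derivatives\<close>

lemma difference_mean_value:
  fixes f :: "'a::real_normed_vector \<Rightarrow> real"
  assumes f: "\<And>x. f differentiable (at x)" and "0 < h"
  obtains s where "0 < s" "s < h" "f (x + h *\<^sub>R a) - f x = h * frechet_derivative f (at (x + s *\<^sub>R a)) a"
proof -
  have "((\<lambda>s. f (x + s *\<^sub>R a)) has_real_derivative frechet_derivative f (at (x + s *\<^sub>R a)) a) (at s)" for s
  proof -
    have "(f has_derivative frechet_derivative f (at (x + s *\<^sub>R a))) (at (x + s *\<^sub>R a))"
      using f frechet_derivative_works by blast
    then have "((\<lambda>s. f (x + s *\<^sub>R a)) has_derivative
        (\<lambda>t. frechet_derivative f (at (x + s *\<^sub>R a)) (t *\<^sub>R a))) (at s)"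
      by (rule has_derivative_compose[rotated]) (auto intro!: derivative_eq_intros)
    then show ?thesis
      using f by (simp add: has_field_derivative_def linear_cmul[OF linear_frechet_derivative]
          mult.commute[of _ "frechet_derivative f _ _"])
  qed
  from MVT2[OF \<open>0 < h\<close> this] obtain s where "0 < s" "s < h"
    "f (x + h *\<^sub>R a) - f (x + 0 *\<^sub>R a) = (h - 0) * frechet_derivative f (at (x + s *\<^sub>R a)) a" by blast
  then show ?thesis using that by simp
qed

definition dder :: "'a::real_normed_vector \<Rightarrow> ('a \<Rightarrow> 'b::real_normed_vector) \<Rightarrow> 'a \<Rightarrow> 'b" where
  "dder a f x = frechet_derivative f (at x) a"

text \<open>Mean value theorem twice: in direction \<open>a\<close> for the increment of
  \<open>f\<close> by \<open>h b\<close>, then in direction \<open>b\<close> for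
  \<open>dder a f\<close>.\<close>

lemma second_difference:
  fixes f :: "'a::real_normed_vector \<Rightarrow> real"
  assumes f: "smooth f" and "0 < h"
  obtains s t where "0 < s" "s < h" "0 < t" "t < h"
    "f (x + h *\<^sub>R a + h *\<^sub>R b) - f (x + h *\<^sub>R a) - f (x + h *\<^sub>R b) + f x
      = h * h * dder b (dder a f) (x + s *\<^sub>R a + t *\<^sub>R b)"
proof -
  let ?g = "\<lambda>y. f (y + h *\<^sub>R b) - f y"
  have fd: "(f has_derivative (\<lambda>e. dder e f y)) (at y)" for y
    using smooth_has_derivative[OF f] by (simp add: dder_def[abs_def])
  have shift: "((\<lambda>y. y + h *\<^sub>R b) has_derivative (\<lambda>e. e)) (at y)" for y
    by (auto intro!: derivative_eq_intros)
  have gd: "(?g has_derivative (\<lambda>e. dder e f (y + h *\<^sub>R b) - dder e f y)) (at y)" for y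
    by (rule has_derivative_diff[OF has_derivative_compose[OF shift fd] fd])
  then have g: "?g differentiable (at y)" for y unfolding differentiable_def by blast
  obtain s where s: "0 < s" "s < h"
    "?g (x + h *\<^sub>R a) - ?g x = h * frechet_derivative ?g (at (x + s *\<^sub>R a)) a"
    by (rule difference_mean_value[OF g \<open>0 < h\<close>, of x a])
  have *: "frechet_derivative ?g (at (x + s *\<^sub>R a)) a
      = dder a f (x + s *\<^sub>R a + h *\<^sub>R b) - dder a f (x + s *\<^sub>R a)"
    using fun_cong[OF frechet_derivative_at[OF gd, of "x + s *\<^sub>R a"], of a] by simp
  have ad: "dder a f differentiable (at y)" for y
    using smooth_differentiable[OF smooth_frechet[OF f]] by (simp add: dder_def[abs_def])
  obtain t where t: "0 < t" "t < h"
    "dder a f (x + s *\<^sub>R a + h *\<^sub>R b) - dder a f (x + s *\<^sub>R a)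
      = h * frechet_derivative (dder a f) (at (x + s *\<^sub>R a + t *\<^sub>R b)) b"
    by (rule difference_mean_value[OF ad \<open>0 < h\<close>, of "x + s *\<^sub>R a" b])
  have "f (x + h *\<^sub>R a + h *\<^sub>R b) - f (x + h *\<^sub>R a) - f (x + h *\<^sub>R b) + f x
      = ?g (x + h *\<^sub>R a) - ?g x" by simp
  also have "\<dots> = h * h * dder b (dder a f) (x + s *\<^sub>R a + t *\<^sub>R b)"
    unfolding s(3) * t(3) by (simp add: dder_def)
  finally show ?thesis using that[OF s(1,2) t(1,2)] by simp
qed

lemma smooth_dder: "smooth f \<Longrightarrow> smooth (dder a f)"
  unfolding dder_def[abs_def] by (rule smooth_frechet)

text \<open>The mixed second difference is symmetric in \<open>a\<close> and \<open>b\<close>.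
  Divided by \<open>h^2\<close> it equals either mixed derivative at some point near
  \<open>x\<close>, and continuity identifies the two limits.\<close>

lemma second_derivative_symmetric:
  fixes f :: "'a::real_normed_vector \<Rightarrow> real"
  assumes f: "smooth f"
  shows "dder b (dder a f) x = dder a (dder b f) x"
proof -
  let ?h = "\<lambda>n::nat. 1 / (real n + 1)"
  have h: "?h \<longlonglongrightarrow> 0"
    using LIMSEQ_inverse_real_of_nat by (simp add: inverse_eq_divide add.commute)
  have "\<exists>s t s' t'. 0 < s \<and> s < ?h n \<and> 0 < t \<and> t < ?h n \<and> 0 < s' \<and> s' < ?h n \<and> 0 < t' \<and> t' < ?h n \<and>
      dder b (dder a f) (x + s *\<^sub>R a + t *\<^sub>R b) = dder a (dder b f) (x + s' *\<^sub>R b + t' *\<^sub>R a)" for n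
  proof -
    have pos: "0 < ?h n" by simp
    obtain s t where st: "0 < s" "s < ?h n" "0 < t" "t < ?h n"
      "f (x + ?h n *\<^sub>R a + ?h n *\<^sub>R b) - f (x + ?h n *\<^sub>R a) - f (x + ?h n *\<^sub>R b) + f x
        = ?h n * ?h n * dder b (dder a f) (x + s *\<^sub>R a + t *\<^sub>R b)"
      by (rule second_difference[OF f pos, of x a b])
    obtain s' t' where st': "0 < s'" "s' < ?h n" "0 < t'" "t' < ?h n"
      "f (x + ?h n *\<^sub>R b + ?h n *\<^sub>R a) - f (x + ?h n *\<^sub>R b) - f (x + ?h n *\<^sub>R a) + f x
        = ?h n * ?h n * dder a (dder b f) (x + s' *\<^sub>R b + t' *\<^sub>R a)"
      by (rule second_difference[OF f pos, of x b a])
    have "?h n * ?h n * dder b (dder a f) (x + s *\<^sub>R a + t *\<^sub>R b)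
        = ?h n * ?h n * dder a (dder b f) (x + s' *\<^sub>R b + t' *\<^sub>R a)"
      unfolding st(5)[symmetric] st'(5)[symmetric] by (simp add: add.commute add.left_commute)
    then have "dder b (dder a f) (x + s *\<^sub>R a + t *\<^sub>R b) = dder a (dder b f) (x + s' *\<^sub>R b + t' *\<^sub>R a)"
      using pos by simp
    then show ?thesis using st(1-4) st'(1-4) by blast
  qed
  then obtain s t s' t' where st: "\<And>n. 0 < s n \<and> s n < ?h n" "\<And>n. 0 < t n \<and> t n < ?h n"
    "\<And>n. 0 < s' n \<and> s' n < ?h n" "\<And>n. 0 < t' n \<and> t' n < ?h n"
    and eq: "\<And>n. dder b (dder a f) (x + s n *\<^sub>R a + t n *\<^sub>R b) = dder a (dder b f) (x + s' n *\<^sub>R b + t' n *\<^sub>R a)"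
    by metis
  have lim: "u \<longlonglongrightarrow> 0" if "\<And>n. 0 < u n \<and> u n < ?h n" for u :: "nat \<Rightarrow> real"
    using that by (intro tendsto_sandwich[OF _ _ tendsto_const h]) (auto intro!: always_eventually less_imp_le)
  have cont: "isCont (dder c (dder d f)) x" for c d
    using smooth_continuous_on[OF smooth_dder[OF smooth_dder[OF f]], of UNIV]
    by (simp add: continuous_on_eq_continuous_at)
  have p: "(\<lambda>n. x + u n *\<^sub>R c + v n *\<^sub>R d) \<longlonglongrightarrow> x" if "u \<longlonglongrightarrow> 0" "v \<longlonglongrightarrow> 0" for u v :: "nat \<Rightarrow> real" and c d
  proof -
    have "(\<lambda>n. x + u n *\<^sub>R c + v n *\<^sub>R d) \<longlonglongrightarrow> x + 0 *\<^sub>R c + 0 *\<^sub>R d"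
      using that by (intro tendsto_intros)
    then show ?thesis by simp
  qed
  have "(\<lambda>n. dder b (dder a f) (x + s n *\<^sub>R a + t n *\<^sub>R b)) \<longlonglongrightarrow> dder b (dder a f) x"
    by (rule isCont_tendsto_compose[OF cont p[OF lim[OF st(1)] lim[OF st(2)]]])
  moreover have "(\<lambda>n. dder b (dder a f) (x + s n *\<^sub>R a + t n *\<^sub>R b)) \<longlonglongrightarrow> dder a (dder b f) x"
    unfolding eq by (rule isCont_tendsto_compose[OF cont p[OF lim[OF st(3)] lim[OF st(4)]]])
  ultimately show ?thesis by (rule LIMSEQ_unique)
qed

lemma partial_commute:
  fixes f :: "real^'d \<Rightarrow> real"
  assumes "smooth f"
  shows "partial i (partial j f) x = partial j (partial i f) x"
  using second_derivative_symmetric[OF assms, of "axis i 1" "axis j 1" x]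
  by (simp add: dder_def[abs_def] partial_def[abs_def])

subsection \<open>A smooth approximation of the indicator of a box\<close>

text \<open>The classical function \<open>exp (- 1 / t)\<close>, extended by zero, with a polynomial
  factor in \<open>1 / t\<close>. The factor makes the family closed under differentiation.\<close>

definition flat :: "real poly \<Rightarrow> real \<Rightarrow> real" where
  "flat p t = (if t \<le> 0 then 0 else poly p (1 / t) * exp (- 1 / t))"

lemma flat_tendsto_0:
  fixes p :: "real poly"
  shows "((\<lambda>s. poly p s * exp (- s)) \<longlongrightarrow> 0) at_top"
proof -
  have "((\<lambda>s. \<Sum>i\<le>degree p. coeff p i * (s ^ i / exp s)) \<longlongrightarrow> (\<Sum>i\<le>degree p. coeff p i * 0)) at_top"
    by (intro tendsto_intros tendsto_power_div_exp_0)
  also have "(\<lambda>s. \<Sum>i\<le>degree p. coeff p i * (s ^ i / exp s)) = (\<lambda>s. poly p s * exp (- s))"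
    by (simp add: poly_altdef sum_distrib_right exp_minus divide_inverse mult.assoc)
  finally show ?thesis by simp
qed

text \<open>With \<open>s = 1 / t\<close>, the derivative of \<open>p(s) exp(- s)\<close> with
  respect to \<open>t\<close> is \<open>s^2 (p(s) - p'(s)) exp(- s)\<close>, again of the same form.
  Only the origin calls for a limit.\<close>

lemma flat_derivative: "(flat p has_real_derivative flat ([:0, 0, 1:] * (p - pderiv p)) t) (at t)"
proof -
  consider "t < 0" | "t = 0" | "t > 0" by linarith
  then show ?thesis
  proof cases
    case 1
    have "((\<lambda>t. 0) has_real_derivative 0) (at t)" by simp
    moreover have "\<forall>\<^sub>F s in nhds t. 0 = flat p s"
      using eventually_nhds_in_open[of "{..<0}" t] 1 by (auto elim!: eventually_mono simp: flat_def)
    ultimately show ?thesis using 1 by (subst DERIV_cong_ev[OF refl _ refl, of _ "\<lambda>t. 0"])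
        (auto simp: flat_def elim: eventually_mono)
  next
    case 2
    \<comment> \<open>After the substitution \<open>s = 1 / h\<close> this is polynomial growth
      against exponential decay.\<close>
    have "((\<lambda>h. flat p h / h) \<longlongrightarrow> 0) (at_right 0)"
    proof (subst filterlim_at_right_to_top, rule Lim_transform_eventually)
      show "((\<lambda>s. poly ([:0, 1:] * p) s * exp (- s)) \<longlongrightarrow> 0) at_top" by (rule flat_tendsto_0)
      show "\<forall>\<^sub>F s in at_top. poly ([:0, 1:] * p) s * exp (- s) = flat p (inverse s) / inverse s"
        using eventually_gt_at_top[of 0] by eventually_elim (auto simp: flat_def field_simps)
    qed
    moreover have "((\<lambda>h. flat p h / h) \<longlongrightarrow> 0) (at_left 0)"
    proof (rule Lim_transform_eventually)
      show "((\<lambda>h. 0) \<longlongrightarrow> 0) (at_left (0::real))" by simp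
      show "\<forall>\<^sub>F h in at_left (0::real). 0 = flat p h / h"
        by (auto simp: flat_def eventually_at_filter)
    qed
    ultimately have "((\<lambda>h. flat p h / h) \<longlongrightarrow> 0) (at 0)" by (rule filterlim_split_at[rotated])
    then show ?thesis using 2 by (simp add: DERIV_def flat_def)
  next
    case 3
    have "((\<lambda>t. poly p (1 / t) * exp (- 1 / t)) has_real_derivative
        (poly (pderiv p) (1 / t) * (- 1 / t\<^sup>2)) * exp (- 1 / t) + poly p (1 / t) * (exp (- 1 / t) * (1 / t\<^sup>2))) (at t)"
      using 3 by (auto intro!: derivative_eq_intros DERIV_chain2[OF poly_DERIV] simp: power2_eq_square)
    moreover have "\<forall>\<^sub>F s in nhds t. poly p (1 / s) * exp (- 1 / s) = flat p s"
      using eventually_nhds_in_open[of "{0<..}" t] 3 by (auto elim!: eventually_mono simp: flat_def)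
    moreover have "(poly (pderiv p) (1 / t) * (- 1 / t\<^sup>2)) * exp (- 1 / t) + poly p (1 / t) * (exp (- 1 / t) * (1 / t\<^sup>2))
        = flat ([:0, 0, 1:] * (p - pderiv p)) t"
      using 3 by (simp add: flat_def power2_eq_square algebra_simps)
    ultimately show ?thesis using DERIV_cong_ev[OF refl _ refl] by metis
  qed
qed

text \<open>Coinductive smoothness calls for an invariant that contains all directional derivatives;
  the algebra generated by constants and by \<open>flat\<close> of affine functions is one.\<close>

inductive flat_algebra :: "('a::real_inner \<Rightarrow> real) \<Rightarrow> bool" where
  const: "flat_algebra (\<lambda>x. c)"
| flat: "flat_algebra (\<lambda>x. flat p (a \<bullet> x + b))"
| add: "flat_algebra f \<Longrightarrow> flat_algebra g \<Longrightarrow> flat_algebra (\<lambda>x. f x + g x)"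
| mult: "flat_algebra f \<Longrightarrow> flat_algebra g \<Longrightarrow> flat_algebra (\<lambda>x. f x * g x)"

lemma flat_algebra_smooth:
  assumes "flat_algebra f"
  shows "smooth f"
  using assms
proof (rule smooth_coinduct_derivative)
  fix f :: "'a \<Rightarrow> real" assume "flat_algebra f"
  then show "\<exists>f'. (\<forall>x. (f has_derivative f' x) (at x)) \<and> (\<forall>e. flat_algebra (\<lambda>x. f' x e))"
  proof induction
    case (const c)
    show ?case by (intro exI[of _ "\<lambda>x e. 0"]) (auto intro: flat_algebra.const)
  next
    case (flat p a b)
    let ?q = "[:0, 0, 1:] * (p - pderiv p)"
    have "((\<lambda>x. flat p (a \<bullet> x + b)) has_derivative (\<lambda>e. flat ?q (a \<bullet> x + b) * (a \<bullet> e))) (at x)" for x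
      by (rule has_derivative_compose[OF _ flat_derivative[THEN has_field_derivative_imp_has_derivative],
            where f = "\<lambda>x. a \<bullet> x + b"]) (auto intro!: derivative_eq_intros)
    then show ?case
      by (intro exI[of _ "\<lambda>x e. flat ?q (a \<bullet> x + b) * (a \<bullet> e)"] conjI allI
          flat_algebra.mult flat_algebra.flat flat_algebra.const)
  next
    case (add f g)
    then obtain f' g' where "\<forall>x. (f has_derivative f' x) (at x)" "\<forall>e. flat_algebra (\<lambda>x. f' x e)"
      "\<forall>x. (g has_derivative g' x) (at x)" "\<forall>e. flat_algebra (\<lambda>x. g' x e)" by blast
    then show ?case
      by (intro exI[of _ "\<lambda>x e. f' x e + g' x e"]) (auto intro: flat_algebra.add has_derivative_add)
  next
    case (mult f g)
    then obtain f' g' where *: "\<forall>x. (f has_derivative f' x) (at x)" "\<forall>e. flat_algebra (\<lambda>x. f' x e)"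
      "\<forall>x. (g has_derivative g' x) (at x)" "\<forall>e. flat_algebra (\<lambda>x. g' x e)" by blast
    show ?case
    proof (intro exI[of _ "\<lambda>x e. f x * g' x e + f' x e * g x"] conjI allI)
      show "((\<lambda>x. f x * g x) has_derivative (\<lambda>e. f x * g' x e + f' x e * g x)) (at x)" for x
        using * by (intro has_derivative_mult) auto
      show "flat_algebra (\<lambda>x. f x * g' x e + f' x e * g x)" for e
        by (intro flat_algebra.add flat_algebra.mult *(2)[rule_format] *(4)[rule_format] mult.hyps)
    qed
  qed
qed

text \<open>The product over the coordinates of \<open>flat 1\<close> at
  \<open>n (x_i - a_i)\<close> and at \<open>n (b_i - x_i)\<close>. The arguments are spelled out as
  \<open>a \<bullet> x + b\<close> to fit the generators of \<open>flat_algebra\<close>.\<close>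

definition box_bump :: "nat \<Rightarrow> 'a::euclidean_space \<Rightarrow> 'a \<Rightarrow> 'a \<Rightarrow> real" where
  "box_bump n a b x =
     (\<Prod>i\<in>Basis. flat 1 ((real n *\<^sub>R i) \<bullet> x + - real n * (a \<bullet> i)) * flat 1 ((- real n *\<^sub>R i) \<bullet> x + real n * (b \<bullet> i)))"

lemma flat_algebra_prod:
  "(\<And>i. i \<in> I \<Longrightarrow> flat_algebra (f i)) \<Longrightarrow> flat_algebra (\<lambda>x. \<Prod>i\<in>I. f i x)"
  by (induction I rule: infinite_finite_induct) (auto intro: flat_algebra.const flat_algebra.mult)

lemma smooth_box_bump: "smooth (box_bump n a b)"
  unfolding box_bump_def[abs_def]
  by (intro flat_algebra_smooth flat_algebra_prod flat_algebra.mult flat_algebra.flat)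

lemma flat_1: "0 \<le> flat 1 t" "flat 1 t \<le> 1" "t \<le> 0 \<Longrightarrow> flat 1 t = 0"
  by (auto simp: flat_def)

lemma box_bump_bounds: "0 \<le> box_bump n a b x" "box_bump n a b x \<le> 1"
  unfolding box_bump_def
  by (auto intro!: prod_nonneg prod_le_1 mult_nonneg_nonneg mult_le_one flat_1)

lemma box_bump_outside:
  assumes "x \<notin> box a b"
  shows "box_bump n a b x = 0"
proof -
  obtain i where i: "i \<in> Basis" "x \<bullet> i \<le> a \<bullet> i \<or> b \<bullet> i \<le> x \<bullet> i"
    using assms by (force simp: mem_box not_less)
  then have "real n * (i \<bullet> x) + - real n * (a \<bullet> i) \<le> 0 \<or> - real n * (i \<bullet> x) + real n * (b \<bullet> i) \<le> 0"
    by (auto simp: inner_commute[of i x] intro: mult_left_mono)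
  then have "flat 1 ((real n *\<^sub>R i) \<bullet> x + - real n * (a \<bullet> i)) * flat 1 ((- real n *\<^sub>R i) \<bullet> x + real n * (b \<bullet> i)) = 0"
    using flat_1(3) by auto
  then show ?thesis unfolding box_bump_def using i(1) by (intro prod_zero) auto
qed

text \<open>For \<open>t > 0\<close> the factor \<open>flat 1 (n t)\<close> is
  \<open>exp (- 1 / (n t))\<close>, which tends to 1; outside the open box some factor vanishes for
  every \<open>n\<close>.\<close>

lemma box_bump_tendsto: "(\<lambda>n. box_bump n a b x) \<longlonglongrightarrow> indicator (box a b) x"
proof (cases "x \<in> box a b")
  case False
  then show ?thesis by (simp add: box_bump_outside)
next
  case True
  have lim: "(\<lambda>n. flat 1 (real n * t)) \<longlonglongrightarrow> 1" if "t > 0" for t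
  proof (rule Lim_transform_eventually)
    have "(\<lambda>n. exp (- (1 / t) * inverse (real n))) \<longlonglongrightarrow> exp (- (1 / t) * 0)"
      by (intro tendsto_intros lim_inverse_n)
    then show "(\<lambda>n. exp (- (1 / t) * inverse (real n))) \<longlonglongrightarrow> 1" by simp
    show "\<forall>\<^sub>F n in sequentially. exp (- (1 / t) * inverse (real n)) = flat 1 (real n * t)"
      using eventually_gt_at_top[of 0]
      by eventually_elim (use that in \<open>auto simp: flat_def field_simps mult_le_0_iff\<close>)
  qed
  have "(\<lambda>n. \<Prod>i\<in>Basis. flat 1 (real n * (x \<bullet> i - a \<bullet> i)) * flat 1 (real n * (b \<bullet> i - x \<bullet> i)))
      \<longlonglongrightarrow> (\<Prod>i\<in>(Basis::'a set). 1 * 1)"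
    using True by (intro tendsto_prod tendsto_mult lim) (auto simp: mem_box)
  moreover have "(\<lambda>n. \<Prod>i\<in>Basis. flat 1 (real n * (x \<bullet> i - a \<bullet> i)) * flat 1 (real n * (b \<bullet> i - x \<bullet> i)))
      = (\<lambda>n. box_bump n a b x)"
    by (auto simp: box_bump_def algebra_simps inner_commute[of x])
  ultimately show ?thesis using True by simp
qed

section \<open>Test functions\<close>

lemma test_functionsI:
  assumes "smooth \<phi>" "compact K" "K \<subseteq> S" "\<And>x. x \<notin> K \<Longrightarrow> \<phi> x = 0"
  shows "\<phi> \<in> test_functions S"
proof -
  have "closure {x. \<phi> x \<noteq> 0} \<subseteq> K"
    using assms(2,4) by (intro closure_minimal compact_imp_closed) auto
  moreover from this have "K \<inter> closure {x. \<phi> x \<noteq> 0} = closure {x. \<phi> x \<noteq> 0}" by blast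
  ultimately show ?thesis
    using assms(1,3) compact_Int_closed[OF assms(2) closed_closure, of "{x. \<phi> x \<noteq> 0}"]
    by (auto simp: test_functions_def)
qed

lemma test_functionsE:
  assumes "\<phi> \<in> test_functions S"
  obtains K where "smooth \<phi>" "compact K" "K \<subseteq> S" "\<And>x. x \<notin> K \<Longrightarrow> \<phi> x = 0"
proof
  show "compact (closure {x. \<phi> x \<noteq> 0})" "closure {x. \<phi> x \<noteq> 0} \<subseteq> S" "smooth \<phi>"
    using assms by (auto simp: test_functions_def)
  show "\<phi> x = 0" if "x \<notin> closure {x. \<phi> x \<noteq> 0}" for x
    using that closure_subset[of "{x. \<phi> x \<noteq> 0}"] by blast
qed

lemma test_functions_smooth: "\<phi> \<in> test_functions S \<Longrightarrow> smooth \<phi>"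
  by (simp add: test_functions_def)

lemma test_functions_mono: "S' \<subseteq> S \<Longrightarrow> test_functions S' \<subseteq> test_functions S"
  by (auto simp: test_functions_def)

lemma test_functions_linear:
  assumes "bounded_linear L" "\<phi> \<in> test_functions S"
  shows "(\<lambda>x. L (\<phi> x)) \<in> test_functions S"
  using assms(2)
proof (rule test_functionsE)
  fix K assume "smooth \<phi>" "compact K" "K \<subseteq> S" "\<And>x. x \<notin> K \<Longrightarrow> \<phi> x = 0"
  then show ?thesis
    by (intro test_functionsI[of _ K]) (auto intro: smooth_linear assms(1) simp: linear_simps(3)[OF assms(1)])
qed

lemma test_functions_add:
  assumes "\<phi> \<in> test_functions S" "\<eta> \<in> test_functions S"
  shows "(\<lambda>x. \<phi> x + \<eta> x) \<in> test_functions S"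
proof -
  obtain K where K: "smooth \<phi>" "compact K" "K \<subseteq> S" "\<And>x. x \<notin> K \<Longrightarrow> \<phi> x = 0"
    using assms(1) by (rule test_functionsE) blast
  obtain K' where K': "smooth \<eta>" "compact K'" "K' \<subseteq> S" "\<And>x. x \<notin> K' \<Longrightarrow> \<eta> x = 0"
    using assms(2) by (rule test_functionsE) blast
  show ?thesis
    using K K' by (intro test_functionsI[of _ "K \<union> K'"] smooth_add compact_Un) auto
qed

lemma test_functions_zero: "(\<lambda>x. 0) \<in> test_functions S"
  by (intro test_functionsI[of _ "{}"] smooth_const) auto

lemma test_functions_sum:
  "(\<And>i. i \<in> I \<Longrightarrow> \<phi> i \<in> test_functions S) \<Longrightarrow> (\<lambda>x. \<Sum>i\<in>I. \<phi> i x) \<in> test_functions S"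
  by (induction I rule: infinite_finite_induct) (auto intro: test_functions_add test_functions_zero)

lemma test_functions_partial:
  assumes "\<phi> \<in> test_functions S"
  shows "partial i \<phi> \<in> test_functions S"
proof -
  obtain K where K: "smooth \<phi>" "compact K" "K \<subseteq> S" "\<And>x. x \<notin> K \<Longrightarrow> \<phi> x = 0"
    using assms by (rule test_functionsE) blast
  show ?thesis
  proof (rule test_functionsI[OF smooth_partial[OF K(1)] K(2,3)])
    fix x assume "x \<notin> K"
    then have "\<forall>\<^sub>F y in nhds x. (\<lambda>y. 0) y = \<phi> y"
      using eventually_nhds_in_open[of "- K" x] K(2,4)
      by (auto simp: compact_imp_closed open_Compl elim!: eventually_mono)
    moreover have "((\<lambda>y. 0) has_derivative (\<lambda>e. 0)) (at x)" by simp
    ultimately have "(\<phi> has_derivative (\<lambda>e. 0)) (at x)"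
      using has_derivative_transform_eventually[of "\<lambda>y. 0" "\<lambda>e. 0" x UNIV \<phi>] K(4)[OF \<open>x \<notin> K\<close>]
      by (auto simp: eventually_nhds_conv_at)
    then show "partial i \<phi> x = 0"
      by (simp add: partial_def frechet_derivative_at[symmetric])
  qed
qed

lemma grad_eq: "grad \<psi> = (\<lambda>x. \<Sum>i\<in>UNIV. partial i \<psi> x *\<^sub>R axis i 1)"
  by (auto simp: grad_def vec_eq_iff axis_def if_distrib cong: if_cong)

lemma test_functions_grad:
  assumes "\<psi> \<in> test_functions S"
  shows "grad \<psi> \<in> test_functions S"
  unfolding grad_eq
  by (intro test_functions_sum test_functions_linear[OF bounded_linear_scaleR_left]
      test_functions_partial assms)

lemma test_functions_bounded:
  assumes "\<phi> \<in> test_functions S"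
  obtains B where "\<And>x. norm (\<phi> x) \<le> B"
proof -
  obtain K where K: "smooth \<phi>" "compact K" "K \<subseteq> S" "\<And>x. x \<notin> K \<Longrightarrow> \<phi> x = 0"
    using assms by (rule test_functionsE) blast
  have "bounded (\<phi> ` K)"
    using K by (intro compact_imp_bounded compact_continuous_image smooth_continuous_on)
  then obtain B where B: "\<And>x. x \<in> K \<Longrightarrow> norm (\<phi> x) \<le> B" by (auto simp: bounded_iff)
  have "norm (\<phi> x) \<le> max B 0" for x
    using B[of x] K(4)[of x] by (cases "x \<in> K") (auto simp: le_max_iff_disj)
  then show ?thesis by (rule that)
qed

lemma test_functions_integrable:
  fixes \<phi> :: "real^'d \<Rightarrow> 'b::euclidean_space"
  assumes "\<phi> \<in> test_functions S"
  shows "integrable lborel \<phi>"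
proof -
  obtain K where K: "smooth \<phi>" "compact K" "K \<subseteq> S" "\<And>x. x \<notin> K \<Longrightarrow> \<phi> x = 0"
    using assms by (rule test_functionsE) blast
  have "integrable lborel (\<lambda>x. indicator K x *\<^sub>R \<phi> x)"
    by (intro borel_integrable_compact K smooth_continuous_on)
  also have "(\<lambda>x. indicator K x *\<^sub>R \<phi> x) = \<phi>" using K(4) by (auto simp: fun_eq_iff indicator_def)
  finally show ?thesis .
qed

lemma smooth_borel: "smooth \<phi> \<Longrightarrow> \<phi> \<in> borel_measurable borel"
  by (intro borel_measurable_continuous_onI smooth_continuous_on)

lemma test_functions_L2:
  fixes \<phi> :: "real^'d \<Rightarrow> 'b::euclidean_space"
  assumes "\<phi> \<in> test_functions S" "S \<in> sets lebesgue"
  shows "\<phi> \<in> L2 S"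
proof -
  have [measurable]: "\<phi> \<in> borel_measurable borel"
    using assms(1) by (intro smooth_borel test_functions_smooth)
  obtain B where B: "\<And>x. norm (\<phi> x) \<le> B" using assms(1) by (rule test_functions_bounded) blast
  have "integrable lborel (\<lambda>x. (norm (\<phi> x))\<^sup>2)"
  proof (rule Bochner_Integration.integrable_bound)
    show "integrable lborel (\<lambda>x. B *\<^sub>R norm (\<phi> x))"
      using test_functions_integrable[OF assms(1)] by auto
    show "AE x in lborel. norm ((norm (\<phi> x))\<^sup>2) \<le> norm (B *\<^sub>R norm (\<phi> x))"
      using B order_trans[OF norm_ge_zero B] by (auto simp: power2_eq_square intro!: mult_right_mono)
  qed measurable
  then have "integrable lebesgue (\<lambda>x. (norm (\<phi> x))\<^sup>2)" by (subst integrable_completion) auto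
  then have "integrable (lebesgue_on S) (\<lambda>x. (norm (\<phi> x))\<^sup>2)"
    using assms(2) integrable_mult_indicator[of S lebesgue "\<lambda>x. (norm (\<phi> x))\<^sup>2"]
    by (subst integrable_restrict_space) auto
  moreover have "\<phi> \<in> borel_measurable (lebesgue_on S)"
    by (intro measurable_restrict_space1 measurable_completion) measurable
  ultimately show ?thesis by (simp add: L2_def)
qed

lemma integral_lebesgue_on_support:
  fixes F :: "real^'d \<Rightarrow> real"
  assumes "S \<in> sets lebesgue" "F \<in> borel_measurable borel" "\<And>x. x \<notin> S \<Longrightarrow> F x = 0"
  shows "(LINT x|lebesgue_on S. F x) = (LINT x|lborel. F x)"
proof -
  have "(LINT x|lebesgue_on S. F x) = (LINT x|lebesgue. indicator S x *\<^sub>R F x)"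
    using assms(1) by (intro integral_restrict_space) auto
  also have "(\<lambda>x. indicator S x *\<^sub>R F x) = F" using assms(3) by (auto simp: fun_eq_iff indicator_def)
  finally show ?thesis using assms(2) by (simp add: integral_completion)
qed

lemma continuous_compact_support_integrable:
  fixes F :: "real^'d \<Rightarrow> real"
  assumes "continuous_on UNIV F" "\<And>x. x \<notin> cball 0 R \<Longrightarrow> F x = 0"
  shows "integrable lborel F"
proof -
  have "integrable lborel (\<lambda>x. indicator (cball 0 R) x *\<^sub>R F x)"
    using continuous_on_subset[OF assms(1)] by (intro borel_integrable_compact) auto
  also have "(\<lambda>x. indicator (cball 0 R) x *\<^sub>R F x) = F" using assms(2) by (auto simp: fun_eq_iff indicator_def)
  finally show ?thesis .
qed

text \<open>Translation invariance of Lebesgue measure makes the integrals of all difference quotients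
  vanish.\<close>

lemma integral_dder_eq_0:
  fixes F :: "real^'d \<Rightarrow> real"
  assumes F: "\<And>x. F differentiable (at x)" and c: "continuous_on UNIV (dder a F)"
    and supp: "\<And>x. x \<notin> cball 0 R \<Longrightarrow> F x = 0" "\<And>x. x \<notin> cball 0 R \<Longrightarrow> dder a F x = 0"
  shows "(LINT x|lborel. dder a F x) = 0"
proof -
  let ?h = "\<lambda>n::nat. 1 / (real n + 1)"
  let ?D = "\<lambda>n x. (F (x + ?h n *\<^sub>R a) - F x) / ?h n"
  \<comment> \<open>Larger than the support by \<open>norm a\<close>: the increments are at most
    \<open>a\<close> in length, so all difference quotients vanish outside this ball.\<close>
  let ?K = "cball (0::real^'d) (R + norm a)"
  have h: "?h \<longlonglongrightarrow> 0"
    using LIMSEQ_inverse_real_of_nat by (simp add: inverse_eq_divide add.commute)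
  have Fc: "continuous_on UNIV F"
    using F by (meson continuous_at_imp_continuous_on differentiable_imp_continuous_within)
  have Fi: "integrable lborel F" by (rule continuous_compact_support_integrable[OF Fc supp(1)])
  have [measurable]: "F \<in> borel_measurable borel" "dder a F \<in> borel_measurable borel"
    using Fc c by (auto intro: borel_measurable_continuous_onI)
  have "bounded (dder a F ` cball 0 R)"
    by (intro compact_imp_bounded compact_continuous_image continuous_on_subset[OF c]) auto
  then obtain B0 where B0: "\<And>x. x \<in> cball 0 R \<Longrightarrow> norm (dder a F x) \<le> B0"
    unfolding bounded_iff by blast
  define B where "B = max B0 0"
  have B: "\<bar>dder a F x\<bar> \<le> B" for x
    using B0[of x] supp(2)[of x] by (cases "x \<in> cball 0 R") (auto simp: B_def le_max_iff_disj)
  \<comment> \<open>By the mean value theorem, the bound \<open>B\<close> on the derivative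
    dominates all difference quotients.\<close>
  have quot: "\<exists>s. 0 < s \<and> s < ?h n \<and> ?D n x = dder a F (x + s *\<^sub>R a)" for n x
  proof -
    have "0 < ?h n" by simp
    then obtain s where "0 < s" "s < ?h n"
      "F (x + ?h n *\<^sub>R a) - F x = ?h n * frechet_derivative F (at (x + s *\<^sub>R a)) a"
      by (rule difference_mean_value[OF F, of "?h n" x a])
    then show ?thesis by (intro exI[of _ s]) (auto simp: dder_def field_simps)
  qed
  have "(\<lambda>n. LINT x|lborel. ?D n x) \<longlonglongrightarrow> (LINT x|lborel. dder a F x)"
  proof (rule integral_dominated_convergence)
    show "integrable lborel (\<lambda>x. B * indicator ?K x :: real)"
      using emeasure_bounded_finite[OF bounded_cball, of "0::real^'d" "R + norm a"]
      by (intro integrable_mult_right integrable_real_indicator) auto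
    show "AE x in lborel. (\<lambda>n. ?D n x) \<longlonglongrightarrow> dder a F x"
    proof (rule AE_I2)
      fix x
      have "\<forall>n. \<exists>s. 0 < s \<and> s < ?h n \<and> ?D n x = dder a F (x + s *\<^sub>R a)" using quot by blast
      from choice[OF this] obtain s where
        "\<forall>n. 0 < s n \<and> s n < ?h n \<and> ?D n x = dder a F (x + s n *\<^sub>R a)" ..
      then have s: "\<And>n. 0 < s n \<and> s n < ?h n" "\<And>n. ?D n x = dder a F (x + s n *\<^sub>R a)"
        by blast+
      have "s \<longlonglongrightarrow> 0"
        using s(1) by (intro tendsto_sandwich[OF _ _ tendsto_const h]) (auto intro!: always_eventually less_imp_le)
      then have "(\<lambda>n. x + s n *\<^sub>R a) \<longlonglongrightarrow> x + 0 *\<^sub>R a" by (intro tendsto_intros)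
      then have "(\<lambda>n. x + s n *\<^sub>R a) \<longlonglongrightarrow> x" by simp
      then show "(\<lambda>n. ?D n x) \<longlonglongrightarrow> dder a F x"
        unfolding s(2) using c by (intro isCont_tendsto_compose[of _ "dder a F"]) (auto simp: continuous_on_eq_continuous_at)
    qed
    show "AE x in lborel. norm (?D n x) \<le> B * indicator ?K x" for n
    proof (rule AE_I2)
      fix x
      obtain s where s: "0 < s" "s < ?h n" "?D n x = dder a F (x + s *\<^sub>R a)" using quot by metis
      show "norm (?D n x) \<le> B * indicator ?K x"
      proof (cases "x \<in> ?K")
        case True
        then show ?thesis unfolding s(3) using B by simp
      next
        case False
        have "?h n \<le> 1" by simp
        then have "s \<le> 1" using s by linarith
        have "norm x \<le> norm (x + s *\<^sub>R a) + norm (s *\<^sub>R a)"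
          using norm_triangle_ineq4[of "x + s *\<^sub>R a" "s *\<^sub>R a"] by simp
        moreover have "norm (s *\<^sub>R a) \<le> norm a" using s \<open>s \<le> 1\<close> by (simp add: mult_left_le_one_le)
        ultimately have "x + s *\<^sub>R a \<notin> cball 0 R" using False by auto
        then show ?thesis unfolding s(3) using supp(2) False by simp
      qed
    qed
  qed measurable
  moreover have "(LINT x|lborel. ?D n x) = 0" for n
  proof -
    have "distr lborel borel (\<lambda>x. x + ?h n *\<^sub>R a) = lborel"
    proof -
      have "(\<lambda>x. x + ?h n *\<^sub>R a) = (+) (?h n *\<^sub>R a)" by (rule ext) (rule add.commute)
      then show ?thesis by (simp only: lborel_distr_plus)
    qed
    then have i: "integrable lborel (\<lambda>x. F (x + ?h n *\<^sub>R a))"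
      and e: "(LINT x|lborel. F (x + ?h n *\<^sub>R a)) = (LINT x|lborel. F x)"
      using integrable_distr_eq[of "\<lambda>x. x + ?h n *\<^sub>R a" lborel borel F]
        integral_distr[of "\<lambda>x. x + ?h n *\<^sub>R a" lborel borel F] Fi by auto
    show ?thesis using Bochner_Integration.integral_diff[OF i Fi] e by simp
  qed
  ultimately show ?thesis by (simp add: LIMSEQ_const_iff)
qed

lemma has_derivative_dder: "smooth f \<Longrightarrow> (f has_derivative (\<lambda>e. dder e f x)) (at x)"
  using smooth_has_derivative by (simp add: dder_def[abs_def])

lemma partial_eq_dder: "partial i f = dder (axis i 1) f"
  by (simp add: partial_def[abs_def] dder_def[abs_def])

text \<open>The product has compact support in \<open>S\<close>, so there is no boundary term even
  though \<open>\<eta>\<close> may be nonzero on the boundary; this matters for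
  \<open>\<eta> = 1\<close>. Boundedness of \<open>S\<close> provides the ball that contains the
  support.\<close>

lemma integration_by_parts:
  fixes \<phi> \<eta> :: "real^'d \<Rightarrow> real"
  assumes \<phi>: "\<phi> \<in> test_functions S" and \<eta>: "smooth \<eta>" and S: "S \<in> sets lebesgue" "bounded S"
  shows "l2_inner S (partial i \<phi>) \<eta> = - l2_inner S \<phi> (partial i \<eta>)"
proof -
  have sm: "smooth \<phi>" using \<phi> by (rule test_functions_smooth)
  obtain R where R: "S \<subseteq> cball 0 R" using S(2) by (auto simp: bounded_iff subset_iff)
  have out: "\<phi> x = 0" if "x \<notin> S" for x
    using test_functionsE[OF \<phi>] that by (metis subsetD)
  have out': "partial i \<phi> x = 0" if "x \<notin> S" for x
    using test_functionsE[OF test_functions_partial[OF \<phi>, of i]] that by (metis subsetD)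
  have outR: "\<phi> x = 0" "partial i \<phi> x = 0" if "x \<notin> cball 0 R" for x
    using that R out out' by blast+
  let ?F = "\<lambda>x. \<phi> x * \<eta> x"
  have D: "(?F has_derivative (\<lambda>e. \<phi> x * dder e \<eta> x + dder e \<phi> x * \<eta> x)) (at x)" for x
    by (intro has_derivative_mult has_derivative_dder sm \<eta>)
  have dF: "dder (axis i 1) ?F = (\<lambda>x. \<phi> x * partial i \<eta> x + partial i \<phi> x * \<eta> x)"
    using fun_cong[OF frechet_derivative_at[OF D], where x = "axis i 1", symmetric]
    by (simp add: dder_def[of "axis i 1" ?F] partial_eq_dder fun_eq_iff)
  have meas: "f \<in> borel_measurable borel" if "smooth f" for f :: "real^'d \<Rightarrow> real"
    using that by (rule smooth_borel)
  note [measurable] = meas[OF sm] meas[OF \<eta>] meas[OF smooth_partial[OF sm]] meas[OF smooth_partial[OF \<eta>]]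
  have "(LINT x|lborel. dder (axis i 1) ?F x) = 0"
  proof (rule integral_dder_eq_0[where R = R])
    show "?F differentiable (at x)" for x using D unfolding differentiable_def by blast
    show "continuous_on UNIV (dder (axis i 1) ?F)"
      unfolding dF by (intro continuous_intros smooth_continuous_on smooth_partial sm \<eta>)
    show "?F x = 0" "dder (axis i 1) ?F x = 0" if "x \<notin> cball 0 R" for x
      using outR[OF that] by (simp_all add: dF)
  qed
  also have "(LINT x|lborel. dder (axis i 1) ?F x) = (LINT x|lborel. \<phi> x * partial i \<eta> x) + (LINT x|lborel. partial i \<phi> x * \<eta> x)"
    unfolding dF
  proof (rule Bochner_Integration.integral_add)
    note c = smooth_continuous_on[OF sm] smooth_continuous_on[OF \<eta>]
      smooth_continuous_on[OF smooth_partial[OF sm]] smooth_continuous_on[OF smooth_partial[OF \<eta>]]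
    show "integrable lborel (\<lambda>x. \<phi> x * partial i \<eta> x)"
      by (rule continuous_compact_support_integrable[where R = R, OF continuous_on_mult[OF c(1,4)]]) (simp add: outR)
    show "integrable lborel (\<lambda>x. partial i \<phi> x * \<eta> x)"
      by (rule continuous_compact_support_integrable[where R = R, OF continuous_on_mult[OF c(3,2)]]) (simp add: outR)
  qed
  finally have "(LINT x|lborel. partial i \<phi> x * \<eta> x) = - (LINT x|lborel. \<phi> x * partial i \<eta> x)" by simp
  moreover have "l2_inner S (partial i \<phi>) \<eta> = (LINT x|lborel. partial i \<phi> x * \<eta> x)"
    unfolding l2_inner_def inner_real_def
    by (rule integral_lebesgue_on_support[OF S(1)]) (use out' in auto)
  moreover have "l2_inner S \<phi> (partial i \<eta>) = (LINT x|lborel. \<phi> x * partial i \<eta> x)"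
    unfolding l2_inner_def inner_real_def
    by (rule integral_lebesgue_on_support[OF S(1)]) (use out in auto)
  ultimately show ?thesis by simp
qed

subsection \<open>The fundamental lemma of the calculus of variations\<close>

text \<open>Boxes are stable under intersection and generate the Borel sets, so by Dynkin's argument
  the integral vanishes over every Borel set. A Borel representative \<open>g\<close> is used
  because Lebesgue measurable sets come from a completion.\<close>

lemma AE_zero_if_box_integrals_zero:
  fixes h :: "'a::euclidean_space \<Rightarrow> real"
  assumes h: "integrable lebesgue h" and box: "\<And>a b. (LINT x:box a b|lebesgue. h x) = 0"
  shows "AE x in lebesgue. h x = 0"
proof -
  obtain g where g[measurable]: "g \<in> borel_measurable lborel" and gh: "AE x in lborel. h x = g x"
    using completion_ex_borel_measurable_real[OF borel_measurable_integrable[OF h]] by blast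
  have gh': "AE x in lebesgue. h x = g x" using gh by (rule AE_completion)
  have gm[measurable]: "g \<in> borel_measurable lebesgue" using g by (rule measurable_completion)
  have "integrable lebesgue g"
    using h gh' by (subst integrable_cong_AE[of g lebesgue h]) (auto elim: eventually_mono)
  then have gi: "integrable lborel g" by (simp add: integrable_completion)
  have set: "set_integrable lborel A g" if "A \<in> sets borel" for A
    unfolding set_integrable_def using that by (intro integrable_mult_indicator gi) simp
  have gbox: "(LINT x:box a b|lborel. g x) = 0" for a b
  proof -
    have "(LINT x:box a b|lborel. g x) = (LINT x:box a b|lebesgue. g x)"
      unfolding set_lebesgue_integral_def by (rule integral_completion[symmetric]) measurable
    also have "\<dots> = (LINT x:box a b|lebesgue. h x)"
      unfolding set_lebesgue_integral_def using gh'
    proof (intro integral_cong_AE)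
      have [measurable]: "h \<in> borel_measurable lebesgue" using h by (rule borel_measurable_integrable)
      have "indicator (box a b) \<in> borel_measurable lebesgue" by (intro measurable_completion) measurable
      then show "(\<lambda>x. indicator (box a b) x *\<^sub>R g x) \<in> borel_measurable lebesgue"
        "(\<lambda>x. indicator (box a b) x *\<^sub>R h x) \<in> borel_measurable lebesgue" by measurable
    qed (auto elim: eventually_mono)
    finally show ?thesis using box by simp
  qed
  \<comment> \<open>The induction step for complements needs the integral over the whole space,
    obtained as a limit over growing boxes.\<close>
  have zero: "(LINT x|lborel. g x) = 0"
  proof -
    have "(\<lambda>n. LINT x|lborel. indicator (box (- (real n *\<^sub>R One)) (real n *\<^sub>R One)) x *\<^sub>R g x) \<longlonglongrightarrow> (LINT x|lborel. g x)"
    proof (rule integral_dominated_convergence)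
      show "integrable lborel (\<lambda>x. norm (g x))" using gi by auto
      show "AE x in lborel. (\<lambda>n. indicator (box (- (real n *\<^sub>R One)) (real n *\<^sub>R One)) x *\<^sub>R g x) \<longlonglongrightarrow> g x"
      proof (rule AE_I2)
        fix x :: 'a
        obtain N where N: "norm x < real N" using reals_Archimedean2 by blast
        have "x \<in> box (- (real n *\<^sub>R One)) (real n *\<^sub>R One)" if "n \<ge> N" for n
        proof -
          have "- real n < x \<bullet> i \<and> x \<bullet> i < real n" if "i \<in> Basis" for i
            using Basis_le_norm[OF that, of x] N \<open>n \<ge> N\<close> by linarith
          then show ?thesis by (auto simp: mem_box)
        qed
        then have "\<forall>\<^sub>F n in sequentially. g x = indicator (box (- (real n *\<^sub>R One)) (real n *\<^sub>R One)) x *\<^sub>R g x"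
          by (intro eventually_sequentiallyI[of N]) simp
        then show "(\<lambda>n. indicator (box (- (real n *\<^sub>R One)) (real n *\<^sub>R One)) x *\<^sub>R g x) \<longlonglongrightarrow> g x"
          by (rule Lim_transform_eventually[OF tendsto_const])
      qed
    qed (auto simp: indicator_def)
    then show ?thesis using gbox by (simp add: set_lebesgue_integral_def LIMSEQ_const_iff)
  qed
  have all: "(LINT x:A|lborel. g x) = 0" if "A \<in> sets borel" for A
  proof -
    have *: "A \<in> sigma_sets UNIV (range (\<lambda>(a, b). box a b))"
      using that by (simp add: borel_eq_box)
    have Is: "Int_stable (range (\<lambda>(a, b). box a b :: 'a set))"
      by (auto simp: Int_stable_def box_Int_box)
    have sub: "range (\<lambda>(a, b). box a b :: 'a set) \<subseteq> Pow UNIV" by simp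
    from * show ?thesis
    proof (induction A rule: sigma_sets_induct_disjoint[OF Is sub, consumes 1, case_names 1 2 3 4])
      case (1 A)
      then show ?case using gbox by auto
    next
      case 2
      show ?case by (simp add: set_lebesgue_integral_def)
    next
      case (3 A)
      have A: "A \<in> sets borel" using 3(1) by (simp add: borel_eq_box)
      have "(LINT x:A \<union> (UNIV - A)|lborel. g x) = (LINT x:A|lborel. g x) + (LINT x:UNIV - A|lborel. g x)"
        using A by (intro set_integral_Un set) auto
      moreover have "A \<union> (UNIV - A) = UNIV" by blast
      ultimately show ?case using zero 3(2) by (simp add: set_lebesgue_integral_def)
    next
      case (4 A)
      have A: "A i \<in> sets borel" for i using 4(2) by (auto simp: borel_eq_box)
      have "(LINT x:(\<Union>i. A i)|lborel. g x) = (\<Sum>i. (LINT x:A i|lborel. g x))"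
        using 4(1) A by (intro lebesgue_integral_countable_add set) (auto simp: disjoint_family_on_def)
      then show ?case using 4(3) by simp
    qed
  qed
  have "AE x in lborel. g x = 0"
    using density_unique_real[OF gi, of "\<lambda>x. 0"] all by (simp add: set_lebesgue_integral_def)
  then have "AE x in lebesgue. g x = 0" by (rule AE_completion)
  then show ?thesis using gh' by eventually_elim simp
qed

text \<open>Smooth approximations of the indicator of a box, times a basis vector, are test
  functions. They show that all integrals over boxes with closure in \<open>S\<close> vanish, and
  \<open>S\<close> is a countable union of closed boxes.\<close>

lemma fundamental_lemma:
  fixes g :: "real^'d \<Rightarrow> 'b::euclidean_space"
  assumes S: "open S" "S \<in> lmeasurable" and g: "g \<in> L2 S"
    and test: "\<And>\<phi>. \<phi> \<in> test_functions S \<Longrightarrow> l2_inner S g \<phi> = 0"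
  shows "AE x in lebesgue_on S. g x = 0"
proof -
  have SL: "S \<in> sets lebesgue" using S(2) by auto
  have "AE x in lebesgue. x \<in> S \<longrightarrow> g x \<bullet> e = 0" if e: "e \<in> Basis" for e
  proof -
    have ge: "integrable (lebesgue_on S) (\<lambda>x. g x \<bullet> e)"
      using L2_integrable_inner[OF g L2_const[OF S(2), of e]] .
    then have gS: "integrable lebesgue (\<lambda>x. indicator S x *\<^sub>R (g x \<bullet> e))"
      using SL by (subst (asm) integrable_restrict_space) auto
    have box0: "(LINT x:box a b|lebesgue. indicator S x *\<^sub>R (g x \<bullet> e)) = 0" if ab: "cbox a b \<subseteq> S" for a b
    proof -
      have "(\<lambda>n. LINT x|lebesgue_on S. box_bump n a b x * (g x \<bullet> e))
          \<longlonglongrightarrow> (LINT x|lebesgue_on S. indicator (box a b) x * (g x \<bullet> e))"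
      proof (rule integral_dominated_convergence)
        show "integrable (lebesgue_on S) (\<lambda>x. norm (g x \<bullet> e))" using ge by (rule integrable_norm)
        show "AE x in lebesgue_on S. (\<lambda>n. box_bump n a b x * (g x \<bullet> e)) \<longlonglongrightarrow> indicator (box a b) x * (g x \<bullet> e)"
          by (intro AE_I2 tendsto_mult box_bump_tendsto tendsto_const)
        show "AE x in lebesgue_on S. norm (box_bump n a b x * (g x \<bullet> e)) \<le> norm (g x \<bullet> e)" for n
          using box_bump_bounds[of n a b] by (intro AE_I2) (auto simp: abs_mult intro!: mult_left_le_one_le)
        have [measurable]: "(\<lambda>x. g x \<bullet> e) \<in> borel_measurable (lebesgue_on S)"
          using ge by (rule borel_measurable_integrable)
        have "indicator (box a b) \<in> borel_measurable (lebesgue_on S)"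
          by (intro measurable_restrict_space1 measurable_completion) measurable
        then show "(\<lambda>x. indicator (box a b) x * (g x \<bullet> e)) \<in> borel_measurable (lebesgue_on S)" by measurable
        have "box_bump n a b \<in> borel_measurable (lebesgue_on S)" for n
          by (intro measurable_restrict_space1 measurable_completion) (simp add: smooth_borel smooth_box_bump)
        then show "(\<lambda>x. box_bump n a b x * (g x \<bullet> e)) \<in> borel_measurable (lebesgue_on S)" for n by measurable
      qed
      moreover have "(LINT x|lebesgue_on S. box_bump n a b x * (g x \<bullet> e)) = 0" for n
      proof -
        have "(\<lambda>x. box_bump n a b x) \<in> test_functions S"
        proof (rule test_functionsI[of _ "cbox a b"])
          show "box_bump n a b x = 0" if "x \<notin> cbox a b" for x
            using that box_subset_cbox[of a b] by (intro box_bump_outside) blast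
        qed (use ab smooth_box_bump in auto)
        from test[OF test_functions_linear[OF bounded_linear_scaleR_left this, of e]]
        show ?thesis by (simp add: l2_inner_def)
      qed
      ultimately have "(LINT x|lebesgue_on S. indicator (box a b) x * (g x \<bullet> e)) = 0"
        by (simp add: LIMSEQ_const_iff)
      also have "(LINT x|lebesgue_on S. indicator (box a b) x * (g x \<bullet> e))
          = (LINT x|lebesgue. indicator S x *\<^sub>R (indicator (box a b) x * (g x \<bullet> e)))"
        using SL by (intro integral_restrict_space) auto
      finally show ?thesis by (simp add: set_lebesgue_integral_def mult.left_commute)
    qed
    \<comment> \<open>\<open>box0\<close> only speaks of boxes with closure in \<open>S\<close>.
      After restriction to one such box, arbitrary boxes may be tested, since their intersection
      with it is again of this kind or empty.\<close>
    have cb: "AE x in lebesgue. x \<in> X \<longrightarrow> g x \<bullet> e = 0" if X: "X = cbox a b" "X \<subseteq> S" for X a b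
    proof -
      let ?h = "\<lambda>x. indicator (box a b) x *\<^sub>R (indicator S x *\<^sub>R (g x \<bullet> e))"
      have "AE x in lebesgue. ?h x = 0"
      proof (rule AE_zero_if_box_integrals_zero)
        show "integrable lebesgue ?h" by (intro integrable_mult_indicator gS) auto
        show "(LINT x:box c d|lebesgue. ?h x) = 0" for c d
        proof -
          obtain p q where pq: "box c d \<inter> box a b = box p q" using box_Int_box by blast
          have "cbox p q \<subseteq> S \<or> box p q = {}"
          proof (cases "box p q = {}")
            case False
            then have "closure (box p q) \<subseteq> closure (box a b)" by (intro closure_mono) (use pq in auto)
            then have "cbox p q \<subseteq> cbox a b" using False by (cases "box a b = {}") auto
            then show ?thesis using X by auto
          qed simp
          then have "(LINT x:box p q|lebesgue. indicator S x *\<^sub>R (g x \<bullet> e)) = 0"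
            using box0 by (auto simp: set_lebesgue_integral_def)
          moreover have "(\<lambda>x. indicator (box c d) x *\<^sub>R ?h x)
              = (\<lambda>x. indicator (box p q) x *\<^sub>R (indicator S x *\<^sub>R (g x \<bullet> e)))"
            unfolding pq[symmetric] by (simp add: fun_eq_iff indicator_inter_arith)
          ultimately show ?thesis by (simp only: set_lebesgue_integral_def)
        qed
      qed
      moreover have "AE x in lebesgue. x \<notin> cbox a b - box a b"
        using negligible_frontier_interval[of a b] unfolding negligible_iff_null_sets by (rule AE_not_in)
      ultimately show ?thesis
      proof eventually_elim
        case (elim x)
        then show ?case using X by (cases "x \<in> box a b") auto
      qed
    qed
    obtain D :: "(real^'d) set set" where D: "countable D" "D \<subseteq> Pow S" "\<And>X. X \<in> D \<Longrightarrow> \<exists>a b. X = cbox a b" "\<Union>D = S"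
      by (rule open_countable_Union_open_cbox[OF S(1)]) blast
    have "AE x in lebesgue. x \<in> X \<longrightarrow> g x \<bullet> e = 0" if XD: "X \<in> D" for X
    proof -
      obtain a b where "X = cbox a b" using D(3)[OF XD] by blast
      moreover have "X \<subseteq> S" using D(2) XD by blast
      ultimately show ?thesis by (rule cb)
    qed
    then have "AE x in lebesgue. \<forall>X\<in>D. x \<in> X \<longrightarrow> g x \<bullet> e = 0"
      by (subst AE_ball_countable[OF D(1)]) blast
    then show ?thesis
    proof eventually_elim
      case (elim x)
      then show ?case using D(4) by blast
    qed
  qed
  then have "AE x in lebesgue. \<forall>e\<in>Basis. x \<in> S \<longrightarrow> g x \<bullet> e = 0"
    by (subst AE_ball_countable[OF countable_finite[OF finite_Basis]]) blast
  then have "AE x in lebesgue. x \<in> S \<longrightarrow> g x = 0"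
    by eventually_elim (auto simp: euclidean_all_zero_iff)
  then show ?thesis using SL by (subst AE_restrict_space_iff) auto
qed

section \<open>Lipschitz boundaries and triangulations\<close>

text \<open>The region strictly below the graph is open and disjoint from \<open>S\<close>, hence
  disjoint from its closure. A frontier point is therefore neither below nor above the
  graph.\<close>

lemma lipschitz_boundary_local:
  fixes S :: "'a::euclidean_space set"
  assumes S: "open S" "lipschitz_boundary S" and x: "x \<in> frontier S"
  obtains r n \<gamma> where "r > 0" "norm n = 1"
    "\<forall>y\<in>ball x r. y \<in> frontier S \<longrightarrow> \<gamma> (y - (y \<bullet> n) *\<^sub>R n) = y \<bullet> n"
    "\<forall>y\<in>ball x r. y \<bullet> n < \<gamma> (y - (y \<bullet> n) *\<^sub>R n) \<longrightarrow> y \<notin> closure S"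
proof -
  obtain r n L and \<gamma> :: "'a \<Rightarrow> real" where *: "r > 0" "norm n = 1" "L-lipschitz_on {y. y \<bullet> n = 0} \<gamma>"
    "S \<inter> ball x r = {y \<in> ball x r. \<gamma> (y - (y \<bullet> n) *\<^sub>R n) < y \<bullet> n}"
    using S(2) x unfolding lipschitz_boundary_def by blast
  have nn: "n \<bullet> n = 1" using *(2) by (simp add: norm_eq_1)
  have "continuous_on UNIV (\<lambda>y. \<gamma> (y - (y \<bullet> n) *\<^sub>R n))"
  proof (rule continuous_on_compose2[OF lipschitz_on_continuous_on[OF *(3)]])
    show "continuous_on UNIV (\<lambda>y. y - (y \<bullet> n) *\<^sub>R n)" by (intro continuous_intros)
    show "range (\<lambda>y. y - (y \<bullet> n) *\<^sub>R n) \<subseteq> {y. y \<bullet> n = 0}"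
      by (auto simp: inner_diff_left nn)
  qed
  then have op: "open ({y. y \<bullet> n < \<gamma> (y - (y \<bullet> n) *\<^sub>R n)} \<inter> ball x r)"
    by (intro open_Int open_Collect_less continuous_intros) auto
  have out: "y \<notin> closure S" if "y \<in> ball x r" "y \<bullet> n < \<gamma> (y - (y \<bullet> n) *\<^sub>R n)" for y
  proof -
    have "S \<inter> ({y. y \<bullet> n < \<gamma> (y - (y \<bullet> n) *\<^sub>R n)} \<inter> ball x r) = {}"
      using *(4) by force
    then have "closure S \<inter> ({y. y \<bullet> n < \<gamma> (y - (y \<bullet> n) *\<^sub>R n)} \<inter> ball x r) = {}"
      using open_Int_closure_eq_empty[OF op, of S] by blast
    then show ?thesis using that by blast
  qed
  have "\<gamma> (y - (y \<bullet> n) *\<^sub>R n) = y \<bullet> n" if y: "y \<in> ball x r" "y \<in> frontier S" for y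
  proof -
    have "y \<in> closure S" "y \<notin> S" using y(2) S(1) by (auto simp: frontier_def interior_open)
    moreover have "\<not> \<gamma> (y - (y \<bullet> n) *\<^sub>R n) < y \<bullet> n" using \<open>y \<notin> S\<close> y(1) *(4) by blast
    ultimately show ?thesis using out[OF y(1)] by force
  qed
  with out show ?thesis by (intro that[of r n \<gamma>] *(1,2)) blast+
qed

text \<open>A Lipschitz domain has no slits: moving from a frontier point against the direction
  \<open>n\<close> leaves the closure at once. This is what keeps interiors of unions of closed
  simplices inside \<open>S\<close>.\<close>

lemma lipschitz_boundary_interior_closure:
  fixes S :: "'a::euclidean_space set"
  assumes S: "open S" "lipschitz_boundary S"
  shows "interior (closure S) = S"
proof
  show "S \<subseteq> interior (closure S)" by (rule interior_maximal[OF closure_subset S(1)])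
  show "interior (closure S) \<subseteq> S"
  proof
    fix x assume x: "x \<in> interior (closure S)"
    show "x \<in> S"
    proof (rule ccontr)
      assume "x \<notin> S"
      then have xf: "x \<in> frontier S"
        using x interior_subset S(1) by (auto simp: frontier_def interior_open)
      obtain r n \<gamma> where *: "r > 0" "norm n = 1"
        "\<forall>y\<in>ball x r. y \<in> frontier S \<longrightarrow> \<gamma> (y - (y \<bullet> n) *\<^sub>R n) = y \<bullet> n"
        "\<forall>y\<in>ball x r. y \<bullet> n < \<gamma> (y - (y \<bullet> n) *\<^sub>R n) \<longrightarrow> y \<notin> closure S"
        by (rule lipschitz_boundary_local[OF S xf])
      have nn: "n \<bullet> n = 1" using *(2) by (simp add: norm_eq_1)
      obtain e where e: "e > 0" "ball x e \<subseteq> closure S"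
        using x by (meson mem_interior)
      define t where "t = min e r / 2"
      have t: "0 < t" "t < e" "t < r" using e(1) *(1) by (auto simp: t_def)
      \<comment> \<open>A point slightly below \<open>x\<close>: it has the same foot on the
        hyperplane and therefore lies under the graph.\<close>
      let ?y = "x - t *\<^sub>R n"
      have yr: "?y \<in> ball x r" and ye: "?y \<in> ball x e" using t *(2) by (auto simp: dist_norm)
      have "?y - (?y \<bullet> n) *\<^sub>R n = x - (x \<bullet> n) *\<^sub>R n"
        by (simp add: inner_diff_left nn algebra_simps)
      moreover have "?y \<bullet> n < \<gamma> (x - (x \<bullet> n) *\<^sub>R n)"
        using bspec[OF *(3), of x] *(1) xf t by (simp add: inner_diff_left nn)
      ultimately have "?y \<notin> closure S" using bspec[OF *(4) yr] by (simp only: simp_thms)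
      then show False using e(2) ye by blast
    qed
  qed
qed

section \<open>Insensitivity of integrals to null sets, and restriction to subsets\<close>

lemma measurable_lebesgue_AE:
  assumes f: "f \<in> borel_measurable lebesgue" and eq: "AE x in lebesgue. f x = g x"
  shows "g \<in> borel_measurable lebesgue"
proof (rule measurableI)
  fix A :: "'b set" assume A: "A \<in> sets borel"
  show "g -` A \<inter> space lebesgue \<in> sets lebesgue"
  proof (rule completion.in_sets_AE)
    show "f -` A \<inter> space lebesgue \<in> sets lebesgue" using f A by (rule measurable_sets)
    show "AE x in lebesgue. x \<in> f -` A \<inter> space lebesgue \<longleftrightarrow> x \<in> g -` A \<inter> space lebesgue"
      using eq by eventually_elim auto
  qed simp
qed simp

text \<open>Holds for arbitrary functions: by completeness of Lebesgue measure the two integrands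
  are measurable together, and if they are not, both integrals take the default value zero.\<close>

lemma l2_inner_spike_set:
  fixes f g :: "real^'d \<Rightarrow> 'b::euclidean_space"
  assumes X: "X \<in> sets lebesgue" and Y: "Y \<in> sets lebesgue" and eq: "AE x in lebesgue. x \<in> X \<longleftrightarrow> x \<in> Y"
  shows "l2_inner X f g = l2_inner Y f g"
proof -
  let ?h = "\<lambda>Z x. indicator Z x *\<^sub>R (f x \<bullet> g x) :: real"
  have AEh: "AE x in lebesgue. ?h X x = ?h Y x"
    using eq by eventually_elim (auto simp: indicator_def)
  have "integral\<^sup>L lebesgue (?h X) = integral\<^sup>L lebesgue (?h Y)"
  proof (cases "?h X \<in> borel_measurable lebesgue")
    case True
    then show ?thesis using AEh measurable_lebesgue_AE[OF True AEh] by (intro integral_cong_AE)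
  next
    case False
    moreover have "?h Y \<notin> borel_measurable lebesgue"
    proof
      assume Y: "?h Y \<in> borel_measurable lebesgue"
      have "AE x in lebesgue. ?h Y x = ?h X x" using AEh by eventually_elim (rule sym)
      from measurable_lebesgue_AE[OF Y this] False show False by simp
    qed
    ultimately have "\<not> integrable lebesgue (?h X)" "\<not> integrable lebesgue (?h Y)"
      using borel_measurable_integrable[of lebesgue "?h X"] borel_measurable_integrable[of lebesgue "?h Y"]
      by argo+
    then show ?thesis by (simp add: not_integrable_integral_eq)
  qed
  then show ?thesis
    using X Y unfolding l2_inner_def by (simp add: integral_restrict_space)
qed

lemma L2_subset:
  assumes "f \<in> L2 S" "P \<subseteq> S" "P \<in> sets lebesgue" "S \<in> sets lebesgue"
  shows "f \<in> L2 P"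
proof -
  have eq: "restrict_space (lebesgue_on S) P = lebesgue_on P"
    using assms(2,3,4) by (subst restrict_restrict_space) (auto simp: Int_absorb1)
  have P: "P \<in> sets (lebesgue_on S)" using assms(2,3,4) by (auto simp: sets_restrict_space_iff)
  have "f \<in> borel_measurable (lebesgue_on P)"
    using measurable_restrict_space1[OF L2_measurable[OF assms(1)], of P] by (simp add: eq)
  moreover have "integrable (lebesgue_on P) (\<lambda>x. (norm (f x))\<^sup>2)"
  proof -
    have "integrable (lebesgue_on S) (\<lambda>x. indicator P x *\<^sub>R (norm (f x))\<^sup>2)"
      by (rule integrable_mult_indicator[OF P L2_integrable_norm_sq[OF assms(1)]])
    then have "integrable (restrict_space (lebesgue_on S) P) (\<lambda>x. (norm (f x))\<^sup>2)"
      using P by (subst integrable_restrict_space) (auto simp: sets.Int_space_eq2)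
    then show ?thesis by (simp add: eq)
  qed
  ultimately show ?thesis by (simp add: L2_def)
qed

lemma AE_lebesgue_on_subset:
  assumes "AE x in lebesgue_on S. Q x" "P \<subseteq> S" "P \<in> sets lebesgue" "S \<in> sets lebesgue"
  shows "AE x in lebesgue_on P. Q x"
  using assms by (auto simp: AE_restrict_space_iff elim!: eventually_mono)

lemma integrable_L2_indicator:
  assumes "f \<in> L2 S" "S \<in> sets lebesgue" "P \<subseteq> S" "P \<in> sets lebesgue"
  shows "integrable lebesgue (\<lambda>x. indicator P x *\<^sub>R (f x \<bullet> f x))"
    "l2_inner P f f = (LINT x|lebesgue. indicator P x *\<^sub>R (f x \<bullet> f x))"
proof -
  have "f \<in> L2 P" using L2_subset assms by blast
  from L2_integrable_inner[OF this this]
  show "integrable lebesgue (\<lambda>x. indicator P x *\<^sub>R (f x \<bullet> f x))"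
    using assms(4) by (subst (asm) integrable_restrict_space) auto
  show "l2_inner P f f = (LINT x|lebesgue. indicator P x *\<^sub>R (f x \<bullet> f x))"
    unfolding l2_inner_def using assms(4) by (subst integral_restrict_space) auto
qed

lemma l2_inner_mono:
  assumes "f \<in> L2 S" "S \<in> sets lebesgue" "Q \<subseteq> S" "P \<subseteq> Q" "P \<in> sets lebesgue" "Q \<in> sets lebesgue"
  shows "l2_inner P f f \<le> l2_inner Q f f"
proof -
  have PS: "P \<subseteq> S" using assms by blast
  show ?thesis
    unfolding integrable_L2_indicator(2)[OF assms(1,2,3,6)] integrable_L2_indicator(2)[OF assms(1,2) PS assms(5)]
    using assms(4)
    by (intro integral_mono integrable_L2_indicator(1)[OF assms(1,2)] assms PS)
      (auto simp: indicator_def)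
qed

section \<open>Simplicial meshes and the overlap of element patches\<close>

locale simplicial_domain =
  fixes S :: "(real^'d) set" and \<T> :: "(real^'d) set set"
  assumes bounded_S: "bounded S" and polytopal: "polytopal_lipschitz_domain S"
    and triangulation: "triangulation_of S \<T>"
begin

lemma open_S: "open S" and S_nonempty: "S \<noteq> {}" and lipschitz_S: "lipschitz_boundary S"
  using polytopal by (auto simp: polytopal_lipschitz_domain_def)

lemma lmeasurable_S: "S \<in> lmeasurable"
  using open_S bounded_S by (simp add: lmeasurable_open)

lemma sets_S: "S \<in> sets lebesgue"
  using lmeasurable_S by auto

lemma finite_T: "finite \<T>"
  and simplex_T: "T \<in> \<T> \<Longrightarrow> int CARD('d) simplex T"
  and face_T: "T \<in> \<T> \<Longrightarrow> T' \<in> \<T> \<Longrightarrow> (T \<inter> T') face_of T"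
  and Union_T: "\<Union>\<T> = closure S"
  using triangulation by (auto simp: triangulation_of_def triangulation_def)

lemma compact_T: "T \<in> \<T> \<Longrightarrow> compact T"
  and convex_T: "T \<in> \<T> \<Longrightarrow> convex T"
  using simplex_T compact_simplex convex_simplex by blast+

lemma aff_dim_T: "T \<in> \<T> \<Longrightarrow> aff_dim T = int CARD('d)"
  using simplex_T aff_dim_simplex by blast

lemma interior_T:
  assumes "T \<in> \<T>"
  shows "interior T \<noteq> {}"
proof -
  have "affine hull T = UNIV" using aff_dim_T[OF assms] aff_dim_eq_full[of T] by simp
  then have "interior T = rel_interior T" using interior_rel_interior_gen[of T] aff_dim_T[OF assms] by simp
  moreover have "T \<noteq> {}" using aff_dim_T[OF assms] by auto
  ultimately show ?thesis using rel_interior_eq_empty[OF convex_T[OF assms]] by simp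
qed

lemma closure_interior_T: "T \<in> \<T> \<Longrightarrow> closure (interior T) = T"
  using convex_closure_interior[OF convex_T interior_T] compact_T[THEN compact_imp_closed] by simp

lemma sets_T: "T \<in> \<T> \<Longrightarrow> T \<in> sets lebesgue"
  using compact_T by (simp add: lmeasurable_compact fmeasurableD)

lemma nonempty_T: "\<T> \<noteq> {}"
  using Union_T S_nonempty closure_subset by auto

lemma diameter_T: "T \<in> \<T> \<Longrightarrow> 0 < diameter T"
proof -
  assume T: "T \<in> \<T>"
  obtain x e where e: "e > 0" "ball x e \<subseteq> T" using interior_T[OF T] by (meson ex_in_conv mem_interior)
  have "diameter (ball x e) \<le> diameter T"
    using e(2) compact_T[OF T] by (intro diameter_subset compact_imp_bounded)
  then show ?thesis using e(1) by simp
qed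

lemma diameter_le_hmax: "T \<in> \<T> \<Longrightarrow> diameter T \<le> hmax \<T>"
  unfolding hmax_def using finite_T by (intro Max_ge) auto

text \<open>The intersection of two simplices is a common face. If the interiors met, this face
  would be full-dimensional and hence equal to both simplices.\<close>

lemma disjoint_interiors:
  assumes "T \<in> \<T>" "T' \<in> \<T>" "T \<noteq> T'"
  shows "interior T \<inter> interior T' = {}"
proof (rule ccontr)
  assume ne: "interior T \<inter> interior T' \<noteq> {}"
  have "aff_dim (interior T \<inter> interior T') = int CARD('d)"
    using ne by (subst aff_dim_open) auto
  then have "aff_dim (T \<inter> T') \<ge> int CARD('d)"
    by (metis aff_dim_subset Int_mono interior_subset)
  then have "T \<inter> T' = T" "T \<inter> T' = T'"
    using face_of_aff_dim_lt[OF convex_T[OF assms(1)] face_T[OF assms(1,2)]] aff_dim_T[OF assms(1)]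
      face_of_aff_dim_lt[OF convex_T[OF assms(2)] face_T[OF assms(2,1)]] aff_dim_T[OF assms(2)]
    by (auto simp: Int_commute)
  then show False using assms(3) by simp
qed

lemma interior_closure_S: "interior (closure S) = S"
  using lipschitz_boundary_interior_closure[OF open_S lipschitz_S] .

text \<open>The union of simplices lies only in \<open>closure S\<close>; the Lipschitz boundary
  enters here to bring its interior back into \<open>S\<close>.\<close>

lemma patch_subset: "patch \<T> T \<subseteq> S"
proof -
  have "\<Union>{K \<in> \<T>. K \<inter> T \<noteq> {}} \<subseteq> closure S" using Union_T by auto
  from interior_mono[OF this] show ?thesis by (simp add: patch_def interior_closure_S)
qed

lemma open_patch: "open (patch \<T> T)"
  by (simp add: patch_def)

lemma sets_patch: "patch \<T> T \<in> sets lebesgue"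
  using open_patch by simp

lemma interior_subset_patch:
  assumes "T \<in> \<T>" "K \<in> \<T>" "T \<inter> K \<noteq> {}"
  shows "interior T \<subseteq> patch \<T> K"
  unfolding patch_def using assms by (intro interior_mono) auto

lemma interior_subset_S:
  assumes "T \<in> \<T>"
  shows "interior T \<subseteq> S"
proof -
  have "T \<subseteq> closure S" using assms Union_T by auto
  from interior_mono[OF this] show ?thesis by (simp add: interior_closure_S)
qed

lemma nonempty_patch: "T \<in> \<T> \<Longrightarrow> patch \<T> T \<noteq> {}"
  using interior_subset_patch[of T T] interior_T[of T] interior_subset[of T] by blast

lemma AE_frontier_T: "T \<in> \<T> \<Longrightarrow> AE x in lebesgue. x \<notin> frontier T"
  using negligible_convex_frontier[OF convex_T] unfolding negligible_iff_null_sets by (rule AE_not_in)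

lemma AE_T_interior:
  assumes "T \<in> \<T>"
  shows "AE x in lebesgue. x \<in> T \<longleftrightarrow> x \<in> interior T"
  using AE_frontier_T[OF assms]
proof eventually_elim
  case (elim x)
  then show ?case using closure_subset[of T] interior_subset[of T] by (auto simp: frontier_def)
qed

lemma l2_inner_T: "T \<in> \<T> \<Longrightarrow> l2_inner T f g = l2_inner (interior T) f g"
  by (rule l2_inner_spike_set[OF sets_T _ AE_T_interior]) auto

lemma AE_all_interior: "AE x in lebesgue. \<forall>T\<in>\<T>. x \<in> T \<longleftrightarrow> x \<in> interior T"
  using AE_T_interior by (subst AE_ball_countable[OF countable_finite[OF finite_T]]) blast

text \<open>Frontiers of convex sets are null, so outside a null set every point of \<open>S\<close>
  lies in the interior of exactly one simplex.\<close>

lemma AE_partition: "AE x in lebesgue. indicator S x = (\<Sum>T\<in>\<T>. indicator (interior T) x :: real)"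
  using AE_all_interior
proof eventually_elim
  case (elim x)
  show ?case
  proof (cases "x \<in> S")
    case True
    then have "x \<in> \<Union>\<T>" using Union_T closure_subset[of S] by auto
    then obtain T where T: "T \<in> \<T>" "x \<in> interior T" using elim by blast
    have "x \<notin> interior T'" if "T' \<in> \<T>" "T' \<noteq> T" for T'
      using disjoint_interiors[OF T(1) that(1)] that(2) T(2) by blast
    then have "(\<Sum>T'\<in>\<T>. indicator (interior T') x :: real) = (\<Sum>T'\<in>\<T>. if T' = T then 1 else 0)"
      using T(2) by (intro sum.cong) (auto simp: indicator_def)
    then show ?thesis using T True finite_T by simp
  next
    case False
    then have "x \<notin> interior T" if "T \<in> \<T>" for T using interior_subset_S[OF that] by blast
    then show ?thesis using False by (simp add: indicator_def)
  qed
qed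

lemma l2_inner_subset_sum:
  assumes f: "f \<in> L2 S" and P: "P \<subseteq> S" "P \<in> sets lebesgue"
  shows "l2_inner P f f = (\<Sum>T\<in>\<T>. l2_inner (P \<inter> interior T) f f)"
proof -
  have sub: "P \<inter> interior T \<subseteq> S" "P \<inter> interior T \<in> sets lebesgue" for T using P by auto
  note i = integrable_L2_indicator[OF f sets_S sub] integrable_L2_indicator[OF f sets_S P]
  have "(\<Sum>T\<in>\<T>. l2_inner (P \<inter> interior T) f f)
      = (LINT x|lebesgue. (\<Sum>T\<in>\<T>. indicator (P \<inter> interior T) x *\<^sub>R (f x \<bullet> f x)))"
    by (simp only: i(2)) (rule Bochner_Integration.integral_sum[symmetric], rule i(1))
  also have "\<dots> = (LINT x|lebesgue. indicator P x *\<^sub>R (f x \<bullet> f x))"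
  proof (rule integral_cong_AE)
    show "(\<lambda>x. \<Sum>T\<in>\<T>. indicator (P \<inter> interior T) x *\<^sub>R (f x \<bullet> f x)) \<in> borel_measurable lebesgue"
      "(\<lambda>x. indicator P x *\<^sub>R (f x \<bullet> f x)) \<in> borel_measurable lebesgue"
      using i(1,3) by (auto intro!: borel_measurable_sum borel_measurable_integrable)
    show "AE x in lebesgue. (\<Sum>T\<in>\<T>. indicator (P \<inter> interior T) x *\<^sub>R (f x \<bullet> f x)) = indicator P x *\<^sub>R (f x \<bullet> f x)"
      using AE_partition
    proof eventually_elim
      case (elim x)
      have "(\<Sum>T\<in>\<T>. indicator (P \<inter> interior T) x *\<^sub>R (f x \<bullet> f x))
          = indicator P x * (\<Sum>T\<in>\<T>. indicator (interior T) x) * (f x \<bullet> f x)"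
        by (simp add: indicator_inter_arith sum_distrib_left sum_distrib_right)
      also have "\<dots> = indicator P x * indicator S x * (f x \<bullet> f x)" by (simp only: elim)
      also have "indicator P x * indicator S x = (indicator P x :: real)"
        using P(1) by (auto simp: indicator_def)
      finally show ?case by simp
    qed
  qed
  finally show ?thesis using i(4) by simp
qed

lemma l2_inner_sum_T:
  assumes f: "f \<in> L2 S"
  shows "l2_inner S f f = (\<Sum>T\<in>\<T>. l2_inner T f f)"
proof -
  have "S \<inter> interior T = interior T" if "T \<in> \<T>" for T using interior_subset_S[OF that] by blast
  then show ?thesis using l2_inner_subset_sum[OF f order_refl sets_S] by (simp add: l2_inner_T)
qed

lemma l2_inner_T_le_patch:
  assumes "f \<in> L2 S" "T \<in> \<T>"
  shows "l2_inner T f f \<le> l2_inner (patch \<T> T) f f"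
proof -
  have "T \<inter> T \<noteq> {}" using interior_T[OF assms(2)] interior_subset[of T] by blast
  then show ?thesis
    unfolding l2_inner_T[OF assms(2)]
    by (intro l2_inner_mono[OF assms(1) sets_S patch_subset] interior_subset_patch assms sets_patch) auto
qed

text \<open>A simplex \<open>T\<close> that is not in the closure of the patch does not touch
  \<open>K\<close>. Then the part of the patch inside \<open>interior T\<close> is covered by
  frontiers of the simplices that touch \<open>K\<close>, hence null, and being open it is
  empty.\<close>

lemma l2_inner_patch_le:
  assumes f: "f \<in> L2 S" and K: "K \<in> \<T>"
  shows "l2_inner (patch \<T> K) f f \<le> (\<Sum>T\<in>{T\<in>\<T>. T \<subseteq> closure (patch \<T> K)}. l2_inner T f f)"
proof -
  let ?P = "patch \<T> K"
  have "l2_inner ?P f f = (\<Sum>T\<in>\<T>. l2_inner (?P \<inter> interior T) f f)"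
    by (rule l2_inner_subset_sum[OF f patch_subset sets_patch])
  also have "\<dots> = (\<Sum>T\<in>{T\<in>\<T>. T \<subseteq> closure ?P}. l2_inner (?P \<inter> interior T) f f)"
  proof (rule sum.mono_neutral_right[OF finite_T])
    show "\<forall>T\<in>\<T> - {T\<in>\<T>. T \<subseteq> closure ?P}. l2_inner (?P \<inter> interior T) f f = 0"
    proof
      fix T assume "T \<in> \<T> - {T\<in>\<T>. T \<subseteq> closure ?P}"
      then have T: "T \<in> \<T>" "\<not> T \<subseteq> closure ?P" by auto
      have "T \<inter> K = {}"
      proof (rule ccontr)
        assume "T \<inter> K \<noteq> {}"
        from closure_mono[OF interior_subset_patch[OF T(1) K this]] show False
          using T(2) by (simp only: closure_interior_T[OF T(1)])
      qed
      have "?P \<inter> interior T = {}"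
      proof (rule ccontr)
        assume ne: "?P \<inter> interior T \<noteq> {}"
        have "?P \<inter> interior T \<subseteq> (\<Union>K'\<in>{K'\<in>\<T>. K' \<inter> K \<noteq> {}}. frontier K')"
        proof
          fix x assume x: "x \<in> ?P \<inter> interior T"
          then have "x \<in> \<Union>{K' \<in> \<T>. K' \<inter> K \<noteq> {}}"
            unfolding patch_def by (rule subsetD[OF interior_subset, OF IntD1])
          then obtain K' where K': "K' \<in> \<T>" "K' \<inter> K \<noteq> {}" "x \<in> K'" by blast
          then have "K' \<noteq> T" using \<open>T \<inter> K = {}\<close> by blast
          then have "x \<notin> interior K'" using disjoint_interiors[OF K'(1) T(1)] x by blast
          then show "x \<in> (\<Union>K'\<in>{K'\<in>\<T>. K' \<inter> K \<noteq> {}}. frontier K')"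
            using K' closure_subset[of K'] by (auto simp: frontier_def)
        qed
        moreover have "negligible (\<Union>K'\<in>{K'\<in>\<T>. K' \<inter> K \<noteq> {}}. frontier K')"
        proof (rule negligible_Union)
          show "finite (frontier ` {K' \<in> \<T>. K' \<inter> K \<noteq> {}})" using finite_T by simp
        qed (auto intro: negligible_convex_frontier convex_T)
        ultimately have "negligible (?P \<inter> interior T)" by (rule negligible_subset[rotated])
        moreover have "open (?P \<inter> interior T)" by (intro open_Int open_patch open_interior)
        ultimately show False using ne open_not_negligible by metis
      qed
      then show "l2_inner (?P \<inter> interior T) f f = 0" by (simp add: l2_inner_def)
    qed
  qed auto
  also have "\<dots> \<le> (\<Sum>T\<in>{T\<in>\<T>. T \<subseteq> closure ?P}. l2_inner T f f)"
  proof (rule sum_mono)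
    fix T assume "T \<in> {T\<in>\<T>. T \<subseteq> closure ?P}"
    then have T: "T \<in> \<T>" by simp
    show "l2_inner (?P \<inter> interior T) f f \<le> l2_inner T f f"
      unfolding l2_inner_T[OF T]
    proof (rule l2_inner_mono[OF f sets_S interior_subset_S[OF T]])
      show "?P \<inter> interior T \<in> sets lebesgue" by (intro sets.Int sets_patch) simp
    qed auto
  qed
  finally show ?thesis .
qed

text \<open>Double counting: after the sums are exchanged, each \<open>T\<close> is counted once for
  every \<open>K\<close> whose closed patch contains it, which is at most \<open>C_OL\<close>
  times.\<close>

lemma l2_inner_sum_patch:
  assumes f: "f \<in> L2 S"
  shows "(\<Sum>K\<in>\<T>. l2_inner (patch \<T> K) f f) \<le> C_OL \<T> * l2_inner S f f"
proof -
  have "(\<Sum>K\<in>\<T>. l2_inner (patch \<T> K) f f)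
      \<le> (\<Sum>K\<in>\<T>. \<Sum>T\<in>{T\<in>\<T>. T \<subseteq> closure (patch \<T> K)}. l2_inner T f f)"
    by (intro sum_mono l2_inner_patch_le f)
  also have "\<dots> = (\<Sum>T\<in>\<T>. \<Sum>K\<in>{K\<in>\<T>. T \<subseteq> closure (patch \<T> K)}. l2_inner T f f)"
    by (rule sum.swap_restrict[OF finite_T finite_T])
  also have "\<dots> = (\<Sum>T\<in>\<T>. card {K\<in>\<T>. T \<subseteq> closure (patch \<T> K)} * l2_inner T f f)" by simp
  also have "\<dots> \<le> (\<Sum>T\<in>\<T>. C_OL \<T> * l2_inner T f f)"
    unfolding C_OL_def using finite_T
    by (intro sum_mono mult_right_mono) (auto intro!: Max_ge)
  also have "\<dots> = C_OL \<T> * l2_inner S f f"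
    by (simp add: l2_inner_sum_T[OF f] sum_distrib_left)
  finally show ?thesis .
qed

end

section \<open>Weak derivatives\<close>

text \<open>Keeps the pairing with \<open>A \<phi>\<close> linear and continuous on
  \<open>L2\<close>, so that weak identities survive linear combinations and limits.\<close>

definition L2_operator ::
  "((real^'d \<Rightarrow> 'c::euclidean_space) \<Rightarrow> real^'d \<Rightarrow> 'b::euclidean_space) \<Rightarrow> (real^'d) set \<Rightarrow> bool" where
  "L2_operator A S \<longleftrightarrow> (\<forall>\<phi>\<in>test_functions S. A \<phi> \<in> L2 S)"

lemma L2_operatorD: "L2_operator A S \<Longrightarrow> \<phi> \<in> test_functions S \<Longrightarrow> A \<phi> \<in> L2 S"
  by (simp add: L2_operator_def)

lemma has_weakD:
  assumes "has_weak s A S v g"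
  shows "g \<in> L2 S" "\<phi> \<in> test_functions S \<Longrightarrow> l2_inner S v (A \<phi>) = s * l2_inner S g \<phi>"
  using assms by (auto simp: has_weak_def)

lemma has_weak_unique:
  fixes A :: "(real^'d \<Rightarrow> 'c::euclidean_space) \<Rightarrow> real^'d \<Rightarrow> 'b::euclidean_space"
  assumes S: "open S" "S \<in> lmeasurable" and "s \<noteq> 0"
    and g: "has_weak s A S v g" and h: "has_weak s A S v h"
  shows "AE x in lebesgue_on S. g x = h x"
proof -
  have "AE x in lebesgue_on S. g x - h x = 0"
  proof (rule fundamental_lemma[OF S])
    show "(\<lambda>x. g x - h x) \<in> L2 S" using has_weakD(1)[OF g] has_weakD(1)[OF h] by (rule L2_diff)
    fix \<phi> :: "real^'d \<Rightarrow> 'c" assume \<phi>: "\<phi> \<in> test_functions S"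
    have "\<phi> \<in> L2 S" using \<phi> S(2) by (intro test_functions_L2) auto
    moreover have "l2_inner S g \<phi> = l2_inner S h \<phi>"
      using has_weakD(2)[OF g \<phi>] has_weakD(2)[OF h \<phi>] \<open>s \<noteq> 0\<close> by simp
    ultimately show "l2_inner S (\<lambda>x. g x - h x) \<phi> = 0"
      using has_weakD(1)[OF g] has_weakD(1)[OF h] by (simp add: l2_inner_diff_left)
  qed
  then show ?thesis by eventually_elim simp
qed

lemma has_weak_lincomb:
  fixes A :: "(real^'d \<Rightarrow> 'c::euclidean_space) \<Rightarrow> real^'d \<Rightarrow> 'b::euclidean_space"
  assumes A: "L2_operator A S" and S: "S \<in> sets lebesgue" and v: "v \<in> L2 S" "has_weak s A S v g"
    and w: "w \<in> L2 S" "has_weak s A S w h"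
  shows "has_weak s A S (\<lambda>x. r *\<^sub>R v x + w x) (\<lambda>x. r *\<^sub>R g x + h x)"
  unfolding has_weak_def
proof (intro conjI ballI)
  note gL = has_weakD(1)[OF v(2)] and hL = has_weakD(1)[OF w(2)]
  show "(\<lambda>x. r *\<^sub>R g x + h x) \<in> L2 S" by (rule L2_add[OF L2_scaleR[OF gL] hL])
  fix \<phi> :: "real^'d \<Rightarrow> 'c" assume \<phi>: "\<phi> \<in> test_functions S"
  have \<phi>L: "\<phi> \<in> L2 S" using \<phi> S by (rule test_functions_L2)
  show "l2_inner S (\<lambda>x. r *\<^sub>R v x + w x) (A \<phi>) = s * l2_inner S (\<lambda>x. r *\<^sub>R g x + h x) \<phi>"
    using has_weakD(2)[OF v(2) \<phi>] has_weakD(2)[OF w(2) \<phi>] L2_operatorD[OF A \<phi>] gL hL v(1) w(1) \<phi>L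
    by (simp add: l2_inner_add_left L2_scaleR l2_inner_scaleR_left algebra_simps)
qed

text \<open>Weak operators are closed: both sides of the defining identity are continuous in the
  \<open>L2\<close> norm.\<close>

lemma has_weak_limit:
  fixes A :: "(real^'d \<Rightarrow> 'c::euclidean_space) \<Rightarrow> real^'d \<Rightarrow> 'b::euclidean_space"
  assumes A: "L2_operator A S" and S: "S \<in> sets lebesgue"
    and w: "\<And>n. v n \<in> L2 S" "\<And>n. has_weak s A S (v n) (g n)"
    and lim: "u \<in> L2 S" "h \<in> L2 S"
      "(\<lambda>n. l2_norm S (\<lambda>x. v n x - u x)) \<longlonglongrightarrow> 0" "(\<lambda>n. l2_norm S (\<lambda>x. g n x - h x)) \<longlonglongrightarrow> 0"
  shows "has_weak s A S u h"
  unfolding has_weak_def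
proof (intro conjI ballI)
  show "h \<in> L2 S" by fact
  fix \<phi> :: "real^'d \<Rightarrow> 'c" assume \<phi>: "\<phi> \<in> test_functions S"
  have \<phi>L: "\<phi> \<in> L2 S" using \<phi> S by (rule test_functions_L2)
  have "(\<lambda>n. l2_inner S (v n) (A \<phi>)) \<longlonglongrightarrow> l2_inner S u (A \<phi>)"
    by (rule l2_inner_tendsto[OF w(1) lim(1) L2_operatorD[OF A \<phi>] lim(3)])
  moreover have "(\<lambda>n. l2_inner S (v n) (A \<phi>)) \<longlonglongrightarrow> s * l2_inner S h \<phi>"
    unfolding has_weakD(2)[OF w(2) \<phi>]
    by (intro tendsto_mult tendsto_const l2_inner_tendsto[OF _ lim(2) \<phi>L lim(4)] has_weakD(1)[OF w(2)])
  ultimately show "l2_inner S u (A \<phi>) = s * l2_inner S h \<phi>" by (rule LIMSEQ_unique)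
qed

lemma has_weak_cong_AE:
  fixes A :: "(real^'d \<Rightarrow> 'c::euclidean_space) \<Rightarrow> real^'d \<Rightarrow> 'b::euclidean_space"
  assumes A: "L2_operator A S" and S: "S \<in> sets lebesgue" and h: "has_weak s A S v g"
    and v: "v \<in> L2 S" "w \<in> L2 S" "AE x in lebesgue_on S. v x = w x"
    and g: "k \<in> L2 S" "AE x in lebesgue_on S. g x = k x"
  shows "has_weak s A S w k"
  unfolding has_weak_def
proof (intro conjI ballI)
  show "k \<in> L2 S" by fact
  fix \<phi> :: "real^'d \<Rightarrow> 'c" assume \<phi>: "\<phi> \<in> test_functions S"
  have \<phi>L: "\<phi> \<in> L2 S" using \<phi> S by (rule test_functions_L2)
  note AL = L2_operatorD[OF A \<phi>]
  have "l2_inner S w (A \<phi>) = l2_inner S v (A \<phi>)"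
    using l2_inner_cong_AE[OF v(1,2) AL AL v(3)] by simp
  also have "\<dots> = s * l2_inner S g \<phi>" by (rule has_weakD(2)[OF h \<phi>])
  also have "l2_inner S g \<phi> = l2_inner S k \<phi>"
    using l2_inner_cong_AE[OF has_weakD(1)[OF h] g(1) \<phi>L \<phi>L g(2)] by simp
  finally show "l2_inner S w (A \<phi>) = s * l2_inner S k \<phi>" .
qed

lemma HspaceD:
  assumes "v \<in> Hspace s A S"
  shows "v \<in> L2 S" "has_weak s A S v (weak s A S v)" "weak s A S v \<in> L2 S"
proof -
  show "v \<in> L2 S" using assms by (simp add: Hspace_def)
  show *: "has_weak s A S v (weak s A S v)"
    unfolding weak_def using assms by (intro someI_ex[of "has_weak s A S v"]) (simp add: Hspace_def)
  show "weak s A S v \<in> L2 S" by (rule has_weakD(1)[OF *])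
qed

lemma HspaceI: "v \<in> L2 S \<Longrightarrow> has_weak s A S v g \<Longrightarrow> v \<in> Hspace s A S"
  by (auto simp: Hspace_def)

lemma weak_eq:
  assumes "open S" "S \<in> lmeasurable" "s \<noteq> 0" "has_weak s A S v g"
  shows "AE x in lebesgue_on S. weak s A S v x = g x"
proof -
  have "has_weak s A S v (weak s A S v)"
    unfolding weak_def by (rule someI[of "has_weak s A S v", OF assms(4)])
  from has_weak_unique[OF assms(1-3) this assms(4)] show ?thesis .
qed

lemma has_weak_zero: "has_weak s A S (\<lambda>x. 0) (\<lambda>x. 0)"
  by (simp add: has_weak_def)

lemma lin_space_Hspace:
  assumes A: "L2_operator A S" and S: "S \<in> sets lebesgue"
  shows "lin_space (Hspace s A S)"
  unfolding lin_space_def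
proof (intro conjI ballI allI)
  show "(\<lambda>x. 0) \<in> Hspace s A S" by (rule HspaceI[OF L2_zero has_weak_zero])
  fix v w r assume v: "v \<in> Hspace s A S" and w: "w \<in> Hspace s A S"
  show "(\<lambda>x. r *\<^sub>R v x + w x) \<in> Hspace s A S"
    by (rule HspaceI[OF L2_add[OF L2_scaleR[OF HspaceD(1)[OF v]] HspaceD(1)[OF w]]
          has_weak_lincomb[OF A S HspaceD(1,2)[OF v] HspaceD(1,2)[OF w]]])
qed

text \<open>The choice made by \<open>weak\<close> is arbitrary, but uniqueness identifies the
  chosen function with the linear combination of the chosen functions, and with zero for null
  arguments.\<close>

lemma L2_linear_weak:
  fixes A :: "(real^'d \<Rightarrow> 'c::euclidean_space) \<Rightarrow> real^'d \<Rightarrow> 'b::euclidean_space"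
  assumes A: "L2_operator A S" and S: "open S" "S \<in> lmeasurable" and s: "s \<noteq> 0"
    and W: "W \<subseteq> Hspace s A S"
  shows "L2_linear S W (weak s A S)"
proof
  have SL: "S \<in> sets lebesgue" using S(2) by auto
  fix v w :: "real^'d \<Rightarrow> 'b" and r :: real
  assume "v \<in> W"
  then have v: "v \<in> Hspace s A S" using W by blast
  show "weak s A S v \<in> L2 S" by (rule HspaceD(3)[OF v])
  show "AE x in lebesgue_on S. weak s A S v x = 0" if "AE x in lebesgue_on S. v x = 0"
  proof (rule weak_eq[OF S s])
    have "AE x in lebesgue_on S. 0 = v x" using that by eventually_elim (rule sym)
    then show "has_weak s A S v (\<lambda>x. 0)"
      by (intro has_weak_cong_AE[OF A SL has_weak_zero L2_zero HspaceD(1)[OF v] _ L2_zero]) simp_all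
  qed
  assume "w \<in> W"
  then have w: "w \<in> Hspace s A S" using W by blast
  show "AE x in lebesgue_on S. weak s A S (\<lambda>y. r *\<^sub>R v y + w y) x = r *\<^sub>R weak s A S v x + weak s A S w x"
    by (rule weak_eq[OF S s has_weak_lincomb[OF A SL HspaceD(1,2)[OF v] HspaceD(1,2)[OF w]]])
qed

subsection \<open>Restriction and components\<close>

lemma l2_inner_test_restrict:
  assumes "\<phi> \<in> test_functions P" "P \<subseteq> S" "P \<in> sets lebesgue" "S \<in> sets lebesgue"
  shows "l2_inner S f \<phi> = l2_inner P f \<phi>"
proof -
  obtain K where K: "K \<subseteq> P" "\<And>x. x \<notin> K \<Longrightarrow> \<phi> x = 0"
    using assms(1) by (rule test_functionsE) blast
  have "(\<lambda>x. indicator S x *\<^sub>R (f x \<bullet> \<phi> x)) = (\<lambda>x. indicator P x *\<^sub>R (f x \<bullet> \<phi> x))"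
  proof
    fix x
    show "indicator S x *\<^sub>R (f x \<bullet> \<phi> x) = indicator P x *\<^sub>R (f x \<bullet> \<phi> x)"
    proof (cases "x \<in> P")
      case True
      then show ?thesis using assms(2) by (simp add: indicator_def subset_iff)
    next
      case False
      then have "\<phi> x = 0" using K by blast
      then show ?thesis by simp
    qed
  qed
  then show ?thesis
    using assms(3,4) by (simp add: l2_inner_def integral_restrict_space)
qed

lemma L2_operator_partial: "S \<in> sets lebesgue \<Longrightarrow> L2_operator (partial i) S"
  by (simp add: L2_operator_def test_functions_L2 test_functions_partial)

lemma H1D:
  assumes "v \<in> H1 S"
  shows "v \<in> L2 S" "has_weak (-1) (partial i) S v (wpartial i S v)" "wpartial i S v \<in> L2 S"
proof -
  have v: "v \<in> Hspace (-1) (partial i) S" for i using assms by (auto simp: H1_def)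
  show "v \<in> L2 S" by (rule HspaceD(1)[OF v])
  show "has_weak (-1) (partial i) S v (wpartial i S v)" "wpartial i S v \<in> L2 S"
    using HspaceD(2,3)[OF v] by (auto simp: wpartial_def)
qed

lemma H1I:
  assumes "v \<in> L2 S" "\<And>i. has_weak (-1) (partial i) S v (g i)"
  shows "v \<in> H1 S"
  unfolding H1_def using HspaceI[OF assms(1) assms(2)] by blast

lemma wpartial_eq:
  assumes "open S" "S \<in> lmeasurable" "has_weak (-1) (partial i) S v g"
  shows "AE x in lebesgue_on S. wpartial i S v x = g x"
  unfolding wpartial_def by (rule weak_eq[OF assms(1,2) _ assms(3)]) simp

lemma lin_space_H1: "S \<in> sets lebesgue \<Longrightarrow> lin_space (H1 S)"
  using lin_space_Hspace[OF L2_operator_partial, of S] by (auto simp: H1_def lin_space_def)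

lemma has_weak_partial_restrict:
  fixes v :: "real^'d \<Rightarrow> 'b::euclidean_space"
  assumes "has_weak (-1) (partial i) S v g" "P \<subseteq> S" "P \<in> sets lebesgue" "S \<in> sets lebesgue"
  shows "has_weak (-1) (partial i) P v g"
  unfolding has_weak_def
proof (intro conjI ballI)
  show "g \<in> L2 P" by (rule L2_subset[OF has_weakD(1)[OF assms(1)] assms(2-4)])
  fix \<phi> :: "real^'d \<Rightarrow> 'b" assume \<phi>: "\<phi> \<in> test_functions P"
  then have "\<phi> \<in> test_functions S" using test_functions_mono[OF assms(2)] by blast
  from has_weakD(2)[OF assms(1) this]
  show "l2_inner P v (partial i \<phi>) = - 1 * l2_inner P g \<phi>"
    by (simp only: l2_inner_test_restrict[OF \<phi> assms(2-4)]
        l2_inner_test_restrict[OF test_functions_partial[OF \<phi>] assms(2-4)])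
qed

lemma H1_restrict:
  assumes v: "v \<in> H1 S" and P: "P \<subseteq> S" "open P" "P \<in> lmeasurable" "S \<in> sets lebesgue"
  shows "v \<in> H1 P" "AE x in lebesgue_on P. wpartial i P v x = wpartial i S v x"
proof -
  have PL: "P \<in> sets lebesgue" using P(3) by auto
  note * = has_weak_partial_restrict[OF H1D(2)[OF v] P(1) PL P(4)]
  show "v \<in> H1 P" by (rule H1I[OF L2_subset[OF H1D(1)[OF v] P(1) PL P(4)] *])
  show "AE x in lebesgue_on P. wpartial i P v x = wpartial i S v x"
    by (rule wpartial_eq[OF P(2,3) *])
qed

lemma L2_component:
  assumes "f \<in> L2 S"
  shows "(\<lambda>x. f x \<bullet> b) \<in> L2 S"
proof -
  have [measurable]: "f \<in> borel_measurable (lebesgue_on S)" by (rule L2_measurable[OF assms])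
  have "integrable (lebesgue_on S) (\<lambda>x. (norm (f x \<bullet> b))\<^sup>2)"
  proof (rule Bochner_Integration.integrable_bound)
    show "integrable (lebesgue_on S) (\<lambda>x. (norm b)\<^sup>2 *\<^sub>R (norm (f x))\<^sup>2)"
      by (intro integrable_scaleR_right impI L2_integrable_norm_sq assms)
    have "(norm (f x \<bullet> b))\<^sup>2 \<le> (norm b)\<^sup>2 * (norm (f x))\<^sup>2" for x
      using power_mono[OF Cauchy_Schwarz_ineq2[of "f x" b], of 2] by (simp add: power_mult_distrib mult.commute)
    then show "AE x in lebesgue_on S. norm ((norm (f x \<bullet> b))\<^sup>2) \<le> norm ((norm b)\<^sup>2 *\<^sub>R (norm (f x))\<^sup>2)"
      by simp
  qed measurable
  then show ?thesis by (auto simp: L2_def)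
qed

lemma l2_inner_component: "l2_inner S (\<lambda>x. f x \<bullet> b) g = l2_inner S f (\<lambda>x. g x *\<^sub>R b)"
  by (simp add: l2_inner_def mult.commute)

lemma l2_inner_sum_components:
  assumes "f \<in> L2 S"
  shows "l2_inner S f f = (\<Sum>b\<in>Basis. l2_inner S (\<lambda>x. f x \<bullet> b) (\<lambda>x. f x \<bullet> b))"
proof -
  have "l2_inner S f f = (LINT x|lebesgue_on S. (\<Sum>b\<in>Basis. (f x \<bullet> b) \<bullet> (f x \<bullet> b)))"
    unfolding l2_inner_def by (rule Bochner_Integration.integral_cong) (auto simp: euclidean_inner[of "f _" "f _"])
  also have "\<dots> = (\<Sum>b\<in>Basis. l2_inner S (\<lambda>x. f x \<bullet> b) (\<lambda>x. f x \<bullet> b))"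
    unfolding l2_inner_def
    by (intro Bochner_Integration.integral_sum L2_integrable_inner L2_component assms)
  finally show ?thesis .
qed

lemma has_weak_partial_component:
  fixes v :: "real^'d \<Rightarrow> 'b::euclidean_space"
  assumes "has_weak (-1) (partial i) S v g"
  shows "has_weak (-1) (partial i) S (\<lambda>x. v x \<bullet> b) (\<lambda>x. g x \<bullet> b)"
  unfolding has_weak_def
proof (intro conjI ballI)
  show "(\<lambda>x. g x \<bullet> b) \<in> L2 S" by (rule L2_component[OF has_weakD(1)[OF assms]])
  fix \<phi> :: "real^'d \<Rightarrow> real" assume \<phi>: "\<phi> \<in> test_functions S"
  have "(\<lambda>x. partial i \<phi> x *\<^sub>R b) = partial i (\<lambda>x. \<phi> x *\<^sub>R b)"
    by (rule ext) (rule partial_linear[OF bounded_linear_scaleR_left test_functions_smooth[OF \<phi>], symmetric])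
  then show "l2_inner S (\<lambda>x. v x \<bullet> b) (partial i \<phi>) = - 1 * l2_inner S (\<lambda>x. g x \<bullet> b) \<phi>"
    using has_weakD(2)[OF assms test_functions_linear[OF bounded_linear_scaleR_left \<phi>, of b]]
    by (simp only: l2_inner_component)
qed

lemma H1_component: "v \<in> H1 S \<Longrightarrow> (\<lambda>x. v x \<bullet> b) \<in> H1 S"
  using H1I[OF L2_component[OF H1D(1)] has_weak_partial_component[OF H1D(2)]] by blast

lemma jacobian_norm_sq: "(jacobian_norm S v)\<^sup>2 = (\<Sum>i\<in>UNIV. (l2_norm S (wpartial i S v))\<^sup>2)"
  by (simp add: jacobian_norm_def sum_nonneg)

lemma jacobian_norm_ge_0: "0 \<le> jacobian_norm S v"
  by (simp add: jacobian_norm_def sum_nonneg)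

text \<open>Weak derivatives act componentwise, up to the choice of representatives. This lets a
  scalar Poincare inequality be summed over the components of a vector field.\<close>

lemma jacobian_norm_components:
  fixes v :: "real^'d \<Rightarrow> 'b::euclidean_space"
  assumes S: "open S" "S \<in> lmeasurable" and v: "v \<in> H1 S"
  shows "(jacobian_norm S v)\<^sup>2 = (\<Sum>b\<in>Basis. (jacobian_norm S (\<lambda>x. v x \<bullet> b))\<^sup>2)"
proof -
  have "(l2_norm S (wpartial i S (\<lambda>x. v x \<bullet> b)))\<^sup>2 = l2_inner S (\<lambda>x. wpartial i S v x \<bullet> b) (\<lambda>x. wpartial i S v x \<bullet> b)"
    for i and b :: 'b
    unfolding l2_norm_sq
    using wpartial_eq[OF S has_weak_partial_component[OF H1D(2)[OF v]]]
      H1D(3)[OF H1_component[OF v]] L2_component[OF H1D(3)[OF v]]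
    by (intro l2_inner_cong_AE)
  then have "(\<Sum>b\<in>Basis. (jacobian_norm S (\<lambda>x. v x \<bullet> b))\<^sup>2)
      = (\<Sum>b\<in>Basis. \<Sum>i\<in>UNIV. l2_inner S (\<lambda>x. wpartial i S v x \<bullet> b) (\<lambda>x. wpartial i S v x \<bullet> b))"
    by (simp add: jacobian_norm_sq)
  also have "\<dots> = (\<Sum>i\<in>UNIV. l2_inner S (wpartial i S v) (wpartial i S v))"
    by (subst sum.swap) (simp only: l2_inner_sum_components[OF H1D(3)[OF v], symmetric])
  finally show ?thesis by (simp add: jacobian_norm_sq l2_norm_sq)
qed

text \<open>Integration by parts against the smooth function 1, after the test function has been
  paired with the constant vector.\<close>

lemma has_weak_const:
  fixes c :: "'b::euclidean_space" and S :: "(real^'d) set"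
  assumes "S \<in> sets lebesgue" "bounded S" "open S"
  shows "has_weak (-1) (partial i) S (\<lambda>x. c) (\<lambda>x. 0)"
  unfolding has_weak_def
proof (intro conjI ballI L2_zero)
  fix \<phi> :: "real^'d \<Rightarrow> 'b" assume \<phi>: "\<phi> \<in> test_functions S"
  let ?\<phi> = "\<lambda>x. \<phi> x \<bullet> c"
  have t: "?\<phi> \<in> test_functions S" by (rule test_functions_linear[OF bounded_linear_inner_left \<phi>])
  have eq: "partial i ?\<phi> = (\<lambda>x. partial i \<phi> x \<bullet> c)"
    by (rule ext) (rule partial_linear[OF bounded_linear_inner_left test_functions_smooth[OF \<phi>]])
  have "partial i (\<lambda>x::real^'d. 1::real) = (\<lambda>x. 0)"
    by (simp add: partial_def fun_eq_iff frechet_derivative_const)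
  then have "l2_inner S (partial i ?\<phi>) (\<lambda>x. 1) = 0"
    using integration_by_parts[OF t smooth_const[of 1] assms(1,2), of i] by simp
  then show "l2_inner S (\<lambda>x. c) (partial i \<phi>) = - 1 * l2_inner S (\<lambda>x. 0) \<phi>"
    unfolding eq by (simp add: l2_inner_def inner_commute)
qed

section \<open>The rotation operators\<close>

lemma test_functions_diff:
  assumes "\<phi> \<in> test_functions S" "\<eta> \<in> test_functions S"
  shows "(\<lambda>x. \<phi> x - \<eta> x) \<in> test_functions S"
  using test_functions_add[OF assms(1)
      test_functions_linear[OF bounded_linear_minus[OF bounded_linear_ident] assms(2)]] by simp

lemma test_functions_component: "\<phi> \<in> test_functions S \<Longrightarrow> (\<lambda>x. \<phi> x $ j) \<in> test_functions S"
  by (rule test_functions_linear[OF bounded_linear_vec_nth])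

lemma test_functions_axis: "\<phi> \<in> test_functions S \<Longrightarrow> (\<lambda>x. \<phi> x *\<^sub>R axis j 1) \<in> test_functions S"
  by (rule test_functions_linear[OF bounded_linear_scaleR_left])

lemma vector2_eq: "vector [a, b] = a *\<^sub>R axis 1 1 + b *\<^sub>R (axis 2 1 :: real^2)"
  by (simp add: vec_eq_iff forall_2 vector_2 axis_def)

lemma vector3_eq: "vector [a, b, c] = a *\<^sub>R axis 1 1 + b *\<^sub>R axis 2 1 + c *\<^sub>R (axis 3 1 :: real^3)"
  by (simp add: vec_eq_iff forall_3 vector_3 axis_def)

lemma test_functions_rot2: "\<phi> \<in> test_functions S \<Longrightarrow> rot2 \<phi> \<in> test_functions S"
  unfolding rot2_def[abs_def]
  by (intro test_functions_diff test_functions_partial test_functions_component)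

lemma test_functions_Curl2:
  assumes "\<phi> \<in> test_functions S"
  shows "Curl2 \<phi> \<in> test_functions S"
proof -
  have "(\<lambda>x. - partial 2 \<phi> x) \<in> test_functions S"
    by (rule test_functions_linear[OF bounded_linear_minus[OF bounded_linear_ident] test_functions_partial[OF assms]])
  then show ?thesis
    unfolding Curl2_def[abs_def] vector2_eq
    by (intro test_functions_add test_functions_axis test_functions_partial assms)
qed

lemma test_functions_rot3:
  assumes "\<phi> \<in> test_functions S"
  shows "rot3 \<phi> \<in> test_functions S"
  unfolding rot3_def[abs_def] vector3_eq
  by (intro test_functions_add test_functions_axis test_functions_diff test_functions_partial
      test_functions_component assms)

lemma grad_component: "(\<lambda>y. grad \<psi> y $ j) = partial j \<psi>"
  by (simp add: grad_def fun_eq_iff)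

lemma rot2_grad: "smooth \<psi> \<Longrightarrow> rot2 (grad \<psi>) = (\<lambda>x. 0)"
  by (simp add: rot2_def[abs_def] grad_component partial_commute[of \<psi> 2 1])

lemma rot3_grad: "smooth \<psi> \<Longrightarrow> rot3 (grad \<psi>) = (\<lambda>x. 0)"
  by (simp add: rot3_def[abs_def] grad_component partial_commute[of \<psi> 3 2] partial_commute[of \<psi> 3 1]
      partial_commute[of \<psi> 2 1] vector3_eq)

lemma partial_commute_fun: 
  fixes f :: "real^'d \<Rightarrow> real"
  shows "smooth f \<Longrightarrow> partial i (partial j f) = partial j (partial i f)"
  by (rule ext) (rule partial_commute)

lemma l2_inner_minus [simp]:
  "l2_inner S f (\<lambda>x. - g x) = - l2_inner S f g" "l2_inner S (\<lambda>x. - f x) g = - l2_inner S f g"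
  by (simp_all add: l2_inner_def)

lemma L2_vec_nth:
  fixes f :: "real^'d \<Rightarrow> real^'n"
  shows "f \<in> L2 S \<Longrightarrow> (\<lambda>x. f x $ j) \<in> L2 S"
  using L2_component[of f S "axis j 1"] by (simp add: inner_axis)

lemma l2_inner_vec:
  fixes f g :: "real^'d \<Rightarrow> real^'n"
  assumes "f \<in> L2 S" "g \<in> L2 S"
  shows "l2_inner S f g = (\<Sum>j\<in>UNIV. l2_inner S (\<lambda>x. f x $ j) (\<lambda>x. g x $ j))"
proof -
  have "l2_inner S f g = (LINT x|lebesgue_on S. (\<Sum>j\<in>UNIV. f x $ j \<bullet> g x $ j))"
    by (simp add: l2_inner_def inner_vec_def)
  also have "\<dots> = (\<Sum>j\<in>UNIV. l2_inner S (\<lambda>x. f x $ j) (\<lambda>x. g x $ j))"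
    unfolding l2_inner_def
    by (intro Bochner_Integration.integral_sum L2_integrable_inner L2_vec_nth assms)
  finally show ?thesis .
qed

text \<open>Integration by parts moves the derivatives from \<open>\<psi>\<close> to
  \<open>\<eta>\<close>, where the mixed second derivatives cancel.\<close>

lemma grad_Curl2_orthogonal:
  assumes S: "S \<in> sets lebesgue" "bounded S" and \<psi>: "\<psi> \<in> test_functions S" and \<eta>: "\<eta> \<in> test_functions S"
  shows "l2_inner S (grad \<psi>) (Curl2 \<eta>) = 0"
proof -
  note sm = smooth_partial[OF test_functions_smooth[OF \<eta>]]
  have c: "(\<lambda>x. Curl2 \<eta> x $ 1) = (\<lambda>x. - partial 2 \<eta> x)" "(\<lambda>x. Curl2 \<eta> x $ 2) = partial 1 \<eta>"
    by (simp_all add: Curl2_def vector_2 fun_eq_iff)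
  have "l2_inner S (grad \<psi>) (Curl2 \<eta>)
      = - l2_inner S (partial 1 \<psi>) (partial 2 \<eta>) + l2_inner S (partial 2 \<psi>) (partial 1 \<eta>)"
    using test_functions_L2[OF test_functions_grad[OF \<psi>] S(1)]
      test_functions_L2[OF test_functions_Curl2[OF \<eta>] S(1)]
    by (simp add: l2_inner_vec sum_2 grad_component c)
  also have "\<dots> = l2_inner S \<psi> (partial 1 (partial 2 \<eta>)) - l2_inner S \<psi> (partial 2 (partial 1 \<eta>))"
    by (simp add: integration_by_parts[OF \<psi> sm S])
  also have "\<dots> = 0"
    by (simp add: partial_commute_fun[OF test_functions_smooth[OF \<eta>], of 2 1])
  finally show ?thesis .
qed

lemma grad_rot3_orthogonal:
  assumes S: "S \<in> sets lebesgue" "bounded S" and \<psi>: "\<psi> \<in> test_functions S" and \<eta>: "\<eta> \<in> test_functions S"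
  shows "l2_inner S (grad \<psi>) (rot3 \<eta>) = 0"
proof -
  let ?\<eta> = "\<lambda>j x. \<eta> x $ j"
  note tc = test_functions_component[OF \<eta>]
  note sm = smooth_partial[OF test_functions_smooth[OF tc]]
  note pL = test_functions_L2[OF test_functions_partial[OF tc] S(1)]
    test_functions_L2[OF test_functions_partial[OF \<psi>] S(1)]
  have c: "(\<lambda>x. rot3 \<eta> x $ 1) = (\<lambda>x. partial 2 (?\<eta> 3) x - partial 3 (?\<eta> 2) x)"
    "(\<lambda>x. rot3 \<eta> x $ 2) = (\<lambda>x. partial 3 (?\<eta> 1) x - partial 1 (?\<eta> 3) x)"
    "(\<lambda>x. rot3 \<eta> x $ 3) = (\<lambda>x. partial 1 (?\<eta> 2) x - partial 2 (?\<eta> 1) x)"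
    by (simp_all add: rot3_def vector_3 fun_eq_iff)
  have "l2_inner S (grad \<psi>) (rot3 \<eta>)
      = l2_inner S (partial 1 \<psi>) (partial 2 (?\<eta> 3)) - l2_inner S (partial 1 \<psi>) (partial 3 (?\<eta> 2))
      + (l2_inner S (partial 2 \<psi>) (partial 3 (?\<eta> 1)) - l2_inner S (partial 2 \<psi>) (partial 1 (?\<eta> 3)))
      + (l2_inner S (partial 3 \<psi>) (partial 1 (?\<eta> 2)) - l2_inner S (partial 3 \<psi>) (partial 2 (?\<eta> 1)))"
    using test_functions_L2[OF test_functions_grad[OF \<psi>] S(1)]
      test_functions_L2[OF test_functions_rot3[OF \<eta>] S(1)] pL
    by (simp add: l2_inner_vec sum_3 grad_component c l2_inner_diff_right)
  also have "\<dots> = 0"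
    by (simp add: integration_by_parts[OF \<psi> sm S]
        partial_commute_fun[OF test_functions_smooth[OF tc], of 2 1]
        partial_commute_fun[OF test_functions_smooth[OF tc], of 3 1]
        partial_commute_fun[OF test_functions_smooth[OF tc], of 3 2])
  finally show ?thesis .
qed

lemma L2_scaleR_const:
  fixes h :: "real^'d \<Rightarrow> real"
  assumes "h \<in> L2 S"
  shows "(\<lambda>x. h x *\<^sub>R c) \<in> L2 S"
  using assms by (auto simp: L2_def power_mult_distrib)

text \<open>Testing with \<open>rot2\<close> defines the weak Curl, so this is the classical formula
  \<open>(- d_2 v, d_1 v)\<close> in weak form. It places \<open>H1\<close> in the domain of the
  weak Curl for \<open>d = 2\<close>, and later identifies the Curl with a rotated gradient.\<close>

lemma has_weak_rot2:
  assumes S: "S \<in> sets lebesgue"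
    and v: "v \<in> L2 S" and g: "\<And>i. has_weak (-1) (partial i) S v (g i)"
  shows "has_weak (-1) rot2 S v (\<lambda>x. vector [- g 2 x, g 1 x])"
  unfolding has_weak_def
proof (intro conjI ballI)
  note gL = has_weakD(1)[OF g]
  have "(\<lambda>x. (- g 2 x) *\<^sub>R axis 1 1 + g 1 x *\<^sub>R (axis 2 1 :: real^2)) \<in> L2 S"
  proof (rule L2_add)
    have sc: "(\<lambda>x. h x *\<^sub>R (axis i 1 :: real^2)) \<in> L2 S" if h: "h \<in> L2 S" for h :: "real^2 \<Rightarrow> real" and i
      using h by (auto simp: L2_def power_mult_distrib)
    show "(\<lambda>x. g 1 x *\<^sub>R (axis 2 1 :: real^2)) \<in> L2 S" by (rule sc[OF gL])
    have "(\<lambda>x. - g 2 x) \<in> L2 S" using L2_scaleR[OF gL, of "-1" 2] by simp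
    from sc[OF this] show "(\<lambda>x. (- g 2 x) *\<^sub>R (axis 1 1 :: real^2)) \<in> L2 S" .
  qed
  then show G: "(\<lambda>x. vector [- g 2 x, g 1 x] :: real^2) \<in> L2 S" by (simp only: vector2_eq)
  fix \<phi> :: "real^2 \<Rightarrow> real^2" assume \<phi>: "\<phi> \<in> test_functions S"
  note tc = test_functions_component[OF \<phi>]
  note pL = test_functions_L2[OF test_functions_partial[OF tc] S] test_functions_L2[OF tc S] test_functions_L2[OF \<phi> S]
  have c: "(\<lambda>x. vector [- g 2 x, g 1 x] $ (1::2)) = (\<lambda>x. - g 2 x)"
    "(\<lambda>x. vector [- g 2 x, g 1 x] $ (2::2)) = g 1"
    by (simp_all add: vector_2 fun_eq_iff)
  have "l2_inner S v (rot2 \<phi>) = l2_inner S v (partial 1 (\<lambda>y. \<phi> y $ 2)) - l2_inner S v (partial 2 (\<lambda>y. \<phi> y $ 1))"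
    unfolding rot2_def[abs_def] by (rule l2_inner_diff_right[OF v pL(1) pL(1)])
  also have "\<dots> = - l2_inner S (g 1) (\<lambda>y. \<phi> y $ 2) + l2_inner S (g 2) (\<lambda>y. \<phi> y $ 1)"
    by (simp add: has_weakD(2)[OF g tc])
  also have "\<dots> = - 1 * l2_inner S (\<lambda>x. vector [- g 2 x, g 1 x]) \<phi>"
    by (simp add: l2_inner_vec[OF G pL(3)] sum_2 c)
  finally show "l2_inner S v (rot2 \<phi>) = - 1 * l2_inner S (\<lambda>x. vector [- g 2 x, g 1 x]) \<phi>" .
qed

text \<open>The curl of an \<open>H1\<close> field assembled from its weak partial derivatives; this
  places \<open>H1\<close> in H(rot) for \<open>d = 3\<close>.\<close>

lemma has_weak_rot3:
  assumes S: "S \<in> sets lebesgue"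
    and v: "v \<in> L2 S" and g: "\<And>i. has_weak (-1) (partial i) S v (g i)"
  shows "has_weak 1 rot3 S v (\<lambda>x. vector
    [g 2 x $ 3 - g 3 x $ 2, g 3 x $ 1 - g 1 x $ 3, g 1 x $ 2 - g 2 x $ 1])" (is "has_weak 1 rot3 S v ?G")
  unfolding has_weak_def
proof (intro conjI ballI)
  note gL = L2_vec_nth[OF has_weakD(1)[OF g]]
  have sc: "(\<lambda>x. h x *\<^sub>R (axis i 1 :: real^3)) \<in> L2 S" if h: "h \<in> L2 S" for h :: "real^3 \<Rightarrow> real" and i
    using h by (auto simp: L2_def power_mult_distrib)
  show G: "?G \<in> L2 S"
    unfolding vector3_eq by (intro L2_add sc L2_diff gL)
  fix \<phi> :: "real^3 \<Rightarrow> real^3" assume \<phi>: "\<phi> \<in> test_functions S"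
  note tc = test_functions_component[OF \<phi>]
  note pL = test_functions_L2[OF test_functions_partial[OF tc] S] test_functions_L2[OF tc S] test_functions_L2[OF \<phi> S]
  have gc: "l2_inner S (\<lambda>x. v x $ j) (partial i (\<lambda>x. \<phi> x $ k)) = - l2_inner S (\<lambda>x. g i x $ j) (\<lambda>x. \<phi> x $ k)" for i j k
    using has_weakD(2)[OF has_weak_partial_component[OF g, of i "axis j 1"] tc, of k] by (simp add: inner_axis)
  have c: "(\<lambda>x. rot3 \<phi> x $ 1) = (\<lambda>x. partial 2 (\<lambda>x. \<phi> x $ 3) x - partial 3 (\<lambda>x. \<phi> x $ 2) x)"
    "(\<lambda>x. rot3 \<phi> x $ 2) = (\<lambda>x. partial 3 (\<lambda>x. \<phi> x $ 1) x - partial 1 (\<lambda>x. \<phi> x $ 3) x)"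
    "(\<lambda>x. rot3 \<phi> x $ 3) = (\<lambda>x. partial 1 (\<lambda>x. \<phi> x $ 2) x - partial 2 (\<lambda>x. \<phi> x $ 1) x)"
    by (simp_all add: rot3_def vector_3 fun_eq_iff)
  show "l2_inner S v (rot3 \<phi>) = 1 * l2_inner S ?G \<phi>"
    using test_functions_L2[OF test_functions_rot3[OF \<phi>] S] pL(1,2) L2_vec_nth[OF v] gL
    by (simp add: l2_inner_vec v G pL(3) sum_3 c l2_inner_diff_right l2_inner_diff_left gc vector_3)
qed

section \<open>Maxwell's operator on a triangulated domain\<close>

text \<open>The interface through which both dimensions share one argument: the sign
  \<open>s = (-1)^(d - 1)\<close>, the complex property \<open>rot grad = 0\<close> and its tested
  form, and the place of \<open>H1\<close>, of the discrete potentials and of constants within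
  H(Curl). Constants matter because means over patches will be subtracted.\<close>

locale maxwell_domain = simplicial_domain S \<T> for S :: "(real^'d) set" and \<T> +
  fixes D :: "('d, 'm::euclidean_space) dimension_data" and s :: real
  assumes s_eq: "s = sgn_dim TYPE('d)"
    and rot_L2: "L2_operator (cl_rot D) S"
    and Curl_L2: "L2_operator (cl_Curl D) S"
    and rot_grad: "\<psi> \<in> test_functions S \<Longrightarrow> cl_rot D (grad \<psi>) = (\<lambda>x. 0)"
    and grad_Curl: "\<psi> \<in> test_functions S \<Longrightarrow> \<eta> \<in> test_functions S \<Longrightarrow> l2_inner S (grad \<psi>) (cl_Curl D \<eta>) = 0"
    and HCurl_subset: "HCurl D S \<subseteq> Hspace s (cl_rot D) S"
    and HCurl_lin: "lin_space (HCurl D S)"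
    and H1_HCurl: "H1 S \<subseteq> HCurl D S"
    and Sh_HCurl: "Sh D S \<T> \<subseteq> HCurl D S"
    and Sh_lin: "lin_space (Sh D S \<T>)"
    and Sh_finite: "finite_dim S (Sh D S \<T>)"
    and const_Sh: "(\<lambda>x. c) \<in> Sh D S \<T>"
    and const_Curl: "AE x in lebesgue_on S. wCurl D S (\<lambda>x. c) x = 0"
begin

lemma s_nz: "s \<noteq> 0" and s_abs [simp]: "\<bar>s\<bar> = 1"
  by (simp_all add: s_eq power_abs)

lemma wCurl_eq: "wCurl D S = weak s (cl_rot D) S"
  and wrot_eq: "wrot D S = weak s (cl_Curl D) S"
  and Hrot_eq: "Hrot (cl_Curl D) S = Hspace s (cl_Curl D) S"
  and tangential_trace_eq:
    "tangential_trace D S v w = l2_inner S v (wCurl D S w) - s * l2_inner S (wrot D S v) w"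
  by (simp_all add: wCurl_def wrot_def Hrot_def tangential_trace_def s_eq)

lemma grad_L2: "L2_operator grad S"
  unfolding L2_operator_def using test_functions_L2[OF test_functions_grad sets_S] by blast

lemma wCurl_linear: "L2_linear S (HCurl D S) (wCurl D S)"
  unfolding wCurl_eq by (rule L2_linear_weak[OF rot_L2 open_S lmeasurable_S s_nz HCurl_subset])

lemma wrot_linear: "L2_linear S (Hrot (cl_Curl D) S) (wrot D S)"
  unfolding wrot_eq by (rule L2_linear_weak[OF Curl_L2 open_S lmeasurable_S s_nz]) (simp add: Hrot_eq)

lemma HCurlD:
  assumes "w \<in> HCurl D S"
  shows "w \<in> L2 S" "wCurl D S w \<in> L2 S"
    "\<phi> \<in> test_functions S \<Longrightarrow> l2_inner S w (cl_rot D \<phi>) = s * l2_inner S (wCurl D S w) \<phi>"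
proof -
  have w: "w \<in> Hspace s (cl_rot D) S" using assms HCurl_subset by blast
  show "w \<in> L2 S" "wCurl D S w \<in> L2 S"
    using HspaceD(1,3)[OF w] by (simp_all add: wCurl_eq)
  show "\<phi> \<in> test_functions S \<Longrightarrow> l2_inner S w (cl_rot D \<phi>) = s * l2_inner S (wCurl D S w) \<phi>"
    using has_weakD(2)[OF HspaceD(2)[OF w]] by (simp add: wCurl_eq)
qed

text \<open>By uniqueness, vanishing of the divergence chosen by \<open>wdiv\<close> amounts to a
  condition on pairings alone, which is visibly linear and stable under limits.\<close>

lemma Hdiv0_iff: "v \<in> Hdiv0 S \<longleftrightarrow> v \<in> L2 S \<and> (\<forall>\<psi>\<in>test_functions S. l2_inner S v (grad \<psi>) = 0)"
proof
  assume v: "v \<in> Hdiv0 S"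
  then have vH: "v \<in> Hspace (-1) grad S" and z: "AE x in lebesgue_on S. weak (-1) grad S v x = 0"
    by (auto simp: Hdiv0_def Hdiv_def wdiv_def)
  have "l2_inner S v (grad \<psi>) = 0" if \<psi>: "\<psi> \<in> test_functions S" for \<psi>
  proof -
    have \<psi>L: "\<psi> \<in> L2 S" by (rule test_functions_L2[OF \<psi> sets_S])
    have "l2_inner S (weak (-1) grad S v) \<psi> = l2_inner S (\<lambda>x. 0) \<psi>"
      by (rule l2_inner_cong_AE[OF HspaceD(3)[OF vH] L2_zero \<psi>L \<psi>L z]) simp
    then show ?thesis using has_weakD(2)[OF HspaceD(2)[OF vH] \<psi>] by simp
  qed
  then show "v \<in> L2 S \<and> (\<forall>\<psi>\<in>test_functions S. l2_inner S v (grad \<psi>) = 0)"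
    using HspaceD(1)[OF vH] by blast
next
  assume v: "v \<in> L2 S \<and> (\<forall>\<psi>\<in>test_functions S. l2_inner S v (grad \<psi>) = 0)"
  then have w: "has_weak (-1) grad S v (\<lambda>x. 0)" by (simp add: has_weak_def)
  have "v \<in> Hspace (-1) grad S" using HspaceI[OF _ w] v by blast
  moreover have "AE x in lebesgue_on S. weak (-1) grad S v x = 0"
    by (rule weak_eq[OF open_S lmeasurable_S _ w]) simp
  ultimately show "v \<in> Hdiv0 S" by (simp add: Hdiv0_def Hdiv_def wdiv_def)
qed

lemma Hdiv0_L2: "v \<in> Hdiv0 S \<Longrightarrow> v \<in> L2 S"
  by (simp add: Hdiv0_iff)

lemma Hdiv0_lin: "lin_space (Hdiv0 S)"
  unfolding lin_space_def
proof (intro conjI ballI allI)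
  show "(\<lambda>x. 0) \<in> Hdiv0 S" by (simp add: Hdiv0_iff)
  fix v w r assume "v \<in> Hdiv0 S" "w \<in> Hdiv0 S"
  then show "(\<lambda>x. r *\<^sub>R v x + w x) \<in> Hdiv0 S"
    using L2_operatorD[OF grad_L2]
    by (simp add: Hdiv0_iff L2_add L2_scaleR l2_inner_add_left l2_inner_scaleR_left)
qed

text \<open>The gradient of a test function is itself a test field, and its classical rotation
  vanishes.\<close>

lemma Curl_Hdiv0:
  assumes "w \<in> HCurl D S"
  shows "wCurl D S w \<in> Hdiv0 S"
  unfolding Hdiv0_iff
proof (intro conjI ballI)
  show "wCurl D S w \<in> L2 S" by (rule HCurlD(2)[OF assms])
  fix \<psi> :: "real^'d \<Rightarrow> real" assume \<psi>: "\<psi> \<in> test_functions S"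
  show "l2_inner S (wCurl D S w) (grad \<psi>) = 0"
    using HCurlD(3)[OF assms test_functions_grad[OF \<psi>]] s_nz by (simp add: rot_grad[OF \<psi>])
qed

lemma const_Hdiv0: "(\<lambda>x. c) \<in> Hdiv0 S"
  unfolding Hdiv0_iff
proof (intro conjI ballI)
  show "(\<lambda>x. c) \<in> L2 S" by (rule L2_const[OF lmeasurable_S])
  fix \<psi> :: "real^'d \<Rightarrow> real" assume \<psi>: "\<psi> \<in> test_functions S"
  have "l2_inner S (\<lambda>x. c $ i) (partial i \<psi>) = 0" for i
    using has_weakD(2)[OF has_weak_const[OF sets_S bounded_S open_S, of i "c $ i"] \<psi>] by simp
  then show "l2_inner S (\<lambda>x. c) (grad \<psi>) = 0"
    using L2_const[OF lmeasurable_S, of c] L2_operatorD[OF grad_L2 \<psi>]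
    by (simp add: l2_inner_vec grad_component)
qed

lemma H0rotD:
  assumes "y \<in> H0rot D S"
  shows "y \<in> L2 S" "wrot D S y \<in> L2 S" "has_weak s (cl_Curl D) S y (wrot D S y)"
    "w \<in> HCurl D S \<Longrightarrow> l2_inner S y (wCurl D S w) = s * l2_inner S (wrot D S y) w"
    "y \<in> Hrot (cl_Curl D) S"
proof -
  show y: "y \<in> Hrot (cl_Curl D) S" using assms by (simp add: H0rot_def)
  then show "y \<in> L2 S" "wrot D S y \<in> L2 S" "has_weak s (cl_Curl D) S y (wrot D S y)"
    using HspaceD[of y s "cl_Curl D" S] by (simp_all add: Hrot_eq wrot_eq)
  show "w \<in> HCurl D S \<Longrightarrow> l2_inner S y (wCurl D S w) = s * l2_inner S (wrot D S y) w"
    using assms by (auto simp: H0rot_def tangential_trace_eq)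
qed

text \<open>The trace condition is formulated with the representative chosen by \<open>wrot\<close>;
  any other weak rotation \<open>r\<close> may be used to verify it.\<close>

lemma H0rotI:
  assumes y: "y \<in> L2 S" and r: "has_weak s (cl_Curl D) S y r"
    and tr: "\<And>w. w \<in> HCurl D S \<Longrightarrow> l2_inner S y (wCurl D S w) = s * l2_inner S r w"
  shows "y \<in> H0rot D S" "AE x in lebesgue_on S. wrot D S y x = r x"
proof -
  show ae: "AE x in lebesgue_on S. wrot D S y x = r x"
    unfolding wrot_eq by (rule weak_eq[OF open_S lmeasurable_S s_nz r])
  have H: "y \<in> Hspace s (cl_Curl D) S" by (rule HspaceI[OF y r])
  have rL: "r \<in> L2 S" "wrot D S y \<in> L2 S"
    using has_weakD(1)[OF r] HspaceD(3)[OF H] by (simp_all add: wrot_eq)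
  have "tangential_trace D S y w = 0" if w: "w \<in> HCurl D S" for w
  proof -
    have "l2_inner S (wrot D S y) w = l2_inner S r w"
      by (rule l2_inner_cong_AE[OF rL(2,1) HCurlD(1)[OF w] HCurlD(1)[OF w] ae]) simp
    then show ?thesis using tr[OF w] by (simp add: tangential_trace_eq)
  qed
  then show "y \<in> H0rot D S" using H by (simp add: H0rot_def Hrot_eq)
qed

lemma H0rot_lin: "lin_space (H0rot D S)"
  unfolding lin_space_def
proof (intro conjI ballI allI)
  show "(\<lambda>x. 0) \<in> H0rot D S" by (rule H0rotI(1)[OF L2_zero has_weak_zero]) simp
  fix v w r assume v: "v \<in> H0rot D S" and w: "w \<in> H0rot D S"
  show "(\<lambda>x. r *\<^sub>R v x + w x) \<in> H0rot D S"
  proof (rule H0rotI(1)[OF _ has_weak_lincomb[OF Curl_L2 sets_S H0rotD(1,3)[OF v] H0rotD(1,3)[OF w]]])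
    show "(\<lambda>x. r *\<^sub>R v x + w x) \<in> L2 S" by (rule L2_add[OF L2_scaleR[OF H0rotD(1)[OF v]] H0rotD(1)[OF w]])
    fix u assume u: "u \<in> HCurl D S"
    show "l2_inner S (\<lambda>x. r *\<^sub>R v x + w x) (wCurl D S u)
        = s * l2_inner S (\<lambda>x. r *\<^sub>R wrot D S v x + wrot D S w x) u"
      using H0rotD[OF v] H0rotD[OF w] HCurlD(1,2)[OF u] u
      by (simp add: l2_inner_add_left L2_scaleR l2_inner_scaleR_left algebra_simps)
  qed
qed

lemma wrot_H0rot: "L2_linear S (H0rot D S) (wrot D S)"
  by (rule L2_linear_mono[OF wrot_linear subsetI]) (rule H0rotD(5))

text \<open>\<open>H0rot\<close> is closed in the graph norm: the weak rotation and Green's identity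
  without boundary term both pass to the limit.\<close>

lemma H0rot_limit:
  assumes y: "\<And>n. y n \<in> H0rot D S" and u: "u \<in> L2 S" "r \<in> L2 S"
    and lim: "(\<lambda>n. l2_norm S (\<lambda>x. y n x - u x)) \<longlonglongrightarrow> 0"
      "(\<lambda>n. l2_norm S (\<lambda>x. wrot D S (y n) x - r x)) \<longlonglongrightarrow> 0"
  shows "u \<in> H0rot D S" "AE x in lebesgue_on S. wrot D S u x = r x"
proof -
  have hw: "has_weak s (cl_Curl D) S u r"
    by (rule has_weak_limit[OF Curl_L2 sets_S H0rotD(1)[OF y] H0rotD(3)[OF y] u lim])
  have tr: "l2_inner S u (wCurl D S w) = s * l2_inner S r w" if w: "w \<in> HCurl D S" for w
  proof (rule LIMSEQ_unique)
    show "(\<lambda>n. l2_inner S (y n) (wCurl D S w)) \<longlonglongrightarrow> l2_inner S u (wCurl D S w)"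
      by (rule l2_inner_tendsto[OF H0rotD(1)[OF y] u(1) HCurlD(2)[OF w] lim(1)])
    show "(\<lambda>n. l2_inner S (y n) (wCurl D S w)) \<longlonglongrightarrow> s * l2_inner S r w"
      unfolding H0rotD(4)[OF y w]
      by (intro tendsto_mult tendsto_const l2_inner_tendsto[OF H0rotD(2)[OF y] u(2) HCurlD(1)[OF w] lim(2)])
  qed
  show "u \<in> H0rot D S" "AE x in lebesgue_on S. wrot D S u x = r x"
    by (rule H0rotI[OF u(1) hw tr], assumption)+
qed

text \<open>The tangential trace pairs \<open>grad \<psi>\<close> with Curls, which are divergence
  free and hence orthogonal to it.\<close>

lemma grad_H0rot:
  assumes "\<psi> \<in> test_functions S"
  shows "grad \<psi> \<in> H0rot D S" "AE x in lebesgue_on S. wrot D S (grad \<psi>) x = 0"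
proof -
  have L: "grad \<psi> \<in> L2 S" by (rule L2_operatorD[OF grad_L2 assms])
  have hw: "has_weak s (cl_Curl D) S (grad \<psi>) (\<lambda>x. 0)"
    using grad_Curl[OF assms] by (simp add: has_weak_def)
  have tr: "l2_inner S (grad \<psi>) (wCurl D S w) = s * l2_inner S (\<lambda>x. 0) w" if w: "w \<in> HCurl D S" for w
    using Curl_Hdiv0[OF w] assms by (simp add: Hdiv0_iff l2_inner_commute)
  show "grad \<psi> \<in> H0rot D S" "AE x in lebesgue_on S. wrot D S (grad \<psi>) x = 0"
    by (rule H0rotI[OF L hw tr], assumption)+
qed

text \<open>The Helmholtz decomposition; the gradient part is only described as a limit of gradients of
  test functions.\<close>

lemma helmholtz:
  assumes y: "y \<in> L2 S"
  obtains g where "(\<lambda>x. y x - g x) \<in> Hdiv0 S" "g \<in> H0rot D S"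
    "AE x in lebesgue_on S. wrot D S g x = 0" "\<And>q. q \<in> Hdiv0 S \<Longrightarrow> l2_inner S g q = 0"
proof -
  let ?G = "grad ` test_functions S :: (real^'d \<Rightarrow> real^'d) set"
  have lin: "lin_space ?G"
    unfolding lin_space_def
  proof (intro conjI ballI allI)
    have "grad (\<lambda>x::real^'d. 0) = (\<lambda>x. 0)"
      by (simp add: grad_def[abs_def] partial_def frechet_derivative_const vec_eq_iff fun_eq_iff)
    then show "(\<lambda>x. 0) \<in> ?G" using test_functions_zero by (metis image_eqI)
    fix v w r assume "v \<in> ?G" "w \<in> ?G"
    then obtain \<phi> \<eta> where \<phi>: "\<phi> \<in> test_functions S" "v = grad \<phi>" and \<eta>: "\<eta> \<in> test_functions S" "w = grad \<eta>"
      by blast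
    note d\<phi> = smooth_has_derivative[OF test_functions_smooth[OF \<phi>(1)]]
    note d\<eta> = smooth_has_derivative[OF test_functions_smooth[OF \<eta>(1)]]
    have "((\<lambda>x. r *\<^sub>R \<phi> x + \<eta> x) has_derivative
        (\<lambda>e. r *\<^sub>R frechet_derivative \<phi> (at x) e + frechet_derivative \<eta> (at x) e)) (at x)" for x
      by (intro has_derivative_add has_derivative_scaleR_right d\<phi> d\<eta>)
    from frechet_derivative_at[OF this]
    have "partial i (\<lambda>x. r *\<^sub>R \<phi> x + \<eta> x) x = r * partial i \<phi> x + partial i \<eta> x" for i x
      by (simp add: partial_def fun_eq_iff)
    then have "(\<lambda>x. r *\<^sub>R v x + w x) = grad (\<lambda>x. r *\<^sub>R \<phi> x + \<eta> x)"
      by (simp add: \<phi>(2) \<eta>(2) grad_def fun_eq_iff vec_eq_iff)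
    moreover have "(\<lambda>x. r *\<^sub>R \<phi> x + \<eta> x) \<in> test_functions S"
      by (intro test_functions_add test_functions_linear[OF bounded_linear_scaleR_right] \<phi>(1) \<eta>(1))
    ultimately show "(\<lambda>x. r *\<^sub>R v x + w x) \<in> ?G" by blast
  qed
  have sub: "?G \<subseteq> L2 S" using L2_operatorD[OF grad_L2] by blast
  obtain g w where g: "g \<in> L2 S" "\<And>n::nat. w n \<in> ?G" "(\<lambda>n. l2_norm S (\<lambda>x. w n x - g x)) \<longlonglongrightarrow> 0"
    "\<And>v. v \<in> ?G \<Longrightarrow> l2_inner S (\<lambda>x. y x - g x) v = 0"
    using L2_projection[OF lmeasurable_S lin sub y] by blast
  have wH: "w n \<in> H0rot D S" "AE x in lebesgue_on S. wrot D S (w n) x = 0" for n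
    using g(2)[of n] grad_H0rot by auto
  \<comment> \<open>The rotations of the approximating gradients are all null, so closedness of
    \<open>H0rot\<close> yields a limit \<open>g\<close> with vanishing rotation.\<close>
  have w0: "l2_norm S (\<lambda>x. wrot D S (w n) x - (\<lambda>x. 0) x) = 0" for n
    using l2_norm_eq_0_iff[OF H0rotD(2)[OF wH(1)[of n]]] wH(2)[of n] by simp
  show ?thesis
  proof (rule that)
    show "(\<lambda>x. y x - g x) \<in> Hdiv0 S"
      unfolding Hdiv0_iff using g(4) L2_diff[OF y g(1)] by blast
    have "(\<lambda>n. l2_norm S (\<lambda>x. wrot D S (w n) x - (\<lambda>x. 0) x)) \<longlonglongrightarrow> 0" unfolding w0 by simp
    note * = H0rot_limit[OF wH(1) g(1) L2_zero g(3) this]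
    show "g \<in> H0rot D S" "AE x in lebesgue_on S. wrot D S g x = 0" using * by simp_all
    fix q assume q: "q \<in> Hdiv0 S"
    show "l2_inner S g q = 0"
    proof (rule l2_inner_orthogonal_limit[OF _ g(1) Hdiv0_L2[OF q] g(3)])
      show "w n \<in> L2 S" for n by (rule H0rotD(1)[OF wH(1)])
      fix n
      obtain \<psi> where "\<psi> \<in> test_functions S" "w n = grad \<psi>" using g(2)[of n] by blast
      then show "l2_inner S (w n) q = 0" using q by (simp add: Hdiv0_iff l2_inner_commute)
    qed
  qed
qed

end

section \<open>Finite-dimensionality of element spaces, and local inequalities on patches\<close>

context simplicial_domain
begin

lemma AE_S_from_T:
  assumes "\<And>T. T \<in> \<T> \<Longrightarrow> AE x in lebesgue_on T. P x"
  shows "AE x in lebesgue_on S. P x"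
proof -
  have "AE x in lebesgue. x \<in> T \<longrightarrow> P x" if "T \<in> \<T>" for T
    using assms[OF that] sets_T[OF that] by (simp add: AE_restrict_space_iff)
  then have "AE x in lebesgue. \<forall>T\<in>\<T>. x \<in> T \<longrightarrow> P x"
    by (subst AE_ball_countable[OF countable_finite[OF finite_T]]) blast
  then have "AE x in lebesgue. x \<in> S \<longrightarrow> P x"
  proof eventually_elim
    case (elim x)
    then show ?case using Union_T closure_subset[of S] by blast
  qed
  then show ?thesis using sets_S by (simp add: AE_restrict_space_iff)
qed

text \<open>Each member is determined up to null sets by finitely many real coefficients; with more
  functions than coefficients, a nontrivial combination has all coefficients zero.\<close>

lemma finite_dim_piecewise_affine:
  fixes W :: "(real^'d \<Rightarrow> 'b::euclidean_space) set"
  assumes W: "\<And>v T. v \<in> W \<Longrightarrow> T \<in> \<T> \<Longrightarrow> \<exists>L c. linear L \<and> (AE x in lebesgue_on T. v x = L x + c)"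
  shows "finite_dim S W"
proof -
  \<comment> \<open>The triple \<open>(T, l, b)\<close> stands for component \<open>b\<close> of the
    image of the basis vector \<open>l\<close> under the linear part on \<open>T\<close>; the extra
    value \<open>l = 0\<close> encodes the constant part.\<close>
  let ?J = "\<T> \<times> (insert 0 Basis :: (real^'d) set) \<times> (Basis :: 'b set)"
  have "finite ?J" using finite_T by simp
  from ex_bij_betw_nat_finite[OF this] obtain e where "bij_betw e {0..<card ?J} ?J" ..
  from bij_betw_imp_surj_on[OF this] obtain N where e: "e ` {..<N} = ?J"
    unfolding lessThan_atLeast0[symmetric] by (rule that)
  obtain n where n: "N < n" using lessI by (rule that)
  show ?thesis unfolding finite_dim_def
  proof (intro exI[of _ n] allI impI)
    fix w assume w: "\<forall>i<n. w i \<in> W"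
    define Q where "Q i T q \<longleftrightarrow> linear (fst q) \<and> (AE x in lebesgue_on T. w i x = fst q x + snd q)"
      for i T and q :: "(real^'d \<Rightarrow> 'b) \<times> 'b"
    define q where "q p = (SOME q. Q (fst p) (snd p) q)" for p
    have Q: "Q i T (q (i, T))" if i: "i < n" and T: "T \<in> \<T>" for i T
    proof -
      have "w i \<in> W" using w i by simp
      from W[OF this T] obtain L c where "linear L \<and> (AE x in lebesgue_on T. w i x = L x + c)"
        by (elim exE)
      then have "Q i T (L, c)" by (simp add: Q_def)
      then have "Q i T (SOME q. Q i T q)" by (rule someI)
      then show ?thesis by (simp add: q_def)
    qed
    define coef where "coef i j = (case e j of (T, l, b) \<Rightarrow>
      (if l = 0 then snd (q (i, T)) else fst (q (i, T)) l) \<bullet> b)" for i j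
    obtain c where c: "\<exists>i<n. c i \<noteq> 0" "\<And>j. j < N \<Longrightarrow> (\<Sum>i<n. c i * coef i j) = 0"
      by (rule underdetermined_system[of N n coef, OF n]) blast
    have c': "(\<Sum>i<n. c i * ((if l = 0 then snd (q (i, T)) else fst (q (i, T)) l) \<bullet> b)) = 0"
      if Tlb: "T \<in> \<T>" "l \<in> insert 0 Basis" "b \<in> Basis" for T l b
    proof -
      have "(T, l, b) \<in> e ` {..<N}" unfolding e using Tlb by blast
      then obtain j where j: "j < N" "e j = (T, l, b)" by (metis imageE lessThan_iff)
      from c(2)[OF j(1)] show ?thesis by (simp add: coef_def j(2))
    qed
    have "AE x in lebesgue_on S. (\<Sum>i<n. c i *\<^sub>R w i x) = 0"
    proof (rule AE_S_from_T)
      fix T assume T: "T \<in> \<T>"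
      have const: "(\<Sum>i<n. c i *\<^sub>R snd (q (i, T))) = 0"
      proof (rule euclidean_eqI)
        fix b :: 'b assume "b \<in> Basis"
        from c'[OF T insertI1 this] show "(\<Sum>i<n. c i *\<^sub>R snd (q (i, T))) \<bullet> b = 0 \<bullet> b"
          by (simp add: inner_sum_left)
      qed
      have lin: "(\<Sum>i<n. c i *\<^sub>R fst (q (i, T)) l) = 0" if "l \<in> Basis" for l
      proof -
        have "l \<noteq> 0" using nonzero_Basis[OF that] .
        show ?thesis
        proof (rule euclidean_eqI)
          fix b :: 'b assume "b \<in> Basis"
          from c'[OF T insertI2[OF that] this] \<open>l \<noteq> 0\<close>
          show "(\<Sum>i<n. c i *\<^sub>R fst (q (i, T)) l) \<bullet> b = 0 \<bullet> b"
            by (simp add: inner_sum_left)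
        qed
      qed
      have zero: "(\<Sum>i<n. c i *\<^sub>R (fst (q (i, T)) x + snd (q (i, T)))) = 0" for x
      proof -
        have "(\<Sum>i<n. c i *\<^sub>R fst (q (i, T)) x) = (\<Sum>i<n. c i *\<^sub>R (\<Sum>l\<in>Basis. (x \<bullet> l) *\<^sub>R fst (q (i, T)) l))"
        proof (rule sum.cong[OF refl])
          fix i assume "i \<in> {..<n}"
          then have L: "linear (fst (q (i, T)))" using Q[of i T] T by (simp add: Q_def)
          have "fst (q (i, T)) (\<Sum>l\<in>Basis. (x \<bullet> l) *\<^sub>R l) = (\<Sum>l\<in>Basis. (x \<bullet> l) *\<^sub>R fst (q (i, T)) l)"
            unfolding linear_sum[OF L] linear_cmul[OF L] ..
          then show "c i *\<^sub>R fst (q (i, T)) x = c i *\<^sub>R (\<Sum>l\<in>Basis. (x \<bullet> l) *\<^sub>R fst (q (i, T)) l)"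
            by (simp only: euclidean_representation)
        qed
        also have "\<dots> = (\<Sum>l\<in>Basis. (x \<bullet> l) *\<^sub>R (\<Sum>i<n. c i *\<^sub>R fst (q (i, T)) l))"
          unfolding scaleR_sum_right
          by (rule trans[OF sum.swap]) (intro sum.cong refl scaleR_left_commute)
        also have "\<dots> = 0"
        proof (rule sum.neutral, rule ballI)
          fix l :: "real^'d" assume "l \<in> Basis"
          from lin[OF this] show "(x \<bullet> l) *\<^sub>R (\<Sum>i<n. c i *\<^sub>R fst (q (i, T)) l) = 0" by (simp only: scaleR_zero_right)
        qed
        finally show ?thesis using const by (simp only: scaleR_add_right sum.distrib add_0_left)
      qed
      have "AE x in lebesgue_on T. w i x = fst (q (i, T)) x + snd (q (i, T))" if "i \<in> {..<n}" for i
        using Q[of i T] that T by (simp add: Q_def)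
      then have "AE x in lebesgue_on T. \<forall>i\<in>{..<n}. w i x = fst (q (i, T)) x + snd (q (i, T))"
        by (subst AE_ball_countable[OF countable_finite[OF finite_lessThan]]) blast
      then show "AE x in lebesgue_on T. (\<Sum>i<n. c i *\<^sub>R w i x) = 0"
      proof eventually_elim
        case (elim x)
        then have "(\<Sum>i<n. c i *\<^sub>R w i x) = (\<Sum>i<n. c i *\<^sub>R (fst (q (i, T)) x + snd (q (i, T))))"
          by (intro sum.cong refl) simp
        then show ?case by (simp only: zero)
      qed
    qed
    then show "\<exists>c::nat \<Rightarrow> real. (\<exists>i<n. c i \<noteq> 0) \<and> (AE x in lebesgue_on S. (\<Sum>i<n. c i *\<^sub>R w i x) = 0)"
      using c(1) by (intro exI[of _ c] conjI)
  qed
qed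

lemma finite_dim_S1: "finite_dim S (S1 S \<T>)"
proof (rule finite_dim_piecewise_affine)
  fix v T assume v: "v \<in> S1 S \<T>" and T: "T \<in> \<T>"
  have "\<forall>T\<in>\<T>. \<exists>a c. AE x in lebesgue_on T. v x = a \<bullet> x + c"
    using v unfolding S1_def by simp
  from bspec[OF this T] obtain a c where "AE x in lebesgue_on T. v x = a \<bullet> x + c" by (elim exE)
  moreover have "linear (\<lambda>x. a \<bullet> x)" by (rule bounded_linear.linear[OF bounded_linear_inner_right])
  ultimately show "\<exists>L c. linear L \<and> (AE x in lebesgue_on T. v x = L x + c)"
    by (intro exI[of _ "\<lambda>x. a \<bullet> x"] exI[of _ c] conjI)
qed

lemma finite_dim_N0: "finite_dim S (N0 C S \<T>)"
proof (rule finite_dim_piecewise_affine)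
  fix v T assume v: "v \<in> N0 C S \<T>" and T: "T \<in> \<T>"
  have "\<forall>T\<in>\<T>. \<exists>\<alpha> (B::real^'d^'d) c.
     (AE x in lebesgue_on T. v x = \<alpha> + (B *v x + c)) \<and> (\<forall>x\<in>T. (B *v x + c) \<bullet> x = 0)"
    using v unfolding N0_def by simp
  from bspec[OF this T] obtain \<alpha> c and B :: "real^'d^'d" where
    "AE x in lebesgue_on T. v x = \<alpha> + (B *v x + c)" by (elim exE conjE)
  then have "AE x in lebesgue_on T. v x = B *v x + (\<alpha> + c)" by eventually_elim simp
  then show "\<exists>L c. linear L \<and> (AE x in lebesgue_on T. v x = L x + c)"
    by (intro exI[of _ "\<lambda>x. B *v x"] exI[of _ "\<alpha> + c"] conjI matrix_vector_mul_linear)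
qed

lemma lmeasurable_patch: "patch \<T> T \<in> lmeasurable"
  using bounded_subset[OF bounded_S patch_subset] open_patch by (rule lmeasurable_open)

text \<open>The given inequality is scalar. Squared norms and squared Jacobian norms are sums over
  components, and so is the vanishing of the mean, so the constant is the same for vector
  fields.\<close>

lemma poincare_vector:
  fixes v :: "real^'d \<Rightarrow> 'b::euclidean_space"
  assumes c: "poincare_constant \<T> c" and T: "T \<in> \<T>" and v: "v \<in> H1 (patch \<T> T)"
    and avg: "(LINT x|lebesgue_on (patch \<T> T). v x) = 0"
  shows "l2_norm (patch \<T> T) v \<le> diameter T * c * jacobian_norm (patch \<T> T) v"
proof -
  let ?P = "patch \<T> T" and ?k = "diameter T * c"
  note P = open_patch[of T] lmeasurable_patch[of T]
  have comp: "l2_norm ?P (\<lambda>x. v x \<bullet> b) \<le> ?k * jacobian_norm ?P (\<lambda>x. v x \<bullet> b)" for b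
  proof -
    have "(LINT x|lebesgue_on ?P. v x \<bullet> b) = (LINT x|lebesgue_on ?P. v x) \<bullet> b"
      by (rule integral_inner_left) (rule L2_integrable[OF P(2) H1D(1)[OF v]])
    then have "(LINT x|lebesgue_on ?P. v x \<bullet> b) = 0" using avg by simp
    then show ?thesis
      using c T H1_component[OF v, of b] unfolding poincare_constant_def poincare_bound_def by blast
  qed
  have sq: "(l2_norm ?P v)\<^sup>2 = (\<Sum>b\<in>Basis. (l2_norm ?P (\<lambda>x. v x \<bullet> b))\<^sup>2)"
    by (simp add: l2_norm_sq l2_inner_sum_components[OF H1D(1)[OF v]])
  show ?thesis
  proof (cases "?k \<ge> 0")
    case True
    have "(l2_norm ?P v)\<^sup>2 \<le> (\<Sum>b\<in>Basis. (?k * jacobian_norm ?P (\<lambda>x. v x \<bullet> b))\<^sup>2)"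
      unfolding sq by (intro sum_mono power_mono comp l2_norm_ge_0)
    also have "\<dots> = (?k * jacobian_norm ?P v)\<^sup>2"
      by (simp add: power_mult_distrib jacobian_norm_components[OF P v] sum_distrib_left)
    finally show ?thesis
      by (rule power2_le_imp_le) (intro mult_nonneg_nonneg[OF True] jacobian_norm_ge_0)
  next
    \<comment> \<open>The sign of \<open>c\<close> is not part of \<open>poincare_constant\<close>.
      A negative factor forces all Jacobian norms of components to vanish, and then both sides are
      zero.\<close>
    case False
    have zero: "jacobian_norm ?P (\<lambda>x. v x \<bullet> b) = 0" for b
    proof -
      have "0 \<le> ?k * jacobian_norm ?P (\<lambda>x. v x \<bullet> b)" using comp[of b] l2_norm_ge_0 by (rule order_trans[rotated])
      moreover have "?k < 0" using False by linarith
      ultimately show ?thesis using jacobian_norm_ge_0[of ?P "\<lambda>x. v x \<bullet> b"]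
        by (smt (verit) mult_neg_pos)
    qed
    have "l2_norm ?P (\<lambda>x. v x \<bullet> b) = 0" for b
      using comp[of b] l2_norm_ge_0[of ?P "\<lambda>x. v x \<bullet> b"] by (simp add: zero)
    then have "(l2_norm ?P v)\<^sup>2 = 0" unfolding sq by simp
    moreover have "(jacobian_norm ?P v)\<^sup>2 = 0" by (simp add: jacobian_norm_components[OF P v] zero)
    ultimately show ?thesis by simp
  qed
qed

lemma measure_patch_pos: "T \<in> \<T> \<Longrightarrow> 0 < measure lebesgue (patch \<T> T)"
  using open_not_negligible[OF open_patch nonempty_patch, of T] lmeasurable_patch[of T]
    measure_nonneg[of lebesgue "patch \<T> T"]
  by (simp add: negligible_iff_measure less_le)

lemma zero_average:
  fixes f :: "real^'d \<Rightarrow> 'b::euclidean_space"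
  assumes T: "T \<in> \<T>" and f: "f \<in> L2 (patch \<T> T)"
  obtains b where "(LINT x|lebesgue_on (patch \<T> T). f x - b) = 0"
proof -
  let ?P = "patch \<T> T"
  let ?m = "measure lebesgue ?P"
  have fin: "finite_measure (lebesgue_on ?P)" by (rule finite_measure_lebesgue_on[OF lmeasurable_patch])
  have m: "measure (lebesgue_on ?P) (space (lebesgue_on ?P)) = ?m"
    using sets_patch by (simp add: space_restrict_space measure_restrict_space)
  define b where "b = (1 / ?m) *\<^sub>R (LINT x|lebesgue_on ?P. f x)"
  have "(LINT x|lebesgue_on ?P. f x - b) = (LINT x|lebesgue_on ?P. f x) - (LINT x|lebesgue_on ?P. b)"
    by (intro Bochner_Integration.integral_diff L2_integrable[OF lmeasurable_patch f]
        finite_measure.integrable_const[OF fin])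
  also have "(LINT x|lebesgue_on ?P. b) = ?m *\<^sub>R b"
    unfolding lebesgue_integral_const m ..
  also have "?m *\<^sub>R b = (LINT x|lebesgue_on ?P. f x)" using measure_patch_pos[OF T] by (simp add: b_def)
  finally show ?thesis using that by simp
qed

lemma l2_norm_T: "T \<in> \<T> \<Longrightarrow> l2_norm T f = l2_norm (interior T) f"
  by (simp add: l2_norm_def l2_inner_T)

lemma l2_norm_T_le_patch: "f \<in> L2 S \<Longrightarrow> T \<in> \<T> \<Longrightarrow> l2_norm T f \<le> l2_norm (patch \<T> T) f"
  unfolding l2_norm_def by (intro real_sqrt_le_mono l2_inner_T_le_patch)

lemma L2_interior: "f \<in> L2 S \<Longrightarrow> T \<in> \<T> \<Longrightarrow> f \<in> L2 (interior T)"
  by (rule L2_subset[OF _ interior_subset_S _ sets_S]) auto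

lemma L2_patch: "f \<in> L2 S \<Longrightarrow> f \<in> L2 (patch \<T> T)"
  by (rule L2_subset[OF _ patch_subset sets_patch sets_S])

text \<open>Local bounds with patches on the right add up to a global one, at the price of the overlap
  constant.\<close>

lemma l2_norm_from_patches:
  assumes f: "f \<in> L2 S" and g: "g \<in> L2 S" and "0 \<le> C"
    and le: "\<And>T. T \<in> \<T> \<Longrightarrow> l2_norm T f \<le> C * l2_norm (patch \<T> T) g"
  shows "l2_norm S f \<le> C * sqrt (C_OL \<T>) * l2_norm S g"
proof (rule power2_le_imp_le)
  have "(l2_norm S f)\<^sup>2 = (\<Sum>T\<in>\<T>. (l2_norm T f)\<^sup>2)" by (simp add: l2_norm_sq l2_inner_sum_T[OF f])
  also have "\<dots> \<le> (\<Sum>T\<in>\<T>. (C * l2_norm (patch \<T> T) g)\<^sup>2)"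
    by (intro sum_mono power_mono le l2_norm_ge_0)
  also have "\<dots> = C\<^sup>2 * (\<Sum>T\<in>\<T>. l2_inner (patch \<T> T) g g)"
    by (simp add: power_mult_distrib l2_norm_sq sum_distrib_left)
  also have "\<dots> \<le> C\<^sup>2 * (C_OL \<T> * l2_inner S g g)"
    by (intro mult_left_mono l2_inner_sum_patch g) simp
  also have "\<dots> = (C * sqrt (C_OL \<T>) * l2_norm S g)\<^sup>2"
    by (simp add: power_mult_distrib l2_norm_sq)
  finally show "(l2_norm S f)\<^sup>2 \<le> (C * sqrt (C_OL \<T>) * l2_norm S g)\<^sup>2" .
  show "0 \<le> C * sqrt (C_OL \<T>) * l2_norm S g" using \<open>0 \<le> C\<close> by simp
qed

lemma l2_norm_const_pos:
  fixes c :: "'b::euclidean_space"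
  assumes T: "T \<in> \<T>" and "c \<noteq> 0"
  shows "0 < l2_norm T (\<lambda>x. c)"
proof (rule ccontr)
  assume "\<not> 0 < l2_norm T (\<lambda>x. c)"
  then have "l2_norm (interior T) (\<lambda>x. c) = 0"
    using l2_norm_ge_0[of T "\<lambda>x. c"] l2_norm_T[OF T, of "\<lambda>x. c"] by linarith
  then have "AE x in lebesgue_on (interior T). c = 0"
    using l2_norm_eq_0_iff[OF L2_interior[OF L2_const[OF lmeasurable_S] T]] by blast
  then have "AE x in lebesgue. x \<notin> interior T"
    using \<open>c \<noteq> 0\<close> by (simp add: AE_restrict_space_iff)
  then have "interior T \<in> null_sets lebesgue" by (simp add: AE_iff_null_sets)
  then show False
    using open_not_negligible[OF open_interior interior_T[OF T]] by (simp add: negligible_iff_null_sets)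
qed

end

section \<open>Stability and local error of the Falk--Winther projections\<close>

locale falk_winther_domain = maxwell_domain S \<T> D s for S :: "(real^'d) set" and \<T>
    and D :: "('d, 'm::euclidean_space) dimension_data" and s +
  fixes \<pi>div :: "(real^'d \<Rightarrow> real^'d) \<Rightarrow> real^'d \<Rightarrow> real^'d"
    and \<pi>Curl :: "(real^'d \<Rightarrow> 'm) \<Rightarrow> real^'d \<Rightarrow> 'm" and C1div C2div C1Curl C2Curl CRD :: real
  assumes fw: "falk_winther D S \<T> \<pi>div \<pi>Curl C1div C2div C1Curl C2Curl"
    and rd: "regular_decomposition_constant D S CRD"
begin

lemma \<pi>Curl_Sh: "w \<in> HCurl D S \<Longrightarrow> \<pi>Curl w \<in> Sh D S \<T>"
  and \<pi>div_RT0: "v \<in> Hdiv S \<Longrightarrow> \<pi>div v \<in> RT0 S \<T>"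
  using fw by (simp_all add: falk_winther_def l2_projection_def)

lemma \<pi>Curl_id: "w \<in> Sh D S \<T> \<Longrightarrow> AE x in lebesgue_on S. \<pi>Curl w x = w x"
  and \<pi>div_id: "v \<in> RT0 S \<T> \<Longrightarrow> AE x in lebesgue_on S. \<pi>div v x = v x"
  using fw by (simp_all add: falk_winther_def l2_projection_def)

lemma \<pi>Curl_lincomb: "v \<in> HCurl D S \<Longrightarrow> w \<in> HCurl D S \<Longrightarrow>
    AE x in lebesgue_on S. \<pi>Curl (\<lambda>y. r *\<^sub>R v y + w y) x = r *\<^sub>R \<pi>Curl v x + \<pi>Curl w x"
  using fw by (simp add: falk_winther_def l2_projection_def l2_linear_on_def)

lemma \<pi>_commute: "w \<in> HCurl D S \<Longrightarrow> AE x in lebesgue_on S. \<pi>div (wCurl D S w) x = wCurl D S (\<pi>Curl w) x"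
  using fw by (simp add: falk_winther_def)

lemma \<pi>div_local: "T \<in> \<T> \<Longrightarrow> v \<in> Hdiv S \<Longrightarrow> l2_norm T (\<pi>div v) \<le>
        C1div * l2_norm (patch \<T> T) v + diameter T * C2div * l2_norm (patch \<T> T) (wdiv S v)"
  using fw by (simp add: falk_winther_def)

lemma \<pi>Curl_local: "T \<in> \<T> \<Longrightarrow> v \<in> HCurl D S \<Longrightarrow> l2_norm T (\<pi>Curl v) \<le>
        C1Curl * l2_norm (patch \<T> T) v + diameter T * C2Curl * l2_norm (patch \<T> T) (wCurl D S v)"
  using fw by (simp add: falk_winther_def)

lemma Hdiv0_Hdiv: "v \<in> Hdiv0 S \<Longrightarrow> v \<in> Hdiv S"
  and RT0_Hdiv: "v \<in> RT0 S \<T> \<Longrightarrow> v \<in> Hdiv S"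
  by (simp_all add: Hdiv0_def RT0_def)

lemma Hdiv_L2: "v \<in> Hdiv S \<Longrightarrow> v \<in> L2 S"
  by (simp add: Hdiv_def Hspace_def)

lemma \<pi>div_L2: "v \<in> Hdiv S \<Longrightarrow> \<pi>div v \<in> L2 S"
  by (rule Hdiv_L2[OF RT0_Hdiv[OF \<pi>div_RT0]])

lemma \<pi>Curl_HCurl: "w \<in> HCurl D S \<Longrightarrow> \<pi>Curl w \<in> HCurl D S"
  using \<pi>Curl_Sh Sh_HCurl by blast

lemma \<pi>div_local_Hdiv0:
  assumes T: "T \<in> \<T>" and v: "v \<in> Hdiv0 S"
  shows "l2_norm T (\<pi>div v) \<le> C1div * l2_norm (patch \<T> T) v"
proof -
  have L: "wdiv S v \<in> L2 S" using HspaceD(3)[of v "-1" grad S] Hdiv0_Hdiv[OF v] by (simp add: Hdiv_def wdiv_def)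
  have "AE x in lebesgue_on S. wdiv S v x = 0" using v by (simp add: Hdiv0_def)
  then have "AE x in lebesgue_on (patch \<T> T). wdiv S v x = 0"
    by (rule AE_lebesgue_on_subset[OF _ patch_subset sets_patch sets_S])
  then have "l2_norm (patch \<T> T) (wdiv S v) = 0"
    using l2_norm_eq_0_iff[OF L2_patch[OF L]] by blast
  then show ?thesis using \<pi>div_local[OF T Hdiv0_Hdiv[OF v]] by simp
qed

lemma AE_interior: "T \<in> \<T> \<Longrightarrow> AE x in lebesgue_on S. P x \<Longrightarrow> AE x in lebesgue_on (interior T). P x"
  by (rule AE_lebesgue_on_subset[OF _ interior_subset_S _ sets_S]) auto

text \<open>The stability constants are positive because the projections reproduce constants.\<close>

lemma C1div_pos: "0 < C1div"
proof -
  obtain T where T: "T \<in> \<T>" using nonempty_T by blast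
  let ?c = "\<lambda>x::real^'d. (1::real^'d)"
  have c: "?c \<in> Hdiv0 S" by (rule const_Hdiv0)
  have "?c \<in> RT0 S \<T>"
    unfolding RT0_def
  proof (intro CollectI conjI ballI Hdiv0_Hdiv c)
    show "\<exists>\<alpha> (\<beta>::real). AE x in lebesgue_on T. (1::real^'d) = \<alpha> + \<beta> *\<^sub>R x" for T
      by (intro exI[of _ 1] exI[of _ 0]) simp
  qed
  from \<pi>div_id[OF this] have "l2_norm (interior T) (\<pi>div ?c) = l2_norm (interior T) ?c"
    by (intro l2_norm_cong_AE L2_interior \<pi>div_L2 Hdiv0_Hdiv Hdiv0_L2 c T AE_interior)
  then have "l2_norm T ?c \<le> C1div * l2_norm (patch \<T> T) ?c"
    using \<pi>div_local_Hdiv0[OF T c] l2_norm_T[OF T, of "\<pi>div ?c"] l2_norm_T[OF T, of ?c] by simp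
  then have "0 < C1div * l2_norm (patch \<T> T) ?c" using l2_norm_const_pos[OF T, of "1::real^'d"] by simp
  then show ?thesis using l2_norm_ge_0[of "patch \<T> T" ?c] unfolding zero_less_mult_iff by linarith
qed

lemma C1Curl_pos: "0 < C1Curl"
proof -
  obtain T where T: "T \<in> \<T>" using nonempty_T by blast
  obtain b :: 'm where b: "b \<in> Basis" using nonempty_Basis by blast
  let ?c = "\<lambda>x::real^'d. b"
  have cS: "?c \<in> Sh D S \<T>" by (rule const_Sh)
  then have c: "?c \<in> HCurl D S" using Sh_HCurl by blast
  have "l2_norm (interior T) (\<pi>Curl ?c) = l2_norm (interior T) ?c"
    using \<pi>Curl_id[OF cS] by (intro l2_norm_cong_AE L2_interior HCurlD(1) \<pi>Curl_HCurl c T AE_interior)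
  moreover have "l2_norm (patch \<T> T) (wCurl D S ?c) = 0"
    using l2_norm_eq_0_iff[OF L2_patch[OF HCurlD(2)[OF c]]]
      AE_lebesgue_on_subset[OF const_Curl patch_subset sets_patch sets_S] by blast
  ultimately have "l2_norm T ?c \<le> C1Curl * l2_norm (patch \<T> T) ?c"
    using \<pi>Curl_local[OF T c] l2_norm_T[OF T, of "\<pi>Curl ?c"] l2_norm_T[OF T, of ?c] by simp
  moreover have "b \<noteq> 0" using b by (metis nonzero_Basis)
  ultimately have "0 < C1Curl * l2_norm (patch \<T> T) ?c" using l2_norm_const_pos[OF T, of b] by simp
  then show ?thesis using l2_norm_ge_0[of "patch \<T> T" ?c] unfolding zero_less_mult_iff by linarith
qed

lemma \<pi>div_bound:
  assumes "v \<in> Hdiv0 S"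
  shows "l2_norm S (\<pi>div v) \<le> C1div * sqrt (C_OL \<T>) * l2_norm S v"
  using C1div_pos
  by (intro l2_norm_from_patches \<pi>div_L2 Hdiv0_Hdiv Hdiv0_L2 assms \<pi>div_local_Hdiv0) auto

text \<open>Constants are reproduced by the projection, so that the mean over the patch may be
  subtracted before the stability estimate is applied.\<close>

lemma \<pi>Curl_local_error:
  assumes c: "poincare_constant \<T> c" and T: "T \<in> \<T>" and \<beta>: "\<beta> \<in> H1 S"
  shows "l2_norm T (\<lambda>x. \<beta> x - \<pi>Curl \<beta> x) \<le> diameter T *
    ((1 + C1Curl) * c * jacobian_norm (patch \<T> T) \<beta> + C2Curl * l2_norm (patch \<T> T) (wCurl D S \<beta>))"
proof -
  let ?P = "patch \<T> T" and ?I = "interior T"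
  have \<beta>H: "\<beta> \<in> HCurl D S" using \<beta> H1_HCurl by blast
  note \<beta>L = HCurlD(1)[OF \<beta>H]
  note \<beta>P = H1_restrict[OF \<beta> patch_subset open_patch lmeasurable_patch sets_S]
  obtain b where b: "(LINT x|lebesgue_on ?P. \<beta> x - b) = 0"
    by (rule zero_average[OF T L2_patch[OF \<beta>L]])
  let ?b = "\<lambda>x::real^'d. b"
  have bS: "?b \<in> Sh D S \<T>" by (rule const_Sh)
  then have bH: "?b \<in> HCurl D S" using Sh_HCurl by blast
  define \<delta> where "\<delta> = (\<lambda>x. (-1) *\<^sub>R ?b x + \<beta> x)"
  have \<delta>: "\<delta> = (\<lambda>x. \<beta> x - b)" by (simp add: \<delta>_def fun_eq_iff)
  have \<delta>H: "\<delta> \<in> HCurl D S" unfolding \<delta>_def by (rule lin_spaceD(2)[OF HCurl_lin bH \<beta>H])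
  have "AE x in lebesgue_on S. \<pi>Curl \<delta> x = (-1) *\<^sub>R \<pi>Curl ?b x + \<pi>Curl \<beta> x"
    unfolding \<delta>_def by (rule \<pi>Curl_lincomb[OF bH \<beta>H])
  with \<pi>Curl_id[OF bS] have "AE x in lebesgue_on S. \<beta> x - \<pi>Curl \<beta> x = \<delta> x - \<pi>Curl \<delta> x"
    by eventually_elim (simp add: \<delta>)
  then have "AE x in lebesgue_on ?I. \<beta> x - \<pi>Curl \<beta> x = \<delta> x - \<pi>Curl \<delta> x"
    by (rule AE_interior[OF T])
  then have "l2_norm T (\<lambda>x. \<beta> x - \<pi>Curl \<beta> x) = l2_norm ?I (\<lambda>x. \<delta> x - \<pi>Curl \<delta> x)"
    unfolding l2_norm_T[OF T]
    by (intro l2_norm_cong_AE L2_interior L2_diff HCurlD(1) \<pi>Curl_HCurl \<beta>H \<delta>H T)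
  also have "\<dots> \<le> l2_norm ?I \<delta> + l2_norm ?I (\<pi>Curl \<delta>)"
    by (intro l2_norm_triangle_diff L2_interior HCurlD(1) \<pi>Curl_HCurl \<delta>H T)
  also have "\<dots> \<le> l2_norm ?P \<delta> + (C1Curl * l2_norm ?P \<delta> + diameter T * C2Curl * l2_norm ?P (wCurl D S \<delta>))"
    using l2_norm_T_le_patch[OF HCurlD(1)[OF \<delta>H] T] \<pi>Curl_local[OF T \<delta>H]
    unfolding l2_norm_T[OF T] by (rule add_mono)
  also have "l2_norm ?P (wCurl D S \<delta>) = l2_norm ?P (wCurl D S \<beta>)"
  proof (intro l2_norm_cong_AE L2_patch HCurlD(2) \<delta>H \<beta>H)
    have "AE x in lebesgue_on S. wCurl D S \<delta> x = (-1) *\<^sub>R wCurl D S ?b x + wCurl D S \<beta> x"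
      unfolding \<delta>_def by (rule L2_linearD(2)[OF wCurl_linear bH \<beta>H])
    with const_Curl have "AE x in lebesgue_on S. wCurl D S \<delta> x = wCurl D S \<beta> x"
      by eventually_elim simp
    then show "AE x in lebesgue_on ?P. wCurl D S \<delta> x = wCurl D S \<beta> x"
      by (rule AE_lebesgue_on_subset[OF _ patch_subset sets_patch sets_S])
  qed
  finally have est: "l2_norm T (\<lambda>x. \<beta> x - \<pi>Curl \<beta> x)
      \<le> (1 + C1Curl) * l2_norm ?P \<delta> + diameter T * C2Curl * l2_norm ?P (wCurl D S \<beta>)"
    by (simp add: algebra_simps)
  \<comment> \<open>Subtracting the mean does not change the weak derivatives on the patch.\<close>
  have bP: "has_weak (-1) (partial i) ?P ?b (\<lambda>x. 0)" for i
    by (rule has_weak_const[OF sets_patch bounded_subset[OF bounded_S patch_subset] open_patch])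
  have d: "has_weak (-1) (partial i) ?P \<delta> (\<lambda>x. (-1) *\<^sub>R 0 + wpartial i ?P \<beta> x)" for i
    unfolding \<delta>_def
    by (rule has_weak_lincomb[OF L2_operator_partial[OF sets_patch] sets_patch L2_const[OF lmeasurable_patch] bP
          H1D(1,2)[OF \<beta>P(1)]])
  have \<delta>1: "\<delta> \<in> H1 ?P" by (rule H1I[OF L2_patch[OF HCurlD(1)[OF \<delta>H]] d])
  have "l2_norm ?P (wpartial i ?P \<delta>) = l2_norm ?P (wpartial i ?P \<beta>)" for i
    using wpartial_eq[OF open_patch lmeasurable_patch d, of i]
    by (intro l2_norm_cong_AE H1D(3)[OF \<delta>1] H1D(3)[OF \<beta>P(1)]) simp
  then have jac: "jacobian_norm ?P \<delta> = jacobian_norm ?P \<beta>" by (simp add: jacobian_norm_def)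
  have "l2_norm ?P \<delta> \<le> diameter T * c * jacobian_norm ?P \<beta>"
    using poincare_vector[OF c T \<delta>1] b unfolding jac by (simp add: \<delta>)
  then have "(1 + C1Curl) * l2_norm ?P \<delta> \<le> (1 + C1Curl) * (diameter T * c * jacobian_norm ?P \<beta>)"
    using C1Curl_pos by (intro mult_left_mono) auto
  with est have "l2_norm T (\<lambda>x. \<beta> x - \<pi>Curl \<beta> x)
      \<le> (1 + C1Curl) * (diameter T * c * jacobian_norm ?P \<beta>)
        + diameter T * C2Curl * l2_norm ?P (wCurl D S \<beta>)" by linarith
  also have "\<dots> = diameter T * ((1 + C1Curl) * c * jacobian_norm ?P \<beta> + C2Curl * l2_norm ?P (wCurl D S \<beta>))"
    by (simp add: algebra_simps)
  finally show ?thesis .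
qed

end

section \<open>Linearity of the finite element spaces\<close>

lemma L2_vecI:
  fixes f :: "real^'d \<Rightarrow> real^'n"
  assumes "\<And>j. (\<lambda>x. f x $ j) \<in> L2 S"
  shows "f \<in> L2 S"
proof -
  have "(\<lambda>x. \<Sum>j\<in>UNIV. f x $ j *\<^sub>R (axis j 1 :: real^'n)) \<in> L2 S"
    by (intro L2_sum L2_scaleR_const assms)
  also have "(\<lambda>x. \<Sum>j\<in>UNIV. f x $ j *\<^sub>R (axis j 1 :: real^'n)) = f"
    by (auto simp: fun_eq_iff vec_eq_iff axis_def if_distrib cong: if_cong)
  finally show ?thesis .
qed

lemma lin_space_N0:
  assumes C: "L2_operator C S" and S: "S \<in> sets lebesgue"
  shows "lin_space (N0 C S \<T>)"
  unfolding lin_space_def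
proof (intro conjI ballI allI)
  have H: "lin_space (Hrot C S)" unfolding Hrot_def by (rule lin_space_Hspace[OF C S])
  show "(\<lambda>x. 0) \<in> N0 C S \<T>"
    unfolding N0_def
  proof (intro CollectI conjI ballI lin_spaceD(1)[OF H])
    fix T
    show "\<exists>\<alpha> (B::real^'a^'a) c. (AE x in lebesgue_on T. (0::real^'a) = \<alpha> + (B *v x + c)) \<and> (\<forall>x\<in>T. (B *v x + c) \<bullet> x = 0)"
      by (intro exI[of _ 0]) (simp add: matrix_vector_mult_0)
  qed
  fix v w r assume v: "v \<in> N0 C S \<T>" and w: "w \<in> N0 C S \<T>"
  show "(\<lambda>x. r *\<^sub>R v x + w x) \<in> N0 C S \<T>"
    unfolding N0_def
  proof (intro CollectI conjI ballI)
    show "(\<lambda>x. r *\<^sub>R v x + w x) \<in> Hrot C S"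
      using v w by (intro lin_spaceD(2)[OF H]) (simp_all add: N0_def)
    fix T assume T: "T \<in> \<T>"
    obtain \<alpha> c and B :: "real^'a^'a" where v': "AE x in lebesgue_on T. v x = \<alpha> + (B *v x + c)"
      "\<forall>x\<in>T. (B *v x + c) \<bullet> x = 0"
      using v T unfolding N0_def by blast
    obtain \<alpha>' c' and B' :: "real^'a^'a" where w': "AE x in lebesgue_on T. w x = \<alpha>' + (B' *v x + c')"
      "\<forall>x\<in>T. (B' *v x + c') \<bullet> x = 0"
      using w T unfolding N0_def by blast
    have mv: "(r *\<^sub>R B + B') *v x + (r *\<^sub>R c + c') = r *\<^sub>R (B *v x + c) + (B' *v x + c')" for x
      by (simp add: matrix_vector_mult_add_rdistrib scaleR_matrix_vector_assoc algebra_simps)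
    show "\<exists>\<alpha> (B::real^'a^'a) c. (AE x in lebesgue_on T. r *\<^sub>R v x + w x = \<alpha> + (B *v x + c)) \<and> (\<forall>x\<in>T. (B *v x + c) \<bullet> x = 0)"
    proof (intro exI conjI)
      show "AE x in lebesgue_on T. r *\<^sub>R v x + w x = (r *\<^sub>R \<alpha> + \<alpha>') + ((r *\<^sub>R B + B') *v x + (r *\<^sub>R c + c'))"
        using v'(1) w'(1) unfolding mv by eventually_elim (simp add: algebra_simps)
      show "\<forall>x\<in>T. ((r *\<^sub>R B + B') *v x + (r *\<^sub>R c + c')) \<bullet> x = 0"
        using v'(2) w'(2) unfolding mv by (simp only: inner_add_left inner_scaleR_left) simp
    qed
  qed
qed

lemma lin_space_S1:
  assumes S: "S \<in> sets lebesgue"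
  shows "lin_space (S1 S \<T>)"
  unfolding lin_space_def
proof (intro conjI ballI allI)
  note H = lin_space_H1[OF S]
  show "(\<lambda>x. 0) \<in> S1 S \<T>"
    unfolding S1_def
  proof (intro CollectI conjI ballI lin_spaceD(1)[OF H])
    fix T
    show "\<exists>a c. AE x in lebesgue_on T. 0 = a \<bullet> x + c" by (intro exI[of _ 0]) simp
  qed
  fix v w r assume v: "v \<in> S1 S \<T>" and w: "w \<in> S1 S \<T>"
  show "(\<lambda>x. r *\<^sub>R v x + w x) \<in> S1 S \<T>"
    unfolding S1_def
  proof (intro CollectI conjI ballI)
    show "(\<lambda>x. r *\<^sub>R v x + w x) \<in> H1 S"
      using v w by (intro lin_spaceD(2)[OF H]) (simp_all add: S1_def)
    fix T assume T: "T \<in> \<T>"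
    obtain a c where v': "AE x in lebesgue_on T. v x = a \<bullet> x + c"
      using v T unfolding S1_def by blast
    obtain a' c' where w': "AE x in lebesgue_on T. w x = a' \<bullet> x + c'"
      using w T unfolding S1_def by blast
    have "AE x in lebesgue_on T. r *\<^sub>R v x + w x = (r *\<^sub>R a + a') \<bullet> x + (r * c + c')"
      using v' w' by eventually_elim (simp add: inner_add_left algebra_simps)
    then show "\<exists>a c. AE x in lebesgue_on T. r *\<^sub>R v x + w x = a \<bullet> x + c" by (intro exI)
  qed
qed

section \<open>The Galerkin error\<close>

context maxwell_domain
begin

lemma a_norm_eq: "a_norm D S v = l2_norm S (wrot D S v)"
  by (simp add: a_norm_def a_form_def l2_norm_def)

lemma a_commute: "a_form D S v w = a_form D S w v"
  unfolding a_form_def by (rule l2_inner_commute)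

lemma a_lincomb_left:
  assumes v: "v \<in> H0rot D S" and w: "w \<in> H0rot D S" and z: "z \<in> H0rot D S"
  shows "a_form D S (\<lambda>x. r *\<^sub>R v x + w x) z = r * a_form D S v z + a_form D S w z"
proof -
  have L: "(\<lambda>x. r *\<^sub>R wrot D S v x + wrot D S w x) \<in> L2 S"
    by (intro L2_add L2_scaleR H0rotD(2) v w)
  have "a_form D S (\<lambda>x. r *\<^sub>R v x + w x) z = l2_inner S (\<lambda>x. r *\<^sub>R wrot D S v x + wrot D S w x) (wrot D S z)"
    unfolding a_form_def
    by (rule l2_inner_cong_AE[OF H0rotD(2)[OF lin_spaceD(2)[OF H0rot_lin v w]] L H0rotD(2)[OF z] H0rotD(2)[OF z]
          L2_linearD(2)[OF wrot_H0rot v w]]) simp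
  also have "\<dots> = r * a_form D S v z + a_form D S w z"
    using H0rotD(2)[OF v] H0rotD(2)[OF w] H0rotD(2)[OF z]
    by (simp add: a_form_def l2_inner_add_left L2_scaleR l2_inner_scaleR_left)
  finally show ?thesis .
qed

lemma a_diff_left:
  assumes "v \<in> H0rot D S" "w \<in> H0rot D S" "z \<in> H0rot D S"
  shows "a_form D S (\<lambda>x. v x - w x) z = a_form D S v z - a_form D S w z"
  using a_lincomb_left[OF assms(2,1,3), of "-1"] by simp

lemma a_diff_right:
  assumes "v \<in> H0rot D S" "w \<in> H0rot D S" "z \<in> H0rot D S"
  shows "a_form D S z (\<lambda>x. v x - w x) = a_form D S z v - a_form D S z w"
  using a_diff_left[OF assms] by (simp only: a_commute[of z])

lemma a_zero_left:
  assumes "z \<in> H0rot D S" "y \<in> H0rot D S" "AE x in lebesgue_on S. wrot D S y x = 0"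
  shows "a_form D S y z = 0"
proof -
  have "a_form D S y z = l2_inner S (\<lambda>x. 0) (wrot D S z)"
    unfolding a_form_def
    by (rule l2_inner_cong_AE[OF H0rotD(2)[OF assms(2)] L2_zero H0rotD(2)[OF assms(1)] H0rotD(2)[OF assms(1)] assms(3)]) simp
  then show ?thesis by simp
qed

lemma a_sum_left:
  fixes n :: nat
  assumes w: "\<And>i. i < n \<Longrightarrow> w i \<in> H0rot D S" and z: "z \<in> H0rot D S"
  shows "a_form D S (\<lambda>x. \<Sum>i<n. c i *\<^sub>R w i x) z = (\<Sum>i<n. c i * a_form D S (w i) z)"
  using w
proof (induction n)
  case 0
  have "AE x in lebesgue_on S. wrot D S (\<lambda>x. 0) x = 0"
    by (rule L2_linearD(3)[OF wrot_H0rot lin_spaceD(1)[OF H0rot_lin]]) simp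
  from a_zero_left[OF z lin_spaceD(1)[OF H0rot_lin] this] show ?case by simp
next
  case (Suc n)
  have "(\<lambda>x. \<Sum>i<n. c i *\<^sub>R w i x) \<in> H0rot D S"
    by (rule lin_space_sum[OF H0rot_lin]) (simp add: Suc.prems)
  from a_lincomb_left[OF Suc.prems[OF lessI] this z, of "c n"] Suc
  show ?case by (simp add: add.commute)
qed

lemma a_Cauchy_Schwarz:
  assumes "v \<in> H0rot D S" "w \<in> H0rot D S"
  shows "\<bar>a_form D S v w\<bar> \<le> a_norm D S v * a_norm D S w"
  unfolding a_form_def a_norm_eq by (rule l2_Cauchy_Schwarz[OF H0rotD(2)[OF assms(1)] H0rotD(2)[OF assms(2)]])

lemma a_norm_sq: "(a_norm D S v)\<^sup>2 = a_form D S v v"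
  by (simp add: a_norm_eq l2_norm_sq a_form_def)

lemma a_norm_ge_0 [simp]: "0 \<le> a_norm D S v"
  by (simp add: a_norm_eq)

lemma V_H0rot: "v \<in> V D S \<Longrightarrow> v \<in> H0rot D S" and V_Hdiv0: "v \<in> V D S \<Longrightarrow> v \<in> Hdiv0 S"
  by (simp_all add: V_def)

lemma V_lin: "lin_space (V D S)"
  unfolding V_def by (rule lin_space_Int[OF H0rot_lin Hdiv0_lin])

lemma Vh_H0rot: "v \<in> Vh D S \<T> \<Longrightarrow> v \<in> H0rot D S"
  by (simp add: Vh_def N0D_def)

lemma Vh_finite: "finite_dim S (Vh D S \<T>)"
  by (rule finite_dim_subset[OF finite_dim_N0]) (auto simp: Vh_def N0D_def)

lemma wgrad_L2: "v \<in> H1 S \<Longrightarrow> wgrad S v \<in> L2 S"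
  by (rule L2_vecI) (simp add: wgrad_def H1D(3) eta_contract_eq)

lemma Vh_lin: "lin_space (Vh D S \<T>)"
proof -
  have N: "lin_space (N0D D S \<T>)"
    unfolding N0D_def by (rule lin_space_Int[OF lin_space_N0[OF Curl_L2 sets_S] H0rot_lin])
  show ?thesis
    unfolding lin_space_def
  proof (intro conjI ballI allI)
    show "(\<lambda>x. 0) \<in> Vh D S \<T>" using lin_spaceD(1)[OF N] by (simp add: Vh_def)
    fix v w r assume v: "v \<in> Vh D S \<T>" and w: "w \<in> Vh D S \<T>"
    show "(\<lambda>x. r *\<^sub>R v x + w x) \<in> Vh D S \<T>"
      unfolding Vh_def
    proof (intro CollectI conjI ballI)
      show "(\<lambda>x. r *\<^sub>R v x + w x) \<in> N0D D S \<T>"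
        using v w by (intro lin_spaceD(2)[OF N]) (simp_all add: Vh_def)
      fix p assume p: "p \<in> S10 S \<T>"
      then have pL: "wgrad S p \<in> L2 S" by (intro wgrad_L2) (simp add: S10_def S1_def)
      have "l2_inner S (wgrad S p) (\<lambda>x. r *\<^sub>R v x + w x) = r * l2_inner S (wgrad S p) v + l2_inner S (wgrad S p) w"
        using pL H0rotD(1)[OF Vh_H0rot[OF v]] H0rotD(1)[OF Vh_H0rot[OF w]]
        by (simp add: l2_inner_add_right L2_scaleR l2_inner_scaleR_right)
      then show "l2_inner S (wgrad S p) (\<lambda>x. r *\<^sub>R v x + w x) = 0"
        using v w p by (simp add: Vh_def)
    qed
  qed
qed

lemma wrot_Vh: "L2_linear S (Vh D S \<T>) (wrot D S)"
  by (rule L2_linear_mono[OF wrot_H0rot subsetI]) (rule Vh_H0rot)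

text \<open>Functions \<open>b i\<close> of \<open>Vh\<close> with orthonormal rotations give the
  projection explicitly as the sum of \<open>a(u, b i) b i\<close>; for the test it is enough that
  rotations of \<open>Vh\<close> are expanded in those of the \<open>b i\<close>.\<close>

lemma Galerkin_projection_exists:
  assumes u: "u \<in> H0rot D S"
  shows "\<exists>w. w \<in> Vh D S \<T> \<and> (\<forall>v \<in> Vh D S \<T>. a_form D S (\<lambda>x. u x - w x) v = 0)"
proof -
  obtain m :: nat and b where b: "\<And>i. i < m \<Longrightarrow> b i \<in> Vh D S \<T>"
    "\<And>i j. i < m \<Longrightarrow> j < m \<Longrightarrow> l2_inner S (wrot D S (b i)) (wrot D S (b j)) = (if i = j then 1 else 0)"
    "\<And>v. v \<in> Vh D S \<T> \<Longrightarrow> AE x in lebesgue_on S. wrot D S v x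
        = (\<Sum>i<m. l2_inner S (wrot D S v) (wrot D S (b i)) *\<^sub>R wrot D S (b i) x)"
    by (rule finite_dim_orthonormal[OF Vh_lin Vh_finite wrot_Vh]) (rule that; assumption)
  have bH: "b i \<in> H0rot D S" if "i < m" for i using b(1)[OF that] by (rule Vh_H0rot)
  define w where "w = (\<lambda>x. \<Sum>i<m. a_form D S u (b i) *\<^sub>R b i x)"
  have w: "w \<in> Vh D S \<T>" unfolding w_def by (rule lin_space_sum[OF Vh_lin]) (simp add: b(1))
  have "a_form D S (\<lambda>x. u x - w x) v = 0" if v: "v \<in> Vh D S \<T>" for v
  proof -
    have expand: "a_form D S z v = (\<Sum>i<m. a_form D S v (b i) * a_form D S z (b i))" if z: "z \<in> H0rot D S" for z
    proof -
      have L: "(\<lambda>x. \<Sum>i<m. l2_inner S (wrot D S v) (wrot D S (b i)) *\<^sub>R wrot D S (b i) x) \<in> L2 S"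
        by (rule L2_sum, rule L2_scaleR, rule H0rotD(2), rule bH) simp
      have "a_form D S z v = l2_inner S (wrot D S z) (\<lambda>x. \<Sum>i<m. l2_inner S (wrot D S v) (wrot D S (b i)) *\<^sub>R wrot D S (b i) x)"
        unfolding a_form_def
        by (rule l2_inner_cong_AE[OF H0rotD(2)[OF z] H0rotD(2)[OF z] H0rotD(2)[OF Vh_H0rot[OF v]] L _ b(3)[OF v]]) simp
      also have "\<dots> = (\<Sum>i<m. l2_inner S (wrot D S z) (\<lambda>x. l2_inner S (wrot D S v) (wrot D S (b i)) *\<^sub>R wrot D S (b i) x))"
        by (rule l2_inner_sum_right[OF H0rotD(2)[OF z]], rule L2_scaleR, rule H0rotD(2), rule bH) simp
      finally show ?thesis by (simp add: l2_inner_scaleR_right a_form_def)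
    qed
    have "a_form D S w v = (\<Sum>i<m. a_form D S u (b i) * a_form D S (b i) v)"
      unfolding w_def by (rule a_sum_left[OF bH Vh_H0rot[OF v]])
    also have "\<dots> = a_form D S u v"
      unfolding expand[OF u] by (intro sum.cong refl) (simp add: a_commute[of v] mult.commute)
    finally show ?thesis by (simp add: a_diff_left[OF u Vh_H0rot[OF w] Vh_H0rot[OF v]])
  qed
  then show ?thesis using w by blast
qed

lemma Gh:
  assumes "u \<in> H0rot D S"
  shows "Gh D S \<T> u \<in> Vh D S \<T>"
    "v \<in> Vh D S \<T> \<Longrightarrow> a_form D S (\<lambda>x. u x - Gh D S \<T> u x) v = 0"
  using someI_ex[OF Galerkin_projection_exists[OF assms]] unfolding Gh_def[symmetric] by simp_all

lemma Gh_H0rot: "u \<in> H0rot D S \<Longrightarrow> Gh D S \<T> u \<in> H0rot D S"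
  by (rule Vh_H0rot[OF Gh(1)])

text \<open>Cea's lemma with constant one, from Galerkin orthogonality and Cauchy--Schwarz.\<close>

lemma Gh_best:
  assumes u: "u \<in> H0rot D S" and v: "v \<in> Vh D S \<T>"
  shows "a_norm D S (\<lambda>x. u x - Gh D S \<T> u x) \<le> a_norm D S (\<lambda>x. u x - v x)"
proof -
  let ?g = "Gh D S \<T> u"
  let ?e = "\<lambda>x. u x - ?g x"
  have e: "?e \<in> H0rot D S" by (rule lin_space_diff[OF H0rot_lin u Gh_H0rot[OF u]])
  have vH: "v \<in> H0rot D S" by (rule Vh_H0rot[OF v])
  have uv: "(\<lambda>x. u x - v x) \<in> H0rot D S" by (rule lin_space_diff[OF H0rot_lin u vH])
  have "a_form D S ?e ?e = a_form D S ?e (\<lambda>x. u x - v x)"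
    using a_diff_right[OF u Gh_H0rot[OF u] e] a_diff_right[OF u vH e] Gh(2)[OF u Gh(1)[OF u]] Gh(2)[OF u v] by simp
  then have "(a_norm D S ?e)\<^sup>2 \<le> a_norm D S ?e * a_norm D S (\<lambda>x. u x - v x)"
    using a_Cauchy_Schwarz[OF e uv] by (simp add: a_norm_sq)
  then show ?thesis
    using a_norm_ge_0[of ?e] a_norm_ge_0[of "\<lambda>x. u x - v x"]
    by (cases "a_norm D S ?e = 0") (auto simp: power2_eq_square mult_le_cancel_left)
qed

text \<open>In the Helmholtz decomposition of \<open>y\<close> the gradient part has no rotation and
  is orthogonal to the divergence-free \<open>f\<close>, so the equation extends from
  \<open>V\<close> to all of \<open>H0rot\<close>. This admits test functions built from
  \<open>Vh\<close>, which are not divergence free.\<close>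

lemma solution_H0rot:
  assumes f: "f \<in> Hdiv0 S" and u: "u \<in> V D S" and sol: "\<And>v. v \<in> V D S \<Longrightarrow> a_form D S u v = l2_inner S f v"
    and y: "y \<in> H0rot D S"
  shows "a_form D S u y = l2_inner S f y"
proof -
  obtain g where g: "(\<lambda>x. y x - g x) \<in> Hdiv0 S" "g \<in> H0rot D S"
    "AE x in lebesgue_on S. wrot D S g x = 0" "\<And>q. q \<in> Hdiv0 S \<Longrightarrow> l2_inner S g q = 0"
    by (rule helmholtz[OF H0rotD(1)[OF y]]) (rule that; assumption)
  have p: "(\<lambda>x. y x - g x) \<in> V D S"
    using g(1) lin_space_diff[OF H0rot_lin y g(2)] by (simp add: V_def)
  have "a_form D S u (\<lambda>x. y x - g x) = a_form D S u y - a_form D S u g"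
    by (rule a_diff_right[OF y g(2) V_H0rot[OF u]])
  moreover have "a_form D S u g = 0"
    using a_zero_left[OF V_H0rot[OF u] g(2,3)] by (simp add: a_commute)
  moreover have "l2_inner S f (\<lambda>x. y x - g x) = l2_inner S f y - l2_inner S f g"
    by (rule l2_inner_diff_right[OF Hdiv0_L2[OF f] H0rotD(1)[OF y] H0rotD(1)[OF g(2)]])
  moreover have "l2_inner S f g = 0" using g(4)[OF f] by (simp add: l2_inner_commute)
  ultimately show ?thesis using sol[OF p] by simp
qed

text \<open>Combining functions with orthonormal Curls gives a right inverse of the discrete Curl
  that is bounded in \<open>L2\<close>. The bound \<open>K\<close> depends on the mesh, which is
  harmless: it only proves finiteness and never enters the eigenvalue bounds.\<close>

lemma Sh_right_inverse:
  obtains K where "0 \<le> K" "\<And>w. w \<in> Sh D S \<T> \<Longrightarrow> \<exists>\<tau>\<in>Sh D S \<T>.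
    (AE x in lebesgue_on S. wCurl D S \<tau> x = wCurl D S w x) \<and> l2_norm S \<tau> \<le> K * l2_norm S (wCurl D S w)"
proof -
  have A: "L2_linear S (Sh D S \<T>) (wCurl D S)" by (rule L2_linear_mono[OF wCurl_linear Sh_HCurl])
  obtain m :: nat and b where b: "\<And>i. i < m \<Longrightarrow> b i \<in> Sh D S \<T>"
    "\<And>i j. i < m \<Longrightarrow> j < m \<Longrightarrow> l2_inner S (wCurl D S (b i)) (wCurl D S (b j)) = (if i = j then 1 else 0)"
    "\<And>v. v \<in> Sh D S \<T> \<Longrightarrow> AE x in lebesgue_on S. wCurl D S v x
        = (\<Sum>i<m. l2_inner S (wCurl D S v) (wCurl D S (b i)) *\<^sub>R wCurl D S (b i) x)"
    by (rule finite_dim_orthonormal[OF Sh_lin Sh_finite A]) (rule that; assumption)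
  have bL: "b i \<in> L2 S" "wCurl D S (b i) \<in> L2 S" if "i < m" for i
    using HCurlD(1,2)[OF subsetD[OF Sh_HCurl b(1)[OF that]]] by simp_all
  have b1: "l2_norm S (wCurl D S (b i)) = 1" if "i < m" for i
    using b(2)[OF that that] by (simp add: l2_norm_def)
  show ?thesis
  proof (rule that)
    show "0 \<le> (\<Sum>i<m. l2_norm S (b i))" by (simp add: sum_nonneg)
    fix w assume w: "w \<in> Sh D S \<T>"
    have wL: "wCurl D S w \<in> L2 S" by (rule HCurlD(2)[OF subsetD[OF Sh_HCurl w]])
    let ?c = "\<lambda>i. l2_inner S (wCurl D S w) (wCurl D S (b i))"
    define \<tau> where "\<tau> = (\<lambda>x. \<Sum>i<m. ?c i *\<^sub>R b i x)"
    show "\<exists>\<tau>\<in>Sh D S \<T>. (AE x in lebesgue_on S. wCurl D S \<tau> x = wCurl D S w x)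
      \<and> l2_norm S \<tau> \<le> (\<Sum>i<m. l2_norm S (b i)) * l2_norm S (wCurl D S w)"
    proof (intro bexI conjI)
      show "\<tau> \<in> Sh D S \<T>" unfolding \<tau>_def by (rule lin_space_sum[OF Sh_lin]) (simp add: b(1))
      have "AE x in lebesgue_on S. wCurl D S \<tau> x = (\<Sum>i<m. ?c i *\<^sub>R wCurl D S (b i) x)"
        unfolding \<tau>_def by (rule L2_linear_sum[OF A Sh_lin b(1)])
      with b(3)[OF w] show "AE x in lebesgue_on S. wCurl D S \<tau> x = wCurl D S w x"
        by eventually_elim simp
      have "l2_norm S \<tau> \<le> (\<Sum>i<m. l2_norm S (\<lambda>x. ?c i *\<^sub>R b i x))"
        unfolding \<tau>_def by (rule l2_norm_sum, rule L2_scaleR, rule bL(1)) simp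
      also have "\<dots> \<le> (\<Sum>i<m. l2_norm S (wCurl D S w) * l2_norm S (b i))"
      proof (rule sum_mono)
        fix i assume "i \<in> {..<m}"
        then have i: "i < m" by simp
        have "\<bar>?c i\<bar> \<le> l2_norm S (wCurl D S w)"
          using l2_Cauchy_Schwarz[OF wL bL(2)[OF i]] b1[OF i] by simp
        then show "l2_norm S (\<lambda>x. ?c i *\<^sub>R b i x) \<le> l2_norm S (wCurl D S w) * l2_norm S (b i)"
          unfolding l2_norm_scaleR by (rule mult_right_mono) simp
      qed
      finally show "l2_norm S \<tau> \<le> (\<Sum>i<m. l2_norm S (b i)) * l2_norm S (wCurl D S w)"
        by (simp add: sum_distrib_left mult.commute)
    qed
  qed
qed

lemma L2_linear_wCurl_diff:
  assumes "v \<in> HCurl D S" "w \<in> HCurl D S"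
  shows "AE x in lebesgue_on S. wCurl D S (\<lambda>y. v y - w y) x = wCurl D S v x - wCurl D S w x"
  by (rule L2_linear_diff[OF wCurl_linear HCurl_lin assms])

end

text \<open>Isolates the interpolation error of vector potentials, whose derivation depends on the
  dimension. \<open>Ch\<close> will be \<open>hmax\<close> times \<open>C_hat\<close> times the root
  of the overlap constant.\<close>

locale galerkin_estimate = falk_winther_domain S \<T> D s \<pi>div \<pi>Curl C1div C2div C1Curl C2Curl CRD
  for S :: "(real^'d) set" and \<T> and D :: "('d, 'm::euclidean_space) dimension_data" and s
    and \<pi>div \<pi>Curl C1div C2div C1Curl C2Curl CRD +
  fixes Ch :: real
  assumes Ch_nonneg: "0 \<le> Ch"
    and potential_error: "\<beta> \<in> H1 S \<Longrightarrow> jacobian_norm S \<beta> \<le> CRD * l2_norm S (wCurl D S \<beta>) \<Longrightarrow>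
      l2_norm S (\<lambda>x. \<beta> x - \<pi>Curl \<beta> x) \<le> Ch * l2_norm S (wCurl D S \<beta>)"
begin

lemma potential:
  assumes f: "f \<in> Hdiv0 S"
  obtains \<beta> where "\<beta> \<in> HCurl D S" "AE x in lebesgue_on S. wCurl D S \<beta> x = f x"
    "l2_norm S (wCurl D S \<beta>) = l2_norm S f"
    "l2_norm S (\<lambda>x. \<beta> x - \<pi>Curl \<beta> x) \<le> Ch * l2_norm S f"
proof -
  obtain \<beta> where \<beta>: "\<beta> \<in> H1 S" "AE x in lebesgue_on S. wCurl D S \<beta> x = f x"
    "jacobian_norm S \<beta> \<le> CRD * l2_norm S f"
    using rd f unfolding regular_decomposition_constant_def by blast
  have H: "\<beta> \<in> HCurl D S" using \<beta>(1) H1_HCurl by blast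
  have n: "l2_norm S (wCurl D S \<beta>) = l2_norm S f"
    by (rule l2_norm_cong_AE[OF HCurlD(2)[OF H] Hdiv0_L2[OF f] \<beta>(2)])
  show ?thesis
    by (rule that[OF H \<beta>(2) n]) (use potential_error[OF \<beta>(1)] \<beta>(3) n in simp)
qed

abbreviation Cdiv :: real where "Cdiv \<equiv> C1div * sqrt (C_OL \<T>)"

lemma \<pi>Curl_error_HCurl: "\<beta> \<in> HCurl D S \<Longrightarrow> (\<lambda>x. \<beta> x - \<pi>Curl \<beta> x) \<in> HCurl D S"
  by (rule lin_space_diff[OF HCurl_lin _ \<pi>Curl_HCurl])

text \<open>The commuting property transfers the \<open>L2\<close> stability of
  \<open>\<pi>div\<close> on divergence-free fields to Curls of projected potentials.\<close>

lemma \<pi>div_Curl_bound: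
  assumes \<beta>: "\<beta> \<in> HCurl D S"
  shows "l2_norm S (wCurl D S (\<pi>Curl \<beta>)) \<le> Cdiv * l2_norm S (wCurl D S \<beta>)"
proof -
  have "l2_norm S (wCurl D S (\<pi>Curl \<beta>)) = l2_norm S (\<pi>div (wCurl D S \<beta>))"
    using l2_norm_cong_AE[OF \<pi>div_L2[OF Hdiv0_Hdiv[OF Curl_Hdiv0[OF \<beta>]]] HCurlD(2)[OF \<pi>Curl_HCurl[OF \<beta>]] \<pi>_commute[OF \<beta>]]
    by simp
  then show ?thesis using \<pi>div_bound[OF Curl_Hdiv0[OF \<beta>]] by simp
qed

text \<open>The vector potential of \<open>v\<close> is corrected by a discrete one, so that a Poincare inequality
  on the whole domain is not needed.\<close>

lemma friedrichs:
  obtains C where "0 \<le> C" "\<And>v. v \<in> V D S \<Longrightarrow> l2_norm S v \<le> C * l2_norm S (wrot D S v)"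
proof -
  obtain K where K: "0 \<le> K" "\<And>w. w \<in> Sh D S \<T> \<Longrightarrow> \<exists>\<tau>\<in>Sh D S \<T>.
    (AE x in lebesgue_on S. wCurl D S \<tau> x = wCurl D S w x) \<and> l2_norm S \<tau> \<le> K * l2_norm S (wCurl D S w)"
    by (rule Sh_right_inverse) (rule that; assumption)
  have Cd: "0 \<le> Cdiv" using C1div_pos by simp
  show ?thesis
  proof (rule that)
    show "0 \<le> Ch + K * Cdiv" using Ch_nonneg K(1) Cd by simp
    fix v assume v: "v \<in> V D S"
    have vH: "v \<in> H0rot D S" and v0: "v \<in> Hdiv0 S" using v by (simp_all add: V_def)
    note vL = H0rotD(1)[OF vH] and rL = H0rotD(2)[OF vH]
    obtain \<beta> where \<beta>: "\<beta> \<in> HCurl D S" "AE x in lebesgue_on S. wCurl D S \<beta> x = v x"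
      "l2_norm S (wCurl D S \<beta>) = l2_norm S v"
      "l2_norm S (\<lambda>x. \<beta> x - \<pi>Curl \<beta> x) \<le> Ch * l2_norm S v"
      by (rule potential[OF v0]) (rule that; assumption)
    obtain \<tau> where \<tau>: "\<tau> \<in> Sh D S \<T>" "AE x in lebesgue_on S. wCurl D S \<tau> x = wCurl D S (\<pi>Curl \<beta>) x"
      "l2_norm S \<tau> \<le> K * l2_norm S (wCurl D S (\<pi>Curl \<beta>))"
      using K(2)[OF \<pi>Curl_Sh[OF \<beta>(1)]] by (elim bexE conjE) (rule that; assumption)
    have \<tau>H: "\<tau> \<in> HCurl D S" using \<tau>(1) Sh_HCurl by blast
    let ?\<gamma> = "\<lambda>x. \<beta> x - \<pi>Curl \<beta> x"
    note \<gamma>H = \<pi>Curl_error_HCurl[OF \<beta>(1)]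
    \<comment> \<open>The Curls of \<open>\<tau>\<close> and of \<open>\<pi>Curl \<beta>\<close>
      cancel, so the Curl of \<open>\<sigma>\<close> is \<open>v\<close>, while the norms of both
      summands are controlled by the norm of \<open>v\<close>.\<close>
    let ?\<sigma> = "\<lambda>x. ?\<gamma> x + \<tau> x"
    have \<sigma>H: "?\<sigma> \<in> HCurl D S" by (rule lin_space_add[OF HCurl_lin \<gamma>H \<tau>H])
    have "AE x in lebesgue_on S. wCurl D S (\<lambda>x. 1 *\<^sub>R ?\<gamma> x + \<tau> x) x = 1 *\<^sub>R wCurl D S ?\<gamma> x + wCurl D S \<tau> x"
      by (rule L2_linearD(2)[OF wCurl_linear \<gamma>H \<tau>H])
    with L2_linear_wCurl_diff[OF \<beta>(1) \<pi>Curl_HCurl[OF \<beta>(1)]] \<tau>(2) \<beta>(2)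
    have "AE x in lebesgue_on S. wCurl D S ?\<sigma> x = v x"
    proof eventually_elim
      case (elim x)
      then show ?case by (simp only: scaleR_one) simp
    qed
    then have "l2_inner S v (wCurl D S ?\<sigma>) = l2_inner S v v"
      by (intro l2_inner_cong_AE vL HCurlD(2) \<sigma>H) simp_all
    then have "(l2_norm S v)\<^sup>2 = s * l2_inner S (wrot D S v) ?\<sigma>"
      using H0rotD(4)[OF vH \<sigma>H] by (simp add: l2_norm_sq)
    also have "\<dots> \<le> \<bar>s * l2_inner S (wrot D S v) ?\<sigma>\<bar>" by (rule abs_ge_self)
    also have "\<dots> \<le> l2_norm S (wrot D S v) * l2_norm S ?\<sigma>"
      using l2_Cauchy_Schwarz[OF rL HCurlD(1)[OF \<sigma>H]] by (simp add: abs_mult)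
    also have "\<dots> \<le> l2_norm S (wrot D S v) * ((Ch + K * Cdiv) * l2_norm S v)"
    proof (rule mult_left_mono)
      have "l2_norm S ?\<sigma> \<le> l2_norm S ?\<gamma> + l2_norm S \<tau>"
        by (rule l2_norm_triangle[OF HCurlD(1)[OF \<gamma>H] HCurlD(1)[OF \<tau>H]])
      moreover have "K * l2_norm S (wCurl D S (\<pi>Curl \<beta>)) \<le> K * (Cdiv * l2_norm S v)"
        using \<pi>div_Curl_bound[OF \<beta>(1)] \<beta>(3) K(1) by (intro mult_left_mono) simp_all
      ultimately show "l2_norm S ?\<sigma> \<le> (Ch + K * Cdiv) * l2_norm S v"
        using \<beta>(4) \<tau>(3) by (simp add: algebra_simps)
    qed simp
    finally have "l2_norm S v * l2_norm S v \<le> ((Ch + K * Cdiv) * l2_norm S (wrot D S v)) * l2_norm S v"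
      by (simp add: power2_eq_square mult_ac)
    then show "l2_norm S v \<le> (Ch + K * Cdiv) * l2_norm S (wrot D S v)"
      using l2_norm_ge_0[of S v] \<open>0 \<le> Ch + K * Cdiv\<close>
      by (cases "l2_norm S v = 0") (auto simp: mult_le_cancel_right)
  qed
qed

text \<open>Write \<open>e = Curl \<beta>\<close>. By Green's identity the right-hand side is the
  pairing of \<open>s \<beta>\<close> with \<open>rot v\<close>, so the rotation of the solution
  must be the projection of \<open>s \<beta>\<close> onto the closure of the rotations. The
  Friedrichs inequality shows that this projection is indeed a rotation of a field in
  \<open>V\<close>.\<close>

lemma solution_exists:
  assumes e: "e \<in> Hdiv0 S"
  obtains z where "z \<in> V D S" "\<And>v. v \<in> V D S \<Longrightarrow> a_form D S z v = l2_inner S e v"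
proof -
  obtain \<beta> where \<beta>: "\<beta> \<in> HCurl D S" "AE x in lebesgue_on S. wCurl D S \<beta> x = e x"
    by (rule potential[OF e]) (rule that; assumption)
  obtain C where C: "0 \<le> C" "\<And>v. v \<in> V D S \<Longrightarrow> l2_norm S v \<le> C * l2_norm S (wrot D S v)"
    by (rule friedrichs) (rule that; assumption)
  note rL = H0rotD(2)[OF V_H0rot] and vL = H0rotD(1)[OF V_H0rot]
  \<comment> \<open>Rotations up to null sets: the range of \<open>wrot\<close>, being made of
    chosen representatives, need not itself be a vector space.\<close>
  define W where "W = {r \<in> L2 S. \<exists>v\<in>V D S. AE x in lebesgue_on S. wrot D S v x = r x}"
  have rW: "wrot D S v \<in> W" if "v \<in> V D S" for v
    unfolding W_def using rL[OF that] that by (intro CollectI conjI bexI[of _ v]) simp_all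
  have W: "lin_space W"
    unfolding lin_space_def
  proof (intro conjI ballI allI)
    have "AE x in lebesgue_on S. wrot D S (\<lambda>x. 0) x = 0"
      by (rule L2_linearD(3)[OF wrot_H0rot lin_spaceD(1)[OF H0rot_lin]]) simp
    then show "(\<lambda>x. 0) \<in> W"
      unfolding W_def by (intro CollectI conjI L2_zero bexI[OF _ lin_spaceD(1)[OF V_lin]])
    fix p q r assume "p \<in> W" "q \<in> W"
    then obtain v w where vw: "p \<in> L2 S" "v \<in> V D S" "AE x in lebesgue_on S. wrot D S v x = p x"
      "q \<in> L2 S" "w \<in> V D S" "AE x in lebesgue_on S. wrot D S w x = q x"
      unfolding W_def by (elim CollectE conjE bexE) (rule that; assumption)
    from L2_linearD(2)[OF wrot_H0rot V_H0rot[OF vw(2)] V_H0rot[OF vw(5)], of r] vw(3,6)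
    have "AE x in lebesgue_on S. wrot D S (\<lambda>y. r *\<^sub>R v y + w y) x = r *\<^sub>R p x + q x"
      by eventually_elim simp
    then show "(\<lambda>x. r *\<^sub>R p x + q x) \<in> W"
      unfolding W_def
      by (intro CollectI conjI L2_add L2_scaleR vw(1,4) bexI[OF _ lin_spaceD(2)[OF V_lin vw(2,5)]])
  qed
  have sub: "W \<subseteq> L2 S" unfolding W_def by blast
  have \<beta>L: "(\<lambda>x. s *\<^sub>R \<beta> x) \<in> L2 S" by (rule L2_scaleR[OF HCurlD(1)[OF \<beta>(1)]])
  obtain \<rho> w where \<rho>: "\<rho> \<in> L2 S" "\<And>n::nat. w n \<in> W" "(\<lambda>n. l2_norm S (\<lambda>x. w n x - \<rho> x)) \<longlonglongrightarrow> 0"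
    "\<And>v. v \<in> W \<Longrightarrow> l2_inner S (\<lambda>x. s *\<^sub>R \<beta> x - \<rho> x) v = 0"
    by (rule L2_projection[OF lmeasurable_S W sub \<beta>L]) (rule that; assumption)
  have "\<forall>n. \<exists>v. v \<in> V D S \<and> (AE x in lebesgue_on S. wrot D S v x = w n x)"
    using \<rho>(2) unfolding W_def by blast
  from choice[OF this] obtain v where v: "\<forall>n. v n \<in> V D S \<and> (AE x in lebesgue_on S. wrot D S (v n) x = w n x)" ..
  then have vV: "v n \<in> V D S" and vw: "AE x in lebesgue_on S. wrot D S (v n) x = w n x" for n by simp_all
  have wL: "w n \<in> L2 S" for n using \<rho>(2) sub by blast
  \<comment> \<open>The Friedrichs inequality turns convergence of the rotations into the Cauchy
    property of the fields.\<close>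
  have diff: "l2_norm S (\<lambda>x. v i x - v j x) \<le> C * (l2_norm S (\<lambda>x. w i x - \<rho> x) + l2_norm S (\<lambda>x. w j x - \<rho> x))" for i j
  proof -
    have "l2_norm S (\<lambda>x. v i x - v j x) \<le> C * l2_norm S (wrot D S (\<lambda>x. v i x - v j x))"
      by (rule C(2)[OF lin_space_diff[OF V_lin vV vV]])
    also have "l2_norm S (wrot D S (\<lambda>x. v i x - v j x)) = l2_norm S (\<lambda>x. w i x - w j x)"
    proof (rule l2_norm_cong_AE[OF rL[OF lin_space_diff[OF V_lin vV vV]] L2_diff[OF wL wL]])
      from L2_linear_diff[OF wrot_H0rot H0rot_lin V_H0rot[OF vV[of i]] V_H0rot[OF vV[of j]]] vw[of i] vw[of j]
      show "AE x in lebesgue_on S. wrot D S (\<lambda>x. v i x - v j x) x = w i x - w j x"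
        by eventually_elim simp
    qed
    also have "C * l2_norm S (\<lambda>x. w i x - w j x) \<le> C * (l2_norm S (\<lambda>x. w i x - \<rho> x) + l2_norm S (\<lambda>x. w j x - \<rho> x))"
      using l2_norm_triangle3[OF wL[of i] \<rho>(1) wL[of j]] l2_norm_minus_commute[of S \<rho> "w j"] C(1)
      by (intro mult_left_mono) simp_all
    finally show ?thesis .
  qed
  have Cau: "\<exists>N. \<forall>i\<ge>N. \<forall>j\<ge>N. l2_norm S (\<lambda>x. v i x - v j x) < \<epsilon>" if \<epsilon>: "\<epsilon> > 0" for \<epsilon>
  proof -
    have "0 < \<epsilon> / (2 * (C + 1))" using \<epsilon> C(1) by simp
    from LIMSEQ_D[OF \<rho>(3) this] obtain N where N: "\<forall>n\<ge>N. norm (l2_norm S (\<lambda>x. w n x - \<rho> x) - 0) < \<epsilon> / (2 * (C + 1))" ..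
    have "l2_norm S (\<lambda>x. v i x - v j x) < \<epsilon>" if ij: "i \<ge> N" "j \<ge> N" for i j
    proof -
      let ?p = "l2_norm S (\<lambda>x. w i x - \<rho> x)" and ?q = "l2_norm S (\<lambda>x. w j x - \<rho> x)"
      have "?p < \<epsilon> / (2 * (C + 1))" "?q < \<epsilon> / (2 * (C + 1))" using N ij by simp_all
      then have "?p + ?q < \<epsilon> / (C + 1)" using C(1) by (simp add: field_simps)
      then have "(C + 1) * (?p + ?q) < \<epsilon>" using C(1) by (simp add: field_simps)
      moreover have "C * (?p + ?q) \<le> (C + 1) * (?p + ?q)" by (intro mult_right_mono) simp_all
      ultimately show ?thesis using diff[of i j] by linarith
    qed
    then show ?thesis by blast
  qed
  obtain z where z: "z \<in> L2 S" "(\<lambda>n. l2_norm S (\<lambda>x. v n x - z x)) \<longlonglongrightarrow> 0"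
    by (rule L2_complete[OF lmeasurable_S vL[OF vV] Cau])
  have "l2_norm S (\<lambda>x. wrot D S (v n) x - \<rho> x) = l2_norm S (\<lambda>x. w n x - \<rho> x)" for n
  proof (rule l2_norm_cong_AE[OF L2_diff[OF rL[OF vV] \<rho>(1)] L2_diff[OF wL \<rho>(1)]])
    show "AE x in lebesgue_on S. wrot D S (v n) x - \<rho> x = w n x - \<rho> x"
      using vw[of n] by eventually_elim simp
  qed
  then have "(\<lambda>n. l2_norm S (\<lambda>x. wrot D S (v n) x - \<rho> x)) \<longlonglongrightarrow> 0" using \<rho>(3) by simp
  note zH = H0rot_limit[OF V_H0rot[OF vV] z(1) \<rho>(1) z(2) this]
  have "z \<in> Hdiv0 S"
    unfolding Hdiv0_iff
  proof (intro conjI ballI z(1))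
    fix \<psi> :: "real^'d \<Rightarrow> real" assume \<psi>: "\<psi> \<in> test_functions S"
    show "l2_inner S z (grad \<psi>) = 0"
    proof (rule l2_inner_orthogonal_limit[OF vL[OF vV] z(1) L2_operatorD[OF grad_L2 \<psi>] z(2)])
      show "l2_inner S (v n) (grad \<psi>) = 0" for n using V_Hdiv0[OF vV[of n]] \<psi> by (simp add: Hdiv0_iff)
    qed
  qed
  then have zV: "z \<in> V D S" using zH(1) by (simp add: V_def)
  show ?thesis
  proof (rule that[OF zV])
    fix y assume y: "y \<in> V D S"
    have "a_form D S z y = l2_inner S \<rho> (wrot D S y)"
      unfolding a_form_def by (rule l2_inner_cong_AE[OF rL[OF zV] \<rho>(1) rL[OF y] rL[OF y] zH(2)]) simp
    also have "\<dots> = l2_inner S (\<lambda>x. s *\<^sub>R \<beta> x) (wrot D S y)"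
      using \<rho>(4)[OF rW[OF y]] by (simp add: l2_inner_diff_left[OF \<beta>L \<rho>(1) rL[OF y]])
    also have "\<dots> = s * l2_inner S (wrot D S y) \<beta>"
      by (simp add: l2_inner_scaleR_left l2_inner_commute)
    also have "\<dots> = l2_inner S y (wCurl D S \<beta>)" by (rule H0rotD(4)[OF V_H0rot[OF y] \<beta>(1), symmetric])
    also have "\<dots> = l2_inner S y e"
      by (rule l2_inner_cong_AE[OF vL[OF y] vL[OF y] HCurlD(2)[OF \<beta>(1)] Hdiv0_L2[OF e] _ \<beta>(2)]) simp
    finally show "a_form D S z y = l2_inner S e y" by (simp add: l2_inner_commute)
  qed
qed

text \<open>An estimate in the style of Prager and Synge: \<open>rot u - \<tau> - s (\<beta> - \<pi>Curl \<beta>)\<close> has vanishing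
  \<open>Curl\<close>, and is therefore orthogonal to \<open>rot (u - v)\<close>.\<close>

lemma prager_synge:
  assumes f: "f \<in> Hdiv0 S" and u: "u \<in> V D S" and sol: "\<And>v. v \<in> V D S \<Longrightarrow> a_form D S u v = l2_inner S f v"
    and \<beta>: "\<beta> \<in> HCurl D S" "AE x in lebesgue_on S. wCurl D S \<beta> x = f x"
    and \<tau>: "\<tau> \<in> HCurl D S" "AE x in lebesgue_on S. wCurl D S \<tau> x = s *\<^sub>R \<pi>div (wCurl D S \<beta>) x"
    and v: "v \<in> H0rot D S"
  shows "a_norm D S (\<lambda>x. u x - v x) \<le> l2_norm S (\<lambda>x. \<beta> x - \<pi>Curl \<beta> x) + l2_norm S (\<lambda>x. \<tau> x - wrot D S v x)"
proof -
  define y where "y = (\<lambda>x. u x - v x)"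
  have uH: "u \<in> H0rot D S" by (rule V_H0rot[OF u])
  have yH: "y \<in> H0rot D S" unfolding y_def by (rule lin_space_diff[OF H0rot_lin uH v])
  note yL = H0rotD(1)[OF yH] and rL = H0rotD(2)[OF yH] and vL = H0rotD(2)[OF v]
  let ?\<gamma> = "\<lambda>x. \<beta> x - \<pi>Curl \<beta> x"
  let ?fh = "\<pi>div (wCurl D S \<beta>)"
  note \<gamma>H = \<pi>Curl_error_HCurl[OF \<beta>(1)]
  note \<gamma>L = HCurlD(1)[OF \<gamma>H] and \<tau>L = HCurlD(1)[OF \<tau>(1)]
  have fhL: "?fh \<in> L2 S" by (rule \<pi>div_L2[OF Hdiv0_Hdiv[OF Curl_Hdiv0[OF \<beta>(1)]]])
  have fL: "f \<in> L2 S" by (rule Hdiv0_L2[OF f])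
  have 1: "l2_inner S \<tau> (wrot D S y) = l2_inner S ?fh y"
  proof -
    have "l2_inner S y (wCurl D S \<tau>) = l2_inner S y (\<lambda>x. s *\<^sub>R ?fh x)"
      by (rule l2_inner_cong_AE[OF yL yL HCurlD(2)[OF \<tau>(1)] L2_scaleR[OF fhL] _ \<tau>(2)]) simp
    then have "s * l2_inner S (wrot D S y) \<tau> = s * l2_inner S y ?fh"
      using H0rotD(4)[OF yH \<tau>(1)] by (simp add: l2_inner_scaleR_right)
    then show ?thesis using s_nz by (simp add: l2_inner_commute)
  qed
  have 2: "s * l2_inner S ?\<gamma> (wrot D S y) = l2_inner S f y - l2_inner S ?fh y"
  proof -
    from L2_linear_wCurl_diff[OF \<beta>(1) \<pi>Curl_HCurl[OF \<beta>(1)]] \<pi>_commute[OF \<beta>(1)] \<beta>(2)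
    have ae: "AE x in lebesgue_on S. wCurl D S ?\<gamma> x = f x - ?fh x" by eventually_elim simp
    have "l2_inner S y (wCurl D S ?\<gamma>) = l2_inner S y (\<lambda>x. f x - ?fh x)"
      by (rule l2_inner_cong_AE[OF yL yL HCurlD(2)[OF \<gamma>H] L2_diff[OF fL fhL] _ ae]) simp
    then show ?thesis
      using H0rotD(4)[OF yH \<gamma>H] l2_inner_diff_right[OF yL fL fhL] by (simp add: l2_inner_commute)
  qed
  \<comment> \<open>\<open>y\<close> need not be divergence free because \<open>v\<close> need not
    be, hence the extension of the variational equation to \<open>H0rot\<close>.\<close>
  have 3: "a_form D S u y = l2_inner S f y" by (rule solution_H0rot[OF f u sol yH])
  have "(a_norm D S y)\<^sup>2 = a_form D S u y - a_form D S v y"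
    unfolding a_norm_sq by (subst (1) y_def) (rule a_diff_left[OF uH v yH])
  also have "\<dots> = l2_inner S \<tau> (wrot D S y) + s * l2_inner S ?\<gamma> (wrot D S y) - l2_inner S (wrot D S v) (wrot D S y)"
    using 1 2 3 by (simp add: a_form_def)
  also have "\<dots> = l2_inner S (\<lambda>x. \<tau> x - wrot D S v x) (wrot D S y) + s * l2_inner S ?\<gamma> (wrot D S y)"
    by (simp add: l2_inner_diff_left[OF \<tau>L vL rL])
  also have "\<dots> \<le> l2_norm S (\<lambda>x. \<tau> x - wrot D S v x) * a_norm D S y + l2_norm S ?\<gamma> * a_norm D S y"
  proof (rule add_mono)
    show "l2_inner S (\<lambda>x. \<tau> x - wrot D S v x) (wrot D S y) \<le> l2_norm S (\<lambda>x. \<tau> x - wrot D S v x) * a_norm D S y"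
      using l2_Cauchy_Schwarz[OF L2_diff[OF \<tau>L vL] rL] by (simp add: a_norm_eq)
    have "s * l2_inner S ?\<gamma> (wrot D S y) \<le> \<bar>s * l2_inner S ?\<gamma> (wrot D S y)\<bar>" by (rule abs_ge_self)
    also have "\<dots> \<le> l2_norm S ?\<gamma> * a_norm D S y"
      using l2_Cauchy_Schwarz[OF \<gamma>L rL] by (simp add: abs_mult a_norm_eq)
    finally show "s * l2_inner S ?\<gamma> (wrot D S y) \<le> l2_norm S ?\<gamma> * a_norm D S y" .
  qed
  finally have "a_norm D S y * a_norm D S y \<le> (l2_norm S ?\<gamma> + l2_norm S (\<lambda>x. \<tau> x - wrot D S v x)) * a_norm D S y"
    by (simp add: power2_eq_square algebra_simps)
  then have "a_norm D S y \<le> l2_norm S ?\<gamma> + l2_norm S (\<lambda>x. \<tau> x - wrot D S v x)"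
    using a_norm_ge_0[of y] l2_norm_ge_0[of S ?\<gamma>] l2_norm_ge_0[of S "\<lambda>x. \<tau> x - wrot D S v x"]
    by (cases "a_norm D S y = 0") (auto simp: mult_le_cancel_right)
  then show ?thesis by (simp add: y_def)
qed

lemma Sf_iff: "\<tau> \<in> Sf D S \<T> f \<longleftrightarrow> \<tau> \<in> Sh D S \<T> \<and> (AE x in lebesgue_on S. wCurl D S \<tau> x = s *\<^sub>R f x)"
  by (simp add: Sf_def s_eq)

lemma Sh_Sf:
  assumes w: "w \<in> Sh D S \<T>" and ae: "AE x in lebesgue_on S. wCurl D S w x = f x"
  shows "(\<lambda>x. s *\<^sub>R w x) \<in> Sf D S \<T> f"
  unfolding Sf_iff
proof
  show "(\<lambda>x. s *\<^sub>R w x) \<in> Sh D S \<T>" by (rule lin_space_scaleR[OF Sh_lin w])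
  from L2_linear_scaleR[OF wCurl_linear HCurl_lin subsetD[OF Sh_HCurl w], of s] ae
  show "AE x in lebesgue_on S. wCurl D S (\<lambda>x. s *\<^sub>R w x) x = s *\<^sub>R f x" by eventually_elim simp
qed

text \<open>Since \<open>\<pi>div\<close> reproduces \<open>RT0\<close>, the commuting property
  makes \<open>\<pi>Curl \<beta>\<close> a discrete potential of \<open>f\<close>, so the affine
  sets \<open>Sf\<close> are nonempty. The bound, uniform in \<open>f\<close>, keeps the supremum in
  \<open>kappa_h\<close> finite.\<close>

lemma Sf_bounded:
  obtains K where "\<And>f. f \<in> Xh S \<T> \<Longrightarrow> \<exists>\<tau>\<in>Sf D S \<T> f. l2_norm S \<tau> \<le> K * l2_norm S f"
proof -
  obtain K where K: "0 \<le> K" "\<And>w. w \<in> Sh D S \<T> \<Longrightarrow> \<exists>\<tau>\<in>Sh D S \<T>.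
    (AE x in lebesgue_on S. wCurl D S \<tau> x = wCurl D S w x) \<and> l2_norm S \<tau> \<le> K * l2_norm S (wCurl D S w)"
    by (rule Sh_right_inverse) (rule that; assumption)
  show ?thesis
  proof (rule that)
    fix f assume f: "f \<in> Xh S \<T>"
    then have f0: "f \<in> Hdiv0 S" and fRT: "f \<in> RT0 S \<T>" by (simp_all add: Xh_def)
    obtain \<beta> where \<beta>: "\<beta> \<in> HCurl D S" "AE x in lebesgue_on S. wCurl D S \<beta> x = f x"
      by (rule potential[OF f0]) (rule that; assumption)
    \<comment> \<open>\<open>\<pi>div\<close> acts on representatives. Its reproduction property is
      therefore applied to \<open>wCurl D S \<beta>\<close> itself, which agrees with
      \<open>f\<close> only almost everywhere.\<close>
    have "wCurl D S \<beta> \<in> RT0 S \<T>"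
      unfolding RT0_def
    proof (intro CollectI conjI ballI Hdiv0_Hdiv[OF Curl_Hdiv0[OF \<beta>(1)]])
      fix T assume T: "T \<in> \<T>"
      have "\<forall>T\<in>\<T>. \<exists>\<alpha> (b::real). AE x in lebesgue_on T. f x = \<alpha> + b *\<^sub>R x" using fRT unfolding RT0_def by simp
      from bspec[OF this T] obtain \<alpha> and b :: real where f_aff: "AE x in lebesgue_on T. f x = \<alpha> + b *\<^sub>R x" by (elim exE)
      have "AE x in lebesgue. x \<in> interior T \<longrightarrow> wCurl D S \<beta> x = f x"
        using AE_interior[OF T \<beta>(2)] by (simp add: AE_restrict_space_iff)
      moreover have "AE x in lebesgue. x \<in> T \<longrightarrow> f x = \<alpha> + b *\<^sub>R x"
        using f_aff sets_T[OF T] by (simp add: AE_restrict_space_iff)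
      ultimately have "AE x in lebesgue. x \<in> T \<longrightarrow> wCurl D S \<beta> x = \<alpha> + b *\<^sub>R x"
        using AE_T_interior[OF T]
      proof eventually_elim
        case (elim x)
        show ?case using elim by argo
      qed
      then have "AE x in lebesgue_on T. wCurl D S \<beta> x = \<alpha> + b *\<^sub>R x"
        using sets_T[OF T] by (simp add: AE_restrict_space_iff)
      then show "\<exists>\<alpha> (b::real). AE x in lebesgue_on T. wCurl D S \<beta> x = \<alpha> + b *\<^sub>R x" by (intro exI)
    qed
    from \<pi>div_id[OF this] \<pi>_commute[OF \<beta>(1)] \<beta>(2)
    have w: "AE x in lebesgue_on S. wCurl D S (\<pi>Curl \<beta>) x = f x" by eventually_elim simp
    obtain \<tau> where \<tau>: "\<tau> \<in> Sh D S \<T>" "AE x in lebesgue_on S. wCurl D S \<tau> x = wCurl D S (\<pi>Curl \<beta>) x"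
      "l2_norm S \<tau> \<le> K * l2_norm S (wCurl D S (\<pi>Curl \<beta>))"
      using K(2)[OF \<pi>Curl_Sh[OF \<beta>(1)]] by (elim bexE conjE) (rule that; assumption)
    show "\<exists>\<tau>\<in>Sf D S \<T> f. l2_norm S \<tau> \<le> K * l2_norm S f"
    proof
      from \<tau>(2) w have "AE x in lebesgue_on S. wCurl D S \<tau> x = f x" by eventually_elim simp
      then show "(\<lambda>x. s *\<^sub>R \<tau> x) \<in> Sf D S \<T> f" by (rule Sh_Sf[OF \<tau>(1)])
      have "l2_norm S (wCurl D S (\<pi>Curl \<beta>)) = l2_norm S f"
        by (rule l2_norm_cong_AE[OF HCurlD(2)[OF \<pi>Curl_HCurl[OF \<beta>(1)]] Hdiv0_L2[OF f0] w])
      then show "l2_norm S (\<lambda>x. s *\<^sub>R \<tau> x) \<le> K * l2_norm S f" using \<tau>(3) by (simp add: l2_norm_scaleR)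
    qed
  qed
qed

lemma wrot_zero: "AE x in lebesgue_on S. wrot D S (\<lambda>x. 0) x = 0"
  by (rule L2_linearD(3)[OF wrot_H0rot lin_spaceD(1)[OF H0rot_lin]]) simp

lemma l2_norm_diff_wrot_zero:
  assumes "\<tau> \<in> L2 S"
  shows "l2_norm S (\<lambda>x. \<tau> x - wrot D S (\<lambda>x. 0) x) = l2_norm S \<tau>"
proof (rule l2_norm_cong_AE[OF L2_diff[OF assms H0rotD(2)[OF lin_spaceD(1)[OF H0rot_lin]]] assms])
  show "AE x in lebesgue_on S. \<tau> x - wrot D S (\<lambda>x. 0) x = \<tau> x"
    using wrot_zero by eventually_elim simp
qed

lemma const_RT0: "(\<lambda>x. c) \<in> RT0 S \<T>"
  unfolding RT0_def
proof (intro CollectI conjI ballI Hdiv0_Hdiv const_Hdiv0)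
  show "\<exists>\<alpha> (b::real). AE x in lebesgue_on T. c = \<alpha> + b *\<^sub>R x" for T
    by (intro exI[of _ c] exI[of _ 0]) simp
qed

text \<open>A supremum of infima of reals is meaningful only after nonemptiness and bounds have been
  checked. Minimisers are replaced by near-minimisers with an error \<open>\<epsilon>\<close>, and
  null fields \<open>f\<close>, which the supremum excludes, are served by zero functions.\<close>

lemma kappa:
  shows kappa_nonneg: "0 \<le> kappa_h D S \<T>"
    and kappa_approx: "\<And>f \<epsilon>. f \<in> Xh S \<T> \<Longrightarrow> 0 < \<epsilon> \<Longrightarrow> \<exists>v\<in>Vh D S \<T>. \<exists>\<tau>\<in>Sf D S \<T> f.
      l2_norm S (\<lambda>x. \<tau> x - wrot D S v x) \<le> (kappa_h D S \<T> + \<epsilon>) * l2_norm S f"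
proof -
  define q where "q f v \<tau> = l2_norm S (\<lambda>x. \<tau> x - wrot D S v x) / l2_norm S f"
    for f :: "real^'d \<Rightarrow> real^'d" and v \<tau>
  define Xs where "Xs = {f \<in> Xh S \<T>. \<not> (AE x in lebesgue_on S. f x = 0)}"
  define \<Phi> where "\<Phi> f = (INF v\<in>Vh D S \<T>. INF \<tau>\<in>Sf D S \<T> f. q f v \<tau>)" for f
  have \<kappa>: "kappa_h D S \<T> = (SUP f\<in>Xs. \<Phi> f)" by (simp add: kappa_h_def Xs_def \<Phi>_def q_def)
  obtain K where K: "\<And>f. f \<in> Xh S \<T> \<Longrightarrow> \<exists>\<tau>\<in>Sf D S \<T> f. l2_norm S \<tau> \<le> K * l2_norm S f"
    by (rule Sf_bounded) (rule that; assumption)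
  have q0: "0 \<le> q f v \<tau>" for f v \<tau> by (simp add: q_def)
  have bq: "bdd_below (q f v ` Sf D S \<T> f)" for f v by (rule bdd_belowI2[of _ 0]) (rule q0)
  have ne: "Sf D S \<T> f \<noteq> {}" if "f \<in> Xh S \<T>" for f using K[OF that] by blast
  have Vne: "Vh D S \<T> \<noteq> {}" using lin_spaceD(1)[OF Vh_lin] by blast
  have i0: "0 \<le> (INF \<tau>\<in>Sf D S \<T> f. q f v \<tau>)" if "f \<in> Xh S \<T>" for f v
    by (rule cINF_greatest[OF ne[OF that] q0])
  have bi: "bdd_below ((\<lambda>v. INF \<tau>\<in>Sf D S \<T> f. q f v \<tau>) ` Vh D S \<T>)" if "f \<in> Xh S \<T>" for f
    by (rule bdd_belowI2[of _ 0]) (rule i0[OF that])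
  have \<Phi>0: "0 \<le> \<Phi> f" if "f \<in> Xh S \<T>" for f
    unfolding \<Phi>_def by (rule cINF_greatest[OF Vne i0[OF that]])
  have XsX: "f \<in> Xh S \<T>" if "f \<in> Xs" for f using that by (simp add: Xs_def)
  have npos: "0 < l2_norm S f" if "f \<in> Xs" for f
    using that l2_norm_eq_0_iff[of f S] l2_norm_ge_0[of S f] Hdiv0_L2[of f]
    by (auto simp: Xs_def Xh_def less_le)
  \<comment> \<open>The competitor \<open>v = 0\<close> together with a bounded discrete potential
    bounds every quotient by the same \<open>K\<close>.\<close>
  have \<Phi>K: "\<Phi> f \<le> K" if f: "f \<in> Xs" for f
  proof -
    obtain \<tau> where \<tau>: "\<tau> \<in> Sf D S \<T> f" "l2_norm S \<tau> \<le> K * l2_norm S f"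
      using K[OF XsX[OF f]] by (elim bexE) (rule that; assumption)
    have \<tau>L: "\<tau> \<in> L2 S" using \<tau>(1) Sh_HCurl HCurlD(1) by (auto simp: Sf_iff)
    have "\<Phi> f \<le> (INF \<tau>\<in>Sf D S \<T> f. q f (\<lambda>x. 0) \<tau>)"
      unfolding \<Phi>_def by (rule cINF_lower[OF bi[OF XsX[OF f]] lin_spaceD(1)[OF Vh_lin]])
    also have "\<dots> \<le> q f (\<lambda>x. 0) \<tau>" by (rule cINF_lower[OF bq \<tau>(1)])
    also have "\<dots> \<le> K"
      unfolding q_def l2_norm_diff_wrot_zero[OF \<tau>L] using \<tau>(2) npos[OF f] by (simp add: pos_divide_le_eq)
    finally show ?thesis .
  qed
  have bdd: "bdd_above (\<Phi> ` Xs)" by (rule bdd_aboveI2[OF \<Phi>K])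
  have \<Phi>\<kappa>: "\<Phi> f \<le> kappa_h D S \<T>" if "f \<in> Xs" for f
    unfolding \<kappa> by (rule cSUP_upper[OF that bdd])
  \<comment> \<open>A nonzero constant field belongs to \<open>Xh\<close>, so the supremum runs over
    a nonempty set of nonnegative numbers.\<close>
  show "0 \<le> kappa_h D S \<T>"
  proof -
    let ?c = "\<lambda>x::real^'d. (1::real^'d)"
    obtain T where T: "T \<in> \<T>" using nonempty_T by blast
    have "\<not> (AE x in lebesgue_on S. ?c x = 0)"
    proof
      assume "AE x in lebesgue_on S. ?c x = 0"
      from AE_interior[OF T this] have "l2_norm (interior T) ?c = 0"
        using l2_norm_eq_0_iff[OF L2_interior[OF L2_const[OF lmeasurable_S] T], of "1::real^'d"] by (rule iffD2[rotated])
      then show False using l2_norm_const_pos[OF T, of "1::real^'d"] l2_norm_T[OF T, of ?c] by simp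
    qed
    then have "?c \<in> Xs" using const_RT0[of 1] const_Hdiv0[of 1] by (simp add: Xs_def Xh_def)
    from order_trans[OF \<Phi>0[OF XsX[OF this]] \<Phi>\<kappa>[OF this]] show ?thesis .
  qed
  fix f :: "real^'d \<Rightarrow> real^'d" and \<epsilon> :: real assume f: "f \<in> Xh S \<T>" and \<epsilon>: "0 < \<epsilon>"
  show "\<exists>v\<in>Vh D S \<T>. \<exists>\<tau>\<in>Sf D S \<T> f.
      l2_norm S (\<lambda>x. \<tau> x - wrot D S v x) \<le> (kappa_h D S \<T> + \<epsilon>) * l2_norm S f"
  proof (cases "f \<in> Xs")
    case True
    have "\<Phi> f < kappa_h D S \<T> + \<epsilon>" using \<Phi>\<kappa>[OF True] \<epsilon> by linarith
    then obtain v where v: "v \<in> Vh D S \<T>" "(INF \<tau>\<in>Sf D S \<T> f. q f v \<tau>) < kappa_h D S \<T> + \<epsilon>"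
      unfolding \<Phi>_def cINF_less_iff[OF Vne bi[OF f]] by (elim bexE) (rule that; assumption)
    then obtain \<tau> where \<tau>: "\<tau> \<in> Sf D S \<T> f" "q f v \<tau> < kappa_h D S \<T> + \<epsilon>"
      unfolding cINF_less_iff[OF ne[OF f] bq] by (elim bexE) (rule that; assumption)
    have "l2_norm S (\<lambda>x. \<tau> x - wrot D S v x) \<le> (kappa_h D S \<T> + \<epsilon>) * l2_norm S f"
      using \<tau>(2) npos[OF True] by (simp add: q_def pos_divide_less_eq)
    then show ?thesis using v(1) \<tau>(1) by blast
  next
    case False
    then have f0: "AE x in lebesgue_on S. f x = 0" using f by (simp add: Xs_def)
    have "AE x in lebesgue_on S. wCurl D S (\<lambda>x. 0) x = 0"
      by (rule L2_linearD(3)[OF wCurl_linear lin_spaceD(1)[OF HCurl_lin]]) simp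
    with f0 have "AE x in lebesgue_on S. wCurl D S (\<lambda>x. 0) x = s *\<^sub>R f x" by eventually_elim simp
    then have "(\<lambda>x. 0) \<in> Sf D S \<T> f" using lin_spaceD(1)[OF Sh_lin] by (simp add: Sf_iff)
    moreover have "l2_norm S (\<lambda>x. (\<lambda>x. 0) x - wrot D S (\<lambda>x. 0) x) = 0"
      by (simp only: l2_norm_diff_wrot_zero[OF L2_zero] l2_norm_zero)
    moreover have "l2_norm S f = 0" using f0 l2_norm_eq_0_iff[of f S] f Hdiv0_L2[of f] by (simp add: Xh_def)
    ultimately show ?thesis
      by (intro bexI[OF _ lin_spaceD(1)[OF Vh_lin]] bexI[of _ "\<lambda>x. 0"]) simp_all
  qed
qed

text \<open>Best approximation lets the Galerkin projection be replaced by a near-minimiser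
  \<open>v\<close> of \<open>kappa_h\<close> for the projected right-hand side. The error then
  splits into the interpolation error \<open>Ch\<close> and the discrete defect, and stability of
  \<open>\<pi>div\<close> returns from the projected right-hand side to \<open>f\<close>.\<close>

lemma Galerkin_error:
  assumes f: "f \<in> Hdiv0 S" and u: "u \<in> V D S" and sol: "\<And>v. v \<in> V D S \<Longrightarrow> a_form D S u v = l2_inner S f v"
  shows "a_norm D S (\<lambda>x. u x - Gh D S \<T> u x) \<le> (Ch + kappa_h D S \<T> * Cdiv) * l2_norm S f"
proof -
  obtain \<beta> where \<beta>: "\<beta> \<in> HCurl D S" "AE x in lebesgue_on S. wCurl D S \<beta> x = f x"
    "l2_norm S (wCurl D S \<beta>) = l2_norm S f" "l2_norm S (\<lambda>x. \<beta> x - \<pi>Curl \<beta> x) \<le> Ch * l2_norm S f"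
    by (rule potential[OF f]) (rule that; assumption)
  \<comment> \<open>Formed from \<open>wCurl D S \<beta>\<close> rather than from its almost
    everywhere equal \<open>f\<close>, because the commuting property is stated for Curls.\<close>
  let ?fh = "\<pi>div (wCurl D S \<beta>)"
  note c0 = Curl_Hdiv0[OF \<beta>(1)]
  have fhL: "?fh \<in> L2 S" by (rule \<pi>div_L2[OF Hdiv0_Hdiv[OF c0]])
  \<comment> \<open>Up to null sets \<open>?fh\<close> is the Curl of
    \<open>\<pi>Curl \<beta>\<close>, hence divergence free.\<close>
  have "?fh \<in> Hdiv0 S"
    unfolding Hdiv0_iff
  proof (intro conjI ballI fhL)
    fix \<psi> :: "real^'d \<Rightarrow> real" assume \<psi>: "\<psi> \<in> test_functions S"
    have "l2_inner S ?fh (grad \<psi>) = l2_inner S (wCurl D S (\<pi>Curl \<beta>)) (grad \<psi>)"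
      by (rule l2_inner_cong_AE[OF fhL HCurlD(2)[OF \<pi>Curl_HCurl[OF \<beta>(1)]] L2_operatorD[OF grad_L2 \<psi>]
            L2_operatorD[OF grad_L2 \<psi>] \<pi>_commute[OF \<beta>(1)]]) simp
    then show "l2_inner S ?fh (grad \<psi>) = 0"
      using Curl_Hdiv0[OF \<pi>Curl_HCurl[OF \<beta>(1)]] \<psi> by (simp add: Hdiv0_iff)
  qed
  then have fhX: "?fh \<in> Xh S \<T>" using \<pi>div_RT0[OF Hdiv0_Hdiv[OF c0]] by (simp add: Xh_def)
  have fhb: "l2_norm S ?fh \<le> Cdiv * l2_norm S f" using \<pi>div_bound[OF c0] \<beta>(3) by simp
  have Cd: "0 \<le> Cdiv" using C1div_pos by simp
  have bound: "a_norm D S (\<lambda>x. u x - Gh D S \<T> u x)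
      \<le> (Ch + kappa_h D S \<T> * Cdiv) * l2_norm S f + \<epsilon> * (Cdiv * l2_norm S f)" if \<epsilon>: "0 < \<epsilon>" for \<epsilon>
  proof -
    obtain v \<tau> where v: "v \<in> Vh D S \<T>" and \<tau>: "\<tau> \<in> Sf D S \<T> ?fh"
      "l2_norm S (\<lambda>x. \<tau> x - wrot D S v x) \<le> (kappa_h D S \<T> + \<epsilon>) * l2_norm S ?fh"
      using kappa_approx[OF fhX \<epsilon>] by (elim bexE) (rule that; assumption)
    have \<tau>H: "\<tau> \<in> HCurl D S" using \<tau>(1) Sh_HCurl by (auto simp: Sf_iff)
    have \<tau>C: "AE x in lebesgue_on S. wCurl D S \<tau> x = s *\<^sub>R ?fh x" using \<tau>(1) by (simp add: Sf_iff)
    have "a_norm D S (\<lambda>x. u x - Gh D S \<T> u x) \<le> a_norm D S (\<lambda>x. u x - v x)"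
      by (rule Gh_best[OF V_H0rot[OF u] v])
    also have "\<dots> \<le> l2_norm S (\<lambda>x. \<beta> x - \<pi>Curl \<beta> x) + l2_norm S (\<lambda>x. \<tau> x - wrot D S v x)"
      by (rule prager_synge[OF f u sol \<beta>(1,2) \<tau>H \<tau>C Vh_H0rot[OF v]])
    also have "\<dots> \<le> Ch * l2_norm S f + (kappa_h D S \<T> + \<epsilon>) * (Cdiv * l2_norm S f)"
    proof (rule add_mono[OF \<beta>(4) order_trans[OF \<tau>(2)]])
      show "(kappa_h D S \<T> + \<epsilon>) * l2_norm S ?fh \<le> (kappa_h D S \<T> + \<epsilon>) * (Cdiv * l2_norm S f)"
        using kappa_nonneg \<epsilon> by (intro mult_left_mono fhb) simp
    qed
    finally show ?thesis by (simp add: algebra_simps)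
  qed
  show ?thesis
  proof (rule field_le_epsilon)
    fix \<epsilon> :: real assume \<epsilon>: "0 < \<epsilon>"
    \<comment> \<open>The error of the near-minimiser is chosen as
      \<open>\<epsilon> / (?B + 1)\<close>, which is legitimate also when \<open>?B\<close>
      vanishes.\<close>
    let ?B = "Cdiv * l2_norm S f"
    have B: "0 \<le> ?B" by (intro mult_nonneg_nonneg[OF Cd] l2_norm_ge_0)
    have "0 < \<epsilon> / (?B + 1)" using \<epsilon> B by (intro divide_pos_pos) linarith+
    from bound[OF this] have "a_norm D S (\<lambda>x. u x - Gh D S \<T> u x)
        \<le> (Ch + kappa_h D S \<T> * Cdiv) * l2_norm S f + \<epsilon> / (?B + 1) * ?B" .
    moreover have "\<epsilon> / (?B + 1) * ?B \<le> \<epsilon>"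
    proof -
      have "\<epsilon> * ?B \<le> \<epsilon> * (?B + 1)" using \<epsilon> by simp
      moreover have "0 < ?B + 1" using B by linarith
      ultimately show ?thesis by (simp add: pos_divide_le_eq)
    qed
    ultimately show "a_norm D S (\<lambda>x. u x - Gh D S \<T> u x) \<le> (Ch + kappa_h D S \<T> * Cdiv) * l2_norm S f + \<epsilon>"
      by linarith
  qed
qed

end

section \<open>The eigenvalue bound\<close>

text \<open>Bolzano--Weierstrass one coordinate at a time, refining the subsequence at each
  step.\<close>

lemma common_convergent_subsequence:
  fixes c :: "nat \<Rightarrow> nat \<Rightarrow> real"
  assumes "\<And>n i. i < m \<Longrightarrow> \<bar>c n i\<bar> \<le> B"
  shows "\<exists>r l. strict_mono (r :: nat \<Rightarrow> nat) \<and> (\<forall>i<m. (\<lambda>n. c (r n) i) \<longlonglongrightarrow> l i)"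
  using assms
proof (induction m)
    case 0
    then show ?case by (intro exI[of _ id]) (simp add: strict_mono_def)
  next
    case (Suc m)
    then obtain r l where r: "strict_mono (r :: nat \<Rightarrow> nat)" "\<forall>i<m. (\<lambda>n. c (r n) i) \<longlonglongrightarrow> l i"
      by (metis less_SucI)
    have "bounded (range (\<lambda>n. c (r n) m))"
      using Suc.prems by (intro boundedI[of _ B]) auto
    from bounded_imp_convergent_subsequence[OF this] obtain l' r' where
      r': "strict_mono r'" "((\<lambda>n. c (r n) m) \<circ> r') \<longlonglongrightarrow> l'" by blast
    have "(\<lambda>n. c ((r \<circ> r') n) i) \<longlonglongrightarrow> (l(m := l')) i" if "i < Suc m" for i
    proof (cases "i = m")
      case True
      then show ?thesis using r'(2) by (simp add: o_def)
    next
      case False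
      then have "(\<lambda>n. c (r n) i) \<longlonglongrightarrow> l i" using r(2) that by simp
      from LIMSEQ_subseq_LIMSEQ[OF this r'(1)] show ?thesis using False by (simp add: o_def)
    qed
    then show ?case using strict_mono_o[OF r(1) r'(1)] by blast
qed

lemma eigensystemD:
  assumes "eigensystem S a W N \<mu> w"
  shows "1 \<le> i \<Longrightarrow> enat i \<le> N \<Longrightarrow> w i \<in> W"
    "1 \<le> i \<Longrightarrow> enat i \<le> N \<Longrightarrow> v \<in> W \<Longrightarrow> a (w i) v = \<mu> i * l2_inner S (w i) v"
    "1 \<le> i \<Longrightarrow> enat i \<le> N \<Longrightarrow> 1 \<le> j \<Longrightarrow> enat j \<le> N \<Longrightarrow> l2_inner S (w i) (w j) = (if i = j then 1 else 0)"
    "1 \<le> i \<Longrightarrow> enat j \<le> N \<Longrightarrow> i \<le> j \<Longrightarrow> \<mu> i \<le> \<mu> j"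
    "eigenfunction S a W \<nu> v \<Longrightarrow> \<exists>J c. finite J \<and> J \<subseteq> {i. 1 \<le> i \<and> enat i \<le> N \<and> \<mu> i = \<nu>} \<and>
      (AE x in lebesgue_on S. v x = (\<Sum>i\<in>J. c i *\<^sub>R w i x))"
proof -
  let ?I = "{i. 1 \<le> i \<and> enat i \<le> N}"
  have *: "\<forall>i\<in>?I. eigenfunction S a W (\<mu> i) (w i)"
    "\<forall>i\<in>?I. \<forall>j\<in>?I. l2_inner S (w i) (w j) = (if i = j then 1 else 0)"
    "\<forall>i\<in>?I. \<forall>j\<in>?I. i \<le> j \<longrightarrow> \<mu> i \<le> \<mu> j"
    "\<forall>\<nu> v. eigenfunction S a W \<nu> v \<longrightarrow> (\<exists>J c. finite J \<and> J \<subseteq> {i\<in>?I. \<mu> i = \<nu>} \<and>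
        (AE x in lebesgue_on S. v x = (\<Sum>i\<in>J. c i *\<^sub>R w i x)))"
    using assms unfolding eigensystem_def Let_def by - ((elim conjE, assumption)+)
  show "w i \<in> W" if "1 \<le> i" "enat i \<le> N" using *(1) that by (simp add: eigenfunction_def)
  show "a (w i) v = \<mu> i * l2_inner S (w i) v" if "1 \<le> i" "enat i \<le> N" "v \<in> W"
    using *(1) that by (simp add: eigenfunction_def)
  show "l2_inner S (w i) (w j) = (if i = j then 1 else 0)" if "1 \<le> i" "enat i \<le> N" "1 \<le> j" "enat j \<le> N"
    using *(2) that by simp
  show "\<mu> i \<le> \<mu> j" if "1 \<le> i" "enat j \<le> N" "i \<le> j"
  proof -
    have "enat i \<le> N" using that(2,3) by (meson enat_ord_simps(1) order_trans)
    then show ?thesis using *(3) that by simp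
  qed
  show "\<exists>J c. finite J \<and> J \<subseteq> {i. 1 \<le> i \<and> enat i \<le> N \<and> \<mu> i = \<nu>} \<and>
      (AE x in lebesgue_on S. v x = (\<Sum>i\<in>J. c i *\<^sub>R w i x))" if "eigenfunction S a W \<nu> v"
    using mp[OF spec[OF spec[OF *(4), of \<nu>], of v] that] by (simp add: conj_assoc)
qed

section \<open>Lower bound for discrete Rayleigh quotients\<close>

context maxwell_domain
begin

lemma a_sum_right:
  fixes n :: nat
  assumes "\<And>i. i < n \<Longrightarrow> w i \<in> H0rot D S" "z \<in> H0rot D S"
  shows "a_form D S z (\<lambda>x. \<Sum>i<n. c i *\<^sub>R w i x) = (\<Sum>i<n. c i * a_form D S z (w i))"
  using a_sum_left[OF assms] by (simp add: a_commute[of z])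

text \<open>In coordinates with respect to an \<open>L2\<close> orthonormal basis, the unit sphere
  of \<open>U\<close> is compact and the quadratic form is a polynomial, so the minimum is attained;
  the first variation at the minimiser is the eigenvalue equation on \<open>U\<close>.\<close>

lemma Rayleigh_minimizer:
  assumes U: "lin_space U" "U \<subseteq> H0rot D S" "finite_dim S U" and v: "v \<in> U" "l2_norm S v \<noteq> 0"
  obtains x \<theta> where "x \<in> U" "l2_inner S x x = 1" "a_form D S x x = \<theta>"
    "\<And>y. y \<in> U \<Longrightarrow> \<theta> * l2_inner S y y \<le> a_form D S y y"
    "\<And>y. y \<in> U \<Longrightarrow> a_form D S x y = \<theta> * l2_inner S x y"
proof -
  have UH: "y \<in> H0rot D S" if "y \<in> U" for y using U(2) that by blast
  have UL: "y \<in> L2 S" if "y \<in> U" for y by (rule H0rotD(1)[OF UH[OF that]])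
  have A: "L2_linear S U (\<lambda>v. v)" by standard (simp_all add: UL)
  obtain m :: nat and b where b: "\<And>i. i < m \<Longrightarrow> b i \<in> U"
    "\<And>i j. i < m \<Longrightarrow> j < m \<Longrightarrow> l2_inner S (b i) (b j) = (if i = j then 1 else 0)"
    "\<And>v. v \<in> U \<Longrightarrow> AE x in lebesgue_on S. v x = (\<Sum>i<m. l2_inner S v (b i) *\<^sub>R b i x)"
    by (rule finite_dim_orthonormal[OF U(1,3) A]) (rule that; assumption)
  have bH: "b i \<in> H0rot D S" if "i < m" for i by (rule UH[OF b(1)[OF that]])
  have bL: "b i \<in> L2 S" if "i < m" for i by (rule UL[OF b(1)[OF that]])
  define X where "X c = (\<lambda>x. \<Sum>i<m. c i *\<^sub>R b i x)" for c :: "nat \<Rightarrow> real"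
  have XU: "X c \<in> U" for c unfolding X_def by (rule lin_space_sum[OF U(1)]) (simp add: b(1))
  have Xn: "l2_inner S (X c) (X c) = (\<Sum>i<m. (c i)\<^sup>2)" for c
  proof -
    have "l2_inner S (X c) (b j) = c j" if j: "j < m" for j
    proof -
      have "l2_inner S (X c) (b j) = (\<Sum>i<m. c i * l2_inner S (b i) (b j))"
        unfolding X_def by (subst l2_inner_sum_left) (simp_all add: L2_scaleR bL j l2_inner_scaleR_left)
      also have "\<dots> = (\<Sum>i<m. if i = j then c j else 0)" using b(2) j by (intro sum.cong) simp_all
      finally show ?thesis using j by simp
    qed
    moreover have "l2_inner S (X c) (X c) = (\<Sum>j<m. c j * l2_inner S (X c) (b j))"
      by (subst (2) X_def, subst l2_inner_sum_right) (simp_all add: L2_scaleR bL UL[OF XU] l2_inner_scaleR_right)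
    ultimately show ?thesis by (simp add: power2_eq_square)
  qed
  have Xa: "a_form D S (X c) (X c) = (\<Sum>i<m. \<Sum>j<m. c i * (c j * a_form D S (b i) (b j)))" for c
  proof -
    have "a_form D S (X c) (X c) = (\<Sum>i<m. c i * a_form D S (b i) (X c))"
      by (subst (1) X_def) (rule a_sum_left[OF bH UH[OF XU]])
    also have "\<dots> = (\<Sum>i<m. c i * (\<Sum>j<m. c j * a_form D S (b i) (b j)))"
      unfolding X_def using a_sum_right[OF bH bH] by (intro sum.cong refl) simp
    finally show ?thesis by (simp add: sum_distrib_left)
  qed
  define Q where "Q = {y \<in> U. l2_inner S y y = 1}"
  have norm_lize: "(\<lambda>x. (1 / l2_norm S y) *\<^sub>R y x) \<in> Q" if y: "y \<in> U" "l2_norm S y \<noteq> 0" for y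
  proof -
    have "l2_inner S (\<lambda>x. (1 / l2_norm S y) *\<^sub>R y x) (\<lambda>x. (1 / l2_norm S y) *\<^sub>R y x) = 1"
      using y(2) by (simp add: l2_inner_scaleR_left l2_inner_scaleR_right l2_norm_sq[symmetric] power2_eq_square)
    then show ?thesis using lin_space_scaleR[OF U(1) y(1)] by (simp add: Q_def)
  qed
  have Qne: "Q \<noteq> {}" using norm_lize[OF v] by blast
  have a0: "0 \<le> a_form D S y y" for y by (simp add: a_form_def)
  define \<theta> where "\<theta> = (INF y\<in>Q. a_form D S y y)"
  have bdd: "bdd_below ((\<lambda>y. a_form D S y y) ` Q)" by (rule bdd_belowI2[of _ 0]) (rule a0)
  have \<theta>: "\<theta> \<le> a_form D S y y" if "y \<in> Q" for y unfolding \<theta>_def by (rule cINF_lower[OF bdd that])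
  have "\<forall>n. \<exists>c. (\<Sum>i<m. (c i)\<^sup>2) = 1 \<and> a_form D S (X c) (X c) < \<theta> + 1 / (real n + 1)"
  proof
    fix n :: nat
    have "(INF y\<in>Q. a_form D S y y) < \<theta> + 1 / (real n + 1)" by (simp add: \<theta>_def)
    then obtain y where y: "y \<in> Q" "a_form D S y y < \<theta> + 1 / (real n + 1)"
      unfolding cINF_less_iff[OF Qne bdd] by (elim bexE) (rule that; assumption)
    have yU: "y \<in> U" and y1: "l2_inner S y y = 1" using y(1) by (simp_all add: Q_def)
    let ?c = "\<lambda>i. l2_inner S y (b i)"
    \<comment> \<open>Replaces a near-minimiser by its coordinate representation, which differs from
      it by a null function, so that the minimising sequence becomes a bounded sequence of
      coefficient vectors.\<close>
    have ae: "AE x in lebesgue_on S. y x = X ?c x" unfolding X_def by (rule b(3)[OF yU])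
    have "l2_inner S (X ?c) (X ?c) = 1"
      using l2_inner_cong_AE[OF UL[OF yU] UL[OF XU] UL[OF yU] UL[OF XU] ae ae] y1 by simp
    moreover have "a_form D S (X ?c) (X ?c) = a_form D S y y"
    proof -
      have "AE x in lebesgue_on S. y x - X ?c x = 0" using ae by eventually_elim simp
      from L2_linearD(3)[OF wrot_H0rot lin_space_diff[OF H0rot_lin UH[OF yU] UH[OF XU]] this]
        L2_linear_diff[OF wrot_H0rot H0rot_lin UH[OF yU] UH[OF XU], of ?c]
      have "AE x in lebesgue_on S. wrot D S (X ?c) x = wrot D S y x" by eventually_elim simp
      then show ?thesis
        unfolding a_form_def by (intro l2_inner_cong_AE H0rotD(2) UH XU yU)
    qed
    ultimately show "\<exists>c. (\<Sum>i<m. (c i)\<^sup>2) = 1 \<and> a_form D S (X c) (X c) < \<theta> + 1 / (real n + 1)"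
      using y(2) by (intro exI[of _ ?c]) (simp add: Xn)
  qed
  from choice[OF this] obtain c where
    c: "\<forall>n. (\<Sum>i<m. (c n i)\<^sup>2) = 1 \<and> a_form D S (X (c n)) (X (c n)) < \<theta> + 1 / (real n + 1)" ..
  have c1: "\<bar>c n i\<bar> \<le> 1" if "i < m" for n i
  proof -
    have "(c n i)\<^sup>2 \<le> (\<Sum>i<m. (c n i)\<^sup>2)" using that by (intro member_le_sum) simp_all
    then have "(c n i)\<^sup>2 \<le> 1" using c by simp
    then show ?thesis by (simp add: abs_square_le_1)
  qed
  have "\<exists>r l. strict_mono (r :: nat \<Rightarrow> nat) \<and> (\<forall>i<m. (\<lambda>n. c (r n) i) \<longlonglongrightarrow> l i)"
    by (rule common_convergent_subsequence[of m c 1]) (rule c1)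
  then obtain r :: "nat \<Rightarrow> nat" and l where r: "strict_mono r" and "\<forall>i<m. (\<lambda>n. c (r n) i) \<longlonglongrightarrow> l i"
    by (elim exE conjE)
  then have l: "(\<lambda>n. c (r n) i) \<longlonglongrightarrow> l i" if "i < m" for i using that by simp
  have "(\<lambda>n. \<Sum>i<m. (c (r n) i)\<^sup>2) \<longlonglongrightarrow> (\<Sum>i<m. (l i)\<^sup>2)"
    by (intro tendsto_sum tendsto_power l) simp
  then have "(\<Sum>i<m. (l i)\<^sup>2) = 1" using c by (simp add: LIMSEQ_const_iff)
  then have X1: "l2_inner S (X l) (X l) = 1" by (simp add: Xn)
  have lim: "(\<lambda>n. a_form D S (X (c (r n))) (X (c (r n)))) \<longlonglongrightarrow> a_form D S (X l) (X l)"
    unfolding Xa by (intro tendsto_sum tendsto_mult tendsto_const l) simp_all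
  have "(\<lambda>n. \<theta> + 1 / (real n + 1)) \<longlonglongrightarrow> \<theta> + 0"
    using LIMSEQ_inverse_real_of_nat by (intro tendsto_add tendsto_const) (simp add: inverse_eq_divide add.commute)
  from LIMSEQ_subseq_LIMSEQ[OF this r] have "(\<lambda>n. \<theta> + 1 / (real (r n) + 1)) \<longlonglongrightarrow> \<theta>" by (simp add: o_def)
  from LIMSEQ_le[OF lim this] have "a_form D S (X l) (X l) \<le> \<theta>" using c by (meson less_imp_le)
  moreover have "\<theta> \<le> a_form D S (X l) (X l)" by (rule \<theta>) (simp add: Q_def XU X1)
  ultimately have Xt: "a_form D S (X l) (X l) = \<theta>" by simp
  have low: "\<theta> * l2_inner S y y \<le> a_form D S y y" if y: "y \<in> U" for y
  proof (cases "l2_norm S y = 0")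
    case True
    then have "l2_inner S y y = 0" by (simp add: l2_norm_sq[symmetric])
    then show ?thesis using a0 by simp
  next
    case False
    let ?y = "\<lambda>x. (1 / l2_norm S y) *\<^sub>R y x"
    have z: "AE x in lebesgue_on S. wrot D S ?y x = (1 / l2_norm S y) *\<^sub>R wrot D S y x"
      by (rule L2_linear_scaleR[OF wrot_H0rot H0rot_lin UH[OF y]])
    have "a_form D S ?y ?y = l2_inner S (\<lambda>x. (1 / l2_norm S y) *\<^sub>R wrot D S y x) (\<lambda>x. (1 / l2_norm S y) *\<^sub>R wrot D S y x)"
      unfolding a_form_def
      by (intro l2_inner_cong_AE z H0rotD(2) UH lin_space_scaleR[OF U(1)] L2_scaleR y)
    also have "\<dots> = a_form D S y y / l2_inner S y y"
      by (simp add: a_form_def l2_inner_scaleR_left l2_inner_scaleR_right l2_norm_sq[symmetric] power2_eq_square)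
    finally have "\<theta> \<le> a_form D S y y / l2_inner S y y" using \<theta>[OF norm_lize[OF y False]] by simp
    moreover have "0 < l2_inner S y y" using False l2_norm_ge_0[of S y] by (simp add: l2_norm_sq[symmetric])
    ultimately show ?thesis by (simp add: pos_le_divide_eq)
  qed
  have eig: "a_form D S (X l) y = \<theta> * l2_inner S (X l) y" if y: "y \<in> U" for y
  proof -
    let ?d = "a_form D S (X l) y - \<theta> * l2_inner S (X l) y"
    let ?e = "a_form D S y y - \<theta> * l2_inner S y y"
    \<comment> \<open>The defect \<open>a(y, y) - \<theta> b(y, y)\<close> is nonnegative on
      \<open>U\<close> and vanishes at \<open>X l\<close>, so along \<open>t y + X l\<close> it has
      no constant term.\<close>
    have quad: "0 \<le> 2 * t * ?d + t\<^sup>2 * ?e" for t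
    proof -
      let ?z = "\<lambda>x. t *\<^sub>R y x + X l x"
      have zU: "?z \<in> U" by (rule lin_spaceD(2)[OF U(1) y XU])
      note H = UH[OF y] UH[OF XU] UH[OF zU]
      have "a_form D S ?z ?z = t * a_form D S y ?z + a_form D S (X l) ?z"
        by (rule a_lincomb_left[OF H(1,2,3)])
      moreover have "a_form D S w ?z = t * a_form D S w y + a_form D S w (X l)" if "w \<in> H0rot D S" for w
        using a_lincomb_left[OF H(1,2) that, of t] by (simp only: a_commute[of w])
      ultimately have "a_form D S ?z ?z = t * (t * a_form D S y y + a_form D S y (X l)) + (t * a_form D S (X l) y + \<theta>)"
        using H(1,2) Xt by simp
      moreover have "l2_inner S ?z ?z = t\<^sup>2 * l2_inner S y y + 2 * t * l2_inner S (X l) y + 1"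
        using UL[OF y] UL[OF XU] X1
        by (simp add: l2_inner_simps L2_add L2_scaleR power2_eq_square algebra_simps l2_inner_commute[of S y "X l"])
      ultimately show ?thesis
        using low[OF zU] by (simp add: a_commute[of y "X l"] power2_eq_square algebra_simps)
    qed
    show ?thesis using nonneg_quadratic_imp_zero[OF quad] by simp
  qed
  show ?thesis by (rule that[OF XU X1 Xt low eig])
qed

text \<open>One half of the min-max principle, drawn from the definition of
  \<open>eigensystem\<close> alone. A minimiser over the orthogonal complement \<open>U\<close> of
  the first \<open>k - 1\<close> eigenfunctions is an eigenfunction on all of \<open>Vh\<close>; its
  expansion must involve some \<open>z i\<close> with \<open>i \<ge> k\<close>, so its eigenvalue is
  at least \<open>\<nu> k\<close>.\<close>

lemma discrete_lower_bound:
  assumes es: "eigensystem S (a_form D S) (Vh D S \<T>) N \<nu> z" and k: "1 \<le> k" "enat k \<le> N"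
    and v: "v \<in> Vh D S \<T>" "\<And>j. 1 \<le> j \<Longrightarrow> j < k \<Longrightarrow> l2_inner S v (z j) = 0"
  shows "\<nu> k * l2_inner S v v \<le> a_form D S v v"
proof (cases "l2_norm S v = 0")
  case True
  then have "l2_inner S v v = 0" by (simp add: l2_norm_sq[symmetric])
  then show ?thesis by (simp add: a_form_def)
next
  case False
  note es = eigensystemD[OF es]
  have jN: "enat j \<le> N" if "j \<le> k" for j using k(2) that by (meson enat_ord_simps(1) order_trans)
  define U where "U = {v \<in> Vh D S \<T>. \<forall>j\<in>{1..<k}. l2_inner S v (z j) = 0}"
  have zV: "z j \<in> Vh D S \<T>" if "1 \<le> j" "enat j \<le> N" for j by (rule es(1)[OF that])
  have VL: "y \<in> L2 S" if "y \<in> Vh D S \<T>" for y by (rule H0rotD(1)[OF Vh_H0rot[OF that]])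
  have zL: "z j \<in> L2 S" if "1 \<le> j" "enat j \<le> N" for j by (rule VL[OF zV[OF that]])
  have UV: "U \<subseteq> Vh D S \<T>" unfolding U_def by blast
  have Ulin: "lin_space U"
    unfolding lin_space_def
  proof (intro conjI ballI allI)
    show "(\<lambda>x. 0) \<in> U" using lin_spaceD(1)[OF Vh_lin] by (simp add: U_def)
    fix p q r assume p: "p \<in> U" and q: "q \<in> U"
    have pq: "p \<in> Vh D S \<T>" "q \<in> Vh D S \<T>" using p q UV by blast+
    have "l2_inner S (\<lambda>x. r *\<^sub>R p x + q x) (z j) = 0" if j: "j \<in> {1..<k}" for j
    proof -
      have zj: "z j \<in> L2 S" using j by (intro zL jN) simp_all
      show ?thesis using p q j VL[OF pq(1)] VL[OF pq(2)] zj
        by (simp add: U_def l2_inner_add_left L2_scaleR l2_inner_scaleR_left)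
    qed
    then show "(\<lambda>x. r *\<^sub>R p x + q x) \<in> U" using lin_spaceD(2)[OF Vh_lin pq] by (simp add: U_def)
  qed
  have UH: "U \<subseteq> H0rot D S" using UV Vh_H0rot by blast
  have vU: "v \<in> U" using v by (simp add: U_def)
  obtain x \<theta> where x: "x \<in> U" "l2_inner S x x = 1" "a_form D S x x = \<theta>"
    "\<And>y. y \<in> U \<Longrightarrow> \<theta> * l2_inner S y y \<le> a_form D S y y"
    "\<And>y. y \<in> U \<Longrightarrow> a_form D S x y = \<theta> * l2_inner S x y"
    by (rule Rayleigh_minimizer[OF Ulin UH finite_dim_subset[OF Vh_finite UV] vU False]) (rule that; assumption)
  have xV: "x \<in> Vh D S \<T>" using x(1) UV by blast
  have xz: "l2_inner S x (z j) = 0" if "1 \<le> j" "j < k" for j using x(1) that by (simp add: U_def)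
  have "eigenfunction S (a_form D S) (Vh D S \<T>) \<theta> x"
    unfolding eigenfunction_def
  proof (intro conjI ballI xV)
    fix y assume y: "y \<in> Vh D S \<T>"
    \<comment> \<open>The \<open>L2\<close> projection of \<open>y\<close> onto the span of the
      first \<open>k - 1\<close> eigenfunctions; these are numbered from 1, whence the shift by
      \<open>Suc\<close>.\<close>
    define p where "p = (\<lambda>x. \<Sum>i<k - 1. l2_inner S y (z (Suc i)) *\<^sub>R z (Suc i) x)"
    have zi: "z (Suc i) \<in> Vh D S \<T>" "z (Suc i) \<in> L2 S" if "i < k - 1" for i
      using that by (auto intro!: zV zL jN)
    have pV: "p \<in> Vh D S \<T>" unfolding p_def by (rule lin_space_sum[OF Vh_lin]) (simp add: zi)
    have pz: "l2_inner S p (z j) = l2_inner S y (z j)" if j: "j \<in> {1..<k}" for j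
    proof -
      have zj: "z j \<in> L2 S" using j by (intro zL jN) simp_all
      have "l2_inner S p (z j) = (\<Sum>i<k - 1. l2_inner S y (z (Suc i)) * l2_inner S (z (Suc i)) (z j))"
        unfolding p_def by (subst l2_inner_sum_left) (simp_all add: L2_scaleR zi zj l2_inner_scaleR_left)
      also have "\<dots> = (\<Sum>i<k - 1. if i = j - 1 then l2_inner S y (z j) else 0)"
      proof (rule sum.cong[OF refl])
        fix i assume "i \<in> {..<k - 1}"
        then have i: "1 \<le> Suc i" "enat (Suc i) \<le> N" and j': "1 \<le> j" "enat j \<le> N" using j by (auto intro!: jN)
        show "l2_inner S y (z (Suc i)) * l2_inner S (z (Suc i)) (z j) = (if i = j - 1 then l2_inner S y (z j) else 0)"
          using es(3)[OF i j'] j'(1) by auto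
      qed
      also have "\<dots> = l2_inner S y (z j)"
      proof -
        have "j - 1 \<in> {..<k - 1}" using j by auto
        then show ?thesis by (simp only: sum.delta'[OF finite_lessThan] sum.delta[OF finite_lessThan] if_True)
      qed
      finally show ?thesis .
    qed
    let ?y = "\<lambda>x. y x - p x"
    have "l2_inner S ?y (z j) = 0" if j: "j \<in> {1..<k}" for j
    proof -
      have zj: "z j \<in> L2 S" using j by (intro zL jN) simp_all
      show ?thesis using pz[OF j] by (simp add: l2_inner_diff_left[OF VL[OF y] VL[OF pV] zj])
    qed
    then have yU: "?y \<in> U" using lin_space_diff[OF Vh_lin y pV] by (simp add: U_def)
    \<comment> \<open>By the discrete eigenvalue equation, orthogonality of \<open>x\<close> to the
      earlier eigenfunctions holds for \<open>a\<close> as well.\<close>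
    have "a_form D S x p = (\<Sum>i<k - 1. l2_inner S y (z (Suc i)) * a_form D S x (z (Suc i)))"
      unfolding p_def by (rule a_sum_right[OF Vh_H0rot[OF zi(1)] Vh_H0rot[OF xV]])
    also have "\<dots> = 0"
    proof (rule sum.neutral, rule ballI)
      fix i assume "i \<in> {..<k - 1}"
      then have i: "1 \<le> Suc i" "Suc i < k" "enat (Suc i) \<le> N" by (auto intro!: jN)
      show "l2_inner S y (z (Suc i)) * a_form D S x (z (Suc i)) = 0"
        using es(2)[OF i(1,3) xV] xz[OF i(1,2)] by (simp add: a_commute[of x] l2_inner_commute[of S _ x])
    qed
    finally have ap: "a_form D S x p = 0" .
    have bp: "l2_inner S x p = 0"
    proof -
      have "l2_inner S x p = (\<Sum>i<k - 1. l2_inner S y (z (Suc i)) * l2_inner S x (z (Suc i)))"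
        unfolding p_def by (subst l2_inner_sum_right) (simp_all add: L2_scaleR zi VL[OF xV] l2_inner_scaleR_right)
      also have "\<dots> = 0" using xz by (intro sum.neutral) auto
      finally show ?thesis .
    qed
    show "a_form D S x y = \<theta> * l2_inner S x y"
      using x(5)[OF yU] ap bp a_diff_right[OF Vh_H0rot[OF y] Vh_H0rot[OF pV] Vh_H0rot[OF xV]]
        l2_inner_diff_right[OF VL[OF xV] VL[OF y] VL[OF pV]] by simp
  qed
  from es(5)[OF this] obtain J c where J: "finite J" "J \<subseteq> {i. 1 \<le> i \<and> enat i \<le> N \<and> \<nu> i = \<theta>}"
    "AE y in lebesgue_on S. x y = (\<Sum>i\<in>J. c i *\<^sub>R z i y)" by (elim exE conjE) (rule that; assumption)
  have zJ: "z i \<in> L2 S" if "i \<in> J" for i using that J(2) by (intro zL) auto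
  have "l2_inner S x x = l2_inner S x (\<lambda>y. \<Sum>i\<in>J. c i *\<^sub>R z i y)"
    by (rule l2_inner_cong_AE[OF VL[OF xV] VL[OF xV] VL[OF xV] _ _ J(3)]) (simp_all add: L2_sum L2_scaleR zJ)
  also have "\<dots> = (\<Sum>i\<in>J. c i * l2_inner S x (z i))"
    by (subst l2_inner_sum_right) (simp_all add: L2_scaleR zJ VL[OF xV] l2_inner_scaleR_right)
  finally have "(\<Sum>i\<in>J. c i * l2_inner S x (z i)) \<noteq> 0" using x(2) by simp
  then obtain i where i: "i \<in> J" "c i * l2_inner S x (z i) \<noteq> 0" by (rule sum.not_neutral_contains_not_neutral)
  have i': "1 \<le> i" "enat i \<le> N" "\<nu> i = \<theta>" using i(1) J(2) by auto
  \<comment> \<open>An eigenfunction with nonzero component along \<open>x\<close> cannot be among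
    the first \<open>k - 1\<close>.\<close>
  have "k \<le> i" using xz[OF i'(1)] i(2) by (auto simp: not_less[symmetric])
  then have "\<nu> k \<le> \<theta>" using es(4)[OF k(1) i'(2)] i'(3) by simp
  then have "\<nu> k * l2_inner S v v \<le> \<theta> * l2_inner S v v" by (intro mult_right_mono) simp_all
  also have "\<dots> \<le> a_form D S v v" by (rule x(4)[OF vU])
  finally show ?thesis .
qed

end

section \<open>Duality and comparison of eigenvalues\<close>

context galerkin_estimate
begin

text \<open>Aubin--Nitsche duality: the divergence-free part of the error is controlled by the Galerkin
  error constant.\<close>

lemma duality:
  assumes "0 \<le> M"
    and M: "\<And>f u. f \<in> Hdiv0 S \<Longrightarrow> u \<in> V D S \<Longrightarrow> (\<And>v. v \<in> V D S \<Longrightarrow> a_form D S u v = l2_inner S f v) \<Longrightarrow>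
      a_norm D S (\<lambda>x. u x - Gh D S \<T> u x) \<le> M * l2_norm S f"
    and W: "W \<in> V D S" and Wh: "Wh \<in> Vh D S \<T>"
    and gal: "\<And>v. v \<in> Vh D S \<T> \<Longrightarrow> a_form D S (\<lambda>x. W x - Wh x) v = 0"
  shows "l2_norm S W \<le> M * a_norm D S (\<lambda>x. W x - Wh x) + l2_norm S Wh"
proof -
  note WH = V_H0rot[OF W] and WhH = Vh_H0rot[OF Wh]
  note WhL = H0rotD(1)[OF WhH]
  let ?d = "\<lambda>x. W x - Wh x"
  have dH: "?d \<in> H0rot D S" by (rule lin_space_diff[OF H0rot_lin WH WhH])
  obtain g where g: "(\<lambda>x. Wh x - g x) \<in> Hdiv0 S" "g \<in> H0rot D S"
    "AE x in lebesgue_on S. wrot D S g x = 0" "\<And>q. q \<in> Hdiv0 S \<Longrightarrow> l2_inner S g q = 0"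
    by (rule helmholtz[OF WhL]) (rule that; assumption)
  \<comment> \<open>The divergence-free part of \<open>Wh\<close>. It has the same rotation as
    \<open>Wh\<close>, and \<open>W - p\<close> lies in \<open>V\<close>, so the latter is an
    admissible right-hand side of the dual problem.\<close>
  define p where "p = (\<lambda>x. Wh x - g x)"
  have pH: "p \<in> H0rot D S" unfolding p_def by (rule lin_space_diff[OF H0rot_lin WhH g(2)])
  have p0: "p \<in> Hdiv0 S" using g(1) by (simp add: p_def)
  have pV: "p \<in> V D S" using pH p0 by (simp add: V_def)
  note pL = H0rotD(1)[OF pH] and gL = H0rotD(1)[OF g(2)]
  define e where "e = (\<lambda>x. W x - p x)"
  have eV: "e \<in> V D S" unfolding e_def by (rule lin_space_diff[OF V_lin W pV])
  note eL = H0rotD(1)[OF V_H0rot[OF eV]]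
  obtain z where z: "z \<in> V D S" "\<And>v. v \<in> V D S \<Longrightarrow> a_form D S z v = l2_inner S e v"
    by (rule solution_exists[OF V_Hdiv0[OF eV]]) (rule that; assumption)
  note zH = V_H0rot[OF z(1)]
  let ?Gz = "Gh D S \<T> z"
  have zg: "(\<lambda>x. z x - ?Gz x) \<in> H0rot D S" by (rule lin_space_diff[OF H0rot_lin zH Gh_H0rot[OF zH]])
  have "(l2_norm S e)\<^sup>2 = a_form D S z e" using z(2)[OF eV] by (simp add: l2_norm_sq)
  also have "\<dots> = a_form D S z W - a_form D S z p" unfolding e_def by (rule a_diff_right[OF WH pH zH])
  also have "a_form D S z p = a_form D S z Wh"
  proof -
    have "a_form D S z g = 0" using a_zero_left[OF zH g(2,3)] by (simp add: a_commute)
    then show ?thesis unfolding p_def using a_diff_right[OF WhH g(2) zH] by simp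
  qed
  \<comment> \<open>Galerkin orthogonality of \<open>W - Wh\<close> allows the discrete function
    \<open>?Gz\<close> to be subtracted from the dual solution.\<close>
  also have "a_form D S z W - a_form D S z Wh = a_form D S (\<lambda>x. z x - ?Gz x) ?d"
    using gal[OF Gh(1)[OF zH]] a_diff_left[OF zH Gh_H0rot[OF zH] dH] a_diff_right[OF WH WhH zH]
    by (simp add: a_commute[of ?Gz])
  also have "\<dots> \<le> a_norm D S (\<lambda>x. z x - ?Gz x) * a_norm D S ?d"
    using a_Cauchy_Schwarz[OF zg dH] by simp
  also have "\<dots> \<le> (M * l2_norm S e) * a_norm D S ?d"
    by (rule mult_right_mono[OF M[OF V_Hdiv0[OF eV] z]]) simp_all
  finally have sq: "(l2_norm S e)\<^sup>2 \<le> (M * a_norm D S ?d) * l2_norm S e" by (simp add: mult_ac)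
  have "l2_norm S e \<le> M * a_norm D S ?d \<or> l2_norm S e = 0"
  proof (cases "l2_norm S e = 0")
    case False
    then have "0 < l2_norm S e" using l2_norm_ge_0[of S e] by linarith
    then show ?thesis using sq by (simp add: power2_eq_square)
  qed simp
  moreover have "0 \<le> M * a_norm D S ?d" using \<open>0 \<le> M\<close> by simp
  \<comment> \<open>\<open>p\<close> is an orthogonal projection of \<open>Wh\<close>, hence not
    larger in norm.\<close>
  moreover have "l2_norm S p \<le> l2_norm S Wh"
  proof -
    have "l2_inner S Wh p - l2_inner S g p = l2_inner S p p"
      using l2_inner_diff_left[OF WhL gL pL] by (simp add: p_def)
    then have "(l2_norm S p)\<^sup>2 = l2_inner S Wh p" using g(4)[OF p0] by (simp add: l2_norm_sq)
    also have "\<dots> \<le> l2_norm S Wh * l2_norm S p" using l2_Cauchy_Schwarz[OF WhL pL] by simp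
    finally show ?thesis
      using l2_norm_ge_0[of S p] l2_norm_ge_0[of S Wh]
      by (cases "l2_norm S p = 0") (auto simp: power2_eq_square mult_le_cancel_right)
  qed
  moreover have "l2_norm S W \<le> l2_norm S e + l2_norm S p"
    using l2_norm_triangle[OF eL pL] by (simp add: e_def)
  ultimately show ?thesis by linarith
qed


text \<open>Stated for any admissible Galerkin constant \<open>M\<close>, so that both
  \<open>Mh\<close> and the explicit upper bound can be inserted.\<close>

lemma eigenvalue_bound:
  assumes M0: "0 \<le> M"
    and M: "\<And>f u. f \<in> Hdiv0 S \<Longrightarrow> u \<in> V D S \<Longrightarrow> (\<And>v. v \<in> V D S \<Longrightarrow> a_form D S u v = l2_inner S f v) \<Longrightarrow>
      a_norm D S (\<lambda>x. u x - Gh D S \<T> u x) \<le> M * l2_norm S f"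
    and kV: "kth_eigenpair S (a_form D S) (V D S) k lam u"
    and kVh: "kth_eigenpair S (a_form D S) (Vh D S \<T>) k lamh uh"
  shows "lamh / (1 + M\<^sup>2 * lamh) \<le> lam"
proof -
  obtain N \<mu> w where es: "eigensystem S (a_form D S) (V D S) N \<mu> w" and k: "1 \<le> k" "enat k \<le> N" and lam: "lam = \<mu> k"
    using kV unfolding kth_eigenpair_def by (elim exE conjE) (rule that; assumption)
  obtain Nh \<nu> z where esh: "eigensystem S (a_form D S) (Vh D S \<T>) Nh \<nu> z" and kh: "enat k \<le> Nh" and lamh: "lamh = \<nu> k"
    using kVh unfolding kth_eigenpair_def by (elim exE conjE) (rule that; assumption)
  note E = eigensystemD[OF es] and Eh = eigensystemD[OF esh]
  have N: "enat (Suc i) \<le> N" and Nh: "enat (Suc i) \<le> Nh" if "i < k" for i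
    using that k(2) kh by (meson Suc_leI enat_ord_simps(1) order_trans)+
  have wV: "w (Suc i) \<in> V D S" if "i < k" for i using E(1)[OF _ N[OF that]] by simp
  have wH: "w (Suc i) \<in> H0rot D S" if "i < k" for i by (rule V_H0rot[OF wV[OF that]])
  have wL: "w (Suc i) \<in> L2 S" if "i < k" for i by (rule H0rotD(1)[OF wH[OF that]])
  have zL: "z (Suc j) \<in> L2 S" if "j < k" for j using H0rotD(1)[OF Vh_H0rot[OF Eh(1)[OF _ Nh[OF that]]]] by simp
  define g where "g i = Gh D S \<T> (w (Suc i))" for i
  have gV: "g i \<in> Vh D S \<T>" if "i < k" for i unfolding g_def by (rule Gh(1)[OF wH[OF that]])
  have gH: "g i \<in> H0rot D S" if "i < k" for i by (rule Vh_H0rot[OF gV[OF that]])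
  have "k - 1 < k" using k(1) by simp
  \<comment> \<open>\<open>k\<close> coefficients against \<open>k - 1\<close> orthogonality
    conditions.\<close>
  then obtain c where c: "\<exists>i<k. c i \<noteq> 0" "\<And>j. j < k - 1 \<Longrightarrow> (\<Sum>i<k. c i * l2_inner S (g i) (z (Suc j))) = 0"
    by (rule underdetermined_system[of "k - 1" k "\<lambda>i j. l2_inner S (g i) (z (Suc j))"])
      (rule that; assumption)
  \<comment> \<open>Not normalised here: the positive factor \<open>l2_inner S W W\<close> is
    carried along and cancelled at the end.\<close>
  define W where "W = (\<lambda>x. \<Sum>i<k. c i *\<^sub>R w (Suc i) x)"
  define Wh where "Wh = (\<lambda>x. \<Sum>i<k. c i *\<^sub>R g i x)"
  have WV: "W \<in> V D S" unfolding W_def by (rule lin_space_sum[OF V_lin]) (simp add: wV)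
  have WhV: "Wh \<in> Vh D S \<T>" unfolding Wh_def by (rule lin_space_sum[OF Vh_lin]) (simp add: gV)
  note WH = V_H0rot[OF WV] and WhH = Vh_H0rot[OF WhV]
  note WL = H0rotD(1)[OF WH]
  have Ww: "l2_inner S (w (Suc i)) W = c i" if i: "i < k" for i
  proof -
    have "l2_inner S (w (Suc i)) W = (\<Sum>j<k. c j * l2_inner S (w (Suc i)) (w (Suc j)))"
      unfolding W_def by (subst l2_inner_sum_right) (simp_all add: L2_scaleR wL i l2_inner_scaleR_right)
    also have "\<dots> = (\<Sum>j<k. if i = j then c j else 0)"
    proof (rule sum.cong[OF refl])
      fix j assume "j \<in> {..<k}"
      then have "j < k" by simp
      then show "c j * l2_inner S (w (Suc i)) (w (Suc j)) = (if i = j then c j else 0)"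
        using E(3)[OF _ N[OF i] _ N[OF \<open>j < k\<close>]] by simp
    qed
    finally show ?thesis using i by simp
  qed
  have WW: "l2_inner S W W = (\<Sum>i<k. (c i)\<^sup>2)"
  proof -
    have "l2_inner S W W = (\<Sum>i<k. c i * l2_inner S (w (Suc i)) W)"
      by (subst (1) W_def, subst l2_inner_sum_left) (simp_all add: L2_scaleR wL WL l2_inner_scaleR_left)
    then show ?thesis by (simp add: Ww power2_eq_square)
  qed
  obtain i0 where i0: "i0 < k" "c i0 \<noteq> 0" using c(1) by blast
  have "(c i0)\<^sup>2 \<le> l2_inner S W W" unfolding WW using i0(1) by (intro member_le_sum) simp_all
  moreover have "0 < (c i0)\<^sup>2" using i0(2) by simp
  ultimately have Wpos: "0 < l2_inner S W W" by linarith
  have aW: "a_form D S W W \<le> lam * l2_inner S W W"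
  proof -
    have "a_form D S W W = (\<Sum>i<k. c i * a_form D S (w (Suc i)) W)"
      by (subst (1) W_def) (rule a_sum_left[OF wH WH])
    also have "\<dots> = (\<Sum>i<k. \<mu> (Suc i) * (c i)\<^sup>2)"
      using E(2)[OF _ N WV] by (intro sum.cong refl) (simp add: Ww power2_eq_square)
    also have "\<dots> \<le> (\<Sum>i<k. lam * (c i)\<^sup>2)"
      using E(4)[OF _ k(2)] by (intro sum_mono mult_right_mono) (simp_all add: lam)
    finally show ?thesis by (simp add: WW sum_distrib_left)
  qed
  have gal: "a_form D S (\<lambda>x. W x - Wh x) v = 0" if v: "v \<in> Vh D S \<T>" for v
  proof -
    note vH = Vh_H0rot[OF v]
    have "a_form D S (w (Suc i)) v = a_form D S (g i) v" if "i < k" for i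
      using Gh(2)[OF wH[OF that] v] a_diff_left[OF wH[OF that] gH[OF that] vH] by (simp add: g_def)
    then have "a_form D S W v = a_form D S Wh v"
      unfolding W_def Wh_def using a_sum_left[OF wH vH, of k] a_sum_left[OF gH vH, of k] by simp
    then show ?thesis using a_diff_left[OF WH WhH vH] by simp
  qed
  have Whz: "l2_inner S Wh (z j) = 0" if "1 \<le> j" "j < k" for j
  proof -
    obtain i where i: "j = Suc i" using \<open>1 \<le> j\<close> by (cases j) simp_all
    have zj: "z j \<in> L2 S" unfolding i using that i by (intro zL) simp
    have "l2_inner S Wh (z j) = (\<Sum>i<k. c i * l2_inner S (g i) (z j))"
      unfolding Wh_def
      by (subst l2_inner_sum_left) (simp_all add: L2_scaleR H0rotD(1)[OF gH] zj l2_inner_scaleR_left)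
    also have "\<dots> = 0" unfolding i using that i by (intro c(2)) simp
    finally show ?thesis .
  qed
  let ?d = "\<lambda>x. W x - Wh x"
  define X Y h where "X = a_norm D S ?d" and "Y = a_norm D S Wh" and "h = l2_norm S Wh"
  have low: "lamh * h\<^sup>2 \<le> Y\<^sup>2"
    using discrete_lower_bound[OF esh k(1) kh WhV Whz] by (simp add: lamh h_def Y_def l2_norm_sq a_norm_sq)
  have dH: "?d \<in> H0rot D S" by (rule lin_space_diff[OF H0rot_lin WH WhH])
  have pyth: "a_form D S W W = X\<^sup>2 + Y\<^sup>2"
    using a_diff_left[OF WH WhH dH] a_diff_right[OF WH WhH WH] a_diff_right[OF WH WhH WhH] gal[OF WhV]
      a_diff_left[OF WH WhH WhH]
    by (simp add: X_def Y_def a_norm_sq a_commute[of Wh W])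
  have dual: "l2_norm S W \<le> M * X + h"
    unfolding X_def h_def by (rule duality[OF M0 M WV WhV gal])
  have lamh0: "0 \<le> lamh"
  proof -
    have zk: "z k \<in> Vh D S \<T>" by (rule Eh(1)[OF k(1) kh])
    have "a_form D S (z k) (z k) = lamh * l2_inner S (z k) (z k)" unfolding lamh by (rule Eh(2)[OF k(1) kh zk])
    then have "lamh = a_form D S (z k) (z k)" using Eh(3)[OF k(1) kh k(1) kh] by simp
    then show ?thesis by (simp add: a_form_def)
  qed
  have "lamh * l2_inner S W W = lamh * (l2_norm S W)\<^sup>2" by (simp add: l2_norm_sq)
  also have "\<dots> \<le> lamh * (M * X + h)\<^sup>2"
    by (intro mult_left_mono power_mono dual lamh0 l2_norm_ge_0)
  \<comment> \<open>Cauchy--Schwarz for the vectors \<open>(M sqrt lamh, 1)\<close> and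
    \<open>(X, h sqrt lamh)\<close>; the difference of the two sides is an explicit square. No
    division by \<open>h\<close> occurs, so a vanishing \<open>Wh\<close> is covered.\<close>
  also have "\<dots> \<le> (1 + M\<^sup>2 * lamh) * (X\<^sup>2 + lamh * h\<^sup>2)"
  proof -
    have "(1 + M\<^sup>2 * lamh) * (X\<^sup>2 + lamh * h\<^sup>2) - lamh * (M * X + h)\<^sup>2 = (X - M * lamh * h)\<^sup>2"
      by (simp add: power2_eq_square algebra_simps)
    then show ?thesis using zero_le_power2[of "X - M * lamh * h"] by linarith
  qed
  also have "\<dots> \<le> (1 + M\<^sup>2 * lamh) * (lam * l2_inner S W W)"
    using low aW pyth lamh0 by (intro mult_left_mono) simp_all
  finally have "lamh * l2_inner S W W \<le> ((1 + M\<^sup>2 * lamh) * lam) * l2_inner S W W" by (simp add: mult_ac)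
  then have "lamh \<le> (1 + M\<^sup>2 * lamh) * lam" using Wpos by (rule mult_right_le_imp_le)
  moreover have "0 < 1 + M\<^sup>2 * lamh" using lamh0 by (intro add_pos_nonneg) simp_all
  ultimately show ?thesis by (simp add: pos_divide_le_eq mult.commute)
qed

text \<open>A normalised eigenfunction has nonzero rotation by the Friedrichs inequality. Positivity
  makes \<open>lam u\<close> a nonzero right-hand side, which determines the sign of
  \<open>Mh\<close>.\<close>

lemma eigenvalue_positive:
  assumes "kth_eigenpair S (a_form D S) (V D S) k lam u"
  shows "0 < lam" "u \<in> V D S" "l2_norm S u = 1" "\<And>v. v \<in> V D S \<Longrightarrow> a_form D S u v = lam * l2_inner S u v"
proof -
  obtain N \<mu> w where es: "eigensystem S (a_form D S) (V D S) N \<mu> w" and k: "1 \<le> k" "enat k \<le> N"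
    and lam: "lam = \<mu> k" and u: "u = w k"
    using assms unfolding kth_eigenpair_def by (elim exE conjE) (rule that; assumption)
  note E = eigensystemD[OF es]
  show uV: "u \<in> V D S" unfolding u by (rule E(1)[OF k])
  show eig: "\<And>v. v \<in> V D S \<Longrightarrow> a_form D S u v = lam * l2_inner S u v" unfolding u lam by (rule E(2)[OF k])
  have uu: "l2_inner S u u = 1" using E(3)[OF k k] by (simp add: u)
  then show u1: "l2_norm S u = 1" by (simp add: l2_norm_def)
  have au: "(l2_norm S (wrot D S u))\<^sup>2 = lam" using eig[OF uV] uu by (simp add: l2_norm_sq a_form_def)
  obtain C where C: "\<And>v. v \<in> V D S \<Longrightarrow> l2_norm S v \<le> C * l2_norm S (wrot D S v)"
    by (rule friedrichs) (rule that; assumption)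
  have "l2_norm S (wrot D S u) \<noteq> 0" using C[OF uV] u1 by auto
  then have "0 < (l2_norm S (wrot D S u))\<^sup>2" by simp
  then show "0 < lam" by (simp only: au)
qed

text \<open>The explicit Galerkin bound makes the set \<open>A\<close> of admissible constants
  nonempty. The eigenfunction \<open>u0\<close> solves the problem with the nonzero right-hand side
  \<open>lam u0\<close>, so no negative constant is admissible. Each single inequality is affine in
  the constant and therefore survives the infimum.\<close>

lemma Mh_attained:
  assumes kV: "kth_eigenpair S (a_form D S) (V D S) k lam u0"
  shows "0 \<le> Mh D S \<T>"
    "f \<in> Hdiv0 S \<Longrightarrow> u \<in> V D S \<Longrightarrow> (\<And>v. v \<in> V D S \<Longrightarrow> a_form D S u v = l2_inner S f v) \<Longrightarrow>
      a_norm D S (\<lambda>x. u x - Gh D S \<T> u x) \<le> Mh D S \<T> * l2_norm S f"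
proof -
  define A where "A = {M. \<forall>f \<in> Hdiv0 S. \<forall>u \<in> V D S. (\<forall>v \<in> V D S. a_form D S u v = l2_inner S f v) \<longrightarrow>
     a_norm D S (\<lambda>x. u x - Gh D S \<T> u x) \<le> M * l2_norm S f}"
  have Mh: "Mh D S \<T> = Inf A" by (simp add: Mh_def A_def)
  have ne: "A \<noteq> {}"
  proof -
    have "Ch + kappa_h D S \<T> * Cdiv \<in> A"
      unfolding A_def
    proof (intro CollectI ballI impI)
      fix f u assume f: "f \<in> Hdiv0 S" and u: "u \<in> V D S" and sol: "\<forall>v\<in>V D S. a_form D S u v = l2_inner S f v"
      show "a_norm D S (\<lambda>x. u x - Gh D S \<T> u x) \<le> (Ch + kappa_h D S \<T> * Cdiv) * l2_norm S f"
        by (rule Galerkin_error[OF f u bspec[OF sol]])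
    qed
    then show ?thesis by blast
  qed
  have AD: "a_norm D S (\<lambda>x. u x - Gh D S \<T> u x) \<le> M * l2_norm S f"
    if "M \<in> A" "f \<in> Hdiv0 S" "u \<in> V D S" "\<And>v. v \<in> V D S \<Longrightarrow> a_form D S u v = l2_inner S f v" for M f u
  proof -
    have "\<forall>f \<in> Hdiv0 S. \<forall>u \<in> V D S. (\<forall>v \<in> V D S. a_form D S u v = l2_inner S f v) \<longrightarrow>
     a_norm D S (\<lambda>x. u x - Gh D S \<T> u x) \<le> M * l2_norm S f" using that(1) by (simp only: A_def mem_Collect_eq)
    from mp[OF bspec[OF bspec[OF this that(2)] that(3)] ballI[OF that(4)]] show ?thesis .
  qed
  note u0 = eigenvalue_positive[OF kV]
  have pos: "0 \<le> M" if M: "M \<in> A" for M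
  proof -
    have f: "(\<lambda>x. lam *\<^sub>R u0 x) \<in> Hdiv0 S" by (rule lin_space_scaleR[OF Hdiv0_lin V_Hdiv0[OF u0(2)]])
    have "a_norm D S (\<lambda>x. u0 x - Gh D S \<T> u0 x) \<le> M * l2_norm S (\<lambda>x. lam *\<^sub>R u0 x)"
      by (rule AD[OF M f u0(2)]) (simp add: u0(4) l2_inner_scaleR_left)
    from order_trans[OF a_norm_ge_0 this] have "0 \<le> M * lam" using u0(1,3) by (simp add: l2_norm_scaleR)
    then show ?thesis using u0(1) by (simp add: zero_le_mult_iff)
  qed
  show "0 \<le> Mh D S \<T>" unfolding Mh by (rule cInf_greatest[OF ne pos])
  assume f: "f \<in> Hdiv0 S" and u: "u \<in> V D S" and sol: "\<And>v. v \<in> V D S \<Longrightarrow> a_form D S u v = l2_inner S f v"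
  let ?e = "a_norm D S (\<lambda>x. u x - Gh D S \<T> u x)"
  have le: "?e \<le> M * l2_norm S f" if "M \<in> A" for M by (rule AD[OF that f u sol])
  show "?e \<le> Mh D S \<T> * l2_norm S f"
  proof (cases "l2_norm S f = 0")
    case True
    obtain M where "M \<in> A" using ne by blast
    from le[OF this] show ?thesis by (simp only: True mult_zero_right)
  next
    case False
    then have fpos: "0 < l2_norm S f" using l2_norm_ge_0[of S f] by linarith
    have "?e / l2_norm S f \<le> Inf A"
      by (rule cInf_greatest[OF ne]) (simp only: pos_divide_le_eq[OF fpos] le)
    then show ?thesis by (simp only: Mh pos_divide_le_eq[OF fpos])
  qed
qed

theorem eigenvalue_lower_bounds:
  assumes kV: "kth_eigenpair S (a_form D S) (V D S) k lam u"
    and kVh: "kth_eigenpair S (a_form D S) (Vh D S \<T>) k lamh uh"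
  shows "lamh / (1 + (Mh D S \<T>)\<^sup>2 * lamh) \<le> lam"
    and "Ch + kappa_h D S \<T> * Cdiv \<le> M \<Longrightarrow> lamh / (1 + M\<^sup>2 * lamh) \<le> lam"
proof -
  show "lamh / (1 + (Mh D S \<T>)\<^sup>2 * lamh) \<le> lam"
    by (rule eigenvalue_bound[OF Mh_attained[OF kV] kV kVh])
  assume M: "Ch + kappa_h D S \<T> * Cdiv \<le> M"
  have "0 \<le> Cdiv" using C1div_pos by simp
  then have "0 \<le> Ch + kappa_h D S \<T> * Cdiv" using Ch_nonneg kappa_nonneg by simp
  then have M0: "0 \<le> M" using M by linarith
  show "lamh / (1 + M\<^sup>2 * lamh) \<le> lam"
  proof (rule eigenvalue_bound[OF M0 _ kV kVh])
    fix f u assume *: "f \<in> Hdiv0 S" "u \<in> V D S" "\<And>v. v \<in> V D S \<Longrightarrow> a_form D S u v = l2_inner S f v"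
    have "a_norm D S (\<lambda>x. u x - Gh D S \<T> u x) \<le> (Ch + kappa_h D S \<T> * Cdiv) * l2_norm S f"
      by (rule Galerkin_error[OF *])
    also have "\<dots> \<le> M * l2_norm S f" by (rule mult_right_mono[OF M]) simp
    finally show "a_norm D S (\<lambda>x. u x - Gh D S \<T> u x) \<le> M * l2_norm S f" .
  qed
qed

end

section \<open>Dimensions two and three\<close>

context simplicial_domain
begin

text \<open>Weak derivatives on the patch are chosen separately from those on \<open>S\<close>;
  uniqueness replaces them by the global ones, to which the overlap estimate applies.\<close>

lemma jacobian_patch:
  assumes v: "v \<in> H1 S"
  shows "(jacobian_norm (patch \<T> T) v)\<^sup>2 = (\<Sum>i\<in>UNIV. l2_inner (patch \<T> T) (wpartial i S v) (wpartial i S v))"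
proof -
  let ?P = "patch \<T> T"
  note r = H1_restrict[OF v patch_subset open_patch lmeasurable_patch sets_S]
  have "l2_inner ?P (wpartial i ?P v) (wpartial i ?P v) = l2_inner ?P (wpartial i S v) (wpartial i S v)" for i
    by (rule l2_inner_cong_AE[OF H1D(3)[OF r(1)] L2_patch[OF H1D(3)[OF v]] H1D(3)[OF r(1)] L2_patch[OF H1D(3)[OF v]] r(2) r(2)])
  then show ?thesis by (simp add: jacobian_norm_sq l2_norm_sq)
qed

lemma sum_jacobian_patch:
  assumes v: "v \<in> H1 S"
  shows "(\<Sum>T\<in>\<T>. (jacobian_norm (patch \<T> T) v)\<^sup>2) \<le> C_OL \<T> * (jacobian_norm S v)\<^sup>2"
proof -
  have "(\<Sum>T\<in>\<T>. (jacobian_norm (patch \<T> T) v)\<^sup>2)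
      = (\<Sum>i\<in>UNIV. \<Sum>T\<in>\<T>. l2_inner (patch \<T> T) (wpartial i S v) (wpartial i S v))"
    unfolding jacobian_patch[OF v] by (rule sum.swap)
  also have "\<dots> \<le> (\<Sum>i\<in>UNIV. C_OL \<T> * l2_inner S (wpartial i S v) (wpartial i S v))"
    by (intro sum_mono l2_inner_sum_patch H1D(3)[OF v])
  finally show ?thesis by (simp add: jacobian_norm_sq l2_norm_sq sum_distrib_left)
qed

lemma hmax_nonneg: "0 \<le> hmax \<T>"
proof -
  obtain T where T: "T \<in> \<T>" using nonempty_T by blast
  show ?thesis using diameter_T[OF T] diameter_le_hmax[OF T] by linarith
qed

end

lemma const_S1: "S \<in> sets lebesgue \<Longrightarrow> S \<in> lmeasurable \<Longrightarrow> bounded S \<Longrightarrow> open S \<Longrightarrow> (\<lambda>x. c) \<in> S1 S \<T>"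
  unfolding S1_def
proof (intro CollectI conjI ballI)
  assume S: "S \<in> sets lebesgue" "S \<in> lmeasurable" "bounded S" "open S"
  show "(\<lambda>x. c) \<in> H1 S" by (rule H1I[OF L2_const[OF S(2)] has_weak_const[OF S(1,3,4)]])
  show "\<exists>a b. AE x in lebesgue_on T. c = a \<bullet> x + b" for T
    by (intro exI[of _ 0] exI[of _ c]) simp
qed

lemma maxwell_domain_2:
  fixes S :: "(real^2) set"
  assumes "simplicial_domain S \<T>"
  shows "maxwell_domain S \<T> dim2 (-1)"
proof -
  interpret simplicial_domain S \<T> by fact
  have op: "L2_operator rot2 S" "L2_operator Curl2 S"
    unfolding L2_operator_def using test_functions_L2[OF test_functions_rot2 sets_S]
      test_functions_L2[OF test_functions_Curl2 sets_S] by blast+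
  show ?thesis
  proof (rule maxwell_domain.intro[OF assms], unfold_locales)
    show "-1 = sgn_dim TYPE(2)" by simp
    show "L2_operator (cl_rot dim2) S" "L2_operator (cl_Curl dim2) S" using op by (simp_all add: dim2_def)
    show "cl_rot dim2 (grad \<psi>) = (\<lambda>x. 0)" if "\<psi> \<in> test_functions S" for \<psi>
      using rot2_grad[OF test_functions_smooth[OF that]] by (simp add: dim2_def)
    show "l2_inner S (grad \<psi>) (cl_Curl dim2 \<eta>) = 0" if "\<psi> \<in> test_functions S" "\<eta> \<in> test_functions S" for \<psi> \<eta>
      using grad_Curl2_orthogonal[OF sets_S bounded_S that] by (simp add: dim2_def)
    show "HCurl dim2 S \<subseteq> Hspace (-1) (cl_rot dim2) S"
    proof
      fix v assume "v \<in> HCurl dim2 S"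
      then have v: "v \<in> H1 S" by (simp add: dim2_def)
      show "v \<in> Hspace (-1) (cl_rot dim2) S"
        using HspaceI[OF H1D(1)[OF v] has_weak_rot2[OF sets_S H1D(1,2)[OF v]]] by (simp add: dim2_def)
    qed
    show "lin_space (HCurl dim2 S)" using lin_space_H1[OF sets_S] by (simp add: dim2_def)
    show "H1 S \<subseteq> HCurl dim2 S" "Sh dim2 S \<T> \<subseteq> HCurl dim2 S" by (auto simp: dim2_def S1_def)
    show "lin_space (Sh dim2 S \<T>)" using lin_space_S1[OF sets_S] by (simp add: dim2_def)
    show "finite_dim S (Sh dim2 S \<T>)" using finite_dim_S1 by (simp add: dim2_def)
    show "(\<lambda>x. c) \<in> Sh dim2 S \<T>" for c
      using const_S1[OF sets_S lmeasurable_S bounded_S open_S] by (simp add: dim2_def)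
    show "AE x in lebesgue_on S. wCurl dim2 S (\<lambda>x. c) x = 0" for c
    proof -
      have "has_weak (-1) rot2 S (\<lambda>x. c) (\<lambda>x. vector [- 0, 0])"
        by (rule has_weak_rot2[OF sets_S L2_const[OF lmeasurable_S] has_weak_const[OF sets_S bounded_S open_S]])
      from weak_eq[OF open_S lmeasurable_S _ this]
      show ?thesis by (simp add: wCurl_def dim2_def vector2_eq)
    qed
  qed
qed

lemma maxwell_domain_3:
  fixes S :: "(real^3) set"
  assumes "simplicial_domain S \<T>"
  shows "maxwell_domain S \<T> dim3 1"
proof -
  interpret simplicial_domain S \<T> by fact
  have op: "L2_operator rot3 S"
    unfolding L2_operator_def using test_functions_L2[OF test_functions_rot3 sets_S] by blast
  have Hrot: "Hrot rot3 S = Hspace 1 rot3 S" by (simp add: Hrot_def)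
  have H1: "H1 S \<subseteq> Hrot rot3 S"
  proof
    fix v :: "real^3 \<Rightarrow> real^3" assume v: "v \<in> H1 S"
    show "v \<in> Hrot rot3 S"
      unfolding Hrot by (rule HspaceI[OF H1D(1)[OF v] has_weak_rot3[OF sets_S H1D(1,2)[OF v]]])
  qed
  have const: "has_weak 1 rot3 S (\<lambda>x. c) (\<lambda>x. 0)" for c
  proof -
    have "has_weak 1 rot3 S (\<lambda>x. c) (\<lambda>x. vector [(0::real^3) $ 3 - (0::real^3) $ 2,
        (0::real^3) $ 1 - (0::real^3) $ 3, (0::real^3) $ 2 - (0::real^3) $ 1])"
      by (rule has_weak_rot3[OF sets_S L2_const[OF lmeasurable_S] has_weak_const[OF sets_S bounded_S open_S]])
    then show ?thesis by (simp add: vector3_eq)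
  qed
  show ?thesis
  proof (rule maxwell_domain.intro[OF assms], unfold_locales)
    show "1 = sgn_dim TYPE(3)" by simp
    show "L2_operator (cl_rot dim3) S" "L2_operator (cl_Curl dim3) S" using op by (simp_all add: dim3_def)
    show "cl_rot dim3 (grad \<psi>) = (\<lambda>x. 0)" if "\<psi> \<in> test_functions S" for \<psi>
      using rot3_grad[OF test_functions_smooth[OF that]] by (simp add: dim3_def)
    show "l2_inner S (grad \<psi>) (cl_Curl dim3 \<eta>) = 0" if "\<psi> \<in> test_functions S" "\<eta> \<in> test_functions S" for \<psi> \<eta>
      using grad_rot3_orthogonal[OF sets_S bounded_S that] by (simp add: dim3_def)
    show "HCurl dim3 S \<subseteq> Hspace 1 (cl_rot dim3) S" by (simp add: dim3_def Hrot)
    show "lin_space (HCurl dim3 S)" using lin_space_Hspace[OF op sets_S] by (simp add: dim3_def Hrot)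
    show "H1 S \<subseteq> HCurl dim3 S" using H1 by (simp add: dim3_def)
    show "Sh dim3 S \<T> \<subseteq> HCurl dim3 S" by (auto simp: dim3_def N0_def)
    show "lin_space (Sh dim3 S \<T>)" using lin_space_N0[OF op sets_S] by (simp add: dim3_def)
    show "finite_dim S (Sh dim3 S \<T>)" using finite_dim_N0 by (simp add: dim3_def)
    show "(\<lambda>x. c) \<in> Sh dim3 S \<T>" for c
    proof -
      have "(\<lambda>x. c) \<in> N0 rot3 S \<T>"
        unfolding N0_def
      proof (intro CollectI conjI ballI)
        show "(\<lambda>x. c) \<in> Hrot rot3 S" unfolding Hrot by (rule HspaceI[OF L2_const[OF lmeasurable_S] const])
        show "\<exists>\<alpha> (B::real^3^3) d. (AE x in lebesgue_on T. c = \<alpha> + (B *v x + d)) \<and> (\<forall>x\<in>T. (B *v x + d) \<bullet> x = 0)" for T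
          by (intro exI[of _ c] exI[of _ 0]) (simp add: matrix_vector_mult_0)
      qed
      then show ?thesis by (simp add: dim3_def)
    qed
    show "AE x in lebesgue_on S. wCurl dim3 S (\<lambda>x. c) x = 0" for c
      using weak_eq[OF open_S lmeasurable_S _ const] by (simp add: wCurl_def dim3_def)
  qed
qed

text \<open>In two dimensions the Curl is the gradient rotated by a right angle, so Jacobian and
  Curl norms coincide on every patch. The two terms of the local error merge into the single
  constant \<open>C_hat\<close> before the sum over patches is taken.\<close>

lemma galerkin_estimate_2:
  fixes S :: "(real^2) set"
  assumes "falk_winther_domain S \<T> dim2 (-1) \<pi>div \<pi>Curl C1div C2div C1Curl C2Curl CRD"
    and c: "poincare_constant \<T> c"
  shows "galerkin_estimate S \<T> dim2 (-1) \<pi>div \<pi>Curl C1div C2div C1Curl C2Curl CRD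
    (hmax \<T> * C_hat 2 C1Curl C2Curl c CRD * sqrt (C_OL \<T>))"
proof -
  interpret falk_winther_domain S \<T> dim2 "-1" \<pi>div \<pi>Curl C1div C2div C1Curl C2Curl CRD by fact
  let ?C = "C_hat 2 C1Curl C2Curl c CRD"
  have C: "?C = (1 + C1Curl) * c + C2Curl" by (simp add: C_hat_def)
  have jac: "jacobian_norm (patch \<T> T) \<beta> = l2_norm (patch \<T> T) (wCurl dim2 S \<beta>)" if \<beta>: "\<beta> \<in> H1 S" for \<beta> T
  proof -
    let ?P = "patch \<T> T" and ?g = "\<lambda>i. wpartial i S \<beta>"
    let ?G = "\<lambda>x. vector [- ?g 2 x, ?g 1 x] :: real^2"
    have hw: "has_weak (-1) rot2 S \<beta> ?G" by (rule has_weak_rot2[OF sets_S H1D(1,2)[OF \<beta>]])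
    from weak_eq[OF open_S lmeasurable_S _ this] have "AE x in lebesgue_on S. wCurl dim2 S \<beta> x = ?G x"
      by (simp add: wCurl_def dim2_def)
    then have ae: "AE x in lebesgue_on ?P. wCurl dim2 S \<beta> x = ?G x"
      by (rule AE_lebesgue_on_subset[OF _ patch_subset sets_patch sets_S])
    have GL: "?G \<in> L2 ?P" by (rule L2_patch[OF has_weakD(1)[OF hw]])
    have WL: "wCurl dim2 S \<beta> \<in> L2 ?P" using HCurlD(2)[OF subsetD[OF H1_HCurl \<beta>]] by (rule L2_patch)
    have "(l2_norm ?P (wCurl dim2 S \<beta>))\<^sup>2 = l2_inner ?P ?G ?G"
      unfolding l2_norm_sq by (rule l2_inner_cong_AE[OF WL GL WL GL ae ae])
    also have "\<dots> = l2_inner ?P (?g 1) (?g 1) + l2_inner ?P (?g 2) (?g 2)"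
      by (simp add: l2_inner_vec[OF GL GL] sum_2 vector_2)
    also have "\<dots> = (jacobian_norm ?P \<beta>)\<^sup>2" by (simp add: jacobian_patch[OF \<beta>] sum_2)
    finally have "(jacobian_norm ?P \<beta>)\<^sup>2 = (l2_norm ?P (wCurl dim2 S \<beta>))\<^sup>2" by (rule sym)
    then show ?thesis by (rule power2_eq_imp_eq[OF _ jacobian_norm_ge_0 l2_norm_ge_0])
  qed
  have local: "l2_norm T (\<lambda>x. \<beta> x - \<pi>Curl \<beta> x) \<le> diameter T * ?C * l2_norm (patch \<T> T) (wCurl dim2 S \<beta>)"
    if "T \<in> \<T>" "\<beta> \<in> H1 S" for T \<beta>
    using \<pi>Curl_local_error[OF c that] unfolding jac[OF that(2)] C by (simp add: algebra_simps)
  text \<open>The constant is nonnegative since the error estimate applies to a potential of a constant field.\<close>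
  have C0: "0 \<le> ?C"
  proof (rule ccontr)
    assume "\<not> 0 \<le> ?C"
    then have neg: "?C < 0" by simp
    obtain T where T: "T \<in> \<T>" using nonempty_T by blast
    have "\<forall>f\<in>Hdiv0 S. \<exists>\<beta>\<in>H1 S. (AE x in lebesgue_on S. wCurl dim2 S \<beta> x = f x) \<and>
        jacobian_norm S \<beta> \<le> CRD * l2_norm S f"
      using rd unfolding regular_decomposition_constant_def by (elim conjE)
    from bspec[OF this const_Hdiv0[of 1]] obtain \<beta> where \<beta>: "\<beta> \<in> H1 S"
      "AE x in lebesgue_on S. wCurl dim2 S \<beta> x = 1" by (elim bexE conjE)
    have bH: "\<beta> \<in> HCurl dim2 S" using \<beta>(1) H1_HCurl by blast
    have "l2_norm (interior T) (wCurl dim2 S \<beta>) = l2_norm (interior T) (\<lambda>x. 1::real^2)"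
      by (rule l2_norm_cong_AE[OF L2_interior[OF HCurlD(2)[OF bH] T] L2_interior[OF L2_const[OF lmeasurable_S] T]
            AE_interior[OF T \<beta>(2)]])
    then have "l2_norm T (wCurl dim2 S \<beta>) = l2_norm T (\<lambda>x. 1::real^2)" by (simp only: l2_norm_T[OF T])
    then have "0 < l2_norm (patch \<T> T) (wCurl dim2 S \<beta>)"
      using l2_norm_const_pos[OF T, of "1::real^2"] l2_norm_T_le_patch[OF HCurlD(2)[OF bH] T] by simp
    then have "diameter T * ?C * l2_norm (patch \<T> T) (wCurl dim2 S \<beta>) < 0"
      using diameter_T[OF T] neg by (intro mult_neg_pos mult_pos_neg)
    then show False using local[OF T \<beta>(1)] l2_norm_ge_0[of T "\<lambda>x. \<beta> x - \<pi>Curl \<beta> x"] by linarith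
  qed
  show ?thesis
  proof unfold_locales
    have h: "0 \<le> hmax \<T> * ?C" by (rule mult_nonneg_nonneg[OF hmax_nonneg C0])
    then show "0 \<le> hmax \<T> * ?C * sqrt (C_OL \<T>)" by simp
    fix \<beta> :: "real^2 \<Rightarrow> real" assume \<beta>: "\<beta> \<in> H1 S"
    then have bH: "\<beta> \<in> HCurl dim2 S" using H1_HCurl by blast
    show "l2_norm S (\<lambda>x. \<beta> x - \<pi>Curl \<beta> x) \<le> hmax \<T> * ?C * sqrt (C_OL \<T>) * l2_norm S (wCurl dim2 S \<beta>)"
    proof (rule l2_norm_from_patches[OF L2_diff[OF HCurlD(1)[OF bH] HCurlD(1)[OF \<pi>Curl_HCurl[OF bH]]] HCurlD(2)[OF bH] h])
      fix T assume T: "T \<in> \<T>"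
      have "diameter T * ?C * l2_norm (patch \<T> T) (wCurl dim2 S \<beta>) \<le> hmax \<T> * ?C * l2_norm (patch \<T> T) (wCurl dim2 S \<beta>)"
        by (intro mult_right_mono diameter_le_hmax T C0 l2_norm_ge_0)
      then show "l2_norm T (\<lambda>x. \<beta> x - \<pi>Curl \<beta> x) \<le> hmax \<T> * ?C * l2_norm (patch \<T> T) (wCurl dim2 S \<beta>)"
        using local[OF T \<beta>] by linarith
    qed
  qed
qed

text \<open>Here the Jacobian is controlled by the Curl only globally, through \<open>CRD\<close>.
  The squares of the two local terms are therefore summed separately over the patches, and the
  regular decomposition is invoked after the summation.\<close>

lemma galerkin_estimate_3:
  fixes S :: "(real^3) set"
  assumes "falk_winther_domain S \<T> dim3 1 \<pi>div \<pi>Curl C1div C2div C1Curl C2Curl CRD"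
    and c: "poincare_constant \<T> c"
  shows "galerkin_estimate S \<T> dim3 1 \<pi>div \<pi>Curl C1div C2div C1Curl C2Curl CRD
    (hmax \<T> * C_hat 3 C1Curl C2Curl c CRD * sqrt (C_OL \<T>))"
proof -
  interpret falk_winther_domain S \<T> dim3 1 \<pi>div \<pi>Curl C1div C2div C1Curl C2Curl CRD by fact
  let ?C = "C_hat 3 C1Curl C2Curl c CRD" and ?p = "(1 + C1Curl) * c"
  have C: "?C = sqrt (2 * ((?p * CRD)\<^sup>2 + C2Curl\<^sup>2))" by (simp add: C_hat_def)
  show ?thesis
  proof unfold_locales
    show C0: "0 \<le> hmax \<T> * ?C * sqrt (C_OL \<T>)" using hmax_nonneg by (simp add: C)
    fix \<beta> :: "real^3 \<Rightarrow> real^3" assume \<beta>: "\<beta> \<in> H1 S" "jacobian_norm S \<beta> \<le> CRD * l2_norm S (wCurl dim3 S \<beta>)"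
    then have bH: "\<beta> \<in> HCurl dim3 S" using H1_HCurl by blast
    let ?f = "wCurl dim3 S \<beta>" and ?\<gamma> = "\<lambda>x. \<beta> x - \<pi>Curl \<beta> x"
    have fL: "?f \<in> L2 S" by (rule HCurlD(2)[OF bH])
    have gL: "?\<gamma> \<in> L2 S" by (rule L2_diff[OF HCurlD(1)[OF bH] HCurlD(1)[OF \<pi>Curl_HCurl[OF bH]]])
    let ?J = "\<lambda>T. jacobian_norm (patch \<T> T) \<beta>" and ?F = "\<lambda>T. l2_norm (patch \<T> T) ?f"
    have local: "(l2_norm T ?\<gamma>)\<^sup>2 \<le> (hmax \<T>)\<^sup>2 * (2 * (?p\<^sup>2 * (?J T)\<^sup>2 + C2Curl\<^sup>2 * (?F T)\<^sup>2))" if T: "T \<in> \<T>" for T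
    proof -
      let ?a = "?p * ?J T" and ?b = "C2Curl * ?F T"
      have "(l2_norm T ?\<gamma>)\<^sup>2 \<le> (diameter T * (?a + ?b))\<^sup>2"
        using \<pi>Curl_local_error[OF c T \<beta>(1)] by (rule power_mono) simp
      also have "\<dots> = (diameter T)\<^sup>2 * (?a + ?b)\<^sup>2" by (rule power_mult_distrib)
      also have "\<dots> \<le> (hmax \<T>)\<^sup>2 * (2 * (?a\<^sup>2 + ?b\<^sup>2))"
      proof (rule mult_mono)
        show "(diameter T)\<^sup>2 \<le> (hmax \<T>)\<^sup>2"
          using diameter_T[OF T] by (intro power_mono diameter_le_hmax T) simp
        \<comment> \<open>Origin of the factor 2 under the root in \<open>C_hat\<close>.\<close>
        show "(?a + ?b)\<^sup>2 \<le> 2 * (?a\<^sup>2 + ?b\<^sup>2)"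
          using zero_le_power2[of "?a - ?b"] by (simp add: power2_diff power2_sum)
      qed simp_all
      finally show ?thesis by (simp only: power_mult_distrib)
    qed
    have "(l2_norm S ?\<gamma>)\<^sup>2 = (\<Sum>T\<in>\<T>. (l2_norm T ?\<gamma>)\<^sup>2)" by (simp add: l2_norm_sq l2_inner_sum_T[OF gL])
    also have "\<dots> \<le> (\<Sum>T\<in>\<T>. (hmax \<T>)\<^sup>2 * (2 * (?p\<^sup>2 * (?J T)\<^sup>2 + C2Curl\<^sup>2 * (?F T)\<^sup>2)))"
      by (intro sum_mono local)
    also have "\<dots> = (hmax \<T>)\<^sup>2 * (2 * (?p\<^sup>2 * (\<Sum>T\<in>\<T>. (?J T)\<^sup>2) + C2Curl\<^sup>2 * (\<Sum>T\<in>\<T>. (?F T)\<^sup>2)))"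
      by (simp only: sum_distrib_left[symmetric] sum.distrib)
    also have "\<dots> \<le> (hmax \<T>)\<^sup>2 * (2 * (?p\<^sup>2 * (C_OL \<T> * (CRD * l2_norm S ?f)\<^sup>2) + C2Curl\<^sup>2 * (C_OL \<T> * (l2_norm S ?f)\<^sup>2)))"
    proof (intro mult_left_mono add_mono)
      have "(jacobian_norm S \<beta>)\<^sup>2 \<le> (CRD * l2_norm S ?f)\<^sup>2"
        using \<beta>(2) jacobian_norm_ge_0 by (rule power_mono)
      then have "C_OL \<T> * (jacobian_norm S \<beta>)\<^sup>2 \<le> C_OL \<T> * (CRD * l2_norm S ?f)\<^sup>2" by (rule mult_left_mono) simp
      then show "(\<Sum>T\<in>\<T>. (?J T)\<^sup>2) \<le> C_OL \<T> * (CRD * l2_norm S ?f)\<^sup>2"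
        using sum_jacobian_patch[OF \<beta>(1)] by linarith
      show "(\<Sum>T\<in>\<T>. (?F T)\<^sup>2) \<le> C_OL \<T> * (l2_norm S ?f)\<^sup>2"
        using l2_inner_sum_patch[OF fL] by (simp add: l2_norm_sq)
    qed simp_all
    also have "\<dots> = (hmax \<T> * ?C * sqrt (C_OL \<T>) * l2_norm S ?f)\<^sup>2"
    proof -
      have "?C\<^sup>2 = 2 * ((?p * CRD)\<^sup>2 + C2Curl\<^sup>2)" by (simp add: C)
      moreover have "(sqrt (C_OL \<T>))\<^sup>2 = C_OL \<T>" by simp
      ultimately show ?thesis by (simp only: power_mult_distrib) (simp add: algebra_simps)
    qed
    finally show "l2_norm S ?\<gamma> \<le> hmax \<T> * ?C * sqrt (C_OL \<T>) * l2_norm S ?f"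
      by (rule power2_le_imp_le) (intro mult_nonneg_nonneg[OF C0] l2_norm_ge_0)
  qed
qed

theorem theorem4p1:
  shows
    "(\<forall>\<Omega> \<T> \<pi>div \<pi>Curl C1div C2div C1Curl C2Curl CRD c k lam u lamh uh.
       bounded \<Omega> \<and> contractible \<Omega> \<and> polytopal_lipschitz_domain \<Omega> \<and> triangulation_of \<Omega> \<T> \<and>
       falk_winther dim2 \<Omega> \<T> \<pi>div \<pi>Curl C1div C2div C1Curl C2Curl \<and>
       regular_decomposition_constant dim2 \<Omega> CRD \<and> poincare_constant \<T> c \<and>
       1 \<le> k \<and> enat k \<le> l2_dim \<Omega> (Vh dim2 \<Omega> \<T>) \<and>
       kth_eigenpair \<Omega> (a_form dim2 \<Omega>) (V dim2 \<Omega>) k lam u \<and>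
       kth_eigenpair \<Omega> (a_form dim2 \<Omega>) (Vh dim2 \<Omega> \<T>) k lamh uh \<longrightarrow>
       lamh / (1 + (Mh dim2 \<Omega> \<T>)\<^sup>2 * lamh) \<le> lam \<and>
       (\<forall>M. (hmax \<T> * C_hat 2 C1Curl C2Curl c CRD + kappa_h dim2 \<Omega> \<T> * C1div) * sqrt (C_OL \<T>) \<le> M
          \<longrightarrow> lamh / (1 + M\<^sup>2 * lamh) \<le> lam)) \<and>
     (\<forall>\<Omega> \<T> \<pi>div \<pi>Curl C1div C2div C1Curl C2Curl CRD c k lam u lamh uh.
       bounded \<Omega> \<and> contractible \<Omega> \<and> polytopal_lipschitz_domain \<Omega> \<and> triangulation_of \<Omega> \<T> \<and>
       falk_winther dim3 \<Omega> \<T> \<pi>div \<pi>Curl C1div C2div C1Curl C2Curl \<and>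
       regular_decomposition_constant dim3 \<Omega> CRD \<and> poincare_constant \<T> c \<and>
       1 \<le> k \<and> enat k \<le> l2_dim \<Omega> (Vh dim3 \<Omega> \<T>) \<and>
       kth_eigenpair \<Omega> (a_form dim3 \<Omega>) (V dim3 \<Omega>) k lam u \<and>
       kth_eigenpair \<Omega> (a_form dim3 \<Omega>) (Vh dim3 \<Omega> \<T>) k lamh uh \<longrightarrow>
       lamh / (1 + (Mh dim3 \<Omega> \<T>)\<^sup>2 * lamh) \<le> lam \<and>
       (\<forall>M. (hmax \<T> * C_hat 3 C1Curl C2Curl c CRD + kappa_h dim3 \<Omega> \<T> * C1div) * sqrt (C_OL \<T>) \<le> M
          \<longrightarrow> lamh / (1 + M\<^sup>2 * lamh) \<le> lam))"
proof (intro conjI allI impI; elim conjE)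
  fix \<Omega> :: "(real^2) set" and \<T> \<pi>div \<pi>Curl and C1div C2div C1Curl C2Curl CRD c :: real and k lam u lamh uh
  assume bounded: "bounded \<Omega>" and polytopal: "polytopal_lipschitz_domain \<Omega>"
    and triangulation: "triangulation_of \<Omega> \<T>"
    and fw: "falk_winther dim2 \<Omega> \<T> \<pi>div \<pi>Curl C1div C2div C1Curl C2Curl"
    and rd: "regular_decomposition_constant dim2 \<Omega> CRD" and c: "poincare_constant \<T> c"
    and kV: "kth_eigenpair \<Omega> (a_form dim2 \<Omega>) (V dim2 \<Omega>) k lam u"
    and kVh: "kth_eigenpair \<Omega> (a_form dim2 \<Omega>) (Vh dim2 \<Omega> \<T>) k lamh uh"
  have "simplicial_domain \<Omega> \<T>"
    by (rule simplicial_domain.intro[OF bounded polytopal triangulation])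
  then have "falk_winther_domain \<Omega> \<T> dim2 (-1) \<pi>div \<pi>Curl C1div C2div C1Curl C2Curl CRD"
    by (intro falk_winther_domain.intro maxwell_domain_2 falk_winther_domain_axioms.intro fw rd)
  note G = galerkin_estimate_2[OF this c]
  show "lamh / (1 + (Mh dim2 \<Omega> \<T>)\<^sup>2 * lamh) \<le> lam"
    by (rule galerkin_estimate.eigenvalue_lower_bounds(1)[OF G kV kVh])
  fix M assume "(hmax \<T> * C_hat 2 C1Curl C2Curl c CRD + kappa_h dim2 \<Omega> \<T> * C1div) * sqrt (C_OL \<T>) \<le> M"
  \<comment> \<open>The stated threshold is \<open>Ch + kappa_h * Cdiv\<close> with the common
    factor \<open>sqrt (C_OL \<T>)\<close> pulled out.\<close>
  then show "lamh / (1 + M\<^sup>2 * lamh) \<le> lam"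
    by (intro galerkin_estimate.eigenvalue_lower_bounds(2)[OF G kV kVh]) (simp add: algebra_simps)
next
  fix \<Omega> :: "(real^3) set" and \<T> \<pi>div \<pi>Curl and C1div C2div C1Curl C2Curl CRD c :: real and k lam u lamh uh
  assume bounded: "bounded \<Omega>" and polytopal: "polytopal_lipschitz_domain \<Omega>"
    and triangulation: "triangulation_of \<Omega> \<T>"
    and fw: "falk_winther dim3 \<Omega> \<T> \<pi>div \<pi>Curl C1div C2div C1Curl C2Curl"
    and rd: "regular_decomposition_constant dim3 \<Omega> CRD" and c: "poincare_constant \<T> c"
    and kV: "kth_eigenpair \<Omega> (a_form dim3 \<Omega>) (V dim3 \<Omega>) k lam u"
    and kVh: "kth_eigenpair \<Omega> (a_form dim3 \<Omega>) (Vh dim3 \<Omega> \<T>) k lamh uh"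
  have "simplicial_domain \<Omega> \<T>"
    by (rule simplicial_domain.intro[OF bounded polytopal triangulation])
  then have "falk_winther_domain \<Omega> \<T> dim3 (1) \<pi>div \<pi>Curl C1div C2div C1Curl C2Curl CRD"
    by (intro falk_winther_domain.intro maxwell_domain_3 falk_winther_domain_axioms.intro fw rd)
  note G = galerkin_estimate_3[OF this c]
  show "lamh / (1 + (Mh dim3 \<Omega> \<T>)\<^sup>2 * lamh) \<le> lam"
    by (rule galerkin_estimate.eigenvalue_lower_bounds(1)[OF G kV kVh])
  fix M assume "(hmax \<T> * C_hat 3 C1Curl C2Curl c CRD + kappa_h dim3 \<Omega> \<T> * C1div) * sqrt (C_OL \<T>) \<le> M"
  then show "lamh / (1 + M\<^sup>2 * lamh) \<le> lam"
    by (intro galerkin_estimate.eigenvalue_lower_bounds(2)[OF G kV kVh]) (simp add: algebra_simps)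
qed

end
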